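(* Let $T$ be a complete theory with monster model $\mathbb{M}$, let $A$ be a set of hyperimaginary parameters, and let $(b_i)_{i<\omega}$ be an $A$-indiscernible sequence. The following are equivalent. (1) $b_{<\omega}$ is a total $\perp^{\mathrm{bu}}$-Morley sequence over $A$. (2) There exists a pair of infinite sequences $I$ and $J$ (of any, possibly distinct, order types) such that $I + J \equiv^{\mathrm{EM}}_A b_{<\omega}$ and $I \perp^{\mathrm{bu}}_A J$. (3) For any sequence $I$, $I \approx_A b_{<\omega}$ if and only if $I \equiv^{\mathrm{LEM}}_A b_{<\omega}$. (4) $[b_{<\omega}]_{\approx_A} \in \operatorname{bdd}^u(A)$.
   Context: $\mathbb{M}$ is a monster model; "small" means of cardinality less than its saturation. An invariant equivalence relation is an equivalence relation $E$ on $\mathbb{M}^x$ such that $ab \equiv cd$ implies ($aEb \iff cEd$); an ultraimaginary is an $E$-class $a_E$ of such. Real tuples, hyperimaginaries, sequences and sets of these, and collections of ultraimaginaries are regarded as ultraimaginaries via product relations. $\operatorname{Aut}(\mathbb{M}/a_E)=\{\sigma: a \mathrel E \sigma(a)\}$; $b_F$ is bounded over $a_E$ if its $\operatorname{Aut}(\mathbb{M}/a_E)$-orbit is small; $\operatorname{bdd}^u(a_E)$ is the class of such. $b \perp^{\mathrm{bu}}_A c$ iff $\operatorname{bdd}^u(Ab)\cap\operatorname{bdd}^u(Ac)=\operatorname{bdd}^u(A)$. $\operatorname{Autf}(\mathbb{M}/A)$ is the group generated by $\operatorname{Aut}(\mathbb{M}/M)$ for small models $M$ with $\operatorname{Aut}(\mathbb{M}/M)\le\operatorname{Aut}(\mathbb{M}/A)$;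 $I \equiv^{\mathrm{Las}}_A J$ means $\sigma(I)=J$ for some $\sigma \in \operatorname{Autf}(\mathbb{M}/A)$. $I+J$ denotes concatenation of sequences. $I \equiv^{\mathrm{EM}}_A J$ means that any increasing tuples from $I$ and from $J$ of the same finite length have the same type over $A$ (order types may differ). A total $\perp^{\mathrm{bu}}$-Morley sequence over $A$ is an $A$-indiscernible sequence $(b_i)_{i<\omega}$ such that for any sequences $I,J$ (any order types) with $I+J \equiv^{\mathrm{EM}}_A b_{<\omega}$, $I \perp^{\mathrm{bu}}_A J$. $I \sim_A J$ holds iff $I$ and $J$ are infinite and $I+J$ or $J+I$ is $A$-indiscernible; $\approx_A$ is the transitive closure of $\sim_A$. $[I]_{\approx_A}$ is the ultraimaginary $[AI]_E$ where $E(AI, BJ)$ holds iff $A=B$ (in the fixed enumeration) and $I \approx_A J$. For $A$-indiscernible sequences, $I \equiv^{\mathrm{LEM}}_A J$ (same Lascar–Ehrenfeucht–Mostowski type) means there is $J' \equiv^{\mathrm{Las}}_A J$ such that $I + J'$ is $A$-indiscernible.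
   Formalization: Same LEM-type is required only between infinite A-indiscernible sequences (for finite I clause (3) would always fail), and the relation E defining [I]_≈ also relates equal sequences so that it is reflexive; the monster's saturation cardinal is an uncountable strong limit. *)

theory Defs
  imports Main
begin

unbundle cardinal_syntax

section \<open>First-order structures\<close>

datatype 'f tm = Var nat | Fn 'f "'f tm list"

datatype ('f, 'p) fm =
    Eq "'f tm" "'f tm"
  | Rel 'p "'f tm list"
  | Neg "('f, 'p) fm"
  | Conj "('f, 'p) fm" "('f, 'p) fm"
  | Exists nat "('f, 'p) fm"

text \<open>
  The signature consists of the symbols with arity in \<open>funs\<close> and \<open>rels\<close>; the universe of the
  structure is the whole type \<open>'m\<close>. Values of \<open>fint\<close> and \<open>rint\<close> outside the signature are irrelevant,
  since only well-formed formulas are ever evaluated.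
\<close>

record ('f, 'p, 'm) struct =
  funs :: "('f \<times> nat) set"
  rels :: "('p \<times> nat) set"
  fint :: "'f \<Rightarrow> 'm list \<Rightarrow> 'm"
  rint :: "'p \<Rightarrow> 'm list \<Rightarrow> bool"

fun wf_tm :: "('f, 'p, 'm, 'z) struct_scheme \<Rightarrow> 'f tm \<Rightarrow> bool" where
  "wf_tm M (Var n) = True"
| "wf_tm M (Fn f ts) = ((f, length ts) \<in> funs M \<and> (\<forall>t\<in>set ts. wf_tm M t))"

fun wf_fm :: "('f, 'p, 'm, 'z) struct_scheme \<Rightarrow> ('f, 'p) fm \<Rightarrow> bool" where
  "wf_fm M (Eq s t) = (wf_tm M s \<and> wf_tm M t)"
| "wf_fm M (Rel p ts) = ((p, length ts) \<in> rels M \<and> (\<forall>t\<in>set ts. wf_tm M t))"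
| "wf_fm M (Neg \<phi>) = wf_fm M \<phi>"
| "wf_fm M (Conj \<phi> \<psi>) = (wf_fm M \<phi> \<and> wf_fm M \<psi>)"
| "wf_fm M (Exists n \<phi>) = wf_fm M \<phi>"

fun fv_tm :: "'f tm \<Rightarrow> nat set" where
  "fv_tm (Var n) = {n}"
| "fv_tm (Fn f ts) = (\<Union>t\<in>set ts. fv_tm t)"

fun fv :: "('f, 'p) fm \<Rightarrow> nat set" where
  "fv (Eq s t) = fv_tm s \<union> fv_tm t"
| "fv (Rel p ts) = (\<Union>t\<in>set ts. fv_tm t)"
| "fv (Neg \<phi>) = fv \<phi>"
| "fv (Conj \<phi> \<psi>) = fv \<phi> \<union> fv \<psi>"
| "fv (Exists n \<phi>) = fv \<phi> - {n}"

fun eval_tm :: "('f, 'p, 'm, 'z) struct_scheme \<Rightarrow> (nat \<Rightarrow> 'm) \<Rightarrow> 'f tm \<Rightarrow> 'm" where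
  "eval_tm M v (Var n) = v n"
| "eval_tm M v (Fn f ts) = fint M f (map (eval_tm M v) ts)"

text \<open>\<open>sat_in M D v \<phi>\<close> is satisfaction in the substructure of \<open>M\<close> with universe \<open>D\<close>.\<close>

fun sat_in ::
  "('f, 'p, 'm, 'z) struct_scheme \<Rightarrow> 'm set \<Rightarrow> (nat \<Rightarrow> 'm) \<Rightarrow> ('f, 'p) fm \<Rightarrow> bool" where
  "sat_in M D v (Eq s t) = (eval_tm M v s = eval_tm M v t)"
| "sat_in M D v (Rel p ts) = rint M p (map (eval_tm M v) ts)"
| "sat_in M D v (Neg \<phi>) = (\<not> sat_in M D v \<phi>)"
| "sat_in M D v (Conj \<phi> \<psi>) = (sat_in M D v \<phi> \<and> sat_in M D v \<psi>)"
| "sat_in M D v (Exists n \<phi>) = (\<exists>d\<in>D. sat_in M D (v(n := d)) \<phi>)"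

abbreviation sat :: "('f, 'p, 'm, 'z) struct_scheme \<Rightarrow> (nat \<Rightarrow> 'm) \<Rightarrow> ('f, 'p) fm \<Rightarrow> bool" where
  "sat M \<equiv> sat_in M UNIV"

definition sentence :: "('f, 'p, 'm, 'z) struct_scheme \<Rightarrow> ('f, 'p) fm \<Rightarrow> bool" where
  "sentence M \<phi> \<longleftrightarrow> wf_fm M \<phi> \<and> fv \<phi> = {}"

text \<open>Only the signature of \<open>M\<close> is used here. Consistency is left to the existence of a model.\<close>

definition complete_theory ::
  "('f, 'p, 'm, 'z) struct_scheme \<Rightarrow> ('f, 'p) fm set \<Rightarrow> bool" where
  "complete_theory M T \<longleftrightarrow>
     (\<forall>\<phi>\<in>T. sentence M \<phi>) \<and> (\<forall>\<phi>. sentence M \<phi> \<longrightarrow> \<phi> \<in> T \<or> Neg \<phi> \<in> T)"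

definition models :: "('f, 'p, 'm, 'z) struct_scheme \<Rightarrow> ('f, 'p) fm set \<Rightarrow> bool" where
  "models M T \<longleftrightarrow> (\<forall>\<phi>\<in>T. \<forall>v. sat M v \<phi>)"

definition elem_sub :: "('f, 'p, 'm, 'z) struct_scheme \<Rightarrow> 'm set \<Rightarrow> bool" where
  "elem_sub M N \<longleftrightarrow>
     N \<noteq> {} \<and>
     (\<forall>(f, n)\<in>funs M. \<forall>xs. length xs = n \<and> set xs \<subseteq> N \<longrightarrow> fint M f xs \<in> N) \<and>
     (\<forall>\<phi> v. wf_fm M \<phi> \<and> range v \<subseteq> N \<longrightarrow> (sat_in M N v \<phi> \<longleftrightarrow> sat M v \<phi>))"

definition automorphisms :: "('f, 'p, 'm, 'z) struct_scheme \<Rightarrow> ('m \<Rightarrow> 'm) set" where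
  "automorphisms M = {\<sigma>. bij \<sigma> \<and>
     (\<forall>(f, n)\<in>funs M. \<forall>xs. length xs = n \<longrightarrow> \<sigma> (fint M f xs) = fint M f (map \<sigma> xs)) \<and>
     (\<forall>(p, n)\<in>rels M. \<forall>xs. length xs = n \<longrightarrow> (rint M p (map \<sigma> xs) \<longleftrightarrow> rint M p xs))}"


section \<open>Monster models\<close>

definition small :: "'k rel \<Rightarrow> 'a set \<Rightarrow> bool" where
  "small \<kappa> X \<longleftrightarrow> |X| <o \<kappa>"

text \<open>
  A partial 1-type over \<open>B\<close> is a set of pairs \<open>(\<phi>, v)\<close>: variable 0 is the variable of the type and
  \<open>v\<close> assigns parameters from \<open>B\<close> to the other free variables of \<open>\<phi>\<close>.
\<close>

definition saturated :: "'k rel \<Rightarrow> ('f, 'p, 'm, 'z) struct_scheme \<Rightarrow> bool" where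
  "saturated \<kappa> M \<longleftrightarrow>
     (\<forall>B p. small \<kappa> B \<and>
        (\<forall>(\<phi>, v)\<in>p. wf_fm M \<phi> \<and> v ` (fv \<phi> - {0}) \<subseteq> B) \<and>
        (\<forall>q\<subseteq>p. finite q \<longrightarrow> (\<exists>c. \<forall>(\<phi>, v)\<in>q. sat M (v(0 := c)) \<phi>)) \<longrightarrow>
        (\<exists>c. \<forall>(\<phi>, v)\<in>p. sat M (v(0 := c)) \<phi>))"

definition strongly_homogeneous :: "'k rel \<Rightarrow> ('f, 'p, 'm, 'z) struct_scheme \<Rightarrow> bool" where
  "strongly_homogeneous \<kappa> M \<longleftrightarrow>
     (\<forall>B f. small \<kappa> B \<and>
        (\<forall>\<phi> v. wf_fm M \<phi> \<and> v ` fv \<phi> \<subseteq> B \<longrightarrow> (sat M v \<phi> \<longleftrightarrow> sat M (f \<circ> v) \<phi>)) \<longrightarrow>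
        (\<exists>\<sigma>\<in>automorphisms M. \<forall>b\<in>B. \<sigma> b = f b))"

text \<open>
  The cardinal \<open>\<kappa>\<close> is an order on all of \<open>'k\<close>, so every set of size less than \<open>\<kappa>\<close> has a copy inside
  \<open>'k\<close>; \<open>'k\<close> therefore serves as the universe for index sets of small tuples and for small linear orders.
\<close>

definition monster_model ::
  "'k rel \<Rightarrow> ('f, 'p) fm set \<Rightarrow> ('f, 'p, 'm, 'z) struct_scheme \<Rightarrow> bool" where
  "monster_model \<kappa> T M \<longleftrightarrow>
     card_order \<kappa> \<and> natLeq <o \<kappa> \<and> small \<kappa> (funs M) \<and> small \<kappa> (rels M) \<and>
     (\<forall>X :: 'k set. small \<kappa> X \<longrightarrow> small \<kappa> (Pow X)) \<and>
     models M T \<and> saturated \<kappa> M \<and> strongly_homogeneous \<kappa> M"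


section \<open>Tuples and ultraimaginaries\<close>

text \<open>
  An element of \<open>M^x\<close> is a partial map with domain \<open>x\<close>; the concatenation of \<open>a\<close> and \<open>b\<close> is
  \<open>case_sum a b\<close>.
\<close>

definition tuples :: "'v set \<Rightarrow> ('v \<rightharpoonup> 'm) set" where
  "tuples x = {a. dom a = x}"

definition act :: "('m \<Rightarrow> 'm) \<Rightarrow> ('v \<rightharpoonup> 'm) \<Rightarrow> ('v \<rightharpoonup> 'm)" where
  "act \<sigma> a = map_option \<sigma> \<circ> a"

definition same_type ::
  "('f, 'p, 'm, 'z) struct_scheme \<Rightarrow> ('v \<rightharpoonup> 'm) \<Rightarrow> ('v \<rightharpoonup> 'm) \<Rightarrow> bool" where
  "same_type M a b \<longleftrightarrow> dom a = dom b \<and>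
     (\<forall>\<phi> s. wf_fm M \<phi> \<and> s ` fv \<phi> \<subseteq> dom a \<longrightarrow>
        (sat M (the \<circ> a \<circ> s) \<phi> \<longleftrightarrow> sat M (the \<circ> b \<circ> s) \<phi>))"

definition invariant_equiv ::
  "('f, 'p, 'm, 'z) struct_scheme \<Rightarrow> 'v set \<Rightarrow> ('v \<rightharpoonup> 'm) rel \<Rightarrow> bool" where
  "invariant_equiv M x E \<longleftrightarrow> equiv (tuples x) E \<and>
     (\<forall>a\<in>tuples x. \<forall>b\<in>tuples x. \<forall>c\<in>tuples x. \<forall>d\<in>tuples x.
        same_type M (case_sum a b) (case_sum c d) \<longrightarrow> ((a, b) \<in> E \<longleftrightarrow> (c, d) \<in> E))"

definition type_definable_equiv ::
  "('f, 'p, 'm, 'z) struct_scheme \<Rightarrow> 'v set \<Rightarrow> ('v \<rightharpoonup> 'm) rel \<Rightarrow> bool" where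
  "type_definable_equiv M x E \<longleftrightarrow> equiv (tuples x) E \<and>
     (\<exists>\<Phi>. (\<forall>(\<phi>, s)\<in>\<Phi>. wf_fm M \<phi> \<and> s ` fv \<phi> \<subseteq> x <+> x) \<and>
          E = {(a, b) \<in> tuples x \<times> tuples x.
                 \<forall>(\<phi>, s)\<in>\<Phi>. sat M (the \<circ> case_sum a b \<circ> s) \<phi>})"

text \<open>
  An ultraimaginary is the equivalence class itself, a set of tuples. The stabilizer and the orbit of
  \<open>a\<^sub>E\<close> depend only on this set. A real tuple \<open>b\<close> is the class \<open>{b}\<close>.
\<close>

definition ultraimaginary ::
  "'k rel \<Rightarrow> ('f, 'p, 'm, 'z) struct_scheme \<Rightarrow> ('v \<rightharpoonup> 'm) set \<Rightarrow> bool" where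
  "ultraimaginary \<kappa> M C \<longleftrightarrow>
     (\<exists>x E a. small \<kappa> x \<and> invariant_equiv M x E \<and> a \<in> tuples x \<and> C = E `` {a})"

text \<open>For \<open>C = a\<^sub>E\<close> with \<open>E\<close> invariant, \<open>a E \<sigma>(a)\<close> holds for one representative iff it holds for all.\<close>

definition Aut ::
  "('f, 'p, 'm, 'z) struct_scheme \<Rightarrow> ('v \<rightharpoonup> 'm) set \<Rightarrow> ('m \<Rightarrow> 'm) set" where
  "Aut M C = {\<sigma> \<in> automorphisms M. \<forall>a\<in>C. act \<sigma> a \<in> C}"

definition bddu ::
  "'k rel \<Rightarrow> ('f, 'p, 'm, 'z) struct_scheme \<Rightarrow> ('v \<rightharpoonup> 'm) set \<Rightarrow> ('w \<rightharpoonup> 'm) set set" where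
  "bddu \<kappa> M A = {D. ultraimaginary \<kappa> M D \<and> small \<kappa> ((\<lambda>\<sigma>. act \<sigma> ` D) ` Aut M A)}"

text \<open>The pair of two ultraimaginaries: the corresponding class of the product relation.\<close>

definition upair :: "('v \<rightharpoonup> 'm) set \<Rightarrow> ('w \<rightharpoonup> 'm) set \<Rightarrow> ('v + 'w \<rightharpoonup> 'm) set" where
  "upair A B = {case_sum a b | a b. a \<in> A \<and> b \<in> B}"

definition bu_indep ::
  "'k rel \<Rightarrow> ('f, 'p, 'm, 'z) struct_scheme \<Rightarrow>
     ('u \<rightharpoonup> 'm) set \<Rightarrow> ('v \<rightharpoonup> 'm) set \<Rightarrow> ('w \<rightharpoonup> 'm) set \<Rightarrow> bool" where
  "bu_indep \<kappa> M A B C \<longleftrightarrow>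
     (bddu \<kappa> M (upair A B) :: ('k \<rightharpoonup> 'm) set set) \<inter> bddu \<kappa> M (upair A C) = bddu \<kappa> M A"

text \<open>
  A small family of hyperimaginaries \<open>(a\<^sub>i)\<^bsub>E\<^sub>i\<^esub>\<close>, \<open>i \<in> K\<close>, where \<open>a\<^sub>i\<close> is the tuple \<open>\<lambda>j. a (i, j)\<close> in the
  variables \<open>x i\<close>. Smallness of \<open>Sigma K x\<close> matters only for singular \<open>\<kappa>\<close>.
\<close>

definition hyperimaginary_family ::
  "'k rel \<Rightarrow> ('f, 'p, 'm, 'z) struct_scheme \<Rightarrow> 'i set \<Rightarrow> ('i \<Rightarrow> 'v set) \<Rightarrow>
     ('i \<Rightarrow> ('v \<rightharpoonup> 'm) rel) \<Rightarrow> ('i \<times> 'v \<rightharpoonup> 'm) \<Rightarrow> bool" where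
  "hyperimaginary_family \<kappa> M K x E a \<longleftrightarrow>
     small \<kappa> K \<and> small \<kappa> (Sigma K x) \<and>
     (\<forall>i\<in>K. type_definable_equiv M (x i) (E i)) \<and> a \<in> tuples (Sigma K x)"

definition product_rel ::
  "'i set \<Rightarrow> ('i \<Rightarrow> 'v set) \<Rightarrow> ('i \<Rightarrow> ('v \<rightharpoonup> 'm) rel) \<Rightarrow> ('i \<times> 'v \<rightharpoonup> 'm) rel" where
  "product_rel K x E = {(a, b) \<in> tuples (Sigma K x) \<times> tuples (Sigma K x).
     \<forall>i\<in>K. (\<lambda>j. a (i, j), \<lambda>j. b (i, j)) \<in> E i}"

definition conj_over ::
  "('f, 'p, 'm, 'z) struct_scheme \<Rightarrow> ('u \<rightharpoonup> 'm) set \<Rightarrow> ('v \<rightharpoonup> 'm) \<Rightarrow> ('v \<rightharpoonup> 'm) \<Rightarrow> bool" where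
  \<comment> \<open>equality of types of real tuples over the (hyper- or ultra-)imaginary parameter \<open>A\<close>\<close>
  "conj_over M A b c \<longleftrightarrow> (\<exists>\<sigma>\<in>Aut M A. act \<sigma> b = c)"

inductive_set Autf ::
  "'k rel \<Rightarrow> ('f, 'p, 'm, 'z) struct_scheme \<Rightarrow> ('v \<rightharpoonup> 'm) set \<Rightarrow> ('m \<Rightarrow> 'm) set"
  for \<kappa> M A where
  gen: "\<lbrakk>elem_sub M N; small \<kappa> N;
         {\<tau> \<in> automorphisms M. \<forall>c\<in>N. \<tau> c = c} \<subseteq> Aut M A;
         \<sigma> \<in> automorphisms M; \<forall>c\<in>N. \<sigma> c = c\<rbrakk> \<Longrightarrow> \<sigma> \<in> Autf \<kappa> M A"
| one: "id \<in> Autf \<kappa> M A"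
| mult: "\<lbrakk>\<sigma> \<in> Autf \<kappa> M A; \<tau> \<in> Autf \<kappa> M A\<rbrakk> \<Longrightarrow> \<sigma> \<circ> \<tau> \<in> Autf \<kappa> M A"
| inverse: "\<sigma> \<in> Autf \<kappa> M A \<Longrightarrow> inv \<sigma> \<in> Autf \<kappa> M A"


section \<open>Sequences\<close>

text \<open>
  A sequence of real tuples is a (reflexive) linear order \<open>sord\<close> on its set of indices together with
  the real tuple \<open>stup\<close> of all its entries: the \<open>i\<close>-th term is \<open>\<lambda>j. stup (i, j)\<close>.
\<close>

record ('o, 'v, 'm) seqn =
  sord :: "'o rel"
  stup :: "'o \<times> 'v \<rightharpoonup> 'm"

definition is_seq :: "'k rel \<Rightarrow> ('o, 'v, 'm) seqn \<Rightarrow> bool" where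
  "is_seq \<kappa> I \<longleftrightarrow> Linear_order (sord I) \<and> small \<kappa> (Field (sord I)) \<and>
     (\<exists>y. small \<kappa> y \<and> stup I \<in> tuples (Field (sord I) \<times> y))"

definition infinite_seq :: "('o, 'v, 'm) seqn \<Rightarrow> bool" where
  "infinite_seq I \<longleftrightarrow> infinite (Field (sord I))"

definition seq_append ::
  "('o, 'v, 'm) seqn \<Rightarrow> ('q, 'v, 'm) seqn \<Rightarrow> ('o + 'q, 'v, 'm) seqn" where
  "seq_append I J = \<lparr>
     sord = {(Inl i, Inl j) | i j. (i, j) \<in> sord I} \<union> {(Inr i, Inr j) | i j. (i, j) \<in> sord J} \<union>
            {(Inl i, Inr j) | i j. i \<in> Field (sord I) \<and> j \<in> Field (sord J)},
     stup = (\<lambda>(k, j). case k of Inl i \<Rightarrow> stup I (i, j) | Inr i \<Rightarrow> stup J (i, j))\<rparr>"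

definition increasing :: "'o rel \<Rightarrow> 'o list \<Rightarrow> bool" where
  "increasing r is \<longleftrightarrow> set is \<subseteq> Field r \<and> sorted_wrt (\<lambda>i j. (i, j) \<in> r \<and> i \<noteq> j) is"

definition subtup :: "('o, 'v, 'm) seqn \<Rightarrow> 'o list \<Rightarrow> (nat \<times> 'v \<rightharpoonup> 'm)" where
  "subtup I is = (\<lambda>(n, j). if n < length is then stup I (is ! n, j) else None)"

definition EM_equiv ::
  "('f, 'p, 'm, 'z) struct_scheme \<Rightarrow> ('u \<rightharpoonup> 'm) set \<Rightarrow>
     ('o, 'v, 'm) seqn \<Rightarrow> ('q, 'v, 'm) seqn \<Rightarrow> bool" where
  "EM_equiv M A I J \<longleftrightarrow>
     (\<forall>is js. increasing (sord I) is \<and> increasing (sord J) js \<and> length is = length js \<longrightarrow>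
        conj_over M A (subtup I is) (subtup J js))"

definition indiscernible ::
  "'k rel \<Rightarrow> ('f, 'p, 'm, 'z) struct_scheme \<Rightarrow> ('u \<rightharpoonup> 'm) set \<Rightarrow> ('o, 'v, 'm) seqn \<Rightarrow> bool" where
  "indiscernible \<kappa> M A I \<longleftrightarrow> is_seq \<kappa> I \<and>
     (\<forall>is js. increasing (sord I) is \<and> increasing (sord I) js \<and> length is = length js \<longrightarrow>
        conj_over M A (subtup I is) (subtup I js))"

definition omega_seq :: "('o, 'v, 'm) seqn \<Rightarrow> bool" where
  "omega_seq I \<longleftrightarrow> sord I =o natLeq"

definition total_bu_Morley ::
  "'k rel \<Rightarrow> ('f, 'p, 'm, 'z) struct_scheme \<Rightarrow> ('u \<rightharpoonup> 'm) set \<Rightarrow> ('o, 'v, 'm) seqn \<Rightarrow> bool" where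
  "total_bu_Morley \<kappa> M A b \<longleftrightarrow> omega_seq b \<and> indiscernible \<kappa> M A b \<and>
     (\<forall>(I :: ('k, 'v, 'm) seqn) (J :: ('k, 'v, 'm) seqn).
        is_seq \<kappa> I \<and> is_seq \<kappa> J \<and> EM_equiv M A (seq_append I J) b \<longrightarrow>
        bu_indep \<kappa> M A {stup I} {stup J})"

definition seq_sim ::
  "'k rel \<Rightarrow> ('f, 'p, 'm, 'z) struct_scheme \<Rightarrow> ('u \<rightharpoonup> 'm) set \<Rightarrow>
     ('o, 'v, 'm) seqn \<Rightarrow> ('o, 'v, 'm) seqn \<Rightarrow> bool" where
  "seq_sim \<kappa> M A I J \<longleftrightarrow> is_seq \<kappa> I \<and> is_seq \<kappa> J \<and> infinite_seq I \<and> infinite_seq J \<and>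
     (indiscernible \<kappa> M A (seq_append I J) \<or> indiscernible \<kappa> M A (seq_append J I))"

text \<open>The index type is \<open>'k\<close>, so that the intermediate sequences may have any small order type.\<close>

definition seq_approx ::
  "'k rel \<Rightarrow> ('f, 'p, 'm, 'z) struct_scheme \<Rightarrow> ('u \<rightharpoonup> 'm) set \<Rightarrow>
     ('k, 'v, 'm) seqn \<Rightarrow> ('k, 'v, 'm) seqn \<Rightarrow> bool" where
  "seq_approx \<kappa> M A = (seq_sim \<kappa> M A)\<^sup>+\<^sup>+"

text \<open>
  The relation \<open>E(AI, BJ)\<close> for sequences of \<open>y\<close>-tuples with index order \<open>r\<close>; here \<open>A\<close> and \<open>B\<close> range over
  the classes of \<open>EA\<close>. The disjunct \<open>s = t\<close> makes the relation reflexive at sequences that are not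
  \<open>A\<close>-indiscernible.
\<close>

definition approx_rel ::
  "'k rel \<Rightarrow> ('f, 'p, 'm, 'z) struct_scheme \<Rightarrow> ('u \<rightharpoonup> 'm) rel \<Rightarrow> 'k rel \<Rightarrow> 'v set \<Rightarrow>
     ('u + 'k \<times> 'v \<rightharpoonup> 'm) rel" where
  "approx_rel \<kappa> M EA r y = {(case_sum a s, case_sum b t) | a b s t.
     (a, b) \<in> EA \<and> s \<in> tuples (Field r \<times> y) \<and> t \<in> tuples (Field r \<times> y) \<and>
     (s = t \<or> seq_approx \<kappa> M (EA `` {a}) \<lparr>sord = r, stup = s\<rparr> \<lparr>sord = r, stup = t\<rparr>)}"

definition approx_class ::
  "'k rel \<Rightarrow> ('f, 'p, 'm, 'z) struct_scheme \<Rightarrow> ('u \<rightharpoonup> 'm) rel \<Rightarrow> ('u \<rightharpoonup> 'm) \<Rightarrow>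
     ('k, 'v, 'm) seqn \<Rightarrow> ('u + 'k \<times> 'v \<rightharpoonup> 'm) set" where
  "approx_class \<kappa> M EA a I =
     approx_rel \<kappa> M EA (sord I) (snd ` dom (stup I)) `` {case_sum a (stup I)}"

definition Las_equiv ::
  "'k rel \<Rightarrow> ('f, 'p, 'm, 'z) struct_scheme \<Rightarrow> ('u \<rightharpoonup> 'm) set \<Rightarrow>
     ('o, 'v, 'm) seqn \<Rightarrow> ('o, 'v, 'm) seqn \<Rightarrow> bool" where
  "Las_equiv \<kappa> M A I J \<longleftrightarrow> sord I = sord J \<and> (\<exists>\<sigma>\<in>Autf \<kappa> M A. act \<sigma> (stup I) = stup J)"

text \<open>
  Lascar-Ehrenfeucht-Mostowski types are types of infinite indiscernible sequences; without the
  infinity requirement a finite initial segment of \<open>J\<close> could have the same type as \<open>J\<close>.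
\<close>

definition LEM_equiv ::
  "'k rel \<Rightarrow> ('f, 'p, 'm, 'z) struct_scheme \<Rightarrow> ('u \<rightharpoonup> 'm) set \<Rightarrow>
     ('o, 'v, 'm) seqn \<Rightarrow> ('q, 'v, 'm) seqn \<Rightarrow> bool" where
  "LEM_equiv \<kappa> M A I J \<longleftrightarrow>
     indiscernible \<kappa> M A I \<and> indiscernible \<kappa> M A J \<and> infinite_seq I \<and> infinite_seq J \<and>
     (\<exists>J'. Las_equiv \<kappa> M A J' J \<and> indiscernible \<kappa> M A (seq_append I J'))"

end

theory Submission
  imports Defs "HOL-Library.Ramsey"
begin

text \<open>
  A bounded ultraimaginary is fixed by all automorphisms over a small model that fix \<open>A\<close>, and every
  infinite \<open>A\<close>-indiscernible sequence is indiscernible over such a model. Hence \<open>\<sim>\<close>-related sequences of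
  the same order type are Lascar equivalent, and limits along a sequence \<open>J\<close> amalgamate
  \<open>J \<sim> K\<^sub>1\<close> and \<open>J \<sim> K\<^sub>2\<close> into one \<open>P\<close> of any order type with \<open>P \<sim> K\<^sub>1\<close> and \<open>P \<sim> K\<^sub>2\<close>.

  (2) implies (4): if \<open>b' + I + J\<close> is indiscernible, then the class of \<open>b'\<close> is bounded over \<open>AI\<close> and over
  \<open>AJ\<close>, hence over \<open>A\<close>. (4) and (3): amalgamation replaces a chain of \<open>\<sim>\<close>-steps by one step up to Lascar
  equivalence; a bounded class is fixed by Lascar strong automorphisms; and if (3) holds, the class
  of \<open>\<sigma> b\<close> depends only on the type of \<open>\<sigma> b\<close> over a small model. (4) implies (1): if \<open>e\<close> is bounded over
  \<open>AI\<close> and \<open>AJ\<close>, where \<open>I + J\<close> is indiscernible, then \<open>e\<close> is bounded over \<open>AK\<close> for all \<open>K \<approx> I\<close> of the order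
  type of \<open>I\<close>. So if \<open>\<sigma>\<close> fixes the class of \<open>I\<close>, then \<open>\<sigma> e\<close> is bounded over \<open>AI\<close>, which leaves few conjugates;
  as the class has few conjugates over \<open>A\<close>, so has \<open>e\<close>.
\<close>

text \<open>Ultraimaginaries have no compactness of their own, since their equivalence relations
  need not be type-definable. Existence proofs therefore live among real tuples: compactness yields
  tuples, homogeneity yields automorphisms, and an ultraimaginary enters only through a
  representative or a count of its conjugates.

  The limits are not taken along an ultrafilter. The part of the limit type that is forced by
  indiscernibility suffices, and it allows any order type for the limit. Indiscernibility is first
  strengthened from \<open>A\<close> to a model, because types over real parameters are decided by
  formulas while those over \<open>A\<close> are not; the limit is then taken over all models and
  sequences involved at once.

  The obstacle in (4) implies (1) is that a chain of \<sim> steps passes through varying order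
  types, while boundedness is transported only between sequences of the same index order. Limits
  along final segments of \<open>I\<close>, whose order is first arranged to have no maximum, insert
  a third sequence right after \<open>I\<close>; of three consecutive blocks in one indiscernible
  sequence, boundedness over two gives boundedness over the third.\<close>

lemma card_of_lists_ordLeq_infinite:
  fixes A :: "'a set"
  assumes "infinite B" "|A| \<le>o |B|"
  shows "|lists A| \<le>o |B|"
proof -
  have len: "|{xs \<in> lists A. length xs = n}| \<le>o |B|" for n
  proof (induction n)
    case 0
    have "{xs \<in> lists A. length xs = 0} = {[]}" by auto
    moreover obtain z where "z \<in> B" using assms(1) by (metis ex_in_conv finite.emptyI)
    moreover have "|{[] :: 'a list}| \<le>o |B|"
      using \<open>z \<in> B\<close> by (subst card_of_ordLeq[symmetric]) (auto intro!: exI[of _ "\<lambda>_. z"])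
    ultimately show ?case by simp
  next
    case (Suc n)
    have "{xs \<in> lists A. length xs = Suc n} \<subseteq>
        (\<lambda>(x, xs). x # xs) ` (A \<times> {xs \<in> lists A. length xs = n})"
      by (force simp: length_Suc_conv image_iff)
    then have "|{xs \<in> lists A. length xs = Suc n}| \<le>o |A \<times> {xs \<in> lists A. length xs = n}|"
      by (meson card_of_image card_of_mono1 ordLeq_transitive)
    also have "|A \<times> {xs \<in> lists A. length xs = n}| \<le>o |B|"
      by (rule card_of_Sigma_ordLeq_infinite[OF assms]) (blast intro: Suc)
    finally show ?case .
  qed
  have "lists A = (\<Union>n. {xs \<in> lists A. length xs = n})" by auto
  moreover have "|\<Union>n. {xs \<in> lists A. length xs = n}| \<le>o |B|"
    using len assms(1) by (intro card_of_UNION_ordLeq_infinite) (auto simp: infinite_iff_card_of_nat[symmetric])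
  ultimately show ?thesis by simp
qed

text \<open>Each of the \<omega> rounds adds at most one value per pair of an index and a list, and
  lists over an infinite set are no more numerous than its elements. Operations accept lists of any
  length and ignore arities, which only enlarges \<open>N\<close>. The lemma serves to count terms
  and formulas and to build Skolem hulls.\<close>

lemma ordLeq_closure_under_lists:
  fixes g :: "'i \<Rightarrow> 'b list \<Rightarrow> 'b"
  assumes inf: "infinite B" and base: "|S| \<le>o |B|" and idx: "|I| \<le>o |B|"
  obtains N where "S \<subseteq> N" "|N| \<le>o |B|" "\<And>i xs. i \<in> I \<Longrightarrow> set xs \<subseteq> N \<Longrightarrow> g i xs \<in> N"
proof
  define step where "step X = X \<union> (\<lambda>(i, xs). g i xs) ` (I \<times> lists X)" for X
  define N where "N n = (step ^^ n) S" for n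
  have mono: "N m \<subseteq> N n" if "m \<le> n" for m n
    using that by (rule lift_Suc_mono_le[rotated]) (auto simp: N_def step_def)
  have "S = N 0" by (simp add: N_def)
  then show "S \<subseteq> (\<Union>n. N n)" by blast
  have "|N n| \<le>o |B|" for n
  proof (induction n)
    case 0
    then show ?case using base by (simp add: N_def)
  next
    case (Suc n)
    have "|I \<times> lists (N n)| \<le>o |B|"
      by (rule card_of_Sigma_ordLeq_infinite[OF inf idx]) (blast intro: card_of_lists_ordLeq_infinite[OF inf Suc])
    then have "|(\<lambda>(i, xs). g i xs) ` (I \<times> lists (N n))| \<le>o |B|"
      using card_of_image ordLeq_transitive by blast
    then have "|step (N n)| \<le>o |B|"
      unfolding step_def using inf Suc
      by (intro card_of_Un_ordLeq_infinite_Field) (simp_all add: card_of_card_order_on Field_card_of)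
    then show ?case by (simp add: N_def)
  qed
  then show "|\<Union>n. N n| \<le>o |B|"
    using inf by (intro card_of_UNION_ordLeq_infinite) (auto simp: infinite_iff_card_of_nat[symmetric])
  fix i xs assume i: "i \<in> I" and xs: "set xs \<subseteq> (\<Union>n. N n)"
  have "\<exists>n. set xs \<subseteq> N n" using xs
  proof (induction xs)
    case (Cons x xs)
    then obtain m n where "set xs \<subseteq> N m" "x \<in> N n" by auto
    then have "set (x # xs) \<subseteq> N (max m n)"
      using mono[of m "max m n"] mono[of n "max m n"] by auto
    then show ?case by blast
  qed auto
  then obtain n where "set xs \<subseteq> N n" by blast
  then have "g i xs \<in> step (N n)" using i by (force simp: step_def lists_eq_set)
  then show "g i xs \<in> (\<Union>n. N n)" by (auto simp: N_def intro!: exI[of _ "Suc n"])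
qed

section \<open>Small sets and the number of formulas\<close>

locale monster =
  fixes \<kappa> :: "'k rel" and M :: "('f, 'p, 'm, 'z) struct_scheme"
  assumes card: "card_order \<kappa>" and unc: "natLeq <o \<kappa>"
    and small_funs: "small \<kappa> (funs M)" and small_rels: "small \<kappa> (rels M)"
    and strong_limit: "\<And>X :: 'k set. small \<kappa> X \<Longrightarrow> small \<kappa> (Pow X)"
    and saturated: "saturated \<kappa> M" and homogeneous: "strongly_homogeneous \<kappa> M"
begin

abbreviation sm :: "'a set \<Rightarrow> bool" where "sm \<equiv> small \<kappa>"

lemma Card_order_\<kappa>: "Card_order \<kappa>"
  using card card_order_on_Card_order by blast

lemma Field_\<kappa>: "Field \<kappa> = UNIV"
  using card card_order_on_Card_order by blast

lemma \<kappa>_card_of: "\<kappa> =o |UNIV :: 'k set|"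
  using card_of_Field_ordIso[OF Card_order_\<kappa>] Field_\<kappa> ordIso_symmetric by metis

lemma infinite_\<kappa>: "infinite (UNIV :: 'k set)"
proof -
  have "natLeq \<le>o \<kappa>" using unc ordLess_imp_ordLeq by blast
  then have "natLeq \<le>o |UNIV :: 'k set|" using \<kappa>_card_of by (rule ordLeq_ordIso_trans)
  then show ?thesis using infinite_iff_natLeq_ordLeq[of "UNIV :: 'k set"] by blast
qed

lemma small_iff_UNIV: "sm X \<longleftrightarrow> |X| <o |UNIV :: 'k set|"
  unfolding small_def using \<kappa>_card_of ordIso_symmetric ordLess_ordIso_trans by blast

lemma small_ordLeq: "sm B \<Longrightarrow> |A| \<le>o |B| \<Longrightarrow> sm A"
  unfolding small_def using ordLeq_ordLess_trans by blast

lemma small_subset: "sm B \<Longrightarrow> A \<subseteq> B \<Longrightarrow> sm A"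
  using small_ordLeq card_of_mono1 by blast

lemma small_image: "sm A \<Longrightarrow> sm (f ` A)"
  using small_ordLeq card_of_image by blast

lemma small_inj_image: "inj_on f A \<Longrightarrow> f ` A \<subseteq> B \<Longrightarrow> sm B \<Longrightarrow> sm A"
  using small_ordLeq card_of_ordLeq by blast

lemma small_nat: "sm (A :: nat set)"
proof -
  have "|UNIV :: nat set| <o \<kappa>"
    using unc card_of_nat ordIso_ordLess_trans by blast
  then show ?thesis by (intro small_subset[of UNIV A]) (simp_all add: small_def)
qed

lemma small_finite: "finite A \<Longrightarrow> sm A"
proof -
  assume "finite A"
  from finite_imp_inj_to_nat_seg[OF this] obtain f and n :: nat where "f ` A = {i. i < n}" "inj_on f A"
    by (elim exE conjE)
  then show ?thesis using small_inj_image[of f A UNIV] small_nat by auto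
qed

lemma small_Plus: "sm A \<Longrightarrow> sm B \<Longrightarrow> sm (A <+> B)"
  unfolding small_iff_UNIV by (rule card_of_Plus_ordLess_infinite[OF infinite_\<kappa>])

lemma small_Un: "sm A \<Longrightarrow> sm B \<Longrightarrow> sm (A \<union> B)"
  unfolding small_iff_UNIV by (rule card_of_Un_ordLess_infinite[OF infinite_\<kappa>])

lemma small_infinite_superset:
  fixes A :: "'a set"
  assumes "sm A" obtains B :: "(nat + 'a) set" where "infinite B" "sm B" "|A| \<le>o |B|" "|UNIV :: nat set| \<le>o |B|"
proof (rule that)
  show "sm ((UNIV :: nat set) <+> A)" using small_Plus[OF small_nat assms] .
  show "infinite ((UNIV :: nat set) <+> A)" by (simp add: finite_Plus_iff)
qed (rule card_of_Plus1 card_of_Plus2)+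

text \<open>The uniform bound \<open>B\<close> matters because \<kappa> may be singular: a small
  union of small sets need not be small when their sizes are cofinal in \<kappa>.\<close>

lemma small_Sigma_bounded:
  assumes "sm A" "sm B" "\<And>i. i \<in> A \<Longrightarrow> |F i| \<le>o |B|" shows "sm (Sigma A F)"
proof -
  obtain C where C: "infinite (C :: (nat + ('a + 'b)) set)" "sm C" "|A <+> B| \<le>o |C|"
    using small_infinite_superset[OF small_Plus[OF assms(1,2)]] by blast
  have "|A| \<le>o |C|" using ordLeq_transitive[OF card_of_Plus1 C(3)] .
  moreover have "|F i| \<le>o |C|" if "i \<in> A" for i
    using ordLeq_transitive[OF assms(3)[OF that] ordLeq_transitive[OF card_of_Plus2 C(3)]] .
  ultimately have "|Sigma A F| \<le>o |C|"
    using card_of_Sigma_ordLeq_infinite[OF C(1)] by blast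
  then show ?thesis by (rule small_ordLeq[OF C(2)])
qed

lemma small_Times: "sm A \<Longrightarrow> sm B \<Longrightarrow> sm (A \<times> B)"
  by (rule small_Sigma_bounded[of A B]) (simp_all add: ordLeq_refl card_of_Card_order)

lemma small_transfer:
  assumes "sm A" obtains X :: "'k set" and f where "bij_betw f A X"
proof -
  have "|A| \<le>o |UNIV :: 'k set|" using assms unfolding small_iff_UNIV by (rule ordLess_imp_ordLeq)
  then obtain f :: "_ \<Rightarrow> 'k" where "inj_on f A" unfolding card_of_ordLeq[symmetric] by (elim exE conjE)
  then show thesis using that[of f "f ` A"] by (simp add: bij_betw_def)
qed

lemma small_Pow: assumes "sm A" shows "sm (Pow A)"
proof -
  obtain X :: "'k set" and f where f: "bij_betw f A X" using small_transfer[OF assms] .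
  then have "sm X" using small_image[OF assms, of f] by (simp add: bij_betw_def)
  then have "sm (Pow X)" by (rule strong_limit)
  moreover have "inj_on (image f) (Pow A)"
    by (rule inj_on_image_Pow[OF bij_betw_imp_inj_on[OF f]])
  moreover have "image f ` Pow A \<subseteq> Pow X"
    using f unfolding bij_betw_def by auto
  ultimately show ?thesis using small_inj_image[of "image f" "Pow A" "Pow X"] by simp
qed

text \<open>The fixed value \<open>c\<close> off \<open>A\<close> makes a function recoverable from
  its graph over \<open>A\<close>, a subset of the small set \<open>A \<times> B\<close>; the strong
  limit property bounds the number of such subsets.\<close>

lemma small_functions: assumes "sm A" "sm B" shows "sm {s. \<forall>x. if x \<in> A then s x \<in> B else s x = c}"
proof -
  have "inj_on (\<lambda>s. {(x, s x) | x. x \<in> A}) {s. \<forall>x. if x \<in> A then s x \<in> B else s x = c}"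
  proof (rule inj_onI, rule ext)
    fix s t x
    assume "s \<in> {s. \<forall>x. if x \<in> A then s x \<in> B else s x = c}" "t \<in> {s. \<forall>x. if x \<in> A then s x \<in> B else s x = c}"
      and eq: "{(x, s x) | x. x \<in> A} = {(x, t x) | x. x \<in> A}"
    then have "x \<notin> A \<Longrightarrow> s x = c \<and> t x = c" by auto
    moreover have "s x = t x" if "x \<in> A" using eq that by blast
    ultimately show "s x = t x" by (cases "x \<in> A") auto
  qed
  moreover have "(\<lambda>s. {(x, s x) | x. x \<in> A}) ` {s. \<forall>x. if x \<in> A then s x \<in> B else s x = c} \<subseteq> Pow (A \<times> B)"
    by (auto split: if_splits)
  moreover have "sm (Pow (A \<times> B))" by (intro small_Pow small_Times assms)
  ultimately show ?thesis by (rule small_inj_image)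
qed

lemma small_closure_under_lists:
  fixes g :: "'i \<Rightarrow> 'b list \<Rightarrow> 'b"
  assumes "sm S" "sm I"
  obtains N where "S \<subseteq> N" "sm N" "\<And>i xs. i \<in> I \<Longrightarrow> set xs \<subseteq> N \<Longrightarrow> g i xs \<in> N"
proof -
  obtain C where C: "infinite (C :: (nat + ('b + 'i)) set)" "sm C" "|S <+> I| \<le>o |C|"
    using small_infinite_superset[OF small_Plus[OF assms]] by blast
  have "|S| \<le>o |C|" "|I| \<le>o |C|"
    using ordLeq_transitive[OF card_of_Plus1 C(3)] ordLeq_transitive[OF card_of_Plus2 C(3)] .
  from ordLeq_closure_under_lists[OF C(1) this, of g] obtain N
    where "S \<subseteq> N" "|N| \<le>o |C|" "\<And>i xs. i \<in> I \<Longrightarrow> set xs \<subseteq> N \<Longrightarrow> g i xs \<in> N" by blast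
  then show thesis using that small_ordLeq[OF C(2)] by blast
qed

text \<open>A small set closed under the term constructors is exhibited in place of an injection.
  Arities are dropped on the way, so that set may contain ill-formed terms too.\<close>

lemma small_wf_tm: "sm {t. wf_tm M t}"
proof -
  obtain N where N: "range Var \<subseteq> N" "sm N" "\<And>i ts. i \<in> fst ` funs M \<Longrightarrow> set ts \<subseteq> N \<Longrightarrow> Fn i ts \<in> N"
    using small_closure_under_lists[of "range Var" "fst ` funs M" Fn, OF small_image[OF small_nat] small_image[OF small_funs]]
    by blast
  have "t \<in> N" if "wf_tm M t" for t
    using that
  proof (induction t)
    case (Fn f ts)
    then have "f \<in> fst ` funs M" "set ts \<subseteq> N" by force+
    then show ?case by (rule N(3))
  qed (use N in auto)
  then show ?thesis using N(2) small_subset by blast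
qed

lemma small_wf_fm: "sm {\<phi>. wf_fm M \<phi>}"
proof -
  let ?T = "{t. wf_tm M t}"
  let ?at = "(\<lambda>(s, t). Eq s t) ` (?T \<times> ?T) \<union> (\<lambda>(p, ts). Rel p ts) ` (fst ` rels M \<times> lists ?T)"
  \<comment> \<open>The constructors are coded by numbers: 0 is negation, 1 conjunction, and n + 2
    the quantifier binding variable n. Arguments are read off the front of the list.\<close>
  let ?g = "\<lambda>i xs. case i of 0 \<Rightarrow> Neg (hd xs) | Suc 0 \<Rightarrow> Conj (hd xs) (hd (tl xs)) | Suc (Suc n) \<Rightarrow> Exists n (hd xs)"
  obtain C where C: "infinite (C :: (nat + 'f tm) set)" "sm C" "|?T| \<le>o |C|"
    using small_infinite_superset[OF small_wf_tm] by blast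
  then have "sm (lists ?T)" using small_ordLeq[OF C(2) card_of_lists_ordLeq_infinite] by blast
  then have "sm ?at"
    by (intro small_Un small_image small_Times small_wf_tm small_rels)
  then obtain N where N: "?at \<subseteq> N" "sm N" "\<And>i xs. i \<in> (UNIV :: nat set) \<Longrightarrow> set xs \<subseteq> N \<Longrightarrow> ?g i xs \<in> N"
    using small_closure_under_lists[of ?at "UNIV :: nat set" ?g, OF _ small_nat] by blast
  have "\<phi> \<in> N" if "wf_fm M \<phi>" for \<phi>
    using that
  proof (induction \<phi>)
    case (Neg \<phi>)
    then show ?case using N(3)[of 0 "[\<phi>]"] by simp
  next
    case (Conj \<phi> \<psi>)
    then show ?case using N(3)[of "Suc 0" "[\<phi>, \<psi>]"] by simp
  next
    case (Exists n \<phi>)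
    then show ?case using N(3)[of "Suc (Suc n)" "[\<phi>]"] by simp
  next
    case (Eq s t)
    then have "Eq s t \<in> ?at" by force
    then show ?case using N(1) by blast
  next
    case (Rel p ts)
    then have "Rel p ts \<in> ?at" by (force simp: lists_eq_set)
    then show ?case using N(1) by blast
  qed
  then show ?thesis using N(2) small_subset by blast
qed

end

section \<open>Definable predicates\<close>

lemma eval_tm_cong: "(\<And>n. n \<in> fv_tm t \<Longrightarrow> v n = w n) \<Longrightarrow> eval_tm M v t = eval_tm M w t"
proof (induction t)
  case (Fn f ts)
  then have "map (eval_tm M v) ts = map (eval_tm M w) ts" by (intro map_cong) auto
  then show ?case by (simp only: eval_tm.simps)
qed simp

lemma sat_in_cong: "(\<And>n. n \<in> fv \<phi> \<Longrightarrow> v n = w n) \<Longrightarrow> sat_in M D v \<phi> = sat_in M D w \<phi>"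
proof (induction \<phi> arbitrary: v w)
  case (Eq s t)
  have "eval_tm M v s = eval_tm M w s" "eval_tm M v t = eval_tm M w t"
    using Eq by (intro eval_tm_cong; auto)+
  then show ?case by (simp only: sat_in.simps)
next
  case (Rel p ts)
  then have "map (eval_tm M v) ts = map (eval_tm M w) ts"
    by (intro map_cong eval_tm_cong) auto
  then show ?case by (simp only: sat_in.simps)
next
  case (Neg \<phi>)
  have "sat_in M D v \<phi> = sat_in M D w \<phi>" using Neg.prems by (intro Neg.IH) auto
  then show ?case by (simp only: sat_in.simps)
next
  case (Conj \<phi> \<psi>)
  have "sat_in M D v \<phi> = sat_in M D w \<phi>" using Conj.prems by (intro Conj.IH(1)) auto
  moreover have "sat_in M D v \<psi> = sat_in M D w \<psi>" using Conj.prems by (intro Conj.IH(2)) auto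
  ultimately show ?case by (simp only: sat_in.simps)
next
  case (Exists n \<phi>)
  have "sat_in M D (v(n := d)) \<phi> = sat_in M D (w(n := d)) \<phi>" for d
    using Exists.prems by (intro Exists.IH) auto
  then show ?case by simp
qed

lemma finite_fv_tm: "finite (fv_tm t)"
  by (induction t) auto

lemma finite_fv: "finite (fv \<phi>)"
  by (induction \<phi>) (auto simp: finite_fv_tm)

primrec rename_tm :: "(nat \<Rightarrow> nat) \<Rightarrow> 'f tm \<Rightarrow> 'f tm" where
  "rename_tm g (Var n) = Var (g n)"
| "rename_tm g (Fn f ts) = Fn f (map (rename_tm g) ts)"

lemma rename_tm:
  "wf_tm M (rename_tm g t) = wf_tm M t" "fv_tm (rename_tm g t) = g ` fv_tm t"
  "eval_tm M v (rename_tm g t) = eval_tm M (v \<circ> g) t"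
proof -
  show "wf_tm M (rename_tm g t) = wf_tm M t" by (induction t) auto
  show "fv_tm (rename_tm g t) = g ` fv_tm t" by (induction t) auto
  show "eval_tm M v (rename_tm g t) = eval_tm M (v \<circ> g) t"
  proof (induction t)
    case (Fn f ts)
    then have "map (eval_tm M v) (map (rename_tm g) ts) = map (eval_tm M (v \<circ> g)) ts"
      by (auto simp: comp_def)
    then show ?case by (simp only: eval_tm.simps rename_tm.simps)
  qed simp
qed

text \<open>An existence statement replaces a renaming function because \<open>g\<close> need not be
  injective, so bound variables have to be chosen afresh.\<close>

lemma rename_fm:
  "\<exists>\<phi>'. (wf_fm M \<phi> \<longrightarrow> wf_fm M \<phi>') \<and> fv \<phi>' \<subseteq> g ` fv \<phi> \<and> (\<forall>v. sat M v \<phi>' \<longleftrightarrow> sat M (v \<circ> g) \<phi>)"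
proof (induction \<phi> arbitrary: g)
  case (Eq s t)
  show ?case
    by (rule exI[of _ "Eq (rename_tm g s) (rename_tm g t)"]) (auto simp: rename_tm comp_def)
next
  case (Rel p ts)
  have "map (eval_tm M v \<circ> rename_tm g) ts = map (eval_tm M (v \<circ> g)) ts" for v
    by (intro map_cong) (auto simp: rename_tm comp_def)
  then show ?case
    by (intro exI[of _ "Rel p (map (rename_tm g) ts)"]) (auto simp: rename_tm comp_def)
next
  case (Neg \<phi>)
  obtain \<phi>' where "wf_fm M \<phi> \<longrightarrow> wf_fm M \<phi>'" "fv \<phi>' \<subseteq> g ` fv \<phi>" "\<forall>v. sat M v \<phi>' \<longleftrightarrow> sat M (v \<circ> g) \<phi>"
    using Neg by blast
  then show ?case by (intro exI[of _ "Neg \<phi>'"]) (simp add: comp_def)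
next
  case (Conj \<phi> \<psi>)
  obtain \<phi>' where "wf_fm M \<phi> \<longrightarrow> wf_fm M \<phi>'" "fv \<phi>' \<subseteq> g ` fv \<phi>" "\<forall>v. sat M v \<phi>' \<longleftrightarrow> sat M (v \<circ> g) \<phi>"
    using Conj(1) by blast
  moreover obtain \<psi>' where "wf_fm M \<psi> \<longrightarrow> wf_fm M \<psi>'" "fv \<psi>' \<subseteq> g ` fv \<psi>" "\<forall>v. sat M v \<psi>' \<longleftrightarrow> sat M (v \<circ> g) \<psi>"
    using Conj(2) by blast
  ultimately show ?case by (intro exI[of _ "Conj \<phi>' \<psi>'"]) (auto simp: comp_def)
next
  case (Exists n \<phi>)
  \<comment> \<open>\<open>m\<close> avoids the image of all free variables, so redirecting
    \<open>n\<close> to \<open>m\<close> captures nothing.\<close>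
  obtain m where m: "m \<notin> g ` fv \<phi>"
    using finite_fv[of \<phi>] by (metis ex_new_if_finite finite_imageI infinite_UNIV_nat)
  obtain \<phi>' where \<phi>': "wf_fm M \<phi> \<longrightarrow> wf_fm M \<phi>'" "fv \<phi>' \<subseteq> (g(n := m)) ` fv \<phi>"
    "\<forall>v. sat M v \<phi>' \<longleftrightarrow> sat M (v \<circ> g(n := m)) \<phi>"
    using Exists[of "g(n := m)"] by blast
  have "sat M (v(m := d) \<circ> g(n := m)) \<phi> = sat M ((v \<circ> g)(n := d)) \<phi>" for v d
    using m by (intro sat_in_cong) auto
  then have "sat M v (Exists m \<phi>') \<longleftrightarrow> sat M (v \<circ> g) (Exists n \<phi>)" for v
    using \<phi>'(3) by simp
  moreover have "fv (Exists m \<phi>') \<subseteq> g ` fv (Exists n \<phi>)"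
    using \<phi>'(2) by (auto split: if_splits)
  ultimately show ?case using \<phi>'(1) by (intro exI[of _ "Exists m \<phi>'"]) (simp add: comp_def)
qed

lemma eval_tm_automorphism:
  assumes "\<sigma> \<in> automorphisms M"
  shows "wf_tm M t \<Longrightarrow> eval_tm M (\<sigma> \<circ> v) t = \<sigma> (eval_tm M v t)"
proof (induction t)
  case (Fn f ts)
  then have "map (eval_tm M (\<sigma> \<circ> v)) ts = map \<sigma> (map (eval_tm M v) ts)" by (auto simp: comp_def)
  moreover have "\<sigma> (fint M f xs) = fint M f (map \<sigma> xs)" if "length xs = length ts" for xs
    using Fn.prems assms that unfolding automorphisms_def by auto
  ultimately show ?case by (metis eval_tm.simps(2) length_map)
qed simp

lemma sat_in_automorphism:
  assumes \<sigma>: "\<sigma> \<in> automorphisms M"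
  shows "wf_fm M \<phi> \<Longrightarrow> sat_in M (\<sigma> ` D) (\<sigma> \<circ> v) \<phi> \<longleftrightarrow> sat_in M D v \<phi>"
proof (induction \<phi> arbitrary: v)
  case (Eq s t)
  have "inj \<sigma>" using \<sigma> by (simp add: automorphisms_def bij_is_inj)
  then show ?case using Eq eval_tm_automorphism[OF \<sigma>, of _ v] by (simp add: inj_eq comp_def)
next
  case (Rel p ts)
  then have "map (eval_tm M (\<sigma> \<circ> v)) ts = map \<sigma> (map (eval_tm M v) ts)"
    using eval_tm_automorphism[OF \<sigma>] by auto
  moreover have "rint M p (map \<sigma> xs) = rint M p xs" if "length xs = length ts" for xs
    using Rel.prems \<sigma> that unfolding automorphisms_def by auto
  ultimately show ?case by (metis sat_in.simps(2) length_map)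
next
  case (Exists n \<phi>)
  have "sat_in M (\<sigma> ` D) ((\<sigma> \<circ> v)(n := \<sigma> d)) \<phi> = sat_in M D (v(n := d)) \<phi>" for d
  proof -
    have eq: "(\<sigma> \<circ> v)(n := \<sigma> d) = \<sigma> \<circ> v(n := d)" by auto
    show ?thesis unfolding eq by (rule Exists.IH) (use Exists.prems in simp)
  qed
  then show ?case by (simp only: sat_in.simps bex_simps)
qed auto

lemma sat_automorphism:
  assumes "\<sigma> \<in> automorphisms M" "wf_fm M \<phi>"
  shows "sat M (\<sigma> \<circ> v) \<phi> \<longleftrightarrow> sat M v \<phi>"
proof -
  have "range \<sigma> = UNIV" using assms(1) by (simp add: automorphisms_def bij_is_surj)
  then show ?thesis using sat_in_automorphism[OF assms, of UNIV v] by (simp only:)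
qed

context monster
begin

text \<open>
  Parameters come from \<open>C\<close>, variables from \<open>X\<close>. Working with the predicate instead of the formula
  makes renaming, substitution of parameters and projection along infinitely many variables harmless.
\<close>

definition pdfn :: "'m set \<Rightarrow> 'x set \<Rightarrow> (('x \<Rightarrow> 'm) \<Rightarrow> bool) \<Rightarrow> bool" where
  "pdfn C X P \<longleftrightarrow> (\<exists>\<phi> s. wf_fm M \<phi> \<and> s ` fv \<phi> \<subseteq> X <+> C \<and>
     (\<forall>a. P a \<longleftrightarrow> sat M (case_sum a id \<circ> s) \<phi>))"

lemma pdfnE:
  assumes "pdfn C X P"
  obtains \<phi> s where "wf_fm M \<phi>" "s ` fv \<phi> \<subseteq> X <+> C" "\<And>a. P a \<longleftrightarrow> sat M (case_sum a id \<circ> s) \<phi>"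
  using assms unfolding pdfn_def by blast

lemma pdfn_cong:
  assumes "pdfn C X P" and eq: "\<And>x. x \<in> X \<Longrightarrow> a x = b x"
  shows "P a = P b"
proof -
  obtain \<phi> s where *: "s ` fv \<phi> \<subseteq> X <+> C" "\<And>a. P a \<longleftrightarrow> sat M (case_sum a id \<circ> s) \<phi>"
    using assms(1) by (elim pdfnE) blast
  have "sat M (case_sum a id \<circ> s) \<phi> = sat M (case_sum b id \<circ> s) \<phi>"
  proof (rule sat_in_cong)
    fix n assume "n \<in> fv \<phi>"
    then have "s n \<in> X <+> C" using *(1) by blast
    then show "(case_sum a id \<circ> s) n = (case_sum b id \<circ> s) n" using eq by auto
  qed
  then show ?thesis using *(2) by simp
qed

lemma pdfn_subst:
  assumes "pdfn C X P" "h ` X \<subseteq> Y <+> C'" "C \<subseteq> C'"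
  shows "pdfn C' Y (\<lambda>a. P (case_sum a id \<circ> h))"
proof -
  obtain \<phi> s where *: "wf_fm M \<phi>" "s ` fv \<phi> \<subseteq> X <+> C" "\<And>a. P a \<longleftrightarrow> sat M (case_sum a id \<circ> s) \<phi>"
    using assms(1) by (elim pdfnE) blast
  have "case_sum (case_sum a id \<circ> h) id \<circ> s = case_sum a id \<circ> (case_sum h Inr \<circ> s)" for a
    by (rule ext) (auto split: sum.splits)
  moreover have "(case_sum h Inr \<circ> s) ` fv \<phi> \<subseteq> Y <+> C'"
  proof
    fix z assume "z \<in> (case_sum h Inr \<circ> s) ` fv \<phi>"
    then obtain w where w: "w \<in> s ` fv \<phi>" "z = case_sum h Inr w" by auto
    then have "w \<in> X <+> C" using *(2) by blast
    then show "z \<in> Y <+> C'" using assms(2,3) w(2) by auto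
  qed
  ultimately show ?thesis using * unfolding pdfn_def
    by (intro exI[of _ \<phi>] exI[of _ "case_sum h Inr \<circ> s"]) simp
qed

lemma pdfn_rename:
  assumes "pdfn C X P" "h ` X \<subseteq> Y" "C \<subseteq> C'"
  shows "pdfn C' Y (\<lambda>a. P (a \<circ> h))"
proof -
  have "case_sum a id \<circ> (Inl \<circ> h) = a \<circ> h" for a :: "'b \<Rightarrow> 'm" by auto
  then show ?thesis using pdfn_subst[OF assms(1), of "Inl \<circ> h" Y C'] assms(2,3) by auto
qed

lemma pdfn_mono: "pdfn C X P \<Longrightarrow> C \<subseteq> C' \<Longrightarrow> X \<subseteq> Y \<Longrightarrow> pdfn C' Y P"
  using pdfn_rename[of C X P id Y C'] by simp

lemma pdfn_not: "pdfn C X P \<Longrightarrow> pdfn C X (\<lambda>a. \<not> P a)"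
proof -
  assume "pdfn C X P"
  then obtain \<phi> s where *: "wf_fm M \<phi>" "s ` fv \<phi> \<subseteq> X <+> C" "\<And>a. P a \<longleftrightarrow> sat M (case_sum a id \<circ> s) \<phi>"
    by (elim pdfnE) blast
  then show ?thesis unfolding pdfn_def by (intro exI[of _ "Neg \<phi>"] exI[of _ s]) simp
qed

lemma pdfn_conj:
  assumes "pdfn C X P" "pdfn C X Q" shows "pdfn C X (\<lambda>a. P a \<and> Q a)"
proof -
  obtain \<phi> s where \<phi>: "wf_fm M \<phi>" "s ` fv \<phi> \<subseteq> X <+> C" "\<And>a. P a \<longleftrightarrow> sat M (case_sum a id \<circ> s) \<phi>"
    using assms(1) by (elim pdfnE) blast
  obtain \<psi> t where \<psi>: "wf_fm M \<psi>" "t ` fv \<psi> \<subseteq> X <+> C" "\<And>a. Q a \<longleftrightarrow> sat M (case_sum a id \<circ> t) \<psi>"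
    using assms(2) by (elim pdfnE) blast
  \<comment> \<open>The two formulas come with unrelated assignments \<open>s\<close> and
    \<open>t\<close>. Moving one formula to the even and the other to the odd variables lets a
    single assignment \<open>u\<close> serve both.\<close>
  obtain \<phi>' where \<phi>': "wf_fm M \<phi>'" "fv \<phi>' \<subseteq> (\<lambda>n. 2 * n) ` fv \<phi>" "\<And>v. sat M v \<phi>' \<longleftrightarrow> sat M (v \<circ> (\<lambda>n. 2 * n)) \<phi>"
    using rename_fm[of M \<phi> "\<lambda>n. 2 * n"] \<phi>(1) by blast
  obtain \<psi>' where \<psi>': "wf_fm M \<psi>'" "fv \<psi>' \<subseteq> (\<lambda>n. 2 * n + 1) ` fv \<psi>" "\<And>v. sat M v \<psi>' \<longleftrightarrow> sat M (v \<circ> (\<lambda>n. 2 * n + 1)) \<psi>"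
    using rename_fm[of M \<psi> "\<lambda>n. 2 * n + 1"] \<psi>(1) by blast
  define u where "u k = (if even k then s (k div 2) else t (k div 2))" for k
  have "v \<circ> u \<circ> (\<lambda>n. 2 * n) = v \<circ> s" "v \<circ> u \<circ> (\<lambda>n. 2 * n + 1) = v \<circ> t" for v :: "'a + 'm \<Rightarrow> 'm"
    by (auto simp: u_def)
  then have "P a \<and> Q a \<longleftrightarrow> sat M (case_sum a id \<circ> u) (Conj \<phi>' \<psi>')" for a
    using \<phi>(3) \<psi>(3) \<phi>'(3) \<psi>'(3) by simp
  moreover have "u ` fv (Conj \<phi>' \<psi>') \<subseteq> X <+> C"
  proof -
    have "u ` fv (Conj \<phi>' \<psi>') \<subseteq> u ` (\<lambda>n. 2 * n) ` fv \<phi> \<union> u ` (\<lambda>n. 2 * n + 1) ` fv \<psi>"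
      using \<phi>'(2) \<psi>'(2) by auto
    also have "u ` (\<lambda>n. 2 * n) ` fv \<phi> = s ` fv \<phi>"
      unfolding image_image by (rule image_cong) (simp_all add: u_def)
    also have "u ` (\<lambda>n. 2 * n + 1) ` fv \<psi> = t ` fv \<psi>"
      unfolding image_image by (rule image_cong) (simp_all add: u_def)
    finally show ?thesis using \<phi>(2) \<psi>(2) by blast
  qed
  ultimately show ?thesis unfolding pdfn_def using \<phi>' \<psi>'
    by (intro exI[of _ "Conj \<phi>' \<psi>'"] exI[of _ u]) simp
qed

lemma pdfn_True: "pdfn C X (\<lambda>_. True)"
  unfolding pdfn_def by (intro exI[of _ "Exists 0 (Eq (Var 0) (Var 0))"]) simp

lemma pdfn_iff: "pdfn C X P \<Longrightarrow> pdfn C X Q \<Longrightarrow> pdfn C X (\<lambda>a. P a \<longleftrightarrow> Q a)"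
proof -
  assume "pdfn C X P" "pdfn C X Q"
  then have "pdfn C X (\<lambda>a. \<not> (P a \<and> \<not> Q a) \<and> \<not> (Q a \<and> \<not> P a))"
    by (intro pdfn_conj pdfn_not)
  moreover have "(\<lambda>a. \<not> (P a \<and> \<not> Q a) \<and> \<not> (Q a \<and> \<not> P a)) = (\<lambda>a. P a \<longleftrightarrow> Q a)" by auto
  ultimately show ?thesis by simp
qed

lemma pdfn_eq: "u \<in> X <+> C \<Longrightarrow> w \<in> X <+> C \<Longrightarrow> pdfn C X (\<lambda>a. case_sum a id u = case_sum a id w)"
  unfolding pdfn_def
  by (intro exI[of _ "Eq (Var 0) (Var 1)"] exI[of _ "\<lambda>n. if n = 0 then u else w"]) auto

lemma pdfn_Ball:
  assumes "finite q" "\<And>i. i \<in> q \<Longrightarrow> pdfn C X (P i)" shows "pdfn C X (\<lambda>a. \<forall>i\<in>q. P i a)"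
  using assms
proof (induction q)
  case (insert i q)
  then have "pdfn C X (\<lambda>a. P i a \<and> (\<forall>i\<in>q. P i a))" by (intro pdfn_conj) auto
  then show ?case by simp
qed (simp add: pdfn_True)

text \<open>This is the shape in which \<open>saturated\<close> accepts a condition: the one
  variable is variable 0 and the others hold parameters.\<close>

lemma pdfn_single:
  assumes "pdfn C {x} P"
  obtains \<phi> v where "wf_fm M \<phi>" "v ` (fv \<phi> - {0}) \<subseteq> C" "\<And>a. P a \<longleftrightarrow> sat M (v(0 := a x)) \<phi>"
proof -
  obtain \<phi> s where *: "wf_fm M \<phi>" "s ` fv \<phi> \<subseteq> {x} <+> C" "\<And>a. P a \<longleftrightarrow> sat M (case_sum a id \<circ> s) \<phi>"
    using assms by (elim pdfnE) blast
  \<comment> \<open>Several formula variables may stand for \<open>x\<close>; they all collapse to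
    0, and the shift keeps the parameter positions away from 0.\<close>
  define g where "g n = (if s n = Inl x then 0 else Suc n)" for n
  obtain \<phi>' where \<phi>': "wf_fm M \<phi>'" "fv \<phi>' \<subseteq> g ` fv \<phi>" "\<And>v. sat M v \<phi>' \<longleftrightarrow> sat M (v \<circ> g) \<phi>"
    using rename_fm[of M \<phi> g] *(1) by blast
  define v where "v k = projr (s (k - 1))" for k
  have s: "s n = Inl x \<or> (\<exists>c\<in>C. s n = Inr c)" if "n \<in> fv \<phi>" for n
  proof -
    have "s n \<in> {x} <+> C" using *(2) that by blast
    then show ?thesis by auto
  qed
  have "v ` (fv \<phi>' - {0}) \<subseteq> C"
  proof
    fix c assume "c \<in> v ` (fv \<phi>' - {0})"
    then obtain k where k: "k \<in> fv \<phi>'" "k \<noteq> 0" "c = v k" by auto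
    then obtain n where "n \<in> fv \<phi>" "k = g n" using \<phi>'(2) by auto
    then show "c \<in> C" using s[of n] k by (auto simp: v_def g_def split: if_splits)
  qed
  moreover have "P a \<longleftrightarrow> sat M (v(0 := a x)) \<phi>'" for a
    unfolding *(3) \<phi>'(3) using s by (intro sat_in_cong) (force simp: g_def v_def)
  ultimately show thesis using \<phi>'(1) that by blast
qed

lemma pdfn_ex1:
  assumes "pdfn C X P" shows "pdfn C (X - {x}) (\<lambda>a. \<exists>d. P (a(x := d)))"
proof -
  obtain \<phi> s where *: "wf_fm M \<phi>" "s ` fv \<phi> \<subseteq> X <+> C" "\<And>a. P a \<longleftrightarrow> sat M (case_sum a id \<circ> s) \<phi>"
    using assms by (elim pdfnE) blast
  define g where "g n = (if s n = Inl x then 0 else Suc n)" for n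
  obtain \<phi>' where \<phi>': "wf_fm M \<phi>'" "fv \<phi>' \<subseteq> g ` fv \<phi>" "\<And>v. sat M v \<phi>' \<longleftrightarrow> sat M (v \<circ> g) \<phi>"
    using rename_fm[of M \<phi> g] *(1) by blast
  define t where "t k = s (k - 1)" for k
  have "t ` fv (Exists 0 \<phi>') \<subseteq> (X - {x}) <+> C"
  proof
    fix z assume "z \<in> t ` fv (Exists 0 \<phi>')"
    then obtain k where k: "k \<in> fv \<phi>'" "k \<noteq> 0" "z = t k" by auto
    then obtain n where n: "n \<in> fv \<phi>" "k = g n" using \<phi>'(2) by auto
    then have "s n \<in> X <+> C" using *(2) by blast
    then show "z \<in> (X - {x}) <+> C" using k n by (auto simp: t_def g_def split: if_splits)
  qed
  moreover have "P (a(x := d)) \<longleftrightarrow> sat M ((case_sum a id \<circ> t)(0 := d)) \<phi>'" for a d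
    unfolding *(3) \<phi>'(3) by (intro sat_in_cong) (auto simp: g_def t_def split: sum.splits)
  ultimately show ?thesis unfolding pdfn_def using \<phi>'(1)
    by (intro exI[of _ "Exists 0 \<phi>'"] exI[of _ t]) simp
qed

lemma pdfn_finite:
  assumes "pdfn C X P" obtains F where "finite F" "F \<subseteq> X" "pdfn C F P"
proof -
  obtain \<phi> s where *: "wf_fm M \<phi>" "s ` fv \<phi> \<subseteq> X <+> C" "\<And>a. P a \<longleftrightarrow> sat M (case_sum a id \<circ> s) \<phi>"
    using assms by (elim pdfnE) blast
  define F where "F = Inl -` (s ` fv \<phi>)"
  have "finite F" unfolding F_def using finite_fv by (intro finite_vimageI) auto
  moreover have "F \<subseteq> X" using *(2) by (auto simp: F_def)
  moreover have "s ` fv \<phi> \<subseteq> F <+> C"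
  proof
    fix z assume z: "z \<in> s ` fv \<phi>"
    then have "z \<in> X <+> C" using *(2) by blast
    then show "z \<in> F <+> C" using z by (cases z) (auto simp: F_def)
  qed
  then have "pdfn C F P" using * unfolding pdfn_def by blast
  ultimately show thesis by (rule that)
qed

text \<open>Infinitely many variables can be quantified away because a formula mentions only
  finitely many of them; the rest may take any value.\<close>

lemma pdfn_proj:
  assumes "pdfn C X P" shows "pdfn C (X - Y) (\<lambda>a. \<exists>b. (\<forall>x. x \<notin> Y \<longrightarrow> b x = a x) \<and> P b)"
proof -
  have fin: "pdfn C (X - G) (\<lambda>a. \<exists>b. (\<forall>x. x \<notin> G \<longrightarrow> b x = a x) \<and> P b)" if "finite G" "pdfn C X P" for G X
    using that
  proof (induction G)
    case empty
    have "(\<exists>b. (\<forall>x. x \<notin> {} \<longrightarrow> b x = a x) \<and> P b) = P a" for a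
    proof -
      have "b = a" if "\<forall>x. b x = a x" for b using that by auto
      then show ?thesis by auto
    qed
    then show ?case using empty by simp
  next
    case (insert y G)
    have "(\<exists>d b. (\<forall>x. x \<notin> G \<longrightarrow> b x = (a(y := d)) x) \<and> P b) =
        (\<exists>b. (\<forall>x. x \<notin> insert y G \<longrightarrow> b x = a x) \<and> P b)" for a
    proof -
      have "\<exists>d b. (\<forall>x. x \<notin> G \<longrightarrow> b x = (a(y := d)) x) \<and> P b"
        if "\<forall>x. x \<notin> insert y G \<longrightarrow> b x = a x" "P b" for b
        using that by (intro exI[of _ "b y"] exI[of _ b]) auto
      moreover have "\<exists>b. (\<forall>x. x \<notin> insert y G \<longrightarrow> b x = a x) \<and> P b"
        if "\<forall>x. x \<notin> G \<longrightarrow> b x = (a(y := d)) x" "P b" for b d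
        using that by (intro exI[of _ b]) auto
      ultimately show ?thesis by blast
    qed
    moreover have "X - G - {y} = X - insert y G" by blast
    ultimately show ?case using pdfn_ex1[OF insert.IH[OF insert.prems], of y] by simp
  qed
  obtain F where F: "finite F" "F \<subseteq> X" "pdfn C F P" using assms by (rule pdfn_finite)
  have "(\<exists>b. (\<forall>x. x \<notin> F \<inter> Y \<longrightarrow> b x = a x) \<and> P b) = (\<exists>b. (\<forall>x. x \<notin> Y \<longrightarrow> b x = a x) \<and> P b)" for a
  proof
    assume "\<exists>b. (\<forall>x. x \<notin> Y \<longrightarrow> b x = a x) \<and> P b"
    then obtain b where b: "\<forall>x. x \<notin> Y \<longrightarrow> b x = a x" "P b" by blast
    have "P (\<lambda>x. if x \<in> F then b x else a x)"
      using b(2) pdfn_cong[OF F(3), of b "\<lambda>x. if x \<in> F then b x else a x"] by simp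
    then show "\<exists>b. (\<forall>x. x \<notin> F \<inter> Y \<longrightarrow> b x = a x) \<and> P b"
      using b(1) by (intro exI[of _ "\<lambda>x. if x \<in> F then b x else a x"]) auto
  qed auto
  moreover have "F - F \<inter> Y \<subseteq> X - Y" using F(2) by blast
  ultimately show ?thesis
    using pdfn_mono[OF fin[OF _ F(3), of "F \<inter> Y"], of C "X - Y"] F(1) by simp
qed

lemma pdfn_automorphism:
  assumes "\<sigma> \<in> automorphisms M" "\<And>c. c \<in> C \<Longrightarrow> \<sigma> c = c" "pdfn C X P"
  shows "P (\<sigma> \<circ> a) \<longleftrightarrow> P a"
proof -
  obtain \<phi> s where *: "wf_fm M \<phi>" "s ` fv \<phi> \<subseteq> X <+> C" "\<And>a. P a \<longleftrightarrow> sat M (case_sum a id \<circ> s) \<phi>"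
    using assms(3) by (elim pdfnE) blast
  have "sat M (case_sum (\<sigma> \<circ> a) id \<circ> s) \<phi> = sat M (\<sigma> \<circ> (case_sum a id \<circ> s)) \<phi>"
  proof (rule sat_in_cong)
    fix n assume "n \<in> fv \<phi>"
    then have "s n \<in> X <+> C" using *(2) by blast
    then show "(case_sum (\<sigma> \<circ> a) id \<circ> s) n = (\<sigma> \<circ> (case_sum a id \<circ> s)) n" using assms(2) by auto
  qed
  then show ?thesis using * sat_automorphism[OF assms(1) *(1)] by (simp only:)
qed

section \<open>Compactness and homogeneity\<close>

text \<open>Saturation treats one variable at a time. Zorn's lemma gives a maximal partial
  assignment that is finitely consistent with \<open>\<Gamma>\<close>; saturation would add one more
  variable to it, so it is already defined on all of \<open>X\<close>.\<close>

lemma compactness: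
  assumes C: "sm C" and X: "sm X" and dfn: "\<And>P. P \<in> \<Gamma> \<Longrightarrow> pdfn C X P"
    and fin: "\<And>q. q \<subseteq> \<Gamma> \<Longrightarrow> finite q \<Longrightarrow> \<exists>a. \<forall>P\<in>q. P a"
  obtains a where "\<And>P. P \<in> \<Gamma> \<Longrightarrow> P a"
proof -
  have "\<forall>P\<in>\<Gamma>. \<exists>F. finite F \<and> F \<subseteq> X \<and> pdfn C F P"
    using dfn pdfn_finite by metis
  then obtain supp where supp: "\<And>P. P \<in> \<Gamma> \<Longrightarrow> finite (supp P) \<and> supp P \<subseteq> X \<and> pdfn C (supp P) P"
    by metis
  define ext_by where "ext_by G a \<longleftrightarrow> (\<forall>x c. (x, c) \<in> G \<longrightarrow> a x = c)" for G and a :: "'a \<Rightarrow> 'm"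
  define \<A> where "\<A> = {G. G \<subseteq> X \<times> UNIV \<and> (\<forall>q\<subseteq>\<Gamma>. finite q \<longrightarrow> (\<exists>a. ext_by G a \<and> (\<forall>P\<in>q. P a)))}"
  have \<A>D: "\<exists>a. ext_by G a \<and> (\<forall>P\<in>q. P a)" if "G \<in> \<A>" "q \<subseteq> \<Gamma>" "finite q" for G q
    using that by (simp add: \<A>_def)
  have functional: "c = d" if "G \<in> \<A>" "(x, c) \<in> G" "(x, d) \<in> G" for G x c d
  proof -
    obtain a where "ext_by G a" using \<A>D[OF \<open>G \<in> \<A>\<close>, of "{}"] by blast
    then show ?thesis using that(2,3) unfolding ext_by_def by auto
  qed
  have "{} \<in> \<A>" using fin unfolding \<A>_def ext_by_def by auto
  moreover have "\<Union>\<C> \<in> \<A>" if ne: "\<C> \<noteq> {}" and chain: "subset.chain \<A> \<C>" for \<C>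
  proof -
    have sub: "\<C> \<subseteq> \<A>" using chain by (simp add: subset.chain_def)
    have fU: "c = d" if "(x, c) \<in> \<Union>\<C>" "(x, d) \<in> \<Union>\<C>" for x c d
    proof -
      obtain G H where G: "G \<in> \<C>" "H \<in> \<C>" "(x, c) \<in> G" "(x, d) \<in> H" using \<open>(x, c) \<in> \<Union>\<C>\<close> \<open>(x, d) \<in> \<Union>\<C>\<close> by blast
      then have "G \<subseteq> H \<or> H \<subseteq> G" using chain by (meson subset.chain_def subset_chain_def)
      then show ?thesis using functional G sub by blast
    qed
    have "\<exists>a. ext_by (\<Union>\<C>) a \<and> (\<forall>P\<in>q. P a)" if q: "q \<subseteq> \<Gamma>" "finite q" for q
    proof -
      define F where "F = \<Union> (supp ` q)"
      have F1: "finite F" using q supp by (auto simp: F_def)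
      have F2: "pdfn C F P" if "P \<in> q" for P
      proof (rule pdfn_mono)
        show "pdfn C (supp P) P" using supp q(1) that by blast
        show "supp P \<subseteq> F" using that by (auto simp: F_def)
      qed simp
      define U where "U = {(x, c) \<in> \<Union>\<C>. x \<in> F}"
      have "inj_on fst U" "fst ` U \<subseteq> F" using fU by (auto simp: U_def inj_on_def)
      then have "finite U" using F1 by (meson finite_imageD finite_subset)
      moreover have "U \<subseteq> \<Union>\<C>" by (auto simp: U_def)
      ultimately obtain G where G: "G \<in> \<C>" "U \<subseteq> G"
        using finite_subset_Union_chain[OF _ _ ne chain] by blast
      then obtain a where a: "ext_by G a" "\<forall>P\<in>q. P a" using \<A>D[of G q] sub q by blast
      \<comment> \<open>Off the finite set \<open>F\<close> of relevant variables the values of the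
        whole union are used, which no condition in \<open>q\<close> can see. On \<open>F\<close> a
        single member \<open>G\<close> of the chain already agrees with the union.\<close>
      define b where "b x = (if x \<in> F then a x else (SOME c. (x, c) \<in> \<Union>\<C>))" for x
      have "ext_by (\<Union>\<C>) b" unfolding ext_by_def
      proof (intro allI impI)
        fix x c assume xc: "(x, c) \<in> \<Union>\<C>"
        show "b x = c"
        proof (cases "x \<in> F")
          case True
          then have "(x, c) \<in> G" using xc G(2) by (auto simp: U_def)
          then show ?thesis using a(1) True by (auto simp: ext_by_def b_def)
        next
          case False
          have "(x, SOME c. (x, c) \<in> \<Union>\<C>) \<in> \<Union>\<C>" using xc by (rule someI)
          then have "(SOME c. (x, c) \<in> \<Union>\<C>) = c" using fU xc by blast
          then show ?thesis using False by (simp add: b_def)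
        qed
      qed
      moreover have "P b" if "P \<in> q" for P
      proof -
        have "P a = P b" by (rule pdfn_cong[OF F2[OF that]]) (simp add: b_def)
        then show ?thesis using a(2) that by blast
      qed
      ultimately show ?thesis by blast
    qed
    moreover have "\<Union>\<C> \<subseteq> X \<times> UNIV" using sub unfolding \<A>_def by blast
    ultimately show ?thesis unfolding \<A>_def by blast
  qed
  ultimately obtain G where G: "G \<in> \<A>" "\<And>H. H \<in> \<A> \<Longrightarrow> G \<subseteq> H \<Longrightarrow> H = G"
    using subset_Zorn_nonempty[of \<A>] by blast
  define val where "val y = (SOME c. (y, c) \<in> G)" for y
  have val: "val y = c" if "(y, c) \<in> G" for y c
    using functional[OF G(1)] that someI[of "\<lambda>c. (y, c) \<in> G"] unfolding val_def by blast
  have ext_val: "a y = val y" if "ext_by G a" "y \<in> Domain G" for a y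
    using that val unfolding ext_by_def by auto
  have GX: "G \<subseteq> X \<times> UNIV" using G(1) by (auto simp: \<A>_def)
  have "X \<subseteq> Domain G"
  proof (rule ccontr)
    assume "\<not> X \<subseteq> Domain G"
    then obtain x where x: "x \<in> X" "x \<notin> Domain G" by blast
    \<comment> \<open>Variables that already have a value turn into parameters, so that a condition
      constrains only the remaining ones.\<close>
    define h where "h y = (if y \<in> Domain G then Inr (val y) else Inl y)" for y
    define C' where "C' = C \<union> val ` X"
    have C': "sm C'" unfolding C'_def using C X by (intro small_Un small_image)
    \<comment> \<open>The open variables other than \<open>x\<close> are quantified away. Finite
      sets of conditions are projected as a whole, since an existential quantifier does not
      distribute over conjunction.\<close>
    define R where "R q b \<longleftrightarrow> (\<exists>a. (\<forall>y. y \<notin> - {x} \<longrightarrow> a y = b y) \<and> (\<forall>P\<in>q. P (case_sum a id \<circ> h)))" for q b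
    have R: "pdfn C' {x} (R q)" if "q \<subseteq> \<Gamma>" "finite q" for q
    proof -
      have "h ` X \<subseteq> X <+> C'" by (auto simp: h_def C'_def)
      then have "pdfn C' X (\<lambda>a. \<forall>P\<in>q. P (case_sum a id \<circ> h))"
        using dfn that by (intro pdfn_Ball pdfn_subst[of C X]) (auto simp: C'_def)
      from pdfn_proj[OF this, of "- {x}"] show ?thesis
        unfolding R_def[abs_def] by (rule pdfn_mono) auto
    qed
    define Q where "Q = {q. q \<subseteq> \<Gamma> \<and> finite q}"
    have "\<forall>q\<in>Q. \<exists>\<phi> v. wf_fm M \<phi> \<and> v ` (fv \<phi> - {0}) \<subseteq> C' \<and> (\<forall>a. R q a \<longleftrightarrow> sat M (v(0 := a x)) \<phi>)"
      using R pdfn_single unfolding Q_def by (metis (no_types, lifting) mem_Collect_eq)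
    then obtain f w where fw: "\<And>q. q \<in> Q \<Longrightarrow> wf_fm M (f q) \<and> w q ` (fv (f q) - {0}) \<subseteq> C' \<and>
        (\<forall>a. R q a \<longleftrightarrow> sat M ((w q)(0 := a x)) (f q))" by metis
    define p where "p = (\<lambda>q. (f q, w q)) ` Q"
    have "\<exists>c. \<forall>(\<phi>, v)\<in>p. sat M (v(0 := c)) \<phi>"
    proof -
      have "\<exists>c. \<forall>(\<phi>, v)\<in>p0. sat M (v(0 := c)) \<phi>" if p0: "p0 \<subseteq> p" "finite p0" for p0
      proof -
        obtain Q0 where Q0: "Q0 \<subseteq> Q" "finite Q0" "p0 = (\<lambda>q. (f q, w q)) ` Q0"
          using finite_subset_image[OF p0(2), of "\<lambda>q. (f q, w q)" Q] p0(1) unfolding p_def by blast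
        then have "\<Union>Q0 \<subseteq> \<Gamma>" "finite (\<Union>Q0)" by (auto simp: Q_def)
        then obtain a where a: "ext_by G a" "\<forall>P\<in>\<Union>Q0. P a" using \<A>D[OF G(1)] by blast
        have "case_sum a id \<circ> h = a" using ext_val[OF a(1)] by (auto simp: h_def)
        then have "R q a" if "q \<in> Q0" for q
          using a(2) that unfolding R_def by (intro exI[of _ a]) auto
        then have "sat M ((w q)(0 := a x)) (f q)" if "q \<in> Q0" for q
          using fw[of q] Q0(1) that by blast
        then have "\<forall>(\<phi>, v)\<in>p0. sat M (v(0 := a x)) \<phi>"
          unfolding Q0(3) by auto
        then show ?thesis by blast
      qed
      moreover have "\<forall>(\<phi>, v)\<in>p. wf_fm M \<phi> \<and> v ` (fv \<phi> - {0}) \<subseteq> C'"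
        using fw by (auto simp: p_def)
      ultimately show ?thesis using saturated C' unfolding saturated_def by blast
    qed
    then obtain c where c: "\<And>q. q \<in> Q \<Longrightarrow> sat M ((w q)(0 := c)) (f q)" by (auto simp: p_def)
    have "\<exists>a. ext_by (insert (x, c) G) a \<and> (\<forall>P\<in>q. P a)" if q: "q \<subseteq> \<Gamma>" "finite q" for q
    proof -
      have "q \<in> Q" using q by (simp add: Q_def)
      then have "R q (\<lambda>_. c)" using c[of q] fw[of q] by blast
      then obtain a where a: "a x = c" "\<forall>P\<in>q. P (case_sum a id \<circ> h)" unfolding R_def by auto
      have "ext_by (insert (x, c) G) (case_sum a id \<circ> h)"
        using a(1) x(2) val by (auto simp: ext_by_def h_def)
      then show ?thesis using a(2) by blast
    qed
    then have "insert (x, c) G \<in> \<A>" using GX x(1) by (auto simp: \<A>_def)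
    then have "insert (x, c) G = G" using G(2) by blast
    then show False using x(2) by blast
  qed
  have "P val" if P: "P \<in> \<Gamma>" for P
  proof -
    obtain a where a: "ext_by G a" "P a"
      using \<A>D[OF G(1), of "{P}"] P by blast
    then show ?thesis
      using pdfn_cong[OF dfn[OF P], of a val] ext_val[OF a(1)] \<open>X \<subseteq> Domain G\<close> by blast
  qed
  then show thesis by (rule that)
qed

text \<open>Entries of the tuple may repeat or lie in \<open>C\<close>. Equality of two entries, or
  of an entry with a parameter, is itself a definable condition, so sending \<open>a x\<close> to
  \<open>b x\<close> and fixing \<open>C\<close> is well defined, and this map is
  elementary.\<close>

lemma homogeneity:
  assumes "sm C" "sm X" and ab: "\<And>P. pdfn C X P \<Longrightarrow> P a \<Longrightarrow> P b"
  obtains \<sigma> where "\<sigma> \<in> automorphisms M" "\<And>c. c \<in> C \<Longrightarrow> \<sigma> c = c" "\<And>x. x \<in> X \<Longrightarrow> \<sigma> (a x) = b x"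
proof -
  have iff: "P a \<longleftrightarrow> P b" if "pdfn C X P" for P
    using ab[OF that] ab[OF pdfn_not[OF that]] by blast
  define f where "f y = (if y \<in> a ` X then b (inv_into X a y) else y)" for y
  have fa: "f (a x) = b x" if "x \<in> X" for x
  proof -
    define x' where "x' = inv_into X a (a x)"
    have x': "x' \<in> X" "a x' = a x" using that by (auto simp: x'_def inv_into_into f_inv_into_f)
    have "pdfn C X (\<lambda>a. case_sum a id (Inl x') = case_sum a id (Inl x))"
      using that x' by (intro pdfn_eq) auto
    from iff[OF this] have "b x' = b x" using x'(2) by simp
    then show ?thesis using that by (simp add: f_def x'_def)
  qed
  have fc: "f c = c" if "c \<in> C" for c
  proof (cases "c \<in> a ` X")
    case True
    then obtain x where x: "x \<in> X" "c = a x" by blast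
    have "pdfn C X (\<lambda>a. case_sum a id (Inl x) = case_sum a id (Inr c))"
      using that x by (intro pdfn_eq) auto
    from iff[OF this] have "b x = c" using x by simp
    then show ?thesis using fa x by simp
  qed (simp add: f_def)
  have "sat M v \<phi> \<longleftrightarrow> sat M (f \<circ> v) \<phi>" if \<phi>: "wf_fm M \<phi>" "v ` fv \<phi> \<subseteq> C \<union> a ` X" for \<phi> v
  proof -
    define s where "s n = (if v n \<in> a ` X then Inl (inv_into X a (v n)) else Inr (v n))" for n
    have s: "s ` fv \<phi> \<subseteq> X <+> C"
      using \<phi>(2) by (auto simp: s_def inv_into_into)
    then have "pdfn C X (\<lambda>a. sat M (case_sum a id \<circ> s) \<phi>)"
      using \<phi>(1) unfolding pdfn_def by blast
    then have "sat M (case_sum a id \<circ> s) \<phi> \<longleftrightarrow> sat M (case_sum b id \<circ> s) \<phi>" by (rule iff)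
    moreover have "case_sum a id \<circ> s = v"
      by (rule ext) (simp add: s_def f_inv_into_f)
    moreover have "sat M (case_sum b id \<circ> s) \<phi> = sat M (f \<circ> v) \<phi>"
      by (rule sat_in_cong) (simp add: s_def f_def)
    ultimately show ?thesis by simp
  qed
  moreover have "sm (C \<union> a ` X)" using assms(1,2) by (intro small_Un small_image)
  ultimately obtain \<sigma> where "\<sigma> \<in> automorphisms M" "\<forall>y\<in>C \<union> a ` X. \<sigma> y = f y"
    using homogeneous unfolding strongly_homogeneous_def by blast
  then show thesis using fa fc by (intro that[of \<sigma>]) auto
qed

section \<open>Small models and numbers of types\<close>

text \<open>A Skolem hull: closure under chosen witnesses gives the Tarski-Vaught condition, from
  which elementarity follows by induction on formulas.\<close>

lemma small_model:
  assumes "sm C" obtains N where "C \<subseteq> N" "sm N" "elem_sub M N"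
proof -
  fix c0 :: 'm
  \<comment> \<open>A list gives the values of the variables 0, 1, ..., with \<open>c0\<close> as
    default beyond its end. The implication under \<open>SOME\<close> in \<open>g\<close> makes the
    choice of a witness total.\<close>
  define val where "val xs k = (if k < length xs then xs ! k else c0)" for xs :: "'m list" and k
  define g where "g = (\<lambda>(\<phi>, n) xs. SOME d. (\<exists>d. sat M ((val xs)(n := d)) \<phi>) \<longrightarrow> sat M ((val xs)(n := d)) \<phi>)"
  have "sm (insert c0 C)" using assms small_Un[OF small_finite[of "{c0}"]] by simp
  moreover have "sm ({\<phi>. wf_fm M \<phi>} \<times> (UNIV :: nat set))" by (intro small_Times small_wf_fm small_nat)
  ultimately obtain N where N: "insert c0 C \<subseteq> N" "sm N"
    "\<And>i xs. i \<in> {\<phi>. wf_fm M \<phi>} \<times> (UNIV :: nat set) \<Longrightarrow> set xs \<subseteq> N \<Longrightarrow> g i xs \<in> N"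
    using small_closure_under_lists[of "insert c0 C" "{\<phi>. wf_fm M \<phi>} \<times> UNIV" g] by blast
  have tarski: "\<exists>d\<in>N. sat M (v(n := d)) \<phi>"
    if wf: "wf_fm M \<phi>" and v: "range v \<subseteq> N" and ex: "\<exists>d. sat M (v(n := d)) \<phi>" for \<phi> n v
  proof -
    obtain m where m: "fv \<phi> \<subseteq> {..<m}" using finite_fv[of \<phi>] by (meson finite_nat_bounded)
    define xs where "xs = map v [0..<m]"
    have eq: "sat M ((val xs)(n := d)) \<phi> = sat M (v(n := d)) \<phi>" for d
      using m by (intro sat_in_cong) (auto simp: val_def xs_def)
    have "(\<exists>d. sat M ((val xs)(n := d)) \<phi>) \<longrightarrow> sat M ((val xs)(n := g (\<phi>, n) xs)) \<phi>"
      unfolding g_def prod.case by (rule someI_ex) blast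
    then have "sat M (v(n := g (\<phi>, n) xs)) \<phi>" using ex eq by simp
    moreover have "g (\<phi>, n) xs \<in> N" using wf v by (intro N(3)) (auto simp: xs_def)
    ultimately show ?thesis by blast
  qed
  have "sat_in M N v \<phi> \<longleftrightarrow> sat M v \<phi>" if "wf_fm M \<phi>" "range v \<subseteq> N" for \<phi> v
    using that
  proof (induction \<phi> arbitrary: v)
    case (Exists n \<phi>)
    have "range (v(n := d)) \<subseteq> N" if "d \<in> N" for d using that Exists.prems by auto
    then have "sat_in M N v (Exists n \<phi>) \<longleftrightarrow> (\<exists>d\<in>N. sat M (v(n := d)) \<phi>)"
      using Exists.IH Exists.prems(1) by auto
    also have "\<dots> \<longleftrightarrow> sat M v (Exists n \<phi>)"
      using tarski[of \<phi> v n] Exists.prems by auto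
    finally show ?case .
  qed auto
  moreover have "fint M f xs \<in> N" if f: "(f, n) \<in> funs M" and xs: "length xs = n" "set xs \<subseteq> N" for f n xs
  proof -
    \<comment> \<open>The value of \<open>f\<close> at \<open>xs\<close> is the witness for the
      formula x0 = f(x1, ..., xn); arguments start at variable 1 because 0 is the quantified
      one.\<close>
    define ts :: "'f tm list" where "ts = map Var [1..<Suc n]"
    define v where "v k = (if 0 < k \<and> k \<le> n then xs ! (k - 1) else c0)" for k
    have ev: "map (eval_tm M (v(0 := d))) ts = xs" for d
      using xs by (intro nth_equalityI) (auto simp: ts_def v_def simp del: upt_Suc)
    have "wf_fm M (Eq (Var 0) (Fn f ts))" using f by (auto simp: ts_def simp del: upt_Suc)
    moreover have "range v \<subseteq> N" using xs N(1) by (auto simp: v_def)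
    moreover have "\<exists>d. sat M (v(0 := d)) (Eq (Var 0) (Fn f ts))" using ev by auto
    ultimately obtain d where d: "d \<in> N" "sat M (v(0 := d)) (Eq (Var 0) (Fn f ts))"
      using tarski by blast
    then show ?thesis using ev by simp
  qed
  ultimately have "elem_sub M N" unfolding elem_sub_def using N(1) by auto
  then show thesis using that N(1,2) by blast
qed

lemma elem_sub_witness1:
  assumes N: "elem_sub M N" and P: "pdfn N {x} P" "P a"
  obtains d where "d \<in> N" "\<And>b. b x = d \<Longrightarrow> P b"
proof -
  obtain \<phi> v where *: "wf_fm M \<phi>" "v ` (fv \<phi> - {0}) \<subseteq> N" "\<And>a. P a \<longleftrightarrow> sat M (v(0 := a x)) \<phi>"
    using P(1) by (rule pdfn_single) blast
  obtain n0 where n0: "n0 \<in> N" using N unfolding elem_sub_def by blast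
  define w where "w k = (if k \<in> fv \<phi> - {0} then v k else n0)" for k
  have eq: "sat M (w(0 := d)) \<phi> = sat M (v(0 := d)) \<phi>" for d
    by (rule sat_in_cong) (auto simp: w_def)
  have w: "range w \<subseteq> N" using *(2) n0 by (auto simp: w_def)
  have "sat M w (Exists 0 \<phi>)" using P(2) *(3) eq by auto
  then have "sat_in M N w (Exists 0 \<phi>)" using N w *(1) unfolding elem_sub_def by (metis wf_fm.simps(5))
  then obtain d where d: "d \<in> N" "sat_in M N (w(0 := d)) \<phi>" by auto
  moreover have "range (w(0 := d)) \<subseteq> N" using w d(1) by auto
  ultimately have "sat M (w(0 := d)) \<phi>"
    using N *(1) unfolding elem_sub_def by blast
  then show thesis using that[OF d(1)] *(3) eq by simp
qed

text \<open>Coordinates are chosen one at a time, each chosen point of \<open>N\<close> becoming a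
  parameter of the condition on the others. This is how types over a model are finitely satisfiable
  in that model.\<close>

lemma elem_sub_witness:
  assumes N: "elem_sub M N" and P: "pdfn N X P" "P a"
  obtains b where "range b \<subseteq> N" "P b"
proof -
  obtain n0 where n0: "n0 \<in> N" using N unfolding elem_sub_def by blast
  obtain F where F: "finite F" "pdfn N F P" using P(1) by (rule pdfn_finite)
  have "\<exists>b. range b \<subseteq> N \<and> P b" using F P(2)
  proof (induction F arbitrary: P a)
    case empty
    then have "P (\<lambda>_. n0)" using pdfn_cong[OF empty(1), of a "\<lambda>_. n0"] by simp
    then show ?case using n0 by (intro exI[of _ "\<lambda>_. n0"]) auto
  next
    case (insert x F)
    have "pdfn N F (\<lambda>a. \<exists>d. P (a(x := d)))"
      using pdfn_ex1[OF insert.prems(1), of x] insert.hyps by (simp add: insert_Diff_if fun_upd_def)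
    moreover have "\<exists>d. P (a(x := d))" using insert.prems(2) by (intro exI[of _ "a x"]) simp
    ultimately obtain b d where b: "range b \<subseteq> N" "P (b(x := d))" using insert.IH by blast
    define h where "h y = (if y = x then Inl x else Inr (b y))" for y
    have h: "case_sum a id \<circ> h = b(x := a x)" for a by (auto simp: h_def)
    have "pdfn N {x} (\<lambda>a. P (case_sum a id \<circ> h))"
      using b(1) by (intro pdfn_subst[OF insert.prems(1)]) (auto simp: h_def)
    then obtain e where e: "e \<in> N" "\<And>a. a x = e \<Longrightarrow> P (case_sum a id \<circ> h)"
      using elem_sub_witness1[OF N, of x "\<lambda>a. P (case_sum a id \<circ> h)" "\<lambda>_. d"] b(2) unfolding h by blast
    then have "P (b(x := e))" using e(2)[of "\<lambda>_. e"] unfolding h by simp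
    moreover have "range (b(x := e)) \<subseteq> N" using b(1) e(1) by auto
    ultimately show ?case by blast
  qed
  then show thesis using that by blast
qed

definition ptype :: "'m set \<Rightarrow> 'x set \<Rightarrow> ('x \<Rightarrow> 'm) \<Rightarrow> (('x \<Rightarrow> 'm) \<Rightarrow> bool) set" where
  "ptype C X a = {P. pdfn C X P \<and> P a}"

text \<open>Resetting \<open>s\<close> to a default off the free variables leaves few assignments
  and hence few definable conditions. A type is a set of such conditions, and \<kappa> is a strong
  limit.\<close>

lemma small_range_ptype:
  assumes "sm C" "sm X" shows "sm (range (ptype C X))"
proof -
  define z :: "'a + 'm" where "z = Inr undefined"
  define S where "S = {s :: nat \<Rightarrow> 'a + 'm. \<forall>n. if n \<in> UNIV then s n \<in> insert z (X <+> C) else s n = z}"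
  have "sm (insert z (X <+> C))"
    using small_Un[OF small_finite[of "{z}"] small_Plus[OF assms(2,1)]] by simp
  then have "sm S" unfolding S_def by (intro small_functions small_nat)
  define den where "den = (\<lambda>(\<phi>, s) a. sat M (case_sum (a :: 'a \<Rightarrow> 'm) id \<circ> s) \<phi>)"
  have "{P. pdfn C X P} \<subseteq> den ` ({\<phi>. wf_fm M \<phi>} \<times> S)"
  proof safe
    fix P assume "pdfn C X P"
    then obtain \<phi> s where *: "wf_fm M \<phi>" "s ` fv \<phi> \<subseteq> X <+> C" "\<And>a. P a \<longleftrightarrow> sat M (case_sum a id \<circ> s) \<phi>"
      by (elim pdfnE) blast
    define t where "t n = (if n \<in> fv \<phi> then s n else z)" for n
    have "sat M (case_sum a id \<circ> s) \<phi> = sat M (case_sum a id \<circ> t) \<phi>" for a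
      by (rule sat_in_cong) (simp add: t_def)
    then have "P = den (\<phi>, t)" using *(3) by (auto simp: den_def)
    moreover have "t \<in> S" using *(2) by (auto simp: t_def S_def)
    ultimately show "P \<in> den ` ({\<phi>. wf_fm M \<phi>} \<times> S)" using *(1) by blast
  qed
  moreover have "sm (den ` ({\<phi>. wf_fm M \<phi>} \<times> S))"
    using \<open>sm S\<close> by (intro small_image small_Times small_wf_fm)
  ultimately have "sm {P. pdfn C X P}" by (rule small_subset[rotated])
  then have "sm (Pow {P. pdfn C X P})" by (rule small_Pow)
  moreover have "range (ptype C X) \<subseteq> Pow {P. pdfn C X P}" by (auto simp: ptype_def)
  ultimately show ?thesis by (rule small_subset)
qed

end

section \<open>Automorphisms and ultraimaginaries\<close>

lemma automorphisms_id: "id \<in> automorphisms M"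
  by (auto simp: automorphisms_def)

lemma automorphisms_bij: "\<sigma> \<in> automorphisms M \<Longrightarrow> bij \<sigma>"
  by (simp add: automorphisms_def)

lemma automorphisms_comp:
  assumes "\<sigma> \<in> automorphisms M" "\<tau> \<in> automorphisms M" shows "\<sigma> \<circ> \<tau> \<in> automorphisms M"
  unfolding automorphisms_def
proof (intro CollectI conjI ballI)
  show "bij (\<sigma> \<circ> \<tau>)" using bij_comp[OF automorphisms_bij[OF assms(2)] automorphisms_bij[OF assms(1)]] .
  show "case z of (f, n) \<Rightarrow> \<forall>xs. length xs = n \<longrightarrow>
      (\<sigma> \<circ> \<tau>) (fint M f xs) = fint M f (map (\<sigma> \<circ> \<tau>) xs)" if "z \<in> funs M" for z
    using assms that by (force simp: automorphisms_def)
  show "case z of (p, n) \<Rightarrow> \<forall>xs. length xs = n \<longrightarrow>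
      rint M p (map (\<sigma> \<circ> \<tau>) xs) = rint M p xs" if "z \<in> rels M" for z
  proof (cases z)
    case (Pair p n)
    have "rint M p (map (\<sigma> \<circ> \<tau>) xs) = rint M p xs" if "length xs = n" for xs
    proof -
      have "rint M p (map \<sigma> (map \<tau> xs)) = rint M p (map \<tau> xs)"
        using assms(1) \<open>z \<in> rels M\<close> that Pair by (auto simp: automorphisms_def simp del: map_map)
      also have "\<dots> = rint M p xs"
        using assms(2) \<open>z \<in> rels M\<close> that Pair by (auto simp: automorphisms_def)
      finally show ?thesis by simp
    qed
    then show ?thesis using Pair by simp
  qed
qed

lemma automorphisms_inv:
  assumes "\<sigma> \<in> automorphisms M" shows "inv \<sigma> \<in> automorphisms M"
  unfolding automorphisms_def
proof (intro CollectI conjI ballI)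
  have b: "bij \<sigma>" using assms by (simp add: automorphisms_def)
  then show "bij (inv \<sigma>)" by (rule bij_imp_bij_inv)
  have m: "map \<sigma> (map (inv \<sigma>) xs) = xs" for xs
    using b by (simp add: map_idI bij_is_surj surj_f_inv_f)
  show "case z of (f, n) \<Rightarrow> \<forall>xs. length xs = n \<longrightarrow>
      inv \<sigma> (fint M f xs) = fint M f (map (inv \<sigma>) xs)" if "z \<in> funs M" for z
  proof (cases z)
    case (Pair f n)
    have "inv \<sigma> (fint M f xs) = fint M f (map (inv \<sigma>) xs)" if "length xs = n" for xs
    proof -
      have "\<sigma> (fint M f (map (inv \<sigma>) xs)) = fint M f (map \<sigma> (map (inv \<sigma>) xs))"
        using assms \<open>z \<in> funs M\<close> that Pair by (auto simp: automorphisms_def simp del: map_map)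
      then have "\<sigma> (fint M f (map (inv \<sigma>) xs)) = fint M f xs" unfolding m .
      then show ?thesis using b by (metis bij_inv_eq_iff)
    qed
    then show ?thesis using Pair by simp
  qed
  show "case z of (p, n) \<Rightarrow> \<forall>xs. length xs = n \<longrightarrow>
      rint M p (map (inv \<sigma>) xs) = rint M p xs" if "z \<in> rels M" for z
  proof (cases z)
    case (Pair p n)
    have "rint M p (map (inv \<sigma>) xs) = rint M p xs" if "length xs = n" for xs
    proof -
      have "rint M p (map \<sigma> (map (inv \<sigma>) xs)) = rint M p (map (inv \<sigma>) xs)"
        using assms \<open>z \<in> rels M\<close> that Pair by (auto simp: automorphisms_def simp del: map_map)
      then show ?thesis unfolding m by simp
    qed
    then show ?thesis using Pair by simp
  qed
qed

lemma act_apply: "act \<sigma> a x = map_option \<sigma> (a x)"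
  by (simp add: act_def)

lemma dom_act [simp]: "dom (act \<sigma> a) = dom a"
  by (auto simp: act_def dom_def)

lemma act_tuples [simp]: "act \<sigma> a \<in> tuples x \<longleftrightarrow> a \<in> tuples x"
  by (simp add: tuples_def)

lemma act_id [simp]: "act id a = a"
  by (rule ext) (simp add: act_apply option.map_id0)

lemma act_comp: "act (\<sigma> \<circ> \<tau>) a = act \<sigma> (act \<tau> a)"
  by (rule ext) (simp add: act_apply option.map_comp)

lemma act_image_id: "act id ` D = D"
  by simp

lemma act_image_comp: "act (\<sigma> \<circ> \<tau>) ` D = act \<sigma> ` act \<tau> ` D"
  by (simp add: act_comp image_image)

lemma act_inv [simp]:
  assumes "\<sigma> \<in> automorphisms M"
  shows "act (inv \<sigma>) (act \<sigma> a) = a" "act \<sigma> (act (inv \<sigma>) a) = a"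
proof -
  have "inv \<sigma> \<circ> \<sigma> = id" "\<sigma> \<circ> inv \<sigma> = id"
    using automorphisms_bij[OF assms] by (simp_all add: bij_is_inj bij_is_surj flip: surj_iff)
  then show "act (inv \<sigma>) (act \<sigma> a) = a" "act \<sigma> (act (inv \<sigma>) a) = a"
    by (simp_all flip: act_comp)
qed

lemma act_image_inv:
  assumes "\<sigma> \<in> automorphisms M"
  shows "act (inv \<sigma>) ` act \<sigma> ` D = D" "act \<sigma> ` act (inv \<sigma>) ` D = D"
  by (simp_all add: image_image act_inv[OF assms])

lemma act_case_sum: "act \<sigma> (case_sum a b) = case_sum (act \<sigma> a) (act \<sigma> b)"
  by (rule ext) (simp add: act_apply split: sum.split)

lemma act_eqI:
  assumes "dom a = dom b" "\<And>x. x \<in> dom a \<Longrightarrow> \<sigma> (the (a x)) = the (b x)"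
  shows "act \<sigma> a = b"
proof
  fix x
  show "act \<sigma> a x = b x"
  proof (cases "x \<in> dom a")
    case True
    then obtain c where "a x = Some c" by blast
    moreover obtain d where "b x = Some d" using True assms(1) by blast
    ultimately have "a x = Some c" "b x = Some d" .
    then show ?thesis using assms(2)[OF True] by (simp add: act_apply)
  next
    case False
    then have "a x = None" "b x = None" using assms(1) by blast+
    then show ?thesis by (simp add: act_apply)
  qed
qed

lemma the_act: "x \<in> dom a \<Longrightarrow> the (act \<sigma> a x) = \<sigma> (the (a x))"
  by (auto simp: act_apply)

lemma dom_case_sum: "dom (case_sum a b) = dom a <+> dom b"
proof (rule set_eqI)
  show "z \<in> dom (case_sum a b) \<longleftrightarrow> z \<in> dom a <+> dom b" for z by (cases z) auto
qed

lemma case_sum_eq_iff: "case_sum a b = case_sum c d \<longleftrightarrow> a = c \<and> b = d"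
proof
  assume eq: "case_sum a b = case_sum c d"
  show "a = c \<and> b = d"
    using fun_cong[OF eq, of "Inl z" for z] fun_cong[OF eq, of "Inr z" for z] by auto
qed simp

lemma case_sum_tuples:
  fixes a :: "'a \<rightharpoonup> 'b" and b :: "'c \<rightharpoonup> 'b"
  shows "case_sum a b \<in> tuples (x <+> y) \<longleftrightarrow> a \<in> tuples x \<and> b \<in> tuples y"
proof -
  have "dom a <+> dom b = x <+> y \<longleftrightarrow> dom a = x \<and> dom b = y"
  proof
    assume "dom a <+> dom b = x <+> y"
    moreover have "Inl -` (A <+> B) = A" "Inr -` (A <+> B) = B" for A :: "'a set" and B :: "'c set" by auto
    ultimately show "dom a = x \<and> dom b = y" by metis
  qed simp
  then show ?thesis by (simp add: tuples_def dom_case_sum)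
qed

lemma same_type_act:
  assumes "\<sigma> \<in> automorphisms M" shows "same_type M a (act \<sigma> a)"
  unfolding same_type_def
proof (intro conjI allI impI)
  fix \<phi> s assume *: "wf_fm M \<phi> \<and> s ` fv \<phi> \<subseteq> dom a"
  have "sat M (the \<circ> act \<sigma> a \<circ> s) \<phi> = sat M (\<sigma> \<circ> (the \<circ> a \<circ> s)) \<phi>"
    using * by (intro sat_in_cong) (simp add: the_act image_subset_iff)
  then show "sat M (the \<circ> a \<circ> s) \<phi> \<longleftrightarrow> sat M (the \<circ> act \<sigma> a \<circ> s) \<phi>"
    using sat_automorphism[OF assms] * by (simp only:)
qed simp

text \<open>Closure under automorphisms is easier to verify than invariance under equality of types.
  Over small sets of variables strong homogeneity leads back, as \<open>invariant_equivI\<close>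
  records.\<close>

definition aut_invariant :: "('f, 'p, 'm, 'z) struct_scheme \<Rightarrow> ('v \<rightharpoonup> 'm) rel \<Rightarrow> bool" where
  "aut_invariant M E \<longleftrightarrow> (\<forall>\<sigma>\<in>automorphisms M. \<forall>a b. (a, b) \<in> E \<longrightarrow> (act \<sigma> a, act \<sigma> b) \<in> E)"

lemma aut_invariantD: "aut_invariant M E \<Longrightarrow> \<sigma> \<in> automorphisms M \<Longrightarrow> (a, b) \<in> E \<Longrightarrow> (act \<sigma> a, act \<sigma> b) \<in> E"
  by (simp add: aut_invariant_def)

lemma equiv_tuples_subset: "equiv (tuples x) E \<Longrightarrow> (a, b) \<in> E \<Longrightarrow> a \<in> tuples x \<and> b \<in> tuples x"
  unfolding equiv_def refl_on_def by blast

lemma invariant_equiv_imp_aut_invariant: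
  assumes "invariant_equiv M x E" shows "aut_invariant M E"
  unfolding aut_invariant_def
proof (intro ballI allI impI)
  fix \<sigma> a b assume \<sigma>: "\<sigma> \<in> automorphisms M" and ab: "(a, b) \<in> E"
  have E: "equiv (tuples x) E" and inv: "\<And>a b c d. a \<in> tuples x \<Longrightarrow> b \<in> tuples x \<Longrightarrow> c \<in> tuples x \<Longrightarrow>
    d \<in> tuples x \<Longrightarrow> same_type M (case_sum a b) (case_sum c d) \<Longrightarrow> (a, b) \<in> E \<longleftrightarrow> (c, d) \<in> E"
    using assms unfolding invariant_equiv_def by simp_all
  have "same_type M (case_sum a b) (case_sum (act \<sigma> a) (act \<sigma> b))"
    using same_type_act[OF \<sigma>, of "case_sum a b"] by (simp add: act_case_sum)
  moreover have "a \<in> tuples x" "b \<in> tuples x" using equiv_tuples_subset[OF E ab] by auto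
  ultimately show "(act \<sigma> a, act \<sigma> b) \<in> E" using inv[of a b "act \<sigma> a" "act \<sigma> b"] ab by simp
qed

lemma type_definable_imp_aut_invariant:
  assumes "type_definable_equiv M x E" shows "aut_invariant M E"
  unfolding aut_invariant_def
proof (intro ballI allI impI)
  fix \<sigma> a b assume \<sigma>: "\<sigma> \<in> automorphisms M" and ab: "(a, b) \<in> E"
  obtain \<Phi> where \<Phi>1: "\<forall>(\<phi>, s)\<in>\<Phi>. wf_fm M \<phi> \<and> s ` fv \<phi> \<subseteq> x <+> x"
    and \<Phi>2: "E = {(a, b) \<in> tuples x \<times> tuples x. \<forall>(\<phi>, s)\<in>\<Phi>. sat M (the \<circ> case_sum a b \<circ> s) \<phi>}"
    using assms unfolding type_definable_equiv_def by (elim conjE exE)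
  have t: "a \<in> tuples x" "b \<in> tuples x" using ab \<Phi>2 by auto
  have "sat M (the \<circ> case_sum (act \<sigma> a) (act \<sigma> b) \<circ> s) \<phi>" if \<phi>: "(\<phi>, s) \<in> \<Phi>" for \<phi> s
  proof -
    have d: "dom (case_sum a b) = x <+> x" using t by (simp add: dom_case_sum tuples_def)
    have "sat M (the \<circ> case_sum a b \<circ> s) \<phi>" using ab \<phi> \<Phi>2 by auto
    moreover have "same_type M (case_sum a b) (act \<sigma> (case_sum a b))" by (rule same_type_act[OF \<sigma>])
    ultimately show ?thesis using \<Phi>1 \<phi> d unfolding same_type_def act_case_sum by auto
  qed
  then show "(act \<sigma> a, act \<sigma> b) \<in> E" using t unfolding \<Phi>2 by auto
qed

lemma act_image_class:
  assumes E: "equiv (tuples x) E" "aut_invariant M E" and \<sigma>: "\<sigma> \<in> automorphisms M"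
  shows "act \<sigma> ` (E `` {a}) = E `` {act \<sigma> a}"
proof
  show "act \<sigma> ` (E `` {a}) \<subseteq> E `` {act \<sigma> a}" using aut_invariantD[OF E(2) \<sigma>] by auto
  show "E `` {act \<sigma> a} \<subseteq> act \<sigma> ` (E `` {a})"
  proof
    fix b assume "b \<in> E `` {act \<sigma> a}"
    then have "(act (inv \<sigma>) (act \<sigma> a), act (inv \<sigma>) b) \<in> E"
      using aut_invariantD[OF E(2) automorphisms_inv[OF \<sigma>]] by blast
    then have "act (inv \<sigma>) b \<in> E `` {a}" using \<sigma> by simp
    then show "b \<in> act \<sigma> ` (E `` {a})" using \<sigma> by (metis act_inv(2) imageI)
  qed
qed

text \<open>The property of an ultraimaginary that makes its stabilizer a group.\<close>

definition block :: "('f, 'p, 'm, 'z) struct_scheme \<Rightarrow> ('v \<rightharpoonup> 'm) set \<Rightarrow> bool" where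
  "block M A \<longleftrightarrow> A \<noteq> {} \<and> (\<forall>\<sigma>\<in>automorphisms M. act \<sigma> ` A \<inter> A \<noteq> {} \<longrightarrow> act \<sigma> ` A = A)"

lemma block_class:
  assumes E: "equiv (tuples x) E" "aut_invariant M E" and a: "a \<in> tuples x"
  shows "block M (E `` {a})"
  unfolding block_def
proof (intro conjI ballI impI)
  show "E `` {a} \<noteq> {}" using equiv_class_self[OF E(1) a] by blast
  fix \<sigma> assume \<sigma>: "\<sigma> \<in> automorphisms M" and "act \<sigma> ` (E `` {a}) \<inter> E `` {a} \<noteq> {}"
  then obtain c where "(act \<sigma> a, c) \<in> E" "(a, c) \<in> E"
    unfolding act_image_class[OF E \<sigma>] by blast
  then have "E `` {act \<sigma> a} = E `` {c}" "E `` {a} = E `` {c}" using equiv_class_eq[OF E(1)] by blast+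
  then show "act \<sigma> ` (E `` {a}) = E `` {a}" unfolding act_image_class[OF E \<sigma>] by simp
qed

lemma Aut_automorphisms: "\<sigma> \<in> Aut M A \<Longrightarrow> \<sigma> \<in> automorphisms M"
  by (simp add: Aut_def)

lemma Aut_block_iff:
  assumes "block M A" shows "\<sigma> \<in> Aut M A \<longleftrightarrow> \<sigma> \<in> automorphisms M \<and> act \<sigma> ` A = A"
  using assms unfolding block_def Aut_def by blast

lemma Aut_blockI:
  "block M A \<Longrightarrow> \<sigma> \<in> automorphisms M \<Longrightarrow> a \<in> A \<Longrightarrow> act \<sigma> a \<in> A \<Longrightarrow> \<sigma> \<in> Aut M A"
  unfolding block_def Aut_def by blast

lemma Aut_image: "block M A \<Longrightarrow> \<sigma> \<in> Aut M A \<Longrightarrow> act \<sigma> ` A = A"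
  by (simp add: Aut_block_iff)

lemma Aut_id: "id \<in> Aut M A"
  by (simp add: Aut_def automorphisms_id)

lemma Aut_comp: "\<sigma> \<in> Aut M A \<Longrightarrow> \<tau> \<in> Aut M A \<Longrightarrow> \<sigma> \<circ> \<tau> \<in> Aut M A"
  by (simp add: Aut_def automorphisms_comp act_comp)

lemma Aut_inv: "block M A \<Longrightarrow> \<sigma> \<in> Aut M A \<Longrightarrow> inv \<sigma> \<in> Aut M A"
  using act_image_inv(1)[of \<sigma> M A] automorphisms_inv[of \<sigma> M] by (simp add: Aut_block_iff)

lemma Aut_conjugate:
  assumes "\<sigma> \<in> automorphisms M" "\<tau> \<in> Aut M (act \<sigma> ` A)"
  shows "inv \<sigma> \<circ> \<tau> \<circ> \<sigma> \<in> Aut M A"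
  unfolding Aut_def
proof (intro CollectI conjI ballI)
  show "inv \<sigma> \<circ> \<tau> \<circ> \<sigma> \<in> automorphisms M"
    using assms by (intro automorphisms_comp automorphisms_inv) (auto dest: Aut_automorphisms)
  fix a assume "a \<in> A"
  then have "act \<tau> (act \<sigma> a) \<in> act \<sigma> ` A" using assms(2) by (simp add: Aut_def)
  then obtain b where b: "b \<in> A" "act \<tau> (act \<sigma> a) = act \<sigma> b" by blast
  then show "act (inv \<sigma> \<circ> \<tau> \<circ> \<sigma>) a \<in> A" using assms(1) by (simp add: act_comp)
qed

lemma upair_singleton: "upair A {s} = (\<lambda>a. case_sum a s) ` A"
  by (auto simp: upair_def)

lemma Aut_upair:
  assumes "A \<noteq> {}" shows "Aut M (upair A {s}) = {\<sigma> \<in> Aut M A. act \<sigma> s = s}"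
proof -
  obtain a where "a \<in> A" using assms by blast
  then show ?thesis
    unfolding Aut_def upair_singleton by (auto simp: act_case_sum case_sum_eq_iff image_iff)
qed

lemma act_image_upair: "act \<sigma> ` upair A {s} = upair (act \<sigma> ` A) {act \<sigma> s}"
  unfolding upair_singleton image_image act_case_sum ..

lemma ultraimaginary_act:
  assumes "ultraimaginary \<kappa> M D" "\<sigma> \<in> automorphisms M" shows "ultraimaginary \<kappa> M (act \<sigma> ` D)"
proof -
  obtain x E a where *: "small \<kappa> x" "invariant_equiv M x E" "a \<in> tuples x" "D = E `` {a}"
    using assms(1) unfolding ultraimaginary_def by blast
  then have "equiv (tuples x) E" by (simp add: invariant_equiv_def)
  then have "act \<sigma> ` D = E `` {act \<sigma> a}"
    using * act_image_class invariant_equiv_imp_aut_invariant assms(2) by metis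
  then show ?thesis using * unfolding ultraimaginary_def by (metis act_tuples)
qed

definition Fix :: "('f, 'p, 'm, 'z) struct_scheme \<Rightarrow> 'm set \<Rightarrow> ('m \<Rightarrow> 'm) set" where
  "Fix M N = {\<tau> \<in> automorphisms M. \<forall>c\<in>N. \<tau> c = c}"

lemma Fix_act: "\<tau> \<in> Fix M N \<Longrightarrow> ran a \<subseteq> N \<Longrightarrow> act \<tau> a = a"
  by (rule act_eqI) (auto simp: Fix_def ran_def)

lemma Fix_conjugate:
  assumes "\<sigma> \<in> automorphisms M" "\<tau> \<in> Fix M (\<sigma> ` N)" shows "inv \<sigma> \<circ> \<tau> \<circ> \<sigma> \<in> Fix M N"
  unfolding Fix_def
proof (intro CollectI conjI ballI)
  show "inv \<sigma> \<circ> \<tau> \<circ> \<sigma> \<in> automorphisms M"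
    using assms by (intro automorphisms_comp automorphisms_inv) (auto simp: Fix_def)
  fix c assume "c \<in> N"
  then have "\<tau> (\<sigma> c) = \<sigma> c" using assms(2) by (simp add: Fix_def)
  then show "(inv \<sigma> \<circ> \<tau> \<circ> \<sigma>) c = c"
    using automorphisms_bij[OF assms(1)] by (simp add: bij_is_inj)
qed

text \<open>Conjugation by \<open>\<sigma>\<close> carries the pointwise stabilizer of
  \<open>N\<close> to that of its image and preserves the stabilizer of \<open>A\<close>. Thus
  automorphisms over \<open>A\<close> permute the models that generate \<open>Autf\<close>.\<close>

lemma Fix_image_subset_Aut:
  assumes A: "block M A" "Fix M N \<subseteq> Aut M A" and \<sigma>: "\<sigma> \<in> Aut M A"
  shows "Fix M (\<sigma> ` N) \<subseteq> Aut M A"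
proof
  fix \<tau> assume \<tau>: "\<tau> \<in> Fix M (\<sigma> ` N)"
  have \<sigma>': "\<sigma> \<in> automorphisms M" using \<sigma> by (rule Aut_automorphisms)
  have "inv \<sigma> \<circ> \<tau> \<circ> \<sigma> \<in> Aut M A" using Fix_conjugate[OF \<sigma>' \<tau>] A(2) by blast
  then have "\<sigma> \<circ> (inv \<sigma> \<circ> \<tau> \<circ> \<sigma>) \<circ> inv \<sigma> \<in> Aut M A"
    using Aut_comp[OF Aut_comp[OF \<sigma>] Aut_inv[OF A(1) \<sigma>]] by blast
  moreover have "\<sigma> \<circ> (inv \<sigma> \<circ> \<tau> \<circ> \<sigma>) \<circ> inv \<sigma> = \<tau>"
    using automorphisms_bij[OF \<sigma>'] by (auto simp: fun_eq_iff bij_is_surj surj_f_inv_f)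
  ultimately show "\<tau> \<in> Aut M A" by simp
qed

lemma elem_sub_image:
  fixes M :: "('f, 'p, 'm, 'z) struct_scheme"
  assumes N: "elem_sub M N" and \<sigma>: "\<sigma> \<in> automorphisms M" shows "elem_sub M (\<sigma> ` N)"
  unfolding elem_sub_def
proof (intro conjI ballI allI impI)
  show "\<sigma> ` N \<noteq> {}" using N by (simp add: elem_sub_def)
  fix z assume z: "z \<in> funs M"
  show "case z of (f, n) \<Rightarrow> \<forall>xs. length xs = n \<and> set xs \<subseteq> \<sigma> ` N \<longrightarrow> fint M f xs \<in> \<sigma> ` N"
  proof (cases z)
    case (Pair f n)
    have "fint M f xs \<in> \<sigma> ` N" if xs: "length xs = n" "set xs \<subseteq> \<sigma> ` N" for xs
    proof -
      define ys where "ys = map (inv \<sigma>) xs"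
      have b: "bij \<sigma>" using \<sigma> by (rule automorphisms_bij)
      have ys: "xs = map \<sigma> ys" using b by (simp add: ys_def map_idI bij_is_surj surj_f_inv_f)
      have "set ys \<subseteq> N" using xs(2) b by (auto simp: ys_def bij_is_inj)
      then have "fint M f ys \<in> N" using N z Pair xs(1) ys unfolding elem_sub_def by auto
      moreover have "fint M f xs = \<sigma> (fint M f ys)"
        using \<sigma> z Pair ys xs(1) unfolding automorphisms_def by auto
      ultimately show ?thesis by blast
    qed
    then show ?thesis using Pair by simp
  qed
next
  fix \<phi> and v :: "nat \<Rightarrow> 'm" assume *: "wf_fm M \<phi> \<and> range v \<subseteq> \<sigma> ` N"
  define w where "w = inv \<sigma> \<circ> v"
  have b: "bij \<sigma>" using \<sigma> by (rule automorphisms_bij)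
  have v: "v = \<sigma> \<circ> w" using b by (auto simp: w_def bij_is_surj surj_f_inv_f)
  have "range w \<subseteq> N"
  proof
    fix c assume "c \<in> range w"
    then obtain n where n: "c = inv \<sigma> (v n)" by (auto simp: w_def)
    moreover obtain c' where "v n = \<sigma> c'" "c' \<in> N" using * by blast
    ultimately show "c \<in> N" using b by (simp add: bij_is_inj)
  qed
  then have "sat_in M N w \<phi> \<longleftrightarrow> sat M w \<phi>" using N * unfolding elem_sub_def by blast
  then show "sat_in M (\<sigma> ` N) v \<phi> \<longleftrightarrow> sat M v \<phi>"
    unfolding v using sat_in_automorphism[OF \<sigma>, of \<phi> N w] sat_automorphism[OF \<sigma>, of \<phi> w] * by blast
qed

context monster
begin

lemma homogeneity_tuple:
  assumes d: "dom a = dom b" and "sm C" "sm (dom a)"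
    and ab: "\<And>P. pdfn C (dom a) P \<Longrightarrow> P (the \<circ> a) \<Longrightarrow> P (the \<circ> b)"
  shows "\<exists>\<sigma>\<in>Fix M C. act \<sigma> a = b"
proof (rule homogeneity[OF assms(2,3), where a = "the \<circ> a" and b = "the \<circ> b"])
  show "P (the \<circ> b)" if "pdfn C (dom a) P" "P (the \<circ> a)" for P using ab that by blast
next
  fix \<sigma> assume "\<sigma> \<in> automorphisms M" "\<And>c. c \<in> C \<Longrightarrow> \<sigma> c = c"
    "\<And>x. x \<in> dom a \<Longrightarrow> \<sigma> ((the \<circ> a) x) = (the \<circ> b) x"
  then show ?thesis using act_eqI[OF d, of \<sigma>] by (intro bexI[of _ \<sigma>]) (simp_all add: Fix_def)
qed

lemma same_type_imp_conjugate:
  assumes "same_type M a b" "sm (dom a)"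
  obtains \<sigma> where "\<sigma> \<in> automorphisms M" "act \<sigma> a = b"
proof -
  have d: "dom a = dom b" using assms(1) by (simp add: same_type_def)
  have ab: "P (the \<circ> b)" if P: "pdfn {} (dom a) P" "P (the \<circ> a)" for P
  proof -
    obtain \<phi> s where *: "wf_fm M \<phi>" "s ` fv \<phi> \<subseteq> dom a <+> {}" "\<And>a. P a \<longleftrightarrow> sat M (case_sum a id \<circ> s) \<phi>"
      using P(1) by (elim pdfnE) blast
    have s: "s n = Inl (projl (s n)) \<and> projl (s n) \<in> dom a" if "n \<in> fv \<phi>" for n
      using *(2) that by (auto simp: Plus_def)
    have eq: "sat M (case_sum c id \<circ> s) \<phi> = sat M (c \<circ> (projl \<circ> s)) \<phi>" for c
      by (rule sat_in_cong) (metis comp_apply s old.sum.simps(5))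
    have "(projl \<circ> s) ` fv \<phi> \<subseteq> dom a" using s by auto
    then have "sat M (the \<circ> a \<circ> (projl \<circ> s)) \<phi> \<longleftrightarrow> sat M (the \<circ> b \<circ> (projl \<circ> s)) \<phi>"
      using assms(1) *(1) unfolding same_type_def by blast
    then show ?thesis using P(2) unfolding *(3) eq by blast
  qed
  have "\<exists>\<sigma>\<in>Fix M {}. act \<sigma> a = b"
    by (rule homogeneity_tuple[OF d small_finite assms(2)]) (use ab in auto)
  then show thesis using that by (auto simp: Fix_def)
qed

lemma invariant_equivI:
  assumes "sm x" "equiv (tuples x) E" "aut_invariant M E" shows "invariant_equiv M x E"
  unfolding invariant_equiv_def
proof (intro conjI ballI impI)
  fix a b c d assume t: "a \<in> tuples x" "b \<in> tuples x" "c \<in> tuples x" "d \<in> tuples x"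
    and st: "same_type M (case_sum a b) (case_sum c d)"
  have "dom (case_sum a b) = x <+> x" using t by (simp add: dom_case_sum tuples_def)
  then have "sm (dom (case_sum a b))" using small_Plus assms(1) by simp
  then obtain \<sigma> where \<sigma>: "\<sigma> \<in> automorphisms M" "act \<sigma> (case_sum a b) = case_sum c d"
    using same_type_imp_conjugate[OF st] by blast
  then have cd: "act \<sigma> a = c" "act \<sigma> b = d" by (simp_all add: act_case_sum case_sum_eq_iff)
  show "(a, b) \<in> E \<longleftrightarrow> (c, d) \<in> E"
  proof
    assume "(c, d) \<in> E"
    then have "(act (inv \<sigma>) c, act (inv \<sigma>) d) \<in> E"
      using aut_invariantD[OF assms(3) automorphisms_inv[OF \<sigma>(1)]] by blast
    then show "(a, b) \<in> E" unfolding cd[symmetric] act_inv(1)[OF \<sigma>(1)] .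
  next
    assume "(a, b) \<in> E"
    then show "(c, d) \<in> E" using aut_invariantD[OF assms(3) \<sigma>(1)] cd by blast
  qed
qed (fact assms)

section \<open>Bounded ultraimaginaries\<close>

lemma bddu_mono:
  assumes "Aut M A' \<subseteq> Aut M A" shows "bddu \<kappa> M A \<subseteq> bddu \<kappa> M A'"
  using small_subset[OF _ image_mono[OF assms]] unfolding bddu_def by blast

lemma bddu_act:
  assumes D: "D \<in> bddu \<kappa> M A" and \<sigma>: "\<sigma> \<in> automorphisms M"
  shows "act \<sigma> ` D \<in> bddu \<kappa> M (act \<sigma> ` A)"
proof -
  let ?O = "(\<lambda>\<tau>. act \<tau> ` D) ` Aut M A"
  have "(\<lambda>\<tau>. act \<tau> ` act \<sigma> ` D) ` Aut M (act \<sigma> ` A) \<subseteq> image (act \<sigma>) ` ?O"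
  proof
    fix Z assume "Z \<in> (\<lambda>\<tau>. act \<tau> ` act \<sigma> ` D) ` Aut M (act \<sigma> ` A)"
    then obtain \<tau> where \<tau>: "\<tau> \<in> Aut M (act \<sigma> ` A)" "Z = act \<tau> ` act \<sigma> ` D" by blast
    have "Z = act \<sigma> ` act (inv \<sigma> \<circ> \<tau> \<circ> \<sigma>) ` D"
      unfolding \<tau>(2) act_image_comp act_image_inv(2)[OF \<sigma>] ..
    then show "Z \<in> image (act \<sigma>) ` ?O" using Aut_conjugate[OF \<sigma> \<tau>(1)] by blast
  qed
  moreover have "sm (image (act \<sigma>) ` ?O)" using small_image[of ?O] D unfolding bddu_def by blast
  ultimately have "sm ((\<lambda>\<tau>. act \<tau> ` act \<sigma> ` D) ` Aut M (act \<sigma> ` A))" by (rule small_subset[rotated])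
  then show ?thesis using ultraimaginary_act[OF _ \<sigma>, of \<kappa> D] D by (simp add: bddu_def)
qed

text \<open>
  Let \<open>T\<close> represent the conjugates of \<open>D\<close> over the model \<open>N\<close>. The type saying of \<open>y\<close> that it realizes
  the type of \<open>d\<close> over \<open>N\<close> and does not distinguish over \<open>N\<close> between the \<open>\<tau> d\<close>, \<open>\<tau> \<in> T\<close>, is finitely
  satisfiable in \<open>N\<close>. A realization lies in one of the classes, hence in all of them.
\<close>

lemma bddu_fixed_by_model:
  fixes D :: "('w \<rightharpoonup> 'm) set"
  assumes D: "D \<in> bddu \<kappa> M A" and N: "elem_sub M N" "sm N" "Fix M N \<subseteq> Aut M A"
    and \<sigma>: "\<sigma> \<in> Fix M N"
  shows "act \<sigma> ` D = D"
proof -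
  obtain x E d where x: "sm x" and E: "invariant_equiv M x E" and d: "d \<in> tuples x" and DE: "D = E `` {d}"
    using D unfolding bddu_def ultraimaginary_def by blast
  have eq: "equiv (tuples x) E" using E by (simp add: invariant_equiv_def)
  have inv: "aut_invariant M E" using E by (rule invariant_equiv_imp_aut_invariant)
  let ?f = "\<lambda>\<tau>. act \<tau> ` D"
  have domd: "dom d = x" using d by (simp add: tuples_def)
  obtain T where T: "T \<subseteq> Fix M N" "inj_on ?f T" "?f ` Fix M N = ?f ` T"
    using subset_refl[of "?f ` Fix M N"] unfolding subset_image_inj[of "?f ` Fix M N" ?f "Fix M N"] by (elim exE conjE)
  have "sm (?f ` Aut M A)" using D by (simp add: bddu_def)
  then have "sm (?f ` T)" using small_subset[OF _ image_mono[OF N(3), of ?f]] T(3) by simp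
  then have smT: "sm T" by (rule small_inj_image[OF T(2) order_refl])
  \<comment> \<open>\<open>T\<close> contains just one automorphism for each conjugate of
    \<open>D\<close>; \<open>id\<close> and \<open>\<sigma>\<close> are added because the conclusion
    compares the classes of \<open>d\<close> and of its image under \<open>\<sigma>\<close>.\<close>
  define S where "S = T \<union> {id, \<sigma>}"
  have "id \<in> Fix M N" using automorphisms_id by (simp add: Fix_def)
  then have S: "sm S" "S \<subseteq> Fix M N" "id \<in> S" "\<sigma> \<in> S"
    using small_Un[OF smT small_finite[of "{id, \<sigma>}"]] T(1) \<sigma> by (simp_all add: S_def)
  define C where "C = N \<union> (\<lambda>(\<tau>, v). the (act \<tau> d v)) ` (S \<times> x)"
  have C: "sm C" unfolding C_def using N(2) S(1) x by (intro small_Un small_image small_Times)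
  define \<Gamma>1 where "\<Gamma>1 = {P. pdfn N x P \<and> P (the \<circ> d)}"
  define \<Gamma>2 where "\<Gamma>2 = (\<lambda>(R, \<tau>, \<tau>') y. R (case_sum y (the \<circ> act \<tau> d)) \<longleftrightarrow> R (case_sum y (the \<circ> act \<tau>' d))) `
    ({R. pdfn N (x <+> x) R} \<times> S \<times> S)"
  have sub: "pdfn C x (\<lambda>y. R (case_sum y (the \<circ> act \<tau> d)))" if "pdfn N (x <+> x) R" "\<tau> \<in> S" for R \<tau>
  proof -
    have "pdfn C x (\<lambda>y. R (case_sum y id \<circ> case_sum Inl (Inr \<circ> (the \<circ> act \<tau> d))))"
      using that by (intro pdfn_subst[OF that(1)]) (auto simp: C_def)
    moreover have "case_sum y id \<circ> case_sum Inl (Inr \<circ> (the \<circ> act \<tau> d)) = case_sum y (the \<circ> act \<tau> d)" for y :: "'w \<Rightarrow> 'm"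
      by (rule ext) (simp split: sum.split)
    ultimately show ?thesis by simp
  qed
  have \<Gamma>: "pdfn C x P" if "P \<in> \<Gamma>1 \<union> \<Gamma>2" for P
    using that
  proof
    assume "P \<in> \<Gamma>1"
    then show ?thesis unfolding \<Gamma>1_def using pdfn_mono[of N x P C x] by (auto simp: C_def)
  next
    assume "P \<in> \<Gamma>2"
    then obtain R \<tau> \<tau>' where *: "pdfn N (x <+> x) R" "\<tau> \<in> S" "\<tau>' \<in> S"
      "P = (\<lambda>y. R (case_sum y (the \<circ> act \<tau> d)) \<longleftrightarrow> R (case_sum y (the \<circ> act \<tau>' d)))"
      unfolding \<Gamma>2_def by blast
    show ?thesis unfolding *(4) using * by (intro pdfn_iff sub)
  qed
  have fin: "\<exists>y. \<forall>P\<in>q. P y" if q: "q \<subseteq> \<Gamma>1 \<union> \<Gamma>2" "finite q" for q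
  proof -
    have "pdfn N x (\<lambda>y. \<forall>P\<in>q \<inter> \<Gamma>1. P y)" using q(2) by (intro pdfn_Ball) (auto simp: \<Gamma>1_def)
    moreover have "\<forall>P\<in>q \<inter> \<Gamma>1. P (the \<circ> d)" by (auto simp: \<Gamma>1_def)
    ultimately obtain y where y: "range y \<subseteq> N" "\<forall>P\<in>q \<inter> \<Gamma>1. P y"
      using elem_sub_witness[OF N(1), of x "\<lambda>y. \<forall>P\<in>q \<inter> \<Gamma>1. P y" "the \<circ> d"] by blast
    \<comment> \<open>The witness \<open>y\<close> lies in \<open>N\<close>, which
      \<open>\<tau>\<close> fixes pointwise, so a condition over \<open>N\<close> on
      \<open>y\<close> and the image of \<open>d\<close> is equivalent to the same condition on
      \<open>y\<close> and \<open>d\<close>.\<close>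
    have key: "R (case_sum y (the \<circ> act \<tau> d)) \<longleftrightarrow> R (case_sum y (the \<circ> d))"
      if R: "pdfn N (x <+> x) R" and \<tau>: "\<tau> \<in> S" for R \<tau>
    proof -
      let ?R = "\<lambda>z. R (case_sum z id \<circ> case_sum (Inr \<circ> y) Inl)"
      have "y v \<in> N" for v using y(1) by blast
      then have R': "pdfn N x ?R" by (intro pdfn_subst[OF R]) auto
      have z: "case_sum z id \<circ> case_sum (Inr \<circ> y) Inl = case_sum y z" for z
        by (rule ext) (simp split: sum.split)
      have "?R (the \<circ> act \<tau> d) = ?R (\<tau> \<circ> (the \<circ> d))"
        using domd by (intro pdfn_cong[OF R']) (simp add: the_act)
      also have "\<dots> = ?R (the \<circ> d)"
        using \<tau> S(2) by (intro pdfn_automorphism[OF _ _ R']) (auto simp: Fix_def)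
      finally show ?thesis unfolding z .
    qed
    have "P y" if P: "P \<in> q" for P
    proof (cases "P \<in> \<Gamma>1")
      case True
      then show ?thesis using y(2) P by blast
    next
      case False
      then have "P \<in> \<Gamma>2" using q(1) P by blast
      then obtain R \<tau> \<tau>' where *: "pdfn N (x <+> x) R" "\<tau> \<in> S" "\<tau>' \<in> S"
        "P = (\<lambda>y. R (case_sum y (the \<circ> act \<tau> d)) \<longleftrightarrow> R (case_sum y (the \<circ> act \<tau>' d)))"
        unfolding \<Gamma>2_def by blast
      show ?thesis unfolding *(4) using key[OF *(1,2)] key[OF *(1,3)] by blast
    qed
    then show ?thesis by blast
  qed
  obtain y where y: "\<And>P. P \<in> \<Gamma>1 \<union> \<Gamma>2 \<Longrightarrow> P y"
    using compactness[OF C x \<Gamma> fin] by blast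
  define e where "e v = (if v \<in> x then Some (y v) else None)" for v
  have dome: "dom e = x" by (auto simp: e_def split: if_splits)
  have "\<exists>\<rho>\<in>Fix M N. act \<rho> d = e"
  proof (rule homogeneity_tuple[OF _ N(2)])
    fix P assume P: "pdfn N (dom d) P" "P (the \<circ> d)"
    then have "P \<in> \<Gamma>1 \<union> \<Gamma>2" using domd by (simp add: \<Gamma>1_def)
    then have "P y" by (rule y)
    moreover have "P y = P (the \<circ> e)" using domd by (intro pdfn_cong[OF P(1)]) (simp add: e_def)
    ultimately show "P (the \<circ> e)" by simp
  qed (use x domd dome in simp_all)
  then obtain \<rho> where \<rho>: "\<rho> \<in> Fix M N" "act \<rho> d = e" by blast
  have \<rho>': "\<rho> \<in> automorphisms M" using \<rho>(1) by (simp add: Fix_def)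
  \<comment> \<open>The conjugate of \<open>D\<close> that contains \<open>e\<close> is one of those
    represented in \<open>T\<close>. Smallness of \<open>T\<close>, which is boundedness of
    \<open>D\<close>, allowed \<open>e\<close> to be indifferent to all of them at once.\<close>
  have "act \<rho> ` D \<in> ?f ` T" using \<rho>(1) T(3) by blast
  then obtain \<tau>0 where \<tau>0: "\<tau>0 \<in> T" "act \<rho> ` D = act \<tau>0 ` D" by blast
  have aut: "\<tau> \<in> automorphisms M" if "\<tau> \<in> S" for \<tau> using S(2) that by (auto simp: Fix_def)
  have "\<tau>0 \<in> S" using \<tau>0(1) by (simp add: S_def)
  have "E `` {e} = E `` {act \<tau>0 d}"
    using \<tau>0(2) act_image_class[OF eq inv \<rho>', of d] act_image_class[OF eq inv aut[OF \<open>\<tau>0 \<in> S\<close>], of d]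
      \<rho>(2) unfolding DE by simp
  then have E0: "(act \<tau>0 d, e) \<in> E"
    using eq_equiv_class_iff[OF eq, of "act \<tau>0 d" e] d dome by (simp add: tuples_def)
  \<comment> \<open>Since \<open>e\<close> does not tell the images of \<open>d\<close> apart over
    \<open>N\<close>, some automorphism fixes \<open>e\<close> and moves one image to the other; it
    carries the one known instance of \<open>E\<close> to the wanted one.\<close>
  have all: "(act \<tau> d, e) \<in> E" if \<tau>: "\<tau> \<in> S" for \<tau>
  proof -
    have R0: "R (case_sum y (the \<circ> act \<tau> d))" if R: "pdfn N (x <+> x) R" "R (case_sum y (the \<circ> act \<tau>0 d))" for R
    proof -
      have "(\<lambda>y. R (case_sum y (the \<circ> act \<tau> d)) \<longleftrightarrow> R (case_sum y (the \<circ> act \<tau>0 d))) \<in> \<Gamma>2"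
        unfolding \<Gamma>2_def using R(1) \<tau> \<open>\<tau>0 \<in> S\<close> by (intro image_eqI[of _ _ "(R, \<tau>, \<tau>0)"]) auto
      from y[OF UnI2[OF this]] show ?thesis using R(2) by simp
    qed
    have val: "case_sum y (the \<circ> act \<tau> d) z = the (case_sum e (act \<tau> d) z)" if "z \<in> x <+> x" for z \<tau>
      using that by (auto simp: e_def)
    have R': "R (the \<circ> case_sum e (act \<tau> d))"
      if R: "pdfn N (x <+> x) R" "R (the \<circ> case_sum e (act \<tau>0 d))" for R
    proof -
      have "R (case_sum y (the \<circ> act \<tau> d)) = R (the \<circ> case_sum e (act \<tau> d))" for \<tau>
        by (rule pdfn_cong[OF R(1)]) (simp add: val)
      then show ?thesis using R0[OF R(1)] R(2) by blast
    qed
    have "\<exists>\<mu>\<in>Fix M N. act \<mu> (case_sum e (act \<tau>0 d)) = case_sum e (act \<tau> d)"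
      using domd dome x R' by (intro homogeneity_tuple[OF _ N(2)]) (simp_all add: dom_case_sum small_Plus)
    then obtain \<mu> where \<mu>: "\<mu> \<in> automorphisms M" "act \<mu> e = e" "act \<mu> (act \<tau>0 d) = act \<tau> d"
      by (auto simp: Fix_def act_case_sum case_sum_eq_iff)
    then show ?thesis using aut_invariantD[OF inv \<mu>(1) E0] by simp
  qed
  have "(act \<sigma> d, e) \<in> E" "(d, e) \<in> E" using all[OF S(4)] all[OF S(3)] by simp_all
  then have "E `` {act \<sigma> d} = E `` {d}"
    using equiv_class_eq[OF eq] by simp
  then show ?thesis unfolding DE act_image_class[OF eq inv aut[OF S(4)]] .
qed

text \<open>A conjugate of \<open>e\<close> that is bounded over \<open>A\<close> is fixed by all
  automorphisms over \<open>N\<close>, so the type over \<open>N\<close> of one representative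
  determines it, and such types are few. The conjugates counted are those under the full
  automorphism group.\<close>

lemma small_bddu_conjugates:
  fixes e :: "('w \<rightharpoonup> 'm) set"
  assumes N: "elem_sub M N" "sm N" "Fix M N \<subseteq> Aut M A" and e: "ultraimaginary \<kappa> M e"
  shows "sm {D \<in> bddu \<kappa> M A. \<exists>\<sigma>\<in>automorphisms M. D = act \<sigma> ` e}"
proof -
  obtain x E d where x: "sm x" and E: "invariant_equiv M x E" and d: "d \<in> tuples x" and eE: "e = E `` {d}"
    using e unfolding ultraimaginary_def by blast
  have eq: "equiv (tuples x) E" using E by (simp add: invariant_equiv_def)
  have inv: "aut_invariant M E" using E by (rule invariant_equiv_imp_aut_invariant)
  have domd: "dom d = x" using d by (simp add: tuples_def)
  let ?B = "{D \<in> bddu \<kappa> M A. \<exists>\<sigma>\<in>automorphisms M. D = act \<sigma> ` e}"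
  define s where "s D = (SOME \<sigma>. \<sigma> \<in> automorphisms M \<and> D = act \<sigma> ` e)" for D
  have s: "s D \<in> automorphisms M \<and> D = act (s D) ` e" if "D \<in> ?B" for D
    using someI_ex[of "\<lambda>\<sigma>. \<sigma> \<in> automorphisms M \<and> D = act \<sigma> ` e"] that unfolding s_def by blast
  have "inj_on (\<lambda>D. ptype N x (the \<circ> act (s D) d)) ?B"
  proof (rule inj_onI)
    fix D D' assume D: "D \<in> ?B" and D': "D' \<in> ?B"
      and pt: "ptype N x (the \<circ> act (s D) d) = ptype N x (the \<circ> act (s D') d)"
    have "\<exists>\<rho>\<in>Fix M N. act \<rho> (act (s D) d) = act (s D') d"
    proof (rule homogeneity_tuple[OF _ N(2)])
      fix P assume "pdfn N (dom (act (s D) d)) P" "P (the \<circ> act (s D) d)"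
      then have "P \<in> ptype N x (the \<circ> act (s D) d)" using domd by (simp add: ptype_def)
      then have "P \<in> ptype N x (the \<circ> act (s D') d)" using pt by (simp only:)
      then show "P (the \<circ> act (s D') d)" by (simp add: ptype_def)
    qed (use x domd in simp_all)
    then obtain \<rho> where \<rho>: "\<rho> \<in> Fix M N" and r: "act \<rho> (act (s D) d) = act (s D') d" by blast
    have \<rho>': "\<rho> \<in> automorphisms M" using \<rho> by (simp add: Fix_def)
    have DE: "D = E `` {act (s D) d}" "D' = E `` {act (s D') d}"
      using s[OF D] s[OF D'] act_image_class[OF eq inv, of "s D" d] act_image_class[OF eq inv, of "s D'" d]
      unfolding eE by auto
    have "act \<rho> ` D = D" using D by (intro bddu_fixed_by_model[OF _ N \<rho>]) blast
    moreover have "act \<rho> ` D = D'"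
      using act_image_class[OF eq inv \<rho>', of "act (s D) d"] r DE by simp
    ultimately show "D = D'" by simp
  qed
  moreover have "(\<lambda>D. ptype N x (the \<circ> act (s D) d)) ` ?B \<subseteq> range (ptype N x)" by blast
  ultimately show ?thesis using small_range_ptype[OF N(2) x] by (rule small_inj_image)
qed

lemma Autf_fixes_bddu:
  assumes "\<sigma> \<in> Autf \<kappa> M A" "D \<in> bddu \<kappa> M A" shows "\<sigma> \<in> automorphisms M \<and> act \<sigma> ` D = D"
  using assms(1)
proof induction
  case (gen N \<sigma>)
  then have "\<sigma> \<in> Fix M N" "Fix M N \<subseteq> Aut M A" by (auto simp: Fix_def)
  then show ?case using bddu_fixed_by_model[OF assms(2) gen(1,2)] gen(4) by blast
next
  case one
  show ?case using automorphisms_id act_image_id by (intro conjI)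
next
  case (mult \<sigma> \<tau>)
  then show ?case using automorphisms_comp[of \<sigma> M \<tau>] by (simp only: act_image_comp)
next
  case (inverse \<sigma>)
  then show ?case using automorphisms_inv act_image_inv(1)[of \<sigma> M D] by auto
qed

lemma Autf_Aut:
  assumes "\<sigma> \<in> Autf \<kappa> M A" "block M A" shows "\<sigma> \<in> Aut M A"
  using assms(1)
proof induction
  case (gen N \<sigma>)
  then show ?case by blast
next
  case (inverse \<sigma>)
  then show ?case using assms(2) by (intro Aut_inv)
next
  case one
  show ?case by (rule Aut_id)
next
  case (mult \<sigma> \<tau>)
  then show ?case by (intro Aut_comp)
qed

lemma Fix_Autf: "elem_sub M N \<Longrightarrow> sm N \<Longrightarrow> Fix M N \<subseteq> Aut M A \<Longrightarrow> \<sigma> \<in> Fix M N \<Longrightarrow> \<sigma> \<in> Autf \<kappa> M A"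
  by (rule Autf.gen[of M N]) (auto simp: Fix_def)

end

section \<open>Hyperimaginary parameters\<close>

context monster
begin

text \<open>One relation on one tuple replaces a family of hyperimaginaries. Real tuples and pairs
  have this form as well, so everything shown for \<open>A\<close> applies again to \<open>A\<close>
  together with a sequence, and to a model coded as a tuple.\<close>

definition hyp_at :: "('u \<rightharpoonup> 'm) set \<Rightarrow> ('u \<rightharpoonup> 'm) \<Rightarrow> bool" where
  "hyp_at A a \<longleftrightarrow> (\<exists>X EA. sm X \<and> type_definable_equiv M X EA \<and> a \<in> tuples X \<and> A = EA `` {a})"

lemma hyp_at_block:
  assumes "hyp_at A a" shows "block M A"
proof -
  obtain X EA where *: "type_definable_equiv M X EA" "a \<in> tuples X" "A = EA `` {a}"
    using assms unfolding hyp_at_def by blast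
  show ?thesis unfolding *(3)
    using *(1,2) by (intro block_class[of X] type_definable_imp_aut_invariant[of M X])
      (simp_all add: type_definable_equiv_def)
qed

lemma hyp_at_mem:
  assumes "hyp_at A a" shows "a \<in> A"
proof -
  obtain X EA where *: "type_definable_equiv M X EA" "a \<in> tuples X" "A = EA `` {a}"
    using assms unfolding hyp_at_def by blast
  then have "equiv (tuples X) EA" by (simp add: type_definable_equiv_def)
  then show ?thesis unfolding *(3) using *(2) by (rule equiv_class_self)
qed

lemma hyp_at_small_ran:
  assumes "hyp_at A a" shows "sm (ran a)"
proof -
  have "sm (dom a)" using assms unfolding hyp_at_def tuples_def by blast
  then have "sm ((the \<circ> a) ` dom a)" by (rule small_image)
  moreover have "ran a \<subseteq> (the \<circ> a) ` dom a" by (force simp: ran_def image_iff)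
  ultimately show ?thesis by (rule small_subset)
qed

lemma hyp_at_Fix:
  assumes "hyp_at A a" "ran a \<subseteq> N" shows "Fix M N \<subseteq> Aut M A"
proof
  fix \<tau> assume \<tau>: "\<tau> \<in> Fix M N"
  then have "act \<tau> a = a" using assms(2) by (rule Fix_act)
  then show "\<tau> \<in> Aut M A"
    using Aut_blockI[OF hyp_at_block[OF assms(1)] _ hyp_at_mem[OF assms(1)], of \<tau>] \<tau> hyp_at_mem[OF assms(1)]
    by (simp add: Fix_def)
qed

lemma sum_fun_split: "w = case_sum (w \<circ> Inl) (w \<circ> Inr)"
  by (rule ext) (simp split: sum.split)

lemma sat_the_case_sum: "the \<circ> case_sum a b \<circ> s = case_sum (the \<circ> a) (the \<circ> b) \<circ> s"
  by (rule ext) (simp split: sum.split)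

text \<open>The product relation is defined by the union of the defining sets of its factors, with
  the variables of factor \<open>i\<close> tagged by \<open>i\<close>.\<close>

lemma hyp_at_family:
  fixes E :: "'i \<Rightarrow> ('v \<rightharpoonup> 'm) rel"
  assumes "hyperimaginary_family \<kappa> M K x E a"
  shows "hyp_at (product_rel K x E `` {a}) a" "equiv (tuples (Sigma K x)) (product_rel K x E)"
    "aut_invariant M (product_rel K x E)" "sm (Sigma K x)" "a \<in> tuples (Sigma K x)"
proof -
  have sm: "sm (Sigma K x)" and td: "\<And>i. i \<in> K \<Longrightarrow> type_definable_equiv M (x i) (E i)"
    and a: "a \<in> tuples (Sigma K x)"
    using assms unfolding hyperimaginary_family_def by blast+
  have eq: "equiv (tuples (x i)) (E i)" if "i \<in> K" for i
    using td[OF that] by (simp add: type_definable_equiv_def)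
  have slice: "(\<lambda>j. c (i, j)) \<in> tuples (x i)" if "c \<in> tuples (Sigma K x)" "i \<in> K" for c :: "'i \<times> 'v \<rightharpoonup> 'm" and i
  proof -
    have "dom c = Sigma K x" using that(1) by (simp add: tuples_def)
    then have "(i, j) \<in> dom c \<longleftrightarrow> j \<in> x i" for j using that(2) by simp
    then show ?thesis by (auto simp: tuples_def dom_def)
  qed
  have "\<forall>i\<in>K. \<exists>\<Phi>. (\<forall>(\<phi>, s)\<in>\<Phi>. wf_fm M \<phi> \<and> s ` fv \<phi> \<subseteq> x i <+> x i) \<and>
      E i = {(a, b) \<in> tuples (x i) \<times> tuples (x i). \<forall>(\<phi>, s)\<in>\<Phi>. sat M (the \<circ> case_sum a b \<circ> s) \<phi>}"
    using td unfolding type_definable_equiv_def by simp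
  from bchoice[OF this] obtain \<Phi> where
    \<Phi>: "\<forall>i\<in>K. (\<forall>(\<phi>, s)\<in>\<Phi> i. wf_fm M \<phi> \<and> s ` fv \<phi> \<subseteq> x i <+> x i) \<and>
      E i = {(a, b) \<in> tuples (x i) \<times> tuples (x i). \<forall>(\<phi>, s)\<in>\<Phi> i. sat M (the \<circ> case_sum a b \<circ> s) \<phi>}"
    by (elim exE)
  let ?m = "\<lambda>i. map_sum (Pair i) (Pair i)"
  define \<Psi> where "\<Psi> = (\<Union>i\<in>K. (\<lambda>(\<phi>, s). (\<phi>, ?m i \<circ> s)) ` \<Phi> i)"
  have "the \<circ> case_sum c d \<circ> (?m i \<circ> s) = the \<circ> case_sum (\<lambda>j. c (i, j)) (\<lambda>j. d (i, j)) \<circ> s"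
    for c d :: "'i \<times> 'v \<rightharpoonup> 'm" and i and s :: "nat \<Rightarrow> 'v + 'v"
    by (rule ext) (simp add: map_sum_def split: sum.split)
  then have \<Psi>: "(\<forall>(\<phi>, s)\<in>\<Psi>. sat M (the \<circ> case_sum c d \<circ> s) \<phi>) \<longleftrightarrow>
      (\<forall>i\<in>K. \<forall>(\<phi>, s)\<in>\<Phi> i. sat M (the \<circ> case_sum (\<lambda>j. c (i, j)) (\<lambda>j. d (i, j)) \<circ> s) \<phi>)" for c d
    unfolding \<Psi>_def by fastforce
  have "product_rel K x E = {(c, d) \<in> tuples (Sigma K x) \<times> tuples (Sigma K x).
      \<forall>(\<phi>, s)\<in>\<Psi>. sat M (the \<circ> case_sum c d \<circ> s) \<phi>}"
  proof -
    have "(\<forall>i\<in>K. (\<lambda>j. c (i, j), \<lambda>j. d (i, j)) \<in> E i) \<longleftrightarrow> (\<forall>(\<phi>, s)\<in>\<Psi>. sat M (the \<circ> case_sum c d \<circ> s) \<phi>)"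
      if "c \<in> tuples (Sigma K x)" "d \<in> tuples (Sigma K x)" for c d
      unfolding \<Psi> using \<Phi> slice[OF that(1)] slice[OF that(2)] by (intro ball_cong) auto
    then show ?thesis unfolding product_rel_def by blast
  qed
  moreover have "\<forall>(\<phi>, s)\<in>\<Psi>. wf_fm M \<phi> \<and> s ` fv \<phi> \<subseteq> Sigma K x <+> Sigma K x"
  proof (intro ballI, clarify)
    fix \<phi> s assume "(\<phi>, s) \<in> \<Psi>"
    then obtain i t where i: "i \<in> K" "(\<phi>, t) \<in> \<Phi> i" "s = ?m i \<circ> t" unfolding \<Psi>_def by auto
    then have t: "wf_fm M \<phi>" "t ` fv \<phi> \<subseteq> x i <+> x i" using bspec[OF \<Phi> i(1)] by blast+
    have "?m i z \<in> Sigma K x <+> Sigma K x" if "z \<in> x i <+> x i" for z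
      using that i(1) by auto
    then show "wf_fm M \<phi> \<and> s ` fv \<phi> \<subseteq> Sigma K x <+> Sigma K x" using t i(3) by auto
  qed
  moreover show "equiv (tuples (Sigma K x)) (product_rel K x E)"
  proof (rule equivI)
    show "product_rel K x E \<subseteq> tuples (Sigma K x) \<times> tuples (Sigma K x)" by (auto simp: product_rel_def)
    show "refl_on (tuples (Sigma K x)) (product_rel K x E)"
      using slice eq by (auto simp: refl_on_def product_rel_def equiv_def)
    show "sym (product_rel K x E)"
      using eq by (auto simp: product_rel_def equiv_def intro!: symI dest: symD)
    show "trans (product_rel K x E)"
      unfolding product_rel_def using eq by (intro transI) (auto simp: equiv_def, meson transD)
  qed
  ultimately have t: "type_definable_equiv M (Sigma K x) (product_rel K x E)"
    unfolding type_definable_equiv_def by blast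
  then show "hyp_at (product_rel K x E `` {a}) a" unfolding hyp_at_def using sm a by blast
  show "aut_invariant M (product_rel K x E)" using t by (rule type_definable_imp_aut_invariant)
  show "sm (Sigma K x)" "a \<in> tuples (Sigma K x)" by fact+
qed

lemma hyp_at_singleton:
  assumes "sm (dom s)" shows "hyp_at {s} s"
proof -
  let ?E = "{(a, b) \<in> tuples (dom s) \<times> tuples (dom s). a = b}"
  let ?\<Phi> = "(\<lambda>z. (Eq (Var 0) (Var 1), \<lambda>n :: nat. if n = 0 then Inl z else Inr z)) ` dom s"
  have "(\<forall>(\<phi>, t)\<in>?\<Phi>. sat M (the \<circ> case_sum a b \<circ> t) \<phi>) \<longleftrightarrow> a = b"
    if "a \<in> tuples (dom s)" "b \<in> tuples (dom s)" for a b
  proof -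
    have "a = b" if "\<forall>z\<in>dom s. the (a z) = the (b z)"
    proof -
      have "act id a = b"
        by (rule act_eqI) (use that \<open>a \<in> _\<close> \<open>b \<in> _\<close> in \<open>auto simp: tuples_def\<close>)
      then show ?thesis by simp
    qed
    then show ?thesis by auto
  qed
  then have "?E = {(a, b) \<in> tuples (dom s) \<times> tuples (dom s). \<forall>(\<phi>, t)\<in>?\<Phi>. sat M (the \<circ> case_sum a b \<circ> t) \<phi>}"
    by blast
  moreover have "\<forall>(\<phi>, t)\<in>?\<Phi>. wf_fm M \<phi> \<and> t ` fv \<phi> \<subseteq> dom s <+> dom s" by auto
  moreover have "equiv (tuples (dom s)) ?E"
    by (intro equivI) (auto simp: refl_on_def sym_def trans_def)
  ultimately have "type_definable_equiv M (dom s) ?E" unfolding type_definable_equiv_def by blast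
  moreover have "{s} = ?E `` {s}" by (auto simp: tuples_def)
  moreover have "s \<in> tuples (dom s)" by (simp add: tuples_def)
  ultimately show ?thesis unfolding hyp_at_def using assms by blast
qed

lemma hyp_at_upair:
  fixes A :: "('u \<rightharpoonup> 'm) set" and B :: "('w \<rightharpoonup> 'm) set"
  assumes "hyp_at A a" "hyp_at B b" shows "hyp_at (upair A B) (case_sum a b)"
proof -
  obtain X EA where A: "sm X" "type_definable_equiv M X EA" "a \<in> tuples X" "A = EA `` {a}"
    using assms(1) unfolding hyp_at_def by blast
  obtain Y EB where B: "sm Y" "type_definable_equiv M Y EB" "b \<in> tuples Y" "B = EB `` {b}"
    using assms(2) unfolding hyp_at_def by blast
  obtain \<Phi> where \<Phi>: "\<forall>(\<phi>, s)\<in>\<Phi>. wf_fm M \<phi> \<and> s ` fv \<phi> \<subseteq> X <+> X"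
    "EA = {(a, b) \<in> tuples X \<times> tuples X. \<forall>(\<phi>, s)\<in>\<Phi>. sat M (the \<circ> case_sum a b \<circ> s) \<phi>}"
    using A(2) unfolding type_definable_equiv_def by (elim conjE exE)
  obtain \<Psi> where \<Psi>: "\<forall>(\<phi>, s)\<in>\<Psi>. wf_fm M \<phi> \<and> s ` fv \<phi> \<subseteq> Y <+> Y"
    "EB = {(a, b) \<in> tuples Y \<times> tuples Y. \<forall>(\<phi>, s)\<in>\<Psi>. sat M (the \<circ> case_sum a b \<circ> s) \<phi>}"
    using B(2) unfolding type_definable_equiv_def by (elim conjE exE)
  have eA: "equiv (tuples X) EA" and eB: "equiv (tuples Y) EB"
    using A(2) B(2) by (simp_all add: type_definable_equiv_def)
  let ?Z = "X <+> Y"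
  define E where "E = {(c, d) \<in> tuples ?Z \<times> tuples ?Z. (c \<circ> Inl, d \<circ> Inl) \<in> EA \<and> (c \<circ> Inr, d \<circ> Inr) \<in> EB}"
  have tup: "c \<circ> Inl \<in> tuples X \<and> c \<circ> Inr \<in> tuples Y" if "c \<in> tuples ?Z" for c :: "'u + 'w \<rightharpoonup> 'm"
    using that case_sum_tuples[of "c \<circ> Inl" "c \<circ> Inr" X Y] sum_fun_split[of c] by simp
  let ?\<Theta> = "(\<lambda>(\<phi>, s). (\<phi>, map_sum Inl Inl \<circ> s)) ` \<Phi> \<union> (\<lambda>(\<phi>, s). (\<phi>, map_sum Inr Inr \<circ> s)) ` \<Psi>"
  have l: "the \<circ> case_sum c d \<circ> (map_sum Inl Inl \<circ> s) = the \<circ> case_sum (c \<circ> Inl) (d \<circ> Inl) \<circ> s"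
    for c d :: "'u + 'w \<rightharpoonup> 'm" and s :: "nat \<Rightarrow> 'u + 'u"
    by (rule ext) (simp add: map_sum_def split: sum.split)
  have r: "the \<circ> case_sum c d \<circ> (map_sum Inr Inr \<circ> s) = the \<circ> case_sum (c \<circ> Inr) (d \<circ> Inr) \<circ> s"
    for c d :: "'u + 'w \<rightharpoonup> 'm" and s :: "nat \<Rightarrow> 'w + 'w"
    by (rule ext) (simp add: map_sum_def split: sum.split)
  have "(\<forall>(\<phi>, s)\<in>?\<Theta>. sat M (the \<circ> case_sum c d \<circ> s) \<phi>) \<longleftrightarrow>
      (\<forall>(\<phi>, s)\<in>\<Phi>. sat M (the \<circ> case_sum (c \<circ> Inl) (d \<circ> Inl) \<circ> s) \<phi>) \<and>
      (\<forall>(\<phi>, s)\<in>\<Psi>. sat M (the \<circ> case_sum (c \<circ> Inr) (d \<circ> Inr) \<circ> s) \<phi>)" for c d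
    unfolding ball_Un ball_simps l[symmetric] r[symmetric] by (simp add: case_prod_unfold)
  then have "E = {(c, d) \<in> tuples ?Z \<times> tuples ?Z. \<forall>(\<phi>, s)\<in>?\<Theta>. sat M (the \<circ> case_sum c d \<circ> s) \<phi>}"
    unfolding E_def \<Phi>(2) \<Psi>(2) using tup by auto
  moreover have "\<forall>(\<phi>, s)\<in>?\<Theta>. wf_fm M \<phi> \<and> s ` fv \<phi> \<subseteq> ?Z <+> ?Z"
  proof -
    have 1: "map_sum Inl Inl z \<in> ?Z <+> ?Z" if "z \<in> X <+> X" for z using that by auto
    have 2: "map_sum Inr Inr z \<in> ?Z <+> ?Z" if "z \<in> Y <+> Y" for z using that by auto
    have "wf_fm M \<phi> \<and> (map_sum Inl Inl \<circ> s) ` fv \<phi> \<subseteq> ?Z <+> ?Z" if "(\<phi>, s) \<in> \<Phi>" for \<phi> s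
      using \<Phi>(1) that 1 by (auto simp: image_subset_iff)
    moreover have "wf_fm M \<phi> \<and> (map_sum Inr Inr \<circ> s) ` fv \<phi> \<subseteq> ?Z <+> ?Z" if "(\<phi>, s) \<in> \<Psi>" for \<phi> s
      using \<Psi>(1) that 2 by (auto simp: image_subset_iff)
    ultimately show ?thesis unfolding ball_Un ball_simps by (simp only: case_prod_unfold prod.sel) (metis prod.collapse)
  qed
  moreover have "equiv (tuples ?Z) E"
  proof (rule equivI)
    show "E \<subseteq> tuples ?Z \<times> tuples ?Z" by (auto simp: E_def)
    show "refl_on (tuples ?Z) E"
      unfolding refl_on_def E_def using tup equiv_class_self[OF eA] equiv_class_self[OF eB] by auto
    show "sym E" unfolding E_def using eA eB by (auto simp: equiv_def intro!: symI dest: symD)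
    show "trans E" unfolding E_def using eA eB by (auto simp: equiv_def intro!: transI dest: transD)
  qed
  ultimately have "type_definable_equiv M ?Z E" unfolding type_definable_equiv_def by blast
  moreover have ab: "case_sum a b \<in> tuples ?Z" using A(3) B(3) by (simp add: case_sum_tuples)
  moreover have "upair A B = E `` {case_sum a b}"
  proof
    show "upair A B \<subseteq> E `` {case_sum a b}"
      unfolding upair_def A(4) B(4) E_def
      using ab equiv_tuples_subset[OF eA] equiv_tuples_subset[OF eB] by (auto simp: case_sum_tuples case_sum_o_inj)
    show "E `` {case_sum a b} \<subseteq> upair A B"
    proof
      fix c assume "c \<in> E `` {case_sum a b}"
      then have "c \<circ> Inl \<in> A" "c \<circ> Inr \<in> B" unfolding E_def A(4) B(4) by (auto simp: case_sum_o_inj)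
      then show "c \<in> upair A B" unfolding upair_def using sum_fun_split[of c] by blast
    qed
  qed
  ultimately show ?thesis unfolding hyp_at_def using small_Plus[OF A(1) B(1)] by blast
qed

section \<open>Types over a hyperimaginary\<close>

lemma pdfn_proj_sum:
  fixes W :: "('x + 'y \<Rightarrow> 'm) \<Rightarrow> bool"
  assumes "pdfn C (X <+> Z) W" shows "pdfn C Z (\<lambda>z. \<exists>x. W (case_sum x z))"
proof -
  let ?P = "\<lambda>a. \<exists>b. (\<forall>v. v \<notin> range Inl \<longrightarrow> b v = a v) \<and> W b"
  have P: "pdfn C ((X <+> Z) - range Inl) ?P" using assms by (rule pdfn_proj)
  have "projr ` ((X <+> Z) - range Inl) \<subseteq> Z" by auto
  from pdfn_rename[OF P this order_refl] have "pdfn C Z (\<lambda>z. ?P (z \<circ> projr))" .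
  moreover have "?P (z \<circ> projr) \<longleftrightarrow> (\<exists>x. W (case_sum x z))" for z
  proof
    assume "?P (z \<circ> projr)"
    then obtain b where b: "\<forall>v. v \<notin> range Inl \<longrightarrow> b v = (z \<circ> projr) v" "W b" by blast
    have "b = case_sum (b \<circ> Inl) z"
    proof
      show "b v = case_sum (b \<circ> Inl) z v" for v
        using b(1) by (cases v) auto
    qed
    then show "\<exists>x. W (case_sum x z)" using b(2) by metis
  next
    assume "\<exists>x. W (case_sum x z)"
    then obtain x where "W (case_sum x z)" by blast
    moreover have "case_sum x z v = (z \<circ> projr) v" if "v \<notin> range Inl" for v
      using that by (cases v) auto
    ultimately show "?P (z \<circ> projr)" by blast
  qed
  ultimately show ?thesis by simp
qed

lemma pdfn_case_sum1:
  assumes "pdfn C (X <+> Z) R" "\<And>v. v \<in> Z \<Longrightarrow> c v \<in> C'" "C \<subseteq> C'"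
  shows "pdfn C' X (\<lambda>x. R (case_sum x c))"
proof -
  have "pdfn C' X (\<lambda>x. R (case_sum x id \<circ> case_sum Inl (Inr \<circ> c)))"
    using assms(2,3) by (intro pdfn_subst[OF assms(1)]) auto
  moreover have "case_sum x id \<circ> case_sum Inl (Inr \<circ> c) = case_sum x c" for x :: "'a \<Rightarrow> 'm"
    by (rule ext) (simp split: sum.split)
  ultimately show ?thesis by simp
qed

text \<open>
  Equality of types over a hyperimaginary is a closed condition over a representative: the partial
  type saying of \<open>x\<close> that it is equivalent to \<open>a\<close> and that \<open>(x, c)\<close> has the type of \<open>(a, c\<^sub>0)\<close> is
  finitely satisfiable, because its finite fragments project to conditions on \<open>c\<close>.
\<close>

lemma conj_over_closed:
  fixes A :: "('u \<rightharpoonup> 'm) set" and c0 c :: "'w \<rightharpoonup> 'm"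
  assumes A: "hyp_at A a" and Z: "sm (dom c0)" "dom c = dom c0"
    and cl: "\<And>\<psi>. pdfn (ran a) (dom c0) \<psi> \<Longrightarrow> (\<And>c'. conj_over M A c0 c' \<Longrightarrow> \<psi> (the \<circ> c')) \<Longrightarrow> \<psi> (the \<circ> c)"
  shows "conj_over M A c0 c"
proof -
  obtain X EA where X: "sm X" "type_definable_equiv M X EA" "a \<in> tuples X" "A = EA `` {a}"
    using A unfolding hyp_at_def by blast
  obtain \<Phi> where \<Phi>: "\<forall>(\<phi>, s)\<in>\<Phi>. wf_fm M \<phi> \<and> s ` fv \<phi> \<subseteq> X <+> X"
    "EA = {(a, b) \<in> tuples X \<times> tuples X. \<forall>(\<phi>, s)\<in>\<Phi>. sat M (the \<circ> case_sum a b \<circ> s) \<phi>}"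
    using X(2) unfolding type_definable_equiv_def by (elim conjE exE)
  have doma: "dom a = X" using X(3) by (simp add: tuples_def)
  have rana: "the (a v) \<in> ran a" if "v \<in> X" for v using that doma by (auto simp: ran_def)
  have ranc: "the (c v) \<in> ran c" if "v \<in> dom c0" for v
    using that unfolding Z(2)[symmetric] by (auto simp: ran_def)
  let ?a = "the \<circ> a" and ?d = "the \<circ> c0" and ?c = "the \<circ> c"
  define T where "T = (\<lambda>(\<phi>, s) x. sat M (case_sum ?a x \<circ> s) \<phi>) ` \<Phi>"
  define Rs where "Rs = {R. pdfn {} (X <+> dom c0) R \<and> R (case_sum ?a ?d)}"
  define \<Gamma> where "\<Gamma> = T \<union> (\<lambda>R x. R (case_sum x ?c)) ` Rs"
  have T: "pdfn (ran a) X P" if P: "P \<in> T" for P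
  proof -
    obtain \<phi> s where *: "(\<phi>, s) \<in> \<Phi>" "P = (\<lambda>x. sat M (case_sum ?a x \<circ> s) \<phi>)" using P unfolding T_def by auto
    define t where "t n = (case s n of Inl z \<Rightarrow> Inr (the (a z)) | Inr z \<Rightarrow> Inl z)" for n
    have "case_sum x id \<circ> t = case_sum ?a x \<circ> s" for x
      by (rule ext) (simp add: t_def split: sum.split)
    moreover have "t ` fv \<phi> \<subseteq> X <+> ran a"
    proof
      fix z assume "z \<in> t ` fv \<phi>"
      then obtain n where n: "n \<in> fv \<phi>" "z = t n" by blast
      then have "s n \<in> X <+> X" using \<Phi>(1) *(1) by blast
      then show "z \<in> X <+> ran a" using rana n(2) by (auto simp: t_def)
    qed
    moreover have "wf_fm M \<phi>" using \<Phi>(1) *(1) by auto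
    ultimately show ?thesis unfolding pdfn_def *(2) by (intro exI[of _ \<phi>] exI[of _ t]) simp
  qed
  have "sm (ran c)"
  proof (rule small_subset)
    show "sm ((the \<circ> c) ` dom c0)" using Z(1) by (rule small_image)
    show "ran c \<subseteq> (the \<circ> c) ` dom c0" using Z(2) by (force simp: ran_def image_iff)
  qed
  then have C: "sm (ran a \<union> ran c)" using hyp_at_small_ran[OF A] by (rule small_Un[rotated])
  have dfn: "pdfn (ran a \<union> ran c) X P" if "P \<in> \<Gamma>" for P
    using that unfolding \<Gamma>_def
  proof
    assume "P \<in> T"
    from T[OF this] show ?thesis by (rule pdfn_mono) auto
  next
    assume "P \<in> (\<lambda>R x. R (case_sum x ?c)) ` Rs"
    then obtain R where R: "pdfn {} (X <+> dom c0) R" "P = (\<lambda>x. R (case_sum x ?c))" unfolding Rs_def by blast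
    show ?thesis unfolding R(2) using ranc by (intro pdfn_case_sum1[OF R(1)]) auto
  qed
  have fin: "\<exists>x. \<forall>P\<in>q. P x" if q: "q \<subseteq> \<Gamma>" "finite q" for q
  proof -
    have "finite (q - T)" "q - T \<subseteq> (\<lambda>R x. R (case_sum x ?c)) ` Rs" using q by (auto simp: \<Gamma>_def)
    from finite_subset_image[OF this] obtain R0 where
      R0: "R0 \<subseteq> Rs" "finite R0" "q - T = (\<lambda>R x. R (case_sum x ?c)) ` R0" by blast
    define W where "W w \<longleftrightarrow> (\<forall>P\<in>q \<inter> T. P (w \<circ> Inl)) \<and> (\<forall>R\<in>R0. R w)" for w :: "'u + 'w \<Rightarrow> 'm"
    have "pdfn (ran a) (X <+> dom c0) W"
      unfolding W_def[abs_def]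
    proof (intro pdfn_conj pdfn_Ball)
      show "pdfn (ran a) (X <+> dom c0) (\<lambda>w. P (w \<circ> Inl))" if "P \<in> q \<inter> T" for P
        using that by (intro pdfn_rename[OF T]) auto
      show "pdfn (ran a) (X <+> dom c0) (\<lambda>w. R w)" if "R \<in> R0" for R
        using that R0(1) pdfn_mono[of "{}" "X <+> dom c0" R "ran a" "X <+> dom c0"] by (auto simp: Rs_def)
    qed (use q R0 in auto)
    from pdfn_proj_sum[OF this] have \<psi>: "pdfn (ran a) (dom c0) (\<lambda>z. \<exists>x. W (case_sum x z))" .
    \<comment> \<open>An automorphism over \<open>A\<close> taking \<open>c0\<close> to
      \<open>c'\<close> moves \<open>a\<close> to an equivalent representative, which is the
      required \<open>x\<close>. Thus the projection holds of every conjugate of \<open>c0\<close>,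
      and \<open>cl\<close> passes it on to \<open>c\<close>.\<close>
    have "\<exists>x. W (case_sum x (the \<circ> c'))" if c': "conj_over M A c0 c'" for c'
    proof -
      obtain \<sigma> where \<sigma>: "\<sigma> \<in> Aut M A" "act \<sigma> c0 = c'" using c' unfolding conj_over_def by blast
      have \<sigma>': "\<sigma> \<in> automorphisms M" using \<sigma>(1) by (rule Aut_automorphisms)
      have "act \<sigma> a \<in> A" using \<sigma>(1) hyp_at_mem[OF A] by (simp add: Aut_def)
      then have EA: "(a, act \<sigma> a) \<in> EA" unfolding X(4) by blast
      have "P (the \<circ> act \<sigma> a)" if P: "P \<in> T" for P
      proof -
        obtain \<phi> s where *: "(\<phi>, s) \<in> \<Phi>" "P = (\<lambda>x. sat M (case_sum ?a x \<circ> s) \<phi>)" using P unfolding T_def by auto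
        have "\<forall>(\<phi>, s)\<in>\<Phi>. sat M (the \<circ> case_sum a (act \<sigma> a) \<circ> s) \<phi>" using EA unfolding \<Phi>(2) by simp
        then have "sat M (the \<circ> case_sum a (act \<sigma> a) \<circ> s) \<phi>" using *(1) by blast
        then show ?thesis unfolding *(2) sat_the_case_sum .
      qed
      moreover have "R (case_sum (the \<circ> act \<sigma> a) (the \<circ> c'))" if "R \<in> R0" for R
      proof -
        have R: "pdfn {} (X <+> dom c0) R" "R (case_sum ?a ?d)" using that R0(1) by (auto simp: Rs_def)
        have "R (case_sum (the \<circ> act \<sigma> a) (the \<circ> c')) = R (\<sigma> \<circ> case_sum ?a ?d)"
        proof (rule pdfn_cong[OF R(1)])
          fix v assume "v \<in> X <+> dom c0"
          then show "case_sum (the \<circ> act \<sigma> a) (the \<circ> c') v = (\<sigma> \<circ> case_sum ?a ?d) v"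
            using the_act[of _ a \<sigma>] the_act[of _ c0 \<sigma>] unfolding \<sigma>(2)[symmetric] doma[symmetric]
            by (elim PlusE) (simp_all only: sum.case comp_apply)
        qed
        also have "\<dots> = R (case_sum ?a ?d)" by (rule pdfn_automorphism[OF \<sigma>' _ R(1)]) simp
        finally show ?thesis using R(2) by simp
      qed
      ultimately have "W (case_sum (the \<circ> act \<sigma> a) (the \<circ> c'))" by (auto simp: W_def case_sum_o_inj)
      then show ?thesis by blast
    qed
    from cl[OF \<psi> this] obtain x where x: "W (case_sum x ?c)" by blast
    have "P x" if "P \<in> q" for P
    proof (cases "P \<in> T")
      case True
      then show ?thesis using x that unfolding W_def case_sum_o_inj by blast
    next
      case False
      then have "P \<in> (\<lambda>R x. R (case_sum x ?c)) ` R0" using that R0(3) by blast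
      then obtain R where "R \<in> R0" "P = (\<lambda>x. R (case_sum x ?c))" by blast
      then show ?thesis using x unfolding W_def by blast
    qed
    then show ?thesis by blast
  qed
  obtain x where x: "\<And>P. P \<in> \<Gamma> \<Longrightarrow> P x"
    using compactness[OF C X(1) dfn fin] by blast
  define a' where "a' v = (if v \<in> X then Some (x v) else None)" for v
  have doma': "dom a' = X" by (auto simp: a'_def split: if_splits)
  have x': "x v = the (a' v)" if "v \<in> X" for v using that by (simp add: a'_def)
  have "sat M (the \<circ> case_sum a a' \<circ> s) \<phi>" if \<phi>: "(\<phi>, s) \<in> \<Phi>" for \<phi> s
  proof -
    have "(\<lambda>x. sat M (case_sum ?a x \<circ> s) \<phi>) \<in> \<Gamma>" using \<phi> unfolding \<Gamma>_def T_def by blast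
    from x[OF this] have "sat M (case_sum ?a x \<circ> s) \<phi>" .
    moreover have "sat M (case_sum ?a x \<circ> s) \<phi> = sat M (the \<circ> case_sum a a' \<circ> s) \<phi>"
    proof (rule sat_in_cong)
      fix n assume "n \<in> fv \<phi>"
      then have "s n \<in> X <+> X" using \<Phi>(1) \<phi> by blast
      then show "(case_sum ?a x \<circ> s) n = (the \<circ> case_sum a a' \<circ> s) n" using x' by auto
    qed
    ultimately show ?thesis by simp
  qed
  then have "(a, a') \<in> EA" unfolding \<Phi>(2) using X(3) doma' by (auto simp: tuples_def)
  then have a'A: "a' \<in> A" unfolding X(4) by blast
  have "\<exists>\<sigma>\<in>Fix M {}. act \<sigma> (case_sum a c0) = case_sum a' c"
  proof (rule homogeneity_tuple)
    show "dom (case_sum a c0) = dom (case_sum a' c)" using doma doma' Z(2) by (simp add: dom_case_sum)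
    show "sm (dom (case_sum a c0))" unfolding dom_case_sum doma using X(1) Z(1) by (rule small_Plus)
    fix R assume R: "pdfn {} (dom (case_sum a c0)) R" "R (the \<circ> case_sum a c0)"
    have "the \<circ> case_sum a c0 = case_sum ?a ?d" by (rule ext) (simp split: sum.split)
    then have "R \<in> Rs" using R unfolding Rs_def dom_case_sum doma by simp
    then have "(\<lambda>x. R (case_sum x ?c)) \<in> \<Gamma>" unfolding \<Gamma>_def by blast
    from x[OF this] have "R (case_sum x ?c)" .
    moreover have "R (case_sum x ?c) = R (the \<circ> case_sum a' c)"
    proof (rule pdfn_cong[OF R(1)])
      show "case_sum x ?c v = (the \<circ> case_sum a' c) v" if "v \<in> dom (case_sum a c0)" for v
        using that x' unfolding dom_case_sum doma by (elim PlusE) (simp_all only: sum.case comp_apply)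
    qed
    ultimately show "R (the \<circ> case_sum a' c)" by simp
  qed (simp add: small_finite)
  then obtain \<sigma> where \<sigma>: "\<sigma> \<in> automorphisms M" "act \<sigma> a = a'" "act \<sigma> c0 = c"
    by (auto simp: Fix_def act_case_sum case_sum_eq_iff)
  then have "\<sigma> \<in> Aut M A"
    using Aut_blockI[OF hyp_at_block[OF A] \<sigma>(1) hyp_at_mem[OF A]] a'A by simp
  then show ?thesis unfolding conj_over_def using \<sigma>(3) by blast
qed

end

section \<open>Linear orders and increasing lists\<close>

lemma lin_total: "Linear_order r \<Longrightarrow> x \<in> Field r \<Longrightarrow> y \<in> Field r \<Longrightarrow> (x, y) \<in> r \<or> (y, x) \<in> r"
  unfolding linear_order_on_def partial_order_on_def preorder_on_def refl_on_def total_on_def by metis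

lemma lin_trans: "Linear_order r \<Longrightarrow> (x, y) \<in> r \<Longrightarrow> (y, z) \<in> r \<Longrightarrow> (x, z) \<in> r"
  unfolding linear_order_on_def partial_order_on_def preorder_on_def by (metis transD)

lemma lin_antisym: "Linear_order r \<Longrightarrow> (x, y) \<in> r \<Longrightarrow> (y, x) \<in> r \<Longrightarrow> x = y"
  unfolding linear_order_on_def partial_order_on_def by (metis antisymD)

lemma lin_refl: "Linear_order r \<Longrightarrow> x \<in> Field r \<Longrightarrow> (x, x) \<in> r"
  using lin_total by fastforce

lemma LinearI:
  assumes "\<And>x. x \<in> Field r \<Longrightarrow> (x, x) \<in> r" "\<And>x y z. (x, y) \<in> r \<Longrightarrow> (y, z) \<in> r \<Longrightarrow> (x, z) \<in> r"
    "\<And>x y. (x, y) \<in> r \<Longrightarrow> (y, x) \<in> r \<Longrightarrow> x = y"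
    "\<And>x y. x \<in> Field r \<Longrightarrow> y \<in> Field r \<Longrightarrow> (x, y) \<in> r \<or> (y, x) \<in> r"
  shows "Linear_order r"
proof -
  have "trans r" using assms(2) by (rule transI)
  moreover have "antisym r" using assms(3) by (rule antisymI)
  moreover have "refl_on (Field r) r" using assms(1) by (auto simp: refl_on_def)
  moreover have "total_on (Field r) r" using assms(4) by (auto simp: total_on_def)
  moreover have "r \<subseteq> Field r \<times> Field r" by (auto simp: Field_def)
  ultimately show ?thesis
    by (simp add: linear_order_on_def partial_order_on_def preorder_on_def)
qed

text \<open>Monotonicity is asked on \<open>R\<close> only: a condition on a sequence involves
  finitely many indices, and the map may be arbitrary elsewhere.\<close>

definition smono :: "'o rel \<Rightarrow> 'o set \<Rightarrow> 'q rel \<Rightarrow> ('o \<Rightarrow> 'q) \<Rightarrow> bool" where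
  "smono r R s e \<longleftrightarrow> (\<forall>x\<in>R. e x \<in> Field s) \<and>
     (\<forall>x\<in>R. \<forall>y\<in>R. (x, y) \<in> r \<and> x \<noteq> y \<longrightarrow> (e x, e y) \<in> s \<and> e x \<noteq> e y)"

lemma smono_subset: "smono r R s e \<Longrightarrow> R' \<subseteq> R \<Longrightarrow> smono r R' s e"
  unfolding smono_def by blast

lemma increasing_map:
  assumes "smono r (set is) s e" "increasing r is" shows "increasing s (map e is)"
proof -
  have "sorted_wrt (\<lambda>i j. (e i, e j) \<in> s \<and> e i \<noteq> e j) is"
  proof (rule sorted_wrt_mono_rel)
    show "sorted_wrt (\<lambda>i j. (i, j) \<in> r \<and> i \<noteq> j) is" using assms(2) by (simp add: increasing_def)
    show "(e x, e y) \<in> s \<and> e x \<noteq> e y" if "x \<in> set is" "y \<in> set is" "(x, y) \<in> r \<and> x \<noteq> y" for x y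
      using assms(1) that unfolding smono_def by blast
  qed
  then show ?thesis using assms(1) by (auto simp: increasing_def sorted_wrt_map smono_def)
qed

lemma finite_max:
  assumes "Linear_order r" "finite S" "S \<noteq> {}" "S \<subseteq> Field r"
  obtains m where "m \<in> S" "\<And>x. x \<in> S \<Longrightarrow> (x, m) \<in> r"
proof -
  have "\<exists>m\<in>S. \<forall>x\<in>S. (x, m) \<in> r" using assms(2,3,4)
  proof (induction rule: finite_ne_induct)
    case (singleton x)
    then show ?case using lin_refl[OF assms(1)] by simp
  next
    case (insert x F)
    then obtain m where m: "m \<in> F" "\<forall>y\<in>F. (y, m) \<in> r" by auto
    then have "(x, m) \<in> r \<or> (m, x) \<in> r" using insert.prems lin_total[OF assms(1)] by auto
    then show ?case
    proof
      assume "(x, m) \<in> r"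
      then show ?thesis using m by auto
    next
      assume mx: "(m, x) \<in> r"
      have "(x, x) \<in> r" using insert.prems lin_refl[OF assms(1)] by simp
      moreover have "(y, x) \<in> r" if "y \<in> F" for y using m(2) that mx lin_trans[OF assms(1)] by blast
      ultimately show ?thesis by auto
    qed
  qed
  then show thesis using that by blast
qed

lemma ex_increasing_list:
  assumes "Linear_order r" "finite S" "S \<subseteq> Field r"
  obtains js where "increasing r js" "set js = S" "length js = card S"
proof -
  have "\<exists>js. increasing r js \<and> set js = S \<and> length js = card S"
    if "card S = n" "finite S" "S \<subseteq> Field r" for n
    using that
  proof (induction n arbitrary: S)
    case 0
    then show ?case by (intro exI[of _ "[]"]) (auto simp: increasing_def)
  next
    case (Suc n)
    then have "S \<noteq> {}" by auto
    with assms(1) Suc.prems obtain m where m: "m \<in> S" "\<And>x. x \<in> S \<Longrightarrow> (x, m) \<in> r"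
      using finite_max[of r S] by blast
    have "card (S - {m}) = n" using Suc.prems m(1) by simp
    then obtain js where js: "increasing r js" "set js = S - {m}" "length js = n"
      using Suc.IH[of "S - {m}"] Suc.prems by auto
    have "increasing r (js @ [m])"
      using js m Suc.prems(3) by (auto simp: increasing_def sorted_wrt_append)
    then show ?case using js m(1) Suc.prems(1) by (intro exI[of _ "js @ [m]"]) auto
  qed
  then show thesis using that assms by blast
qed

lemma increasing_unique:
  assumes "Linear_order r"
  shows "increasing r is \<Longrightarrow> increasing r js \<Longrightarrow> set is = set js \<Longrightarrow> is = js"
proof (induction "is" arbitrary: js)
  case Nil
  then show ?case by simp
next
  case (Cons x xs)
  then obtain y ys where js: "js = y # ys" by (cases js) auto
  have x: "\<forall>z\<in>set xs. (x, z) \<in> r \<and> x \<noteq> z" and ix: "increasing r xs"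
    using Cons.prems(1) by (auto simp: increasing_def)
  have y: "\<forall>z\<in>set ys. (y, z) \<in> r \<and> y \<noteq> z" and iy: "increasing r ys"
    using Cons.prems(2) js by (auto simp: increasing_def)
  have "x = y"
  proof (rule ccontr)
    assume ne: "x \<noteq> y"
    have "x \<in> set ys" "y \<in> set xs" using Cons.prems(3) js ne by auto
    then have "(x, y) \<in> r" "(y, x) \<in> r" using x y by auto
    then show False using ne lin_antisym[OF assms] by blast
  qed
  moreover have "set xs = set ys"
    using Cons.prems(3) js x y \<open>x = y\<close> by auto
  ultimately show ?case using Cons.IH[OF ix iy] js by simp
qed

lemma ex_increasing_length:
  assumes "Linear_order r" "infinite S" "S \<subseteq> Field r"
  obtains js where "increasing r js" "set js \<subseteq> S" "length js = n"
proof -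
  obtain T where T: "T \<subseteq> S" "finite T" "card T = n"
    using infinite_arbitrarily_large[OF assms(2), of n] by blast
  then obtain js where "increasing r js" "set js = T" "length js = card T"
    using ex_increasing_list[OF assms(1), of T] assms(3) by blast
  then show thesis using that T by blast
qed

text \<open>An infinite subset of a linear order has room for every finite order, maxima being
  matched with maxima. No assumption on the kind of infinite order is made.\<close>

lemma ex_smono:
  assumes r: "Linear_order r" and R: "finite R" "R \<subseteq> Field r"
    and s: "Linear_order s" and S: "infinite S" "S \<subseteq> Field s"
  obtains e where "smono r R s e" "e ` R \<subseteq> S"
proof -
  have fin: "\<exists>e. smono r R s e \<and> e ` R \<subseteq> S" if "card R = n" "finite R" "R \<subseteq> Field r" "finite S" "card S = n" "S \<subseteq> Field s" for n R S
    using that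
  proof (induction n arbitrary: R S)
    case 0
    then show ?case by (auto simp: smono_def)
  next
    case (Suc n)
    then have "R \<noteq> {}" "S \<noteq> {}" by auto
    obtain m where m: "m \<in> R" "\<And>x. x \<in> R \<Longrightarrow> (x, m) \<in> r"
      using finite_max[OF r Suc.prems(2) \<open>R \<noteq> {}\<close> Suc.prems(3)] by blast
    obtain k where k: "k \<in> S" "\<And>x. x \<in> S \<Longrightarrow> (x, k) \<in> s"
      using finite_max[OF s Suc.prems(4) \<open>S \<noteq> {}\<close> Suc.prems(6)] by blast
    have "card (R - {m}) = n" "card (S - {k}) = n" using Suc.prems m(1) k(1) by simp_all
    then obtain e where e: "smono r (R - {m}) s e" "e ` (R - {m}) \<subseteq> S - {k}"
      using Suc.IH[of "R - {m}" "S - {k}"] Suc.prems by auto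
    have "smono r R s (e(m := k))"
      unfolding smono_def
    proof (intro conjI ballI impI)
      show "(e(m := k)) x \<in> Field s" if "x \<in> R" for x
        using that e(2) k(1) Suc.prems(6) by auto
      fix x y assume xy: "x \<in> R" "y \<in> R" "(x, y) \<in> r \<and> x \<noteq> y"
      have "x \<noteq> m" using xy m(2)[of y] lin_antisym[OF r] by blast
      then have ex: "e x \<in> S - {k}" using e(2) xy(1) by blast
      show "((e(m := k)) x, (e(m := k)) y) \<in> s" "(e(m := k)) x \<noteq> (e(m := k)) y"
        using \<open>x \<noteq> m\<close> ex k(2) e(1) xy unfolding smono_def by auto
    qed
    moreover have "(e(m := k)) ` R \<subseteq> S" using e(2) k(1) by auto
    ultimately show ?case by blast
  qed
  obtain T where T: "T \<subseteq> S" "finite T" "card T = card R"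
    using infinite_arbitrarily_large[OF S(1), of "card R"] by blast
  then obtain e where "smono r R s e" "e ` R \<subseteq> T" using fin[OF refl R T(2,3)] S(2) by blast
  then show thesis using that \<open>T \<subseteq> S\<close> by blast
qed

section \<open>Sequences\<close>

definition aseq :: "('m \<Rightarrow> 'm) \<Rightarrow> ('o, 'v, 'm) seqn \<Rightarrow> ('o, 'v, 'm) seqn" where
  "aseq \<sigma> Q = \<lparr>sord = sord Q, stup = act \<sigma> (stup Q)\<rparr>"

lemma aseq_simps [simp]: "sord (aseq \<sigma> Q) = sord Q" "stup (aseq \<sigma> Q) = act \<sigma> (stup Q)"
  by (simp_all add: aseq_def)

lemma act_subtup: "act \<sigma> (subtup Q is) = subtup (aseq \<sigma> Q) is"
  by (rule ext) (auto simp: subtup_def act_apply split: prod.split)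

lemma subtup_map:
  assumes "\<And>i j. i \<in> set is \<Longrightarrow> stup Q' (i, j) = stup Q (h i, j)"
  shows "subtup Q' is = subtup Q (map h is)"
  using assms by (intro ext) (auto simp: subtup_def split: prod.split)

lemma subtup_nth: "n < length is \<Longrightarrow> subtup Q is (n, j) = stup Q (is ! n, j)"
  by (simp add: subtup_def)

lemma conj_over_sym: "block M A \<Longrightarrow> conj_over M A u v \<Longrightarrow> conj_over M A v u"
  unfolding conj_over_def using Aut_inv Aut_automorphisms act_inv(1) by metis

lemma conj_over_trans: "conj_over M A u v \<Longrightarrow> conj_over M A v w \<Longrightarrow> conj_over M A u w"
  unfolding conj_over_def using Aut_comp act_comp by metis

lemma conj_over_mono: "Aut M A \<subseteq> Aut M A' \<Longrightarrow> conj_over M A u v \<Longrightarrow> conj_over M A' u v"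
  unfolding conj_over_def by blast

lemma conj_over_act:
  assumes "\<sigma> \<in> automorphisms M" "conj_over M A u v"
  shows "conj_over M (act \<sigma> ` A) (act \<sigma> u) (act \<sigma> v)"
proof -
  obtain \<rho> where \<rho>: "\<rho> \<in> Aut M A" "act \<rho> u = v" using assms(2) unfolding conj_over_def by blast
  have "\<rho> \<in> Aut M (act (inv \<sigma>) ` act \<sigma> ` A)" using \<rho>(1) by (simp add: act_image_inv[OF assms(1)])
  from Aut_conjugate[OF automorphisms_inv[OF assms(1)] this]
  have "inv (inv \<sigma>) \<circ> \<rho> \<circ> inv \<sigma> \<in> Aut M (act \<sigma> ` A)" .
  moreover have "inv (inv \<sigma>) = \<sigma>" using automorphisms_bij[OF assms(1)] by (rule inv_inv_eq)
  ultimately have "\<sigma> \<circ> \<rho> \<circ> inv \<sigma> \<in> Aut M (act \<sigma> ` A)" by simp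
  moreover have "act (\<sigma> \<circ> \<rho> \<circ> inv \<sigma>) (act \<sigma> u) = act \<sigma> v"
    unfolding act_comp act_inv(1)[OF assms(1)] \<rho>(2) ..
  ultimately show ?thesis unfolding conj_over_def by blast
qed

text \<open>Subsequences, reassociated sums and sequences placed along another index order are all
  instances: \<open>h\<close> sends an index of the new sequence to the index of the same entry in
  the old one.\<close>

lemma EM_pull:
  assumes "\<And>i j. i \<in> Field (sord Q') \<Longrightarrow> stup Q' (i, j) = stup Q (h i, j)"
    "smono (sord Q') (Field (sord Q')) (sord Q) h" "EM_equiv M A Q b"
  shows "EM_equiv M A Q' b"
  unfolding EM_equiv_def
proof (intro allI impI, elim conjE)
  fix "is" js assume *: "increasing (sord Q') is" "increasing (sord b) js" "length is = length js"
  have F: "set is \<subseteq> Field (sord Q')" using *(1) by (simp add: increasing_def)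
  then have "increasing (sord Q) (map h is)"
    using increasing_map[OF smono_subset[OF assms(2)] *(1)] by blast
  then have "conj_over M A (subtup Q (map h is)) (subtup b js)"
    using assms(3) * unfolding EM_equiv_def by simp
  moreover have "subtup Q' is = subtup Q (map h is)" using assms(1) F by (intro subtup_map) blast
  ultimately show "conj_over M A (subtup Q' is) (subtup b js)" by simp
qed

lemma indiscernible_iff: "indiscernible \<kappa> M A Q \<longleftrightarrow> is_seq \<kappa> Q \<and> EM_equiv M A Q Q"
  unfolding indiscernible_def EM_equiv_def by blast

lemma EM_sym: "block M A \<Longrightarrow> EM_equiv M A Q Q' \<Longrightarrow> EM_equiv M A Q' Q"
  unfolding EM_equiv_def using conj_over_sym by metis

text \<open>An infinite \<open>b\<close> has increasing tuples of every length, which serve as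
  intermediate tuples; a finite \<open>b\<close> would say nothing about long ones.\<close>

lemma EM_trans:
  assumes "EM_equiv M A Q b" "EM_equiv M A b Q'" "Linear_order (sord b)" "infinite_seq b"
  shows "EM_equiv M A Q Q'"
  unfolding EM_equiv_def
proof (intro allI impI, elim conjE)
  fix "is" js assume *: "increasing (sord Q) is" "increasing (sord Q') js" "length is = length js"
  obtain ks where "increasing (sord b) ks" "length ks = length is"
    using ex_increasing_length[OF assms(3), of "Field (sord b)"] assms(4) unfolding infinite_seq_def by blast
  then have "conj_over M A (subtup Q is) (subtup b ks)" "conj_over M A (subtup b ks) (subtup Q' js)"
    using assms(1,2) * unfolding EM_equiv_def by auto
  then show "conj_over M A (subtup Q is) (subtup Q' js)" by (rule conj_over_trans)
qed

lemma EM_mono: "Aut M A \<subseteq> Aut M A' \<Longrightarrow> EM_equiv M A Q Q' \<Longrightarrow> EM_equiv M A' Q Q'"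
  unfolding EM_equiv_def using conj_over_mono by metis

lemma indiscernible_mono: "Aut M A \<subseteq> Aut M A' \<Longrightarrow> indiscernible \<kappa> M A Q \<Longrightarrow> indiscernible \<kappa> M A' Q"
  unfolding indiscernible_iff using EM_mono by blast

lemma indiscernible_pull:
  assumes "\<And>i j. i \<in> Field (sord Q') \<Longrightarrow> stup Q' (i, j) = stup Q (h i, j)"
    "smono (sord Q') (Field (sord Q')) (sord Q) h" "is_seq \<kappa> Q'" "indiscernible \<kappa> M A Q" "block M A"
  shows "indiscernible \<kappa> M A Q'"
proof -
  have "EM_equiv M A Q' Q" using EM_pull[OF assms(1,2)] assms(4) unfolding indiscernible_iff by blast
  from EM_pull[OF assms(1,2) EM_sym[OF assms(5) this]] show ?thesis
    using assms(3) unfolding indiscernible_iff by blast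
qed

lemma EM_aseq:
  assumes "\<sigma> \<in> automorphisms M" "EM_equiv M A Q Q'"
  shows "EM_equiv M (act \<sigma> ` A) (aseq \<sigma> Q) (aseq \<sigma> Q')"
  unfolding EM_equiv_def
proof (intro allI impI, elim conjE)
  fix "is" js assume *: "increasing (sord (aseq \<sigma> Q)) is" "increasing (sord (aseq \<sigma> Q')) js" "length is = length js"
  then have "conj_over M A (subtup Q is) (subtup Q' js)" using assms(2) unfolding EM_equiv_def by simp
  then show "conj_over M (act \<sigma> ` A) (subtup (aseq \<sigma> Q) is) (subtup (aseq \<sigma> Q') js)"
    unfolding act_subtup[symmetric] by (rule conj_over_act[OF assms(1)])
qed

lemma is_seq_aseq [simp]: "is_seq \<kappa> (aseq \<sigma> Q) = is_seq \<kappa> Q"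
  by (simp add: is_seq_def)

lemma indiscernible_aseq:
  "\<sigma> \<in> automorphisms M \<Longrightarrow> indiscernible \<kappa> M A Q \<Longrightarrow> indiscernible \<kappa> M (act \<sigma> ` A) (aseq \<sigma> Q)"
  using EM_aseq unfolding indiscernible_iff by auto

lemma EM_aseq_left:
  assumes "block M A" "\<sigma> \<in> Aut M A" "EM_equiv M A Q Q'" shows "EM_equiv M A (aseq \<sigma> Q) Q'"
  unfolding EM_equiv_def
proof (intro allI impI, elim conjE)
  fix "is" js assume *: "increasing (sord (aseq \<sigma> Q)) is" "increasing (sord Q') js" "length is = length js"
  have "conj_over M A (subtup Q is) (subtup Q' js)" using assms(3) * unfolding EM_equiv_def by simp
  moreover have "conj_over M A (subtup Q is) (subtup (aseq \<sigma> Q) is)"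
    unfolding conj_over_def using assms(2) act_subtup by blast
  ultimately show "conj_over M A (subtup (aseq \<sigma> Q) is) (subtup Q' js)"
    using conj_over_sym[OF assms(1)] conj_over_trans by blast
qed

lemma sord_append: "sord (seq_append I J) = {(Inl i, Inl j) | i j. (i, j) \<in> sord I} \<union>
    {(Inr i, Inr j) | i j. (i, j) \<in> sord J} \<union> {(Inl i, Inr j) | i j. i \<in> Field (sord I) \<and> j \<in> Field (sord J)}"
  by (simp add: seq_append_def)

lemma sord_append_iff [simp]:
  "(Inl i, Inl i') \<in> sord (seq_append I J) \<longleftrightarrow> (i, i') \<in> sord I"
  "(Inr j, Inr j') \<in> sord (seq_append I J) \<longleftrightarrow> (j, j') \<in> sord J"
  "(Inl i, Inr j) \<in> sord (seq_append I J) \<longleftrightarrow> i \<in> Field (sord I) \<and> j \<in> Field (sord J)"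
  "(Inr j, Inl i) \<notin> sord (seq_append I J)"
  by (auto simp: sord_append)

lemma stup_append [simp]:
  "stup (seq_append I J) (Inl i, j) = stup I (i, j)" "stup (seq_append I J) (Inr k, j) = stup J (k, j)"
  by (simp_all add: seq_append_def)

lemma Field_iff: "z \<in> Field r \<longleftrightarrow> (\<exists>w. (z, w) \<in> r \<or> (w, z) \<in> r)"
  by (auto simp: Field_def)

lemma Field_append: "Field (sord (seq_append I J)) = Field (sord I) <+> Field (sord J)"
proof (rule set_eqI)
  fix z
  show "z \<in> Field (sord (seq_append I J)) \<longleftrightarrow> z \<in> Field (sord I) <+> Field (sord J)"
    by (cases z) (auto simp: Field_iff split_sum_ex)
qed

lemma Linear_order_append:
  assumes I: "Linear_order (sord I)" and J: "Linear_order (sord J)"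
  shows "Linear_order (sord (seq_append I J))"
proof (rule LinearI)
  fix x y z
  show "(x, x) \<in> sord (seq_append I J)" if "x \<in> Field (sord (seq_append I J))"
    using that lin_refl[OF I] lin_refl[OF J] by (cases x) (auto simp: Field_append)
  show "(x, z) \<in> sord (seq_append I J)" if "(x, y) \<in> sord (seq_append I J)" "(y, z) \<in> sord (seq_append I J)"
    using that
    by (cases x; cases y; cases z; (simp)?; blast intro: FieldI1 FieldI2 lin_trans[OF I] lin_trans[OF J])
  show "x = y" if "(x, y) \<in> sord (seq_append I J)" "(y, x) \<in> sord (seq_append I J)"
    using that lin_antisym[OF I] lin_antisym[OF J] by (cases x; cases y) auto
  show "(x, y) \<in> sord (seq_append I J) \<or> (y, x) \<in> sord (seq_append I J)"
    if "x \<in> Field (sord (seq_append I J))" "y \<in> Field (sord (seq_append I J))"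
    using that lin_total[OF I] lin_total[OF J] by (cases x; cases y) (auto simp: Field_append)
qed

lemma aseq_append: "aseq \<sigma> (seq_append I J) = seq_append (aseq \<sigma> I) (aseq \<sigma> J)"
proof -
  have "act \<sigma> (stup (seq_append I J)) = stup (seq_append (aseq \<sigma> I) (aseq \<sigma> J))"
    by (rule ext) (auto simp: act_apply seq_append_def split: sum.split prod.split)
  then show ?thesis by (simp add: aseq_def seq_append_def)
qed

lemma smono_Inl: "smono (sord I) (Field (sord I)) (sord (seq_append I J)) Inl"
  by (auto simp: smono_def Field_append)

lemma smono_Inr: "smono (sord J) (Field (sord J)) (sord (seq_append I J)) Inr"
  by (auto simp: smono_def Field_append)

text \<open>A set of parameters becomes a real tuple indexed by its own elements, so that its
  stabilizer as an ultraimaginary is the pointwise stabilizer \<open>Fix\<close>.\<close>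

definition idm :: "'m set \<Rightarrow> ('m \<rightharpoonup> 'm)" where
  "idm N = (\<lambda>c. if c \<in> N then Some c else None)"

lemma dom_idm: "dom (idm N) = N"
  by (auto simp: idm_def split: if_splits)

lemma Aut_idm: "Aut M {idm N} = Fix M N"
proof -
  have "act \<sigma> (idm N) = idm N \<longleftrightarrow> (\<forall>c\<in>N. \<sigma> c = c)" for \<sigma>
    by (auto simp: act_apply idm_def fun_eq_iff)
  then show ?thesis by (auto simp: Aut_def Fix_def)
qed

context monster
begin

text \<open>\<open>is_seq\<close> hides the variable set \<open>y\<close>. Naming it makes sequences
  comparable entry by entry, which concatenation and equality of types presuppose.\<close>

definition ysq :: "'v set \<Rightarrow> ('o, 'v, 'm) seqn \<Rightarrow> bool" where
  "ysq y I \<longleftrightarrow> Linear_order (sord I) \<and> sm (Field (sord I)) \<and> sm y \<and> stup I \<in> tuples (Field (sord I) \<times> y)"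

lemma is_seq_ysq: "is_seq \<kappa> I \<longleftrightarrow> (\<exists>y. ysq y I)"
  by (auto simp: is_seq_def ysq_def)

lemma ysqD:
  assumes "ysq y I"
  shows "Linear_order (sord I)" "sm (Field (sord I))" "sm y" "dom (stup I) = Field (sord I) \<times> y" "is_seq \<kappa> I"
  using assms is_seq_ysq by (auto simp: ysq_def tuples_def)

lemma ysq_aseq [simp]: "ysq y (aseq \<sigma> I) = ysq y I"
  by (simp add: ysq_def)

lemma ysq_append:
  assumes "ysq y I" "ysq y J" shows "ysq y (seq_append I J)"
proof -
  have "dom (stup (seq_append I J)) = (Field (sord I) <+> Field (sord J)) \<times> y"
  proof (rule set_eqI, clarify)
    fix k j
    have "(i, j) \<in> dom (stup I) \<longleftrightarrow> i \<in> Field (sord I) \<and> j \<in> y" for i using ysqD(4)[OF assms(1)] by simp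
    moreover have "(i, j) \<in> dom (stup J) \<longleftrightarrow> i \<in> Field (sord J) \<and> j \<in> y" for i using ysqD(4)[OF assms(2)] by simp
    ultimately show "(k, j) \<in> dom (stup (seq_append I J)) \<longleftrightarrow> (k, j) \<in> (Field (sord I) <+> Field (sord J)) \<times> y"
      by (cases k) (auto simp: dom_def)
  qed
  moreover have "Linear_order (sord (seq_append I J))"
    using ysqD(1)[OF assms(1)] ysqD(1)[OF assms(2)] by (rule Linear_order_append)
  moreover have "sm (Field (sord (seq_append I J)))"
    unfolding Field_append using ysqD(2)[OF assms(1)] ysqD(2)[OF assms(2)] by (rule small_Plus)
  ultimately show ?thesis unfolding ysq_def using ysqD(3)[OF assms(1)] by (simp add: tuples_def Field_append)
qed

lemma append_ysq:
  assumes "is_seq \<kappa> (seq_append I J)" "is_seq \<kappa> I" "is_seq \<kappa> J"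
  obtains y where "ysq y I" "ysq y J"
proof -
  obtain y where y: "ysq y (seq_append I J)" using assms(1) is_seq_ysq by blast
  have d: "(k, j) \<in> dom (stup (seq_append I J)) \<longleftrightarrow> k \<in> Field (sord I) <+> Field (sord J) \<and> j \<in> y" for k j
    using ysqD(4)[OF y] by (simp add: Field_append)
  have "dom (stup I) = Field (sord I) \<times> y"
  proof (rule set_eqI, clarify)
    show "(i, j) \<in> dom (stup I) \<longleftrightarrow> (i, j) \<in> Field (sord I) \<times> y" for i j
      using d[of "Inl i" j] by (auto simp: dom_def)
  qed
  moreover have "dom (stup J) = Field (sord J) \<times> y"
  proof (rule set_eqI, clarify)
    show "(i, j) \<in> dom (stup J) \<longleftrightarrow> (i, j) \<in> Field (sord J) \<times> y" for i j
      using d[of "Inr i" j] by (auto simp: dom_def)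
  qed
  ultimately have "ysq y I" "ysq y J"
    using assms(2,3) ysqD(3)[OF y] by (auto simp: ysq_def is_seq_def tuples_def)
  then show thesis by (rule that)
qed

lemma dom_subtup:
  assumes "ysq y Q" "set is \<subseteq> Field (sord Q)" shows "dom (subtup Q is) = {..<length is} \<times> y"
proof (rule set_eqI, clarify)
  fix n j
  have "(is ! n, j) \<in> dom (stup Q) \<longleftrightarrow> j \<in> y" if "n < length is"
    using assms ysqD(4)[OF assms(1)] that nth_mem[OF that] by auto
  then show "(n, j) \<in> dom (subtup Q is) \<longleftrightarrow> (n, j) \<in> {..<length is} \<times> y"
    by (auto simp: subtup_def dom_def)
qed

lemma hyp_at_idm: "sm N \<Longrightarrow> hyp_at {idm N} (idm N)"
  by (rule hyp_at_singleton) (simp add: dom_idm)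

lemma conj_over_idmI:
  assumes "dom u = dom v" "sm N" "sm (dom u)" "\<And>P. pdfn N (dom u) P \<Longrightarrow> P (the \<circ> u) \<Longrightarrow> P (the \<circ> v)"
  shows "conj_over M {idm N} u v"
  unfolding conj_over_def Aut_idm
  by (rule homogeneity_tuple[OF assms(1-3)]) (use assms(4) in blast)

lemma conj_over_idmD:
  assumes "conj_over M {idm N} u v" "pdfn N (dom u) P" shows "P (the \<circ> u) \<longleftrightarrow> P (the \<circ> v)"
proof -
  obtain \<sigma> where \<sigma>: "\<sigma> \<in> Fix M N" "act \<sigma> u = v" using assms(1) unfolding conj_over_def Aut_idm by blast
  have "P (the \<circ> v) = P (\<sigma> \<circ> (the \<circ> u))"
    unfolding \<sigma>(2)[symmetric] by (rule pdfn_cong[OF assms(2)]) (simp add: the_act)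
  also have "\<dots> = P (the \<circ> u)"
    using \<sigma>(1) by (intro pdfn_automorphism[OF _ _ assms(2)]) (auto simp: Fix_def)
  finally show ?thesis by simp
qed

text \<open>Finite increasing tuples are conjugate by assumption. A definable condition on the whole
  sequence involves finitely many indices, so \<open>conj_over_closed\<close> passes from these
  tuples to the full one.\<close>

lemma EM_conj:
  assumes A: "hyp_at A a" and Q: "ysq y Q" "ysq y Q'" "sord Q = sord Q'" and EM: "EM_equiv M A Q Q'"
  shows "conj_over M A (stup Q) (stup Q')"
proof (rule conj_over_closed[OF A])
  let ?D = "Field (sord Q) \<times> y"
  have d: "dom (stup Q) = ?D" "dom (stup Q') = ?D" using ysqD(4)[OF Q(1)] ysqD(4)[OF Q(2)] Q(3) by simp_all
  show "sm (dom (stup Q))" unfolding d using ysqD[OF Q(1)] by (intro small_Times)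
  show "dom (stup Q') = dom (stup Q)" using d by simp
  fix \<psi> assume \<psi>: "pdfn (ran a) (dom (stup Q)) \<psi>"
    and all: "\<And>c'. conj_over M A (stup Q) c' \<Longrightarrow> \<psi> (the \<circ> c')"
  obtain F where F: "finite F" "F \<subseteq> ?D" "pdfn (ran a) F \<psi>" using \<psi> unfolding d by (rule pdfn_finite)
  have fF: "finite (fst ` F)" "fst ` F \<subseteq> Field (sord Q)" using F by auto
  obtain "is" where "is": "increasing (sord Q) is" "set is = fst ` F" "length is = card (fst ` F)"
    by (rule ex_increasing_list[OF ysqD(1)[OF Q(1)] fF])
  then have "conj_over M A (subtup Q is) (subtup Q' is)"
    using EM Q(3) unfolding EM_equiv_def by simp
  then obtain \<sigma> where \<sigma>: "\<sigma> \<in> Aut M A" "act \<sigma> (subtup Q is) = subtup Q' is" unfolding conj_over_def by blast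
  have eq: "act \<sigma> (stup Q) v = stup Q' v" if v: "v \<in> F" for v
  proof -
    obtain i j where ij: "v = (i, j)" by (cases v)
    then have "i \<in> set is" using "is"(2) v by force
    then obtain n where n: "n < length is" "i = is ! n" by (auto simp: in_set_conv_nth)
    have "subtup (aseq \<sigma> Q) is (n, j) = subtup Q' is (n, j)" using \<sigma>(2) by (simp add: act_subtup)
    then show ?thesis using n ij by (simp add: subtup_nth)
  qed
  have "\<psi> (the \<circ> act \<sigma> (stup Q))" using all \<sigma>(1) unfolding conj_over_def by blast
  moreover have "\<psi> (the \<circ> act \<sigma> (stup Q)) = \<psi> (the \<circ> stup Q')"
    by (rule pdfn_cong[OF F(3)]) (simp add: eq)
  ultimately show "\<psi> (the \<circ> stup Q')" by simp
qed

end

section \<open>Limits of finite subsequences\<close>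

lemma increasing_distinct: "increasing r ks \<Longrightarrow> distinct ks"
  by (induction ks) (auto simp: increasing_def)

text \<open>Ramsey's theorem is applied once for each colouring in the finite set \<open>L\<close>,
  each time inside the homogeneous set found before.\<close>

lemma homogeneous_subset:
  fixes r :: "'o rel" and L :: "(nat \<times> ('o list \<Rightarrow> bool)) set"
  assumes r: "Linear_order r" and "finite L" and H0: "infinite H0" "H0 \<subseteq> Field r"
  obtains H where "H \<subseteq> H0" "infinite H"
    "\<And>n \<phi> ks ks'. (n, \<phi>) \<in> L \<Longrightarrow> increasing r ks \<Longrightarrow> increasing r ks' \<Longrightarrow> set ks \<subseteq> H \<Longrightarrow> set ks' \<subseteq> H \<Longrightarrow>
       length ks = n \<Longrightarrow> length ks' = n \<Longrightarrow> \<phi> ks \<longleftrightarrow> \<phi> ks'"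
proof -
  have "\<exists>H. H \<subseteq> H0 \<and> infinite H \<and> (\<forall>n \<phi> ks ks'. (n, \<phi>) \<in> L \<longrightarrow> increasing r ks \<longrightarrow> increasing r ks' \<longrightarrow>
      set ks \<subseteq> H \<longrightarrow> set ks' \<subseteq> H \<longrightarrow> length ks = n \<longrightarrow> length ks' = n \<longrightarrow> \<phi> ks = \<phi> ks')"
    using assms(2)
  proof (induction L)
    case empty
    then show ?case using H0 by (intro exI[of _ H0]) simp
  next
    case (insert l L)
    obtain n \<phi> where l: "l = (n, \<phi>)" by (cases l)
    obtain H where H: "H \<subseteq> H0" "infinite H" "\<forall>n \<phi> ks ks'. (n, \<phi>) \<in> L \<longrightarrow> increasing r ks \<longrightarrow> increasing r ks' \<longrightarrow>
      set ks \<subseteq> H \<longrightarrow> set ks' \<subseteq> H \<longrightarrow> length ks = n \<longrightarrow> length ks' = n \<longrightarrow> \<phi> ks = \<phi> ks'"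
      using insert.IH by blast
    \<comment> \<open>In a linear order a finite set has exactly one increasing enumeration, so a
      colouring of increasing lists becomes a colouring of n-element sets.\<close>
    define f where "f X = (if \<exists>ks. increasing r ks \<and> set ks = X \<and> \<phi> ks then 1 else 0 :: nat)" for X
    have "\<forall>X. X \<subseteq> H \<and> finite X \<and> card X = n \<longrightarrow> f X < 2" by (simp add: f_def)
    from Ramsey[OF H(2) this] obtain Y t where
      Y: "Y \<subseteq> H" "infinite Y" "\<forall>X. X \<subseteq> Y \<and> finite X \<and> card X = n \<longrightarrow> f X = t" by blast
    have f: "\<phi> ks \<longleftrightarrow> t = 1" if ks: "increasing r ks" "set ks \<subseteq> Y" "length ks = n" for ks
    proof -
      have "distinct ks" using ks(1) by (rule increasing_distinct)
      then have "card (set ks) = n" using ks(3) distinct_card by blast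
      then have "f (set ks) = t" using Y(3) ks(2) by blast
      moreover have "(\<exists>ks'. increasing r ks' \<and> set ks' = set ks \<and> \<phi> ks') \<longleftrightarrow> \<phi> ks"
        using increasing_unique[OF r _ ks(1)] ks(1) by blast
      ultimately show ?thesis by (auto simp: f_def split: if_splits)
    qed
    show ?case
    proof (intro exI[of _ Y] conjI allI impI)
      show "Y \<subseteq> H0" using Y(1) H(1) by blast
      show "infinite Y" by (rule Y(2))
      fix n' \<phi>' ks ks' assume *: "(n', \<phi>') \<in> insert l L" "increasing r ks" "increasing r ks'" "set ks \<subseteq> Y" "set ks' \<subseteq> Y"
        "length ks = n'" "length ks' = n'"
      show "\<phi>' ks = \<phi>' ks'"
      proof (cases "(n', \<phi>') \<in> L")
        case True
        have "set ks \<subseteq> H" "set ks' \<subseteq> H" using *(4,5) Y(1) by auto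
        then show ?thesis using H(3)[rule_format, OF True *(2,3) _ _ *(6,7)] by blast
      next
        case False
        then have "n' = n" "\<phi>' = \<phi>" using * l by auto
        then show ?thesis using f * by blast
      qed
    qed
  qed
  then show thesis using that by metis
qed

context monster
begin

text \<open>
  \<open>t\<close> is a limit of \<open>I\<close> along \<open>\<F>\<close>, indexed by \<open>r\<close>: a condition on finitely many entries holds of \<open>t\<close> as soon
  as it holds of all corresponding increasing tuples of \<open>I\<close> inside some member of \<open>\<F>\<close>.
\<close>

definition avg :: "'m set \<Rightarrow> 'v set \<Rightarrow> ('o, 'v, 'm) seqn \<Rightarrow> 'o set set \<Rightarrow> 'q rel \<Rightarrow> ('q \<times> 'v \<rightharpoonup> 'm) \<Rightarrow> bool" where
  "avg C y I \<F> r t \<longleftrightarrow> t \<in> tuples (Field r \<times> y) \<and>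
     (\<forall>R S W. finite R \<and> R \<subseteq> Field r \<and> S \<in> \<F> \<and> pdfn C (R \<times> y) W \<and>
        (\<forall>e. smono r R (sord I) e \<and> e ` R \<subseteq> S \<longrightarrow> W (\<lambda>(q, j). the (stup I (e q, j)))) \<longrightarrow> W (the \<circ> t))"

lemma avg_tuples: "avg C y I \<F> r t \<Longrightarrow> t \<in> tuples (Field r \<times> y)"
  by (simp add: avg_def)

lemma avgD:
  assumes "avg C y I \<F> r t" "finite R" "R \<subseteq> Field r" "S \<in> \<F>" "pdfn C (R \<times> y) W"
    "\<And>e. smono r R (sord I) e \<Longrightarrow> e ` R \<subseteq> S \<Longrightarrow> W (\<lambda>(q, j). the (stup I (e q, j)))"
  shows "W (the \<circ> t)"
  using assms unfolding avg_def by blast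

text \<open>Finitely many conditions refer to finitely many members of the directed family. A common
  smaller member is infinite, so it receives an increasing copy of the indices involved, and the
  entries of \<open>I\<close> there satisfy all these conditions.\<close>

lemma ex_avg:
  fixes I :: "('o, 'v, 'm) seqn" and r :: "'q rel"
  assumes I: "ysq y I" and ne: "\<F> \<noteq> {}" and inf: "\<And>S. S \<in> \<F> \<Longrightarrow> infinite S \<and> S \<subseteq> Field (sord I)"
    and dir: "\<And>S T. S \<in> \<F> \<Longrightarrow> T \<in> \<F> \<Longrightarrow> \<exists>U\<in>\<F>. U \<subseteq> S \<inter> T"
    and r: "Linear_order r" "sm (Field r)" and C: "sm C"
  obtains t where "avg C y I \<F> r t"
proof -
  define val where "val e = (\<lambda>(q, j). the (stup I (e q, j)))" for e :: "'q \<Rightarrow> 'o"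
  define good where "good R S W \<longleftrightarrow> finite R \<and> R \<subseteq> Field r \<and> S \<in> \<F> \<and> pdfn C (R \<times> y) W \<and>
     (\<forall>e. smono r R (sord I) e \<and> e ` R \<subseteq> S \<longrightarrow> W (val e))" for R S W
  define \<Gamma> where "\<Gamma> = {W. \<exists>R S. good R S W}"
  have "\<forall>W\<in>\<Gamma>. \<exists>z. good (fst z) (snd z) W" unfolding \<Gamma>_def by auto
  from bchoice[OF this] obtain g where g: "\<forall>W\<in>\<Gamma>. good (fst (g W)) (snd (g W)) W" by (elim exE)
  have X: "sm (Field r \<times> y)" using r(2) ysqD(3)[OF I] by (rule small_Times)
  have dfn: "pdfn C (Field r \<times> y) W" if "W \<in> \<Gamma>" for W
  proof -
    have "good (fst (g W)) (snd (g W)) W" using g that by blast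
    then have "pdfn C (fst (g W) \<times> y) W" "fst (g W) \<times> y \<subseteq> Field r \<times> y" unfolding good_def by blast+
    then show ?thesis using pdfn_mono by blast
  qed
  have fin: "\<exists>a. \<forall>W\<in>q. W a" if q: "q \<subseteq> \<Gamma>" "finite q" for q
  proof -
    have "\<exists>S\<in>\<F>. \<forall>W\<in>q. S \<subseteq> snd (g W)" using q(2,1)
    proof (induction q)
      case empty
      then show ?case using ne by auto
    next
      case (insert W q)
      then obtain S where S: "S \<in> \<F>" "\<forall>W\<in>q. S \<subseteq> snd (g W)" by auto
      have "good (fst (g W)) (snd (g W)) W" using g insert.prems by blast
      then have "snd (g W) \<in> \<F>" unfolding good_def by blast
      then obtain U where "U \<in> \<F>" "U \<subseteq> S \<inter> snd (g W)" using dir S(1) by blast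
      then show ?case using S(2) by (intro bexI[of _ U]) auto
    qed
    then obtain S where S: "S \<in> \<F>" "\<forall>W\<in>q. S \<subseteq> snd (g W)" by blast
    define R where "R = (\<Union>W\<in>q. fst (g W))"
    have gW: "good (fst (g W)) (snd (g W)) W" if "W \<in> q" for W using g q(1) that by blast
    have R: "finite R" "R \<subseteq> Field r" using q(2) gW unfolding R_def good_def by auto
    obtain e where e: "smono r R (sord I) e" "e ` R \<subseteq> S"
      using ex_smono[OF r(1) R ysqD(1)[OF I]] inf[OF S(1)] by blast
    have "W (val e)" if W: "W \<in> q" for W
    proof -
      have sub: "fst (g W) \<subseteq> R" using W by (auto simp: R_def)
      then have "smono r (fst (g W)) (sord I) e" using e(1) smono_subset by blast
      moreover have "e ` fst (g W) \<subseteq> snd (g W)" using e(2) S(2) W sub by blast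
      ultimately show ?thesis using gW[OF W] unfolding good_def by blast
    qed
    then show ?thesis by blast
  qed
  obtain u where u: "\<And>W. W \<in> \<Gamma> \<Longrightarrow> W u" using compactness[OF C X dfn fin] by blast
  define t where "t z = (if z \<in> Field r \<times> y then Some (u z) else None)" for z
  have "W (the \<circ> t)" if "good R S W" for R S W
  proof -
    have "W \<in> \<Gamma>" using that unfolding \<Gamma>_def by blast
    then have "W u" by (rule u)
    have p: "pdfn C (R \<times> y) W" "R \<subseteq> Field r" using that unfolding good_def by blast+
    have "W u = W (the \<circ> t)" using p(2) by (intro pdfn_cong[OF p(1)]) (auto simp: t_def)
    then show ?thesis using \<open>W u\<close> by simp
  qed
  moreover have "t \<in> tuples (Field r \<times> y)" by (auto simp: tuples_def t_def split: if_splits)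
  ultimately have "avg C y I \<F> r t" unfolding avg_def good_def val_def by blast
  then show thesis by (rule that)
qed

text \<open>
  \<open>Q'\<close> is composed of entries of the limit \<open>t\<close> and entries of the indiscernible sequence \<open>Q\<close>, which contains
  \<open>I\<close> by means of \<open>f\<close>; \<open>d\<close> records the origin of an entry. It suffices that each finite part of \<open>Q'\<close>
  becomes increasing in \<open>Q\<close> when its entries from \<open>t\<close> are replaced by entries of \<open>I\<close> in a member of \<open>\<F>\<close>.
\<close>

lemma avg_EM:
  fixes I :: "('o, 'v, 'm) seqn" and Q :: "('a, 'v, 'm) seqn" and Q' :: "('b, 'v, 'm) seqn" and r :: "'q rel"
    and d :: "'b \<Rightarrow> 'q + 'a"
  assumes av: "avg C y I \<F> r t" and Q: "ysq y Q" "indiscernible \<kappa> M {idm N} Q"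
    and N: "sm N" "N \<subseteq> C" "ran (stup Q) \<subseteq> C"
    and f: "\<And>i j. i \<in> Field (sord I) \<Longrightarrow> stup Q (f i, j) = stup I (i, j)"
    and Q': "ysq y Q'"
    and d: "\<And>z. z \<in> Field (sord Q') \<Longrightarrow> case d z of Inl p \<Rightarrow> p \<in> Field r \<and> (\<forall>j. stup Q' (z, j) = t (p, j))
        | Inr k \<Rightarrow> k \<in> Field (sord Q) \<and> (\<forall>j. stup Q' (z, j) = stup Q (k, j))"
    and cond: "\<And>F. finite F \<Longrightarrow> F \<subseteq> Field (sord Q') \<Longrightarrow> \<exists>S\<in>\<F>. \<forall>e. smono r {p. Inl p \<in> d ` F} (sord I) e \<longrightarrow>
        e ` {p. Inl p \<in> d ` F} \<subseteq> S \<longrightarrow> smono (sord Q') F (sord Q) (\<lambda>z. case d z of Inl p \<Rightarrow> f (e p) | Inr k \<Rightarrow> k)"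
  shows "EM_equiv M {idm N} Q Q'"
  unfolding EM_equiv_def
proof (intro allI impI, elim conjE)
  fix js "is" assume js: "increasing (sord Q) js" and "is": "increasing (sord Q') is" and len: "length js = length is"
  have F: "set is \<subseteq> Field (sord Q')" "set js \<subseteq> Field (sord Q)" using "is" js by (simp_all add: increasing_def)
  let ?n = "length is" and ?R = "{p. Inl p \<in> d ` set is}"
  have dom: "dom (subtup Q js) = {..<?n} \<times> y" "dom (subtup Q' is) = {..<?n} \<times> y"
    using dom_subtup[OF Q(1) F(2)] dom_subtup[OF Q' F(1)] len by simp_all
  have dz: "case d (is ! n) of Inl p \<Rightarrow> p \<in> Field r \<and> (\<forall>j. stup Q' (is ! n, j) = t (p, j))
        | Inr k \<Rightarrow> k \<in> Field (sord Q) \<and> (\<forall>j. stup Q' (is ! n, j) = stup Q (k, j))" if "n < ?n" for n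
    using d F(1) nth_mem[OF that] by blast
  show "conj_over M {idm N} (subtup Q js) (subtup Q' is)"
  proof (rule conj_over_idmI)
    show "dom (subtup Q js) = dom (subtup Q' is)" using dom by simp
    show "sm N" by (rule N(1))
    show "sm (dom (subtup Q js))" unfolding dom using small_nat ysqD(3)[OF Q'] by (rule small_Times)
    fix P assume P: "pdfn N (dom (subtup Q js)) P" "P (the \<circ> subtup Q js)"
    note P1 = P(1)[unfolded dom]
    \<comment> \<open>The condition \<open>P\<close> on a tuple of \<open>Q'\<close> becomes one on
      \<open>t\<close> alone: places filled from the limit stay variables, places filled from
      \<open>Q\<close> turn into parameters in \<open>C\<close>.\<close>
    define h where "h = (\<lambda>(n, j). case d (is ! n) of Inl p \<Rightarrow> Inl (p, j) | Inr k \<Rightarrow> Inr (the (stup Q (k, j))))"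
    define W where "W u \<longleftrightarrow> P (case_sum u id \<circ> h)" for u :: "'q \<times> 'v \<Rightarrow> 'm"
    have R: "finite ?R" "?R \<subseteq> Field r"
    proof -
      have "?R = Inl -` (d ` set is)" by auto
      then show "finite ?R" by (simp add: finite_vimageI)
      show "?R \<subseteq> Field r"
      proof
        fix p assume "p \<in> ?R"
        then obtain z where "z \<in> set is" "d z = Inl p" by (metis imageE mem_Collect_eq)
        then show "p \<in> Field r" using d[of z] F(1) by auto
      qed
    qed
    have W: "pdfn C (?R \<times> y) W"
      unfolding W_def[abs_def]
    proof (rule pdfn_subst[OF P1 _ N(2)])
      show "h ` ({..<?n} \<times> y) \<subseteq> ?R \<times> y <+> C"
      proof clarify
        fix n j assume nj: "n < ?n" "j \<in> y"
        show "h (n, j) \<in> ?R \<times> y <+> C"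
        proof (cases "d (is ! n)")
          case (Inl p)
          then have "p \<in> ?R" using nj(1) nth_mem by (metis (mono_tags, lifting) image_eqI mem_Collect_eq)
          then show ?thesis using Inl nj(2) by (auto simp: h_def)
        next
          case (Inr k)
          then have "k \<in> Field (sord Q)" using dz[OF nj(1)] by simp
          then have "(k, j) \<in> dom (stup Q)" using ysqD(4)[OF Q(1)] nj(2) by blast
          then obtain v where "stup Q (k, j) = Some v" by blast
          then have "the (stup Q (k, j)) \<in> ran (stup Q)" using ranI[of "stup Q" "(k, j)" v] by simp
          then show ?thesis using Inr N(3) by (auto simp: h_def)
        qed
      qed
    qed
    obtain S where S: "S \<in> \<F>" "\<forall>e. smono r ?R (sord I) e \<longrightarrow> e ` ?R \<subseteq> S \<longrightarrow>
        smono (sord Q') (set is) (sord Q) (\<lambda>z. case d z of Inl p \<Rightarrow> f (e p) | Inr k \<Rightarrow> k)"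
      using cond[OF finite_set F(1)] by blast
    have "W (the \<circ> t)"
    proof (rule avgD[OF av R S(1) W])
      fix e assume e: "smono r ?R (sord I) e" "e ` ?R \<subseteq> S"
      \<comment> \<open>With limit entries replaced by entries of \<open>I\<close>, the list
        \<open>is\<close> becomes increasing in \<open>Q\<close>, and indiscernibility compares its
        type over \<open>N\<close> with that of \<open>js\<close>.\<close>
      define c where "c z = (case d z of Inl p \<Rightarrow> f (e p) | Inr k \<Rightarrow> k)" for z
      have "smono (sord Q') (set is) (sord Q) c" unfolding c_def[abs_def] using S(2) e by blast
      then have "increasing (sord Q) (map c is)" using "is" by (rule increasing_map)
      then have "conj_over M {idm N} (subtup Q js) (subtup Q (map c is))"
        using Q(2) js len unfolding indiscernible_def by simp
      from conj_over_idmD[OF this P(1)] have "P (the \<circ> subtup Q (map c is))" using P(2) by simp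
      moreover have "P (the \<circ> subtup Q (map c is)) = P (case_sum (\<lambda>(q, j). the (stup I (e q, j))) id \<circ> h)"
      proof (rule pdfn_cong[OF P1])
        fix v assume "v \<in> {..<?n} \<times> y"
        then obtain n j where v: "v = (n, j)" "n < ?n" by auto
        have "(the \<circ> subtup Q (map c is)) v = the (stup Q (c (is ! n), j))" using v by (simp add: subtup_nth)
        also have "\<dots> = (case_sum (\<lambda>(q, j). the (stup I (e q, j))) id \<circ> h) v"
        proof (cases "d (is ! n)")
          case (Inl p)
          then have "p \<in> ?R" using v(2) nth_mem by (metis (mono_tags, lifting) image_eqI mem_Collect_eq)
          then have "e p \<in> Field (sord I)" using e(1) unfolding smono_def by blast
          then show ?thesis using Inl f v(1) by (simp add: c_def h_def)
        next
          case (Inr k)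
          then show ?thesis using v(1) by (simp add: c_def h_def)
        qed
        finally show "(the \<circ> subtup Q (map c is)) v = (case_sum (\<lambda>(q, j). the (stup I (e q, j))) id \<circ> h) v" .
      qed
      ultimately show "W (\<lambda>(q, j). the (stup I (e q, j)))" unfolding W_def by simp
    qed
    moreover have "P (the \<circ> subtup Q' is) = P (case_sum (the \<circ> t) id \<circ> h)"
    proof (rule pdfn_cong[OF P1])
      fix v assume "v \<in> {..<?n} \<times> y"
      then obtain n j where v: "v = (n, j)" "n < ?n" by auto
      show "(the \<circ> subtup Q' is) v = (case_sum (the \<circ> t) id \<circ> h) v"
        using dz[OF v(2)] v by (cases "d (is ! n)") (simp_all add: subtup_nth h_def)
    qed
    ultimately show "P (the \<circ> subtup Q' is)" unfolding W_def by simp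
  qed
qed

text \<open>By compactness finitely many demands suffice, and these are met inside a homogeneous set
  given by Ramsey's theorem. The last conclusion, inheritance of whatever all increasing tuples of
  \<open>Q\<close> satisfy, is what ties the extracted sequence to \<open>Q\<close>.\<close>

lemma ramsey_indiscernible:
  fixes Q :: "('o, 'v, 'm) seqn"
  assumes Q: "ysq y Q" "infinite_seq Q" and C: "sm C"
  obtains t where "t \<in> tuples (Field (sord Q) \<times> y)" "indiscernible \<kappa> M {idm C} \<lparr>sord = sord Q, stup = t\<rparr>"
    "\<And>is \<phi>. increasing (sord Q) is \<Longrightarrow> pdfn C ({..<length is} \<times> y) \<phi> \<Longrightarrow>
      (\<And>ks. increasing (sord Q) ks \<Longrightarrow> length ks = length is \<Longrightarrow> \<phi> (the \<circ> subtup Q ks)) \<Longrightarrow>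
      \<phi> (the \<circ> subtup \<lparr>sord = sord Q, stup = t\<rparr> is)"
proof -
  let ?r = "sord Q"
  let ?X = "Field ?r \<times> y"
  have lin: "Linear_order ?r" using ysqD(1)[OF Q(1)] .
  define sel where "sel u is = u \<circ> (\<lambda>(n, j). (is ! n, j))" for u :: "'o \<times> 'v \<Rightarrow> 'm" and "is" :: "'o list"
  \<comment> \<open>\<open>D1\<close> collects the conditions to be inherited from \<open>Q\<close>,
    \<open>D2\<close> the demand that increasing tuples of the same length satisfy the same
    conditions.\<close>
  define D1 where "D1 = {(\<phi>, is). increasing ?r is \<and> pdfn C ({..<length is} \<times> y) \<phi> \<and>
      (\<forall>ks. increasing ?r ks \<and> length ks = length is \<longrightarrow> \<phi> (the \<circ> subtup Q ks))}"
  define D2 where "D2 = {(\<phi>, is, js). increasing ?r is \<and> increasing ?r js \<and> length js = length is \<and> pdfn C ({..<length is} \<times> y) \<phi>}"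
  define f1 where "f1 = (\<lambda>(\<phi>, is) u. \<phi> (sel u is) :: bool)"
  define f2 where "f2 = (\<lambda>(\<phi>, is, js) u. \<phi> (sel u is) \<longleftrightarrow> (\<phi> (sel u js) :: bool))"
  have sel: "pdfn C ?X (\<lambda>u. \<phi> (sel u is))" if "increasing ?r is" "pdfn C ({..<n} \<times> y) \<phi>" "n = length is" for \<phi> "is" n
    unfolding sel_def using that nth_mem[of _ "is"]
    by (intro pdfn_rename[OF that(2)]) (auto simp: increasing_def)
  have dfn: "pdfn C ?X W" if "W \<in> f1 ` D1 \<union> f2 ` D2" for W
    using that
  proof
    assume "W \<in> f1 ` D1"
    then obtain \<phi> "is" where "(\<phi>, is) \<in> D1" "W = (\<lambda>u. \<phi> (sel u is))" by (auto simp: f1_def)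
    then show ?thesis using sel[of "is" _ \<phi>] unfolding D1_def by simp
  next
    assume "W \<in> f2 ` D2"
    then obtain \<phi> "is" js where *: "(\<phi>, is, js) \<in> D2" "W = (\<lambda>u. \<phi> (sel u is) \<longleftrightarrow> \<phi> (sel u js))" by (auto simp: f2_def)
    have D: "increasing ?r is" "increasing ?r js" "length js = length is" "pdfn C ({..<length is} \<times> y) \<phi>"
      using *(1) unfolding D2_def by auto
    show ?thesis unfolding *(2)
      by (rule pdfn_iff[OF sel[OF D(1,4) refl] sel[OF D(2,4) D(3)[symmetric]]])
  qed
  have fin: "\<exists>u. \<forall>W\<in>q. W u" if q: "q \<subseteq> f1 ` D1 \<union> f2 ` D2" "finite q" for q
  proof -
    have "q = (q \<inter> f1 ` D1) \<union> (q \<inter> f2 ` D2)" using q(1) by blast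
    moreover obtain E1 where E1: "E1 \<subseteq> D1" "finite E1" "q \<inter> f1 ` D1 = f1 ` E1"
      using finite_subset_image[of "q \<inter> f1 ` D1" f1 D1] q(2) by blast
    moreover obtain E2 where E2: "E2 \<subseteq> D2" "finite E2" "q \<inter> f2 ` D2 = f2 ` E2"
      using finite_subset_image[of "q \<inter> f2 ` D2" f2 D2] q(2) by blast
    ultimately have qE: "q = f1 ` E1 \<union> f2 ` E2" by simp
    define L where "L = (\<lambda>(\<phi>, is, js). (length is, \<lambda>ks. \<phi> (the \<circ> subtup Q ks))) ` E2"
    have "finite L" unfolding L_def using E2(2) by simp
    obtain H where H: "H \<subseteq> Field ?r" "infinite H"
      "\<And>n \<phi> ks ks'. (n, \<phi>) \<in> L \<Longrightarrow> increasing ?r ks \<Longrightarrow> increasing ?r ks' \<Longrightarrow> set ks \<subseteq> H \<Longrightarrow> set ks' \<subseteq> H \<Longrightarrow>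
       length ks = n \<Longrightarrow> length ks' = n \<Longrightarrow> \<phi> ks \<longleftrightarrow> \<phi> ks'"
      using homogeneous_subset[OF lin \<open>finite L\<close>, of "Field ?r"] Q(2) unfolding infinite_seq_def by blast
    define R where "R = (\<Union>(\<phi>, is)\<in>E1. set is) \<union> (\<Union>(\<phi>, is, js)\<in>E2. set is \<union> set js)"
    have "finite R" unfolding R_def using E1(2) E2(2) by auto
    moreover have "R \<subseteq> Field ?r" unfolding R_def using E1(1) E2(1) by (force simp: D1_def D2_def increasing_def)
    ultimately obtain e where e: "smono ?r R ?r e" "e ` R \<subseteq> H"
      using ex_smono[OF lin _ _ lin H(2,1)] by blast
    define u where "u = (\<lambda>(q, j). the (stup Q (e q, j)))"
    have inc: "increasing ?r (map e is)" "set (map e is) \<subseteq> H" if "increasing ?r is" "set is \<subseteq> R" for "is"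
      using increasing_map[OF smono_subset[OF e(1) that(2)] that(1)] e(2) that(2) by auto
    have val: "\<phi> (sel u is) = \<phi> (the \<circ> subtup Q (map e is))" if "pdfn C ({..<n} \<times> y) \<phi>" "n = length is" for \<phi> "is" n
      using that by (intro pdfn_cong[OF that(1)]) (auto simp: sel_def u_def subtup_nth)
    have "W u" if W: "W \<in> q" for W
      using W unfolding qE
    proof
      assume "W \<in> f1 ` E1"
      then obtain \<phi> "is" where *: "(\<phi>, is) \<in> E1" "W = (\<lambda>u. \<phi> (sel u is))" by (auto simp: f1_def)
      then have D: "(\<phi>, is) \<in> D1" using E1(1) by blast
      have "set is \<subseteq> R" using *(1) by (auto simp: R_def)
      then have "increasing ?r (map e is)" using inc(1) D by (simp add: D1_def)
      then have "\<phi> (the \<circ> subtup Q (map e is))" using D by (simp add: D1_def)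
      then show "W u" unfolding *(2) using val[of "length is" \<phi> "is"] D by (simp add: D1_def)
    next
      assume "W \<in> f2 ` E2"
      then obtain \<phi> "is" js where *: "(\<phi>, is, js) \<in> E2" "W = (\<lambda>u. \<phi> (sel u is) \<longleftrightarrow> \<phi> (sel u js))" by (auto simp: f2_def)
      then have D: "increasing ?r is" "increasing ?r js" "length js = length is" "pdfn C ({..<length is} \<times> y) \<phi>"
        using E2(1) by (auto simp: D2_def)
      have R: "set is \<subseteq> R" "set js \<subseteq> R" using *(1) by (auto simp: R_def)
      have "(length is, \<lambda>ks. \<phi> (the \<circ> subtup Q ks)) \<in> L"
        unfolding L_def using *(1) by (intro image_eqI[of _ _ "(\<phi>, is, js)"]) auto
      from H(3)[OF this inc(1)[OF D(1) R(1)] inc(1)[OF D(2) R(2)] inc(2)[OF D(1) R(1)] inc(2)[OF D(2) R(2)]]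
      have "\<phi> (the \<circ> subtup Q (map e is)) \<longleftrightarrow> \<phi> (the \<circ> subtup Q (map e js))" using D(3) by simp
      then show "W u" unfolding *(2) using val[OF D(4) refl] val[OF D(4) D(3)[symmetric]] by blast
    qed
    then show ?thesis by blast
  qed
  have X: "sm ?X" using ysqD(2,3)[OF Q(1)] by (rule small_Times)
  obtain u where u: "\<And>W. W \<in> f1 ` D1 \<union> f2 ` D2 \<Longrightarrow> W u" using compactness[OF C X dfn fin] by blast
  define t where "t z = (if z \<in> ?X then Some (u z) else None)" for z
  let ?Q = "\<lparr>sord = ?r, stup = t\<rparr>"
  have t: "t \<in> tuples ?X" by (auto simp: tuples_def t_def split: if_splits)
  have yQ: "ysq y ?Q" using Q(1) t by (simp add: ysq_def)
  have val: "\<phi> (sel u is) = \<phi> (the \<circ> subtup ?Q is)"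
    if inc: "increasing ?r is" and \<phi>: "pdfn C ({..<n} \<times> y) \<phi>" and n: "n = length is" for \<phi> "is" n
  proof (rule pdfn_cong[OF \<phi>])
    fix v assume "v \<in> {..<n} \<times> y"
    then obtain m j where v: "v = (m, j)" "m < length is" "j \<in> y" using n by auto
    then have "is ! m \<in> Field ?r" using inc nth_mem[OF v(2)] by (auto simp: increasing_def)
    then show "sel u is v = (the \<circ> subtup ?Q is) v" using v by (simp add: sel_def subtup_nth t_def)
  qed
  have "EM_equiv M {idm C} ?Q ?Q"
    unfolding EM_equiv_def
  proof (intro allI impI, elim conjE)
    fix "is" js assume "increasing (sord ?Q) is" "increasing (sord ?Q) js" and len: "length is = length js"
    then have inc: "increasing ?r is" "increasing ?r js" by simp_all
    have dom: "dom (subtup ?Q is) = {..<length is} \<times> y" "dom (subtup ?Q js) = {..<length is} \<times> y"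
      using dom_subtup[OF yQ] inc len by (simp_all add: increasing_def)
    show "conj_over M {idm C} (subtup ?Q is) (subtup ?Q js)"
    proof (rule conj_over_idmI)
      show "sm (dom (subtup ?Q is))" unfolding dom using small_nat ysqD(3)[OF Q(1)] by (rule small_Times)
      fix P assume P: "pdfn C (dom (subtup ?Q is)) P" "P (the \<circ> subtup ?Q is)"
      then have "(P, is, js) \<in> D2" using inc len dom by (simp add: D2_def)
      then have "(\<lambda>u. P (sel u is) \<longleftrightarrow> P (sel u js)) \<in> f1 ` D1 \<union> f2 ` D2"
        by (intro UnI2 image_eqI[of _ _ "(P, is, js)"]) (auto simp: f2_def)
      from u[OF this] have "P (sel u is) \<longleftrightarrow> P (sel u js)" .
      then show "P (the \<circ> subtup ?Q js)"
        using P(2) val[OF inc(1) P(1)[unfolded dom] refl] val[OF inc(2) P(1)[unfolded dom] len] by blast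
    qed (use dom C in simp_all)
  qed
  then have "indiscernible \<kappa> M {idm C} ?Q" using ysqD(5)[OF yQ] by (simp add: indiscernible_iff)
  moreover have "\<phi> (the \<circ> subtup ?Q is)"
    if "increasing ?r is" "pdfn C ({..<length is} \<times> y) \<phi>"
      "\<And>ks. increasing ?r ks \<Longrightarrow> length ks = length is \<Longrightarrow> \<phi> (the \<circ> subtup Q ks)" for "is" \<phi>
  proof -
    have "(\<phi>, is) \<in> D1" using that by (simp add: D1_def)
    then have "(\<lambda>u. \<phi> (sel u is)) \<in> f1 ` D1 \<union> f2 ` D2"
      by (intro UnI1 image_eqI[of _ _ "(\<phi>, is)"]) (auto simp: f1_def)
    from u[OF this] show ?thesis using val[OF that(1,2) refl] by blast
  qed
  ultimately show thesis using that[OF t] by blast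
qed

text \<open>A sequence extracted from \<open>Q\<close> over any small model containing a
  representative of \<open>A\<close> keeps the Ehrenfeucht-Mostowski type of \<open>Q\<close> over
  \<open>A\<close>, so an automorphism over \<open>A\<close> takes it to \<open>Q\<close>. The image
  of the model under that automorphism is the required one.\<close>

lemma indiscernible_over_model:
  assumes A: "hyp_at A a" and Q: "indiscernible \<kappa> M A Q" "infinite_seq Q"
  obtains N where "elem_sub M N" "sm N" "Fix M N \<subseteq> Aut M A" "indiscernible \<kappa> M {idm N} Q"
proof -
  obtain y where y: "ysq y Q" using Q(1) is_seq_ysq[of Q] by (auto simp: indiscernible_def)
  obtain N where N: "ran a \<subseteq> N" "sm N" "elem_sub M N" using small_model[OF hyp_at_small_ran[OF A]] by blast
  obtain t where t: "t \<in> tuples (Field (sord Q) \<times> y)" "indiscernible \<kappa> M {idm N} \<lparr>sord = sord Q, stup = t\<rparr>"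
    "\<And>is \<phi>. increasing (sord Q) is \<Longrightarrow> pdfn N ({..<length is} \<times> y) \<phi> \<Longrightarrow>
      (\<And>ks. increasing (sord Q) ks \<Longrightarrow> length ks = length is \<Longrightarrow> \<phi> (the \<circ> subtup Q ks)) \<Longrightarrow>
      \<phi> (the \<circ> subtup \<lparr>sord = sord Q, stup = t\<rparr> is)"
    by (rule ramsey_indiscernible[OF y Q(2) N(2)]) blast
  let ?Q = "\<lparr>sord = sord Q, stup = t\<rparr>"
  have yQ: "ysq y ?Q" using y t(1) by (simp add: ysq_def)
  have bl: "block M A" using A by (rule hyp_at_block)
  have "EM_equiv M A Q ?Q"
    unfolding EM_equiv_def
  proof (intro allI impI, elim conjE)
    fix js "is" assume js: "increasing (sord Q) js" and "is": "increasing (sord ?Q) is" and len: "length js = length is"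
    have dom: "dom (subtup Q js) = {..<length is} \<times> y" "dom (subtup ?Q is) = {..<length is} \<times> y"
      using dom_subtup[OF yQ, of "is"] dom_subtup[OF y, of js] js "is" len by (simp_all add: increasing_def)
    show "conj_over M A (subtup Q js) (subtup ?Q is)"
    proof (rule conj_over_closed[OF A])
      show "sm (dom (subtup Q js))" unfolding dom using small_nat ysqD(3)[OF y] by (rule small_Times)
      show "dom (subtup ?Q is) = dom (subtup Q js)" using dom by simp
      fix \<psi> assume \<psi>: "pdfn (ran a) (dom (subtup Q js)) \<psi>" "\<And>c'. conj_over M A (subtup Q js) c' \<Longrightarrow> \<psi> (the \<circ> c')"
      show "\<psi> (the \<circ> subtup ?Q is)"
      proof (rule t(3))
        show "increasing (sord Q) is" using "is" by simp
        show "pdfn N ({..<length is} \<times> y) \<psi>" using pdfn_mono[OF \<psi>(1) N(1) order_refl] unfolding dom .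
        fix ks assume "increasing (sord Q) ks" "length ks = length is"
        then have "conj_over M A (subtup Q js) (subtup Q ks)" using Q(1) js len unfolding indiscernible_def by simp
        then show "\<psi> (the \<circ> subtup Q ks)" by (rule \<psi>(2))
      qed
    qed
  qed
  then have "EM_equiv M A ?Q Q" by (rule EM_sym[OF bl])
  from EM_conj[OF A yQ y _ this] have "conj_over M A t (stup Q)" by simp
  then obtain \<sigma> where \<sigma>: "\<sigma> \<in> Aut M A" "act \<sigma> t = stup Q" unfolding conj_over_def by blast
  have \<sigma>': "\<sigma> \<in> automorphisms M" using \<sigma>(1) by (rule Aut_automorphisms)
  have "aseq \<sigma> ?Q = Q" using \<sigma>(2) by (simp add: aseq_def)
  then have "indiscernible \<kappa> M (act \<sigma> ` {idm N}) Q" using indiscernible_aseq[OF \<sigma>' t(2)] by simp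
  moreover have "Aut M (act \<sigma> ` {idm N}) \<subseteq> Aut M {idm (\<sigma> ` N)}"
  proof
    fix \<tau> assume \<tau>: "\<tau> \<in> Aut M (act \<sigma> ` {idm N})"
    then have "act \<tau> (act \<sigma> (idm N)) = act \<sigma> (idm N)" by (simp add: Aut_def)
    then have "\<tau> (\<sigma> c) = \<sigma> c" if "c \<in> N" for c
      using that by (auto simp: act_apply idm_def fun_eq_iff dest!: spec[of _ c])
    then show "\<tau> \<in> Aut M {idm (\<sigma> ` N)}" unfolding Aut_idm using Aut_automorphisms[OF \<tau>] by (auto simp: Fix_def)
  qed
  ultimately have "indiscernible \<kappa> M {idm (\<sigma> ` N)} Q" by (rule indiscernible_mono[rotated])
  moreover have "Fix M (\<sigma> ` N) \<subseteq> Aut M A"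
    using Fix_image_subset_Aut[OF bl hyp_at_Fix[OF A N(1)] \<sigma>(1)] .
  ultimately show thesis using that[of "\<sigma> ` N"] elem_sub_image[OF N(3) \<sigma>'] small_image[OF N(2)] by blast
qed

end

section \<open>Concatenations that contain a limit\<close>

lemma Inl_in_Plus [simp]: "Inl x \<in> X <+> Y \<longleftrightarrow> x \<in> X"
  by auto

lemma Inr_in_Plus [simp]: "Inr y \<in> X <+> Y \<longleftrightarrow> y \<in> Y"
  by auto

text \<open>This lemma and its three variants discharge the hypothesis \<open>cond\<close> of
  \<open>avg_EM\<close>: once limit entries are replaced by entries of \<open>I\<close>, a finite
  part of the new concatenation must be increasing in the old one. Here the limit takes the place of
  \<open>I\<close> to the left of \<open>K\<close>.\<close>

lemma smono_ext_left:
  assumes "smono r {p. Inl p \<in> case_sum Inl (Inr \<circ> Inr) ` F} (sord I) e"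
    and F: "F \<subseteq> Field (sord (seq_append P K))" and r: "r = sord P"
  shows "smono (sord (seq_append P K)) F (sord (seq_append I K))
    (\<lambda>z. case case_sum Inl (Inr \<circ> Inr) z of Inl p \<Rightarrow> Inl (e p) | Inr k \<Rightarrow> k)"
proof -
  have R: "p \<in> {p. Inl p \<in> case_sum Inl (Inr \<circ> Inr) ` F}" if "Inl p \<in> F" for p
    using that by force
  have e: "e p \<in> Field (sord I)" if "Inl p \<in> F" for p
    using assms(1) R[OF that] unfolding smono_def by blast
  have e2: "(e p, e q) \<in> sord I \<and> e p \<noteq> e q" if "Inl p \<in> F" "Inl q \<in> F" "(p, q) \<in> r" "p \<noteq> q" for p q
    using assms(1) R[OF that(1)] R[OF that(2)] that(3,4) unfolding smono_def by blast
  show ?thesis unfolding smono_def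
  proof (intro conjI ballI impI)
    fix x assume x: "x \<in> F"
    then have "x \<in> Field (sord P) <+> Field (sord K)" using F by (auto simp: Field_append)
    then show "(case case_sum Inl (Inr \<circ> Inr) x of Inl p \<Rightarrow> Inl (e p) | Inr k \<Rightarrow> k) \<in> Field (sord (seq_append I K))"
      using e x by (auto simp: Field_append)
  next
    fix x y assume xy: "x \<in> F" "y \<in> F" "(x, y) \<in> sord (seq_append P K) \<and> x \<noteq> y"
    show "(case case_sum Inl (Inr \<circ> Inr) x of Inl p \<Rightarrow> Inl (e p) | Inr k \<Rightarrow> k,
        case case_sum Inl (Inr \<circ> Inr) y of Inl p \<Rightarrow> Inl (e p) | Inr k \<Rightarrow> k) \<in> sord (seq_append I K)"
      "(case case_sum Inl (Inr \<circ> Inr) x of Inl p \<Rightarrow> Inl (e p) | Inr k \<Rightarrow> k) \<noteq>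
        (case case_sum Inl (Inr \<circ> Inr) y of Inl p \<Rightarrow> Inl (e p) | Inr k \<Rightarrow> k)"
      using xy e e2 r by (cases x; cases y; simp)+
  qed
qed

lemma smono_ext_right:
  assumes "smono r {p. Inl p \<in> case_sum (Inr \<circ> Inl) Inl ` F} (sord I) e"
    and F: "F \<subseteq> Field (sord (seq_append K P))" and r: "r = sord P"
  shows "smono (sord (seq_append K P)) F (sord (seq_append K I))
    (\<lambda>z. case case_sum (Inr \<circ> Inl) Inl z of Inl p \<Rightarrow> Inr (e p) | Inr k \<Rightarrow> k)"
proof -
  have R: "p \<in> {p. Inl p \<in> case_sum (Inr \<circ> Inl) Inl ` F}" if "Inr p \<in> F" for p
    using that by force
  have e: "e p \<in> Field (sord I)" if "Inr p \<in> F" for p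
    using assms(1) R[OF that] unfolding smono_def by blast
  have e2: "(e p, e q) \<in> sord I \<and> e p \<noteq> e q" if "Inr p \<in> F" "Inr q \<in> F" "(p, q) \<in> r" "p \<noteq> q" for p q
    using assms(1) R[OF that(1)] R[OF that(2)] that(3,4) unfolding smono_def by blast
  show ?thesis unfolding smono_def
  proof (intro conjI ballI impI)
    fix x assume x: "x \<in> F"
    then have "x \<in> Field (sord K) <+> Field (sord P)" using F by (auto simp: Field_append)
    then show "(case case_sum (Inr \<circ> Inl) Inl x of Inl p \<Rightarrow> Inr (e p) | Inr k \<Rightarrow> k) \<in> Field (sord (seq_append K I))"
      using e x by (auto simp: Field_append)
  next
    fix x y assume xy: "x \<in> F" "y \<in> F" "(x, y) \<in> sord (seq_append K P) \<and> x \<noteq> y"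
    show "(case case_sum (Inr \<circ> Inl) Inl x of Inl p \<Rightarrow> Inr (e p) | Inr k \<Rightarrow> k,
        case case_sum (Inr \<circ> Inl) Inl y of Inl p \<Rightarrow> Inr (e p) | Inr k \<Rightarrow> k) \<in> sord (seq_append K I)"
      "(case case_sum (Inr \<circ> Inl) Inl x of Inl p \<Rightarrow> Inr (e p) | Inr k \<Rightarrow> k) \<noteq>
        (case case_sum (Inr \<circ> Inl) Inl y of Inl p \<Rightarrow> Inr (e p) | Inr k \<Rightarrow> k)"
      using xy e e2 r by (cases x; cases y; simp)+
  qed
qed

lemma sum3_cases:
  obtains i where "x = Inl (Inl i)" | p where "x = Inl (Inr p)" | k where "x = Inr k"
  by (metis sum.exhaust)

text \<open>Now \<open>I\<close> itself stays and the limit follows it. The order survives only if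
  the substituted entries lie beyond the finitely many indices of \<open>I\<close> in
  \<open>F\<close>; this is the hypothesis \<open>above\<close>, which limits along final segments
  satisfy.\<close>

lemma smono_ext_mid:
  fixes I :: "('o, 'v, 'm) seqn" and P :: "('q, 'v, 'm) seqn" and K :: "('a, 'v, 'm) seqn"
  defines "d \<equiv> case_sum (case_sum (Inr \<circ> Inl) Inl) (Inr \<circ> Inr)"
  assumes "smono r {p. Inl p \<in> d ` F} (sord I) e"
    and F: "F \<subseteq> Field (sord (seq_append (seq_append I P) K))" and r: "r = sord P"
    and above: "\<And>i p. Inl (Inl i) \<in> F \<Longrightarrow> p \<in> {p. Inl p \<in> d ` F} \<Longrightarrow> (i, e p) \<in> sord I \<and> i \<noteq> e p"
  shows "smono (sord (seq_append (seq_append I P) K)) F (sord (seq_append I K))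
    (\<lambda>z. case d z of Inl p \<Rightarrow> Inl (e p) | Inr k \<Rightarrow> k)"
proof -
  define c where "c z = (case d z of Inl p \<Rightarrow> Inl (e p) | Inr k \<Rightarrow> k)" for z
  have c: "c (Inl (Inl i)) = Inl i" "c (Inl (Inr p)) = Inl (e p)" "c (Inr k) = Inr k" for i p k
    by (simp_all add: c_def d_def)
  have R: "p \<in> {p. Inl p \<in> d ` F}" if "Inl (Inr p) \<in> F" for p
    using that unfolding d_def by force
  have e: "e p \<in> Field (sord I)" if "Inl (Inr p) \<in> F" for p
    using assms(2) R[OF that] unfolding smono_def by blast
  have e2: "(e p, e q) \<in> sord I \<and> e p \<noteq> e q" if "Inl (Inr p) \<in> F" "Inl (Inr q) \<in> F" "(p, q) \<in> r" "p \<noteq> q" for p q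
    using assms(2) R[OF that(1)] R[OF that(2)] that(3,4) unfolding smono_def by blast
  have e3: "(i, e p) \<in> sord I \<and> i \<noteq> e p" if "Inl (Inl i) \<in> F" "Inl (Inr p) \<in> F" for i p
    using above[OF that(1) R[OF that(2)]] .
  have "smono (sord (seq_append (seq_append I P) K)) F (sord (seq_append I K)) c"
    unfolding smono_def
  proof (intro conjI ballI impI)
    fix x assume x: "x \<in> F"
    then have "x \<in> (Field (sord I) <+> Field (sord P)) <+> Field (sord K)" using F by (auto simp: Field_append)
    then show "c x \<in> Field (sord (seq_append I K))"
      using e x by (auto simp: Field_append c)
  next
    fix x y assume xy: "x \<in> F" "y \<in> F" "(x, y) \<in> sord (seq_append (seq_append I P) K) \<and> x \<noteq> y"
    have "(c x, c y) \<in> sord (seq_append I K) \<and> c x \<noteq> c y"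
      using xy e e2 e3 r by (cases x rule: sum3_cases; cases y rule: sum3_cases) (simp_all add: c Field_append)
    then show "(c x, c y) \<in> sord (seq_append I K)" "c x \<noteq> c y" by blast+
  qed
  then show ?thesis unfolding c_def[abs_def] .
qed

lemma smono_ext_end:
  fixes I :: "('o, 'v, 'm) seqn" and P :: "('q, 'v, 'm) seqn" and K :: "('a, 'v, 'm) seqn"
  defines "d \<equiv> case_sum Inr Inl"
  assumes "smono r {p. Inl p \<in> d ` F} (sord I) e"
    and F: "F \<subseteq> Field (sord (seq_append (seq_append K I) P))" and r: "r = sord P"
    and above: "\<And>i p. Inl (Inr i) \<in> F \<Longrightarrow> p \<in> {p. Inl p \<in> d ` F} \<Longrightarrow> (i, e p) \<in> sord I \<and> i \<noteq> e p"
  shows "smono (sord (seq_append (seq_append K I) P)) F (sord (seq_append K I))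
    (\<lambda>z. case d z of Inl p \<Rightarrow> Inr (e p) | Inr k \<Rightarrow> k)"
proof -
  define c where "c z = (case d z of Inl p \<Rightarrow> Inr (e p) | Inr k \<Rightarrow> k)" for z
  have c: "c (Inr p) = Inr (e p)" "c (Inl k) = k" for p k
    by (simp_all add: c_def d_def)
  have R: "p \<in> {p. Inl p \<in> d ` F}" if "Inr p \<in> F" for p
    using that unfolding d_def by force
  have e: "e p \<in> Field (sord I)" if "Inr p \<in> F" for p
    using assms(2) R[OF that] unfolding smono_def by blast
  have e2: "(e p, e q) \<in> sord I \<and> e p \<noteq> e q" if "Inr p \<in> F" "Inr q \<in> F" "(p, q) \<in> r" "p \<noteq> q" for p q
    using assms(2) R[OF that(1)] R[OF that(2)] that(3,4) unfolding smono_def by blast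
  have e3: "(i, e p) \<in> sord I \<and> i \<noteq> e p" if "Inl (Inr i) \<in> F" "Inr p \<in> F" for i p
    using above[OF that(1) R[OF that(2)]] .
  have "smono (sord (seq_append (seq_append K I) P)) F (sord (seq_append K I)) c"
    unfolding smono_def
  proof (intro conjI ballI impI)
    fix x assume x: "x \<in> F"
    then have "x \<in> (Field (sord K) <+> Field (sord I)) <+> Field (sord P)" using F by (auto simp: Field_append)
    then show "c x \<in> Field (sord (seq_append K I))"
      using e x by (auto simp: Field_append c)
  next
    fix x y assume xy: "x \<in> F" "y \<in> F" "(x, y) \<in> sord (seq_append (seq_append K I) P) \<and> x \<noteq> y"
    have "(c x, c y) \<in> sord (seq_append K I) \<and> c x \<noteq> c y"
      using xy e e2 e3 r by (cases x rule: sum3_cases; cases y rule: sum3_cases) (simp_all add: c Field_append)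
    then show "(c x, c y) \<in> sord (seq_append K I)" "c x \<noteq> c y" by blast+
  qed
  then show ?thesis unfolding c_def[abs_def] .
qed

definition no_max :: "'o rel \<Rightarrow> bool" where
  "no_max r \<longleftrightarrow> (\<forall>x\<in>Field r. \<exists>z. (x, z) \<in> r \<and> x \<noteq> z)"

text \<open>A limit along strict final segments behaves like a point beyond every index of
  \<open>r\<close>, so it may be inserted directly to the right of the sequence.\<close>

definition tails :: "'o rel \<Rightarrow> 'o set set" where
  "tails r = (\<lambda>x. {s. (x, s) \<in> r \<and> x \<noteq> s}) ` Field r"

lemma tails_infinite:
  assumes "Linear_order r" "no_max r" "S \<in> tails r" shows "infinite S" "S \<subseteq> Field r"
proof -
  obtain x where x: "x \<in> Field r" "S = {s. (x, s) \<in> r \<and> x \<noteq> s}" using assms(3) by (auto simp: tails_def)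
  show S: "S \<subseteq> Field r" unfolding x by (auto simp: Field_def)
  show "infinite S"
  proof
    assume fin: "finite S"
    have ne: "S \<noteq> {}" using assms(2) x by (auto simp: no_max_def)
    obtain m where m: "m \<in> S" "\<And>s. s \<in> S \<Longrightarrow> (s, m) \<in> r"
      by (rule finite_max[OF assms(1) fin ne S]) blast
    then obtain z where z: "(m, z) \<in> r" "m \<noteq> z" using assms(2) S m(1) unfolding no_max_def by blast
    have "(x, m) \<in> r" "x \<noteq> m" using m(1) x(2) by auto
    then have "(x, z) \<in> r" "x \<noteq> z" using z lin_trans[OF assms(1)] lin_antisym[OF assms(1)] by blast+
    then have "z \<in> S" using x(2) by blast
    then show False using m(2) z lin_antisym[OF assms(1)] by blast
  qed
qed

lemma tails_directed:
  assumes "Linear_order r" "S \<in> tails r" "T \<in> tails r" shows "\<exists>U\<in>tails r. U \<subseteq> S \<inter> T"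
proof -
  obtain x where x: "x \<in> Field r" "S = {s. (x, s) \<in> r \<and> x \<noteq> s}" using assms(2) by (auto simp: tails_def)
  obtain y where y: "y \<in> Field r" "T = {s. (y, s) \<in> r \<and> y \<noteq> s}" using assms(3) by (auto simp: tails_def)
  have sub: "{s. (v, s) \<in> r \<and> v \<noteq> s} \<subseteq> {s. (u, s) \<in> r \<and> u \<noteq> s}" if "(u, v) \<in> r" for u v
    using that lin_trans[OF assms(1)] lin_antisym[OF assms(1)] by blast
  from lin_total[OF assms(1) x(1) y(1)] show ?thesis
  proof
    assume "(x, y) \<in> r"
    from sub[OF this] have "T \<subseteq> S" by (simp only: x(2) y(2))
    then show ?thesis using assms(3) by (intro bexI[of _ T]) auto
  next
    assume "(y, x) \<in> r"
    from sub[OF this] have "S \<subseteq> T" by (simp only: x(2) y(2))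
    then show ?thesis using assms(2) by (intro bexI[of _ S]) auto
  qed
qed

lemma tails_above:
  assumes "Linear_order r" "finite X" "X \<subseteq> Field r" "Field r \<noteq> {}"
  obtains S where "S \<in> tails r" "\<And>x s. x \<in> X \<Longrightarrow> s \<in> S \<Longrightarrow> (x, s) \<in> r \<and> x \<noteq> s"
proof (cases "X = {}")
  case True
  then show thesis using that assms(4) by (auto simp: tails_def)
next
  case False
  obtain m where m: "m \<in> X" "\<And>x. x \<in> X \<Longrightarrow> (x, m) \<in> r" by (rule finite_max[OF assms(1,2) False assms(3)]) blast
  have "(x, s) \<in> r \<and> x \<noteq> s" if "x \<in> X" "s \<in> {s. (m, s) \<in> r \<and> m \<noteq> s}" for x s
    using that m(2)[OF that(1)] lin_trans[OF assms(1)] lin_antisym[OF assms(1)] by blast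
  moreover have "{s. (m, s) \<in> r \<and> m \<noteq> s} \<in> tails r" using m(1) assms(3) by (auto simp: tails_def)
  ultimately show thesis using that by blast
qed

section \<open>Extension, Lascar equivalence and amalgamation\<close>

context monster
begin

lemma small_ran: "ysq y Q \<Longrightarrow> sm (ran (stup Q))"
proof -
  assume Q: "ysq y Q"
  have "sm (dom (stup Q))" unfolding ysqD(4)[OF Q] using ysqD(2,3)[OF Q] by (rule small_Times)
  then have "sm ((the \<circ> stup Q) ` dom (stup Q))" by (rule small_image)
  moreover have "ran (stup Q) \<subseteq> (the \<circ> stup Q) ` dom (stup Q)"
  proof
    fix v assume "v \<in> ran (stup Q)"
    then obtain z where z: "stup Q z = Some v" by (auto simp: ran_def)
    then show "v \<in> (the \<circ> stup Q) ` dom (stup Q)" by (intro image_eqI[of _ _ z]) auto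
  qed
  ultimately show ?thesis by (rule small_subset)
qed

lemma indiscernible_linear: "indiscernible \<kappa> M A Q \<Longrightarrow> Linear_order (sord Q)"
  by (simp add: indiscernible_def is_seq_def)

lemma EM_indiscernible:
  assumes "block M A" "indiscernible \<kappa> M A b" "infinite_seq b" "is_seq \<kappa> Q" "EM_equiv M A Q b"
  shows "indiscernible \<kappa> M A Q"
  using EM_trans[OF assms(5) EM_sym[OF assms(1,5)] indiscernible_linear[OF assms(2)] assms(3)] assms(4)
  by (simp add: indiscernible_iff)

lemma avg_indiscernible:
  assumes A: "hyp_at A a" and N: "Fix M N \<subseteq> Aut M A" and Q: "ysq y Q" "infinite_seq Q" "indiscernible \<kappa> M {idm N} Q"
    and Q': "ysq y Q'" and EM: "EM_equiv M {idm N} Q Q'"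
  shows "indiscernible \<kappa> M A Q'" "EM_equiv M A Q' Q"
proof -
  have sub: "Aut M {idm N} \<subseteq> Aut M A" using N by (simp add: Aut_idm)
  have bl: "block M A" using A by (rule hyp_at_block)
  show E: "EM_equiv M A Q' Q" using EM_sym[OF bl EM_mono[OF sub EM]] .
  show "indiscernible \<kappa> M A Q'"
    by (rule EM_indiscernible[OF bl indiscernible_mono[OF sub Q(3)] Q(2) ysqD(5)[OF Q'] E])
qed

text \<open>A limit of \<open>b\<close> along the trivial family, indexed by \<open>r\<close>:
  finite parts of \<open>r\<close> embed into the infinite order of \<open>b\<close>, and
  indiscernibility over a model makes the choice of embedding immaterial.\<close>

lemma stretch:
  fixes r :: "'q rel" and b :: "('o, 'v, 'm) seqn"
  assumes A: "hyp_at A a" and b: "indiscernible \<kappa> M A b" "infinite_seq b" "ysq y b"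
    and r: "Linear_order r" "sm (Field r)"
  obtains t where "ysq y \<lparr>sord = r, stup = t\<rparr>" "EM_equiv M A \<lparr>sord = r, stup = t\<rparr> b"
proof -
  obtain N where N: "elem_sub M N" "sm N" "Fix M N \<subseteq> Aut M A" "indiscernible \<kappa> M {idm N} b"
    by (rule indiscernible_over_model[OF A b(1,2)])
  have C: "sm (N \<union> ran (stup b))" using N(2) small_ran[OF b(3)] by (rule small_Un)
  have F: "infinite S \<and> S \<subseteq> Field (sord b)" if "S \<in> {Field (sord b)}" for S
    using that b(2) by (simp add: infinite_seq_def)
  have D: "\<exists>U\<in>{Field (sord b)}. U \<subseteq> S \<inter> T" if "S \<in> {Field (sord b)}" "T \<in> {Field (sord b)}" for S T
    using that by simp
  obtain t where t: "avg (N \<union> ran (stup b)) y b {Field (sord b)} r t"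
    by (rule ex_avg[OF b(3) _ F D r C]) simp
  let ?Q = "\<lparr>sord = r, stup = t\<rparr>"
  have Q: "ysq y ?Q" using avg_tuples[OF t] r ysqD(3)[OF b(3)] by (simp add: ysq_def)
  have "EM_equiv M {idm N} b ?Q"
  proof (rule avg_EM[OF t b(3) N(4) N(2) _ _ _ Q, where f = id and d = Inl])
    fix F :: "'q set" assume F: "finite F" "F \<subseteq> Field (sord ?Q)"
    have "{p. (Inl p :: 'q + 'o) \<in> Inl ` F} = F" by auto
    then show "\<exists>S\<in>{Field (sord b)}. \<forall>e. smono r {p. (Inl p :: 'q + 'o) \<in> Inl ` F} (sord b) e \<longrightarrow>
        e ` {p. (Inl p :: 'q + 'o) \<in> Inl ` F} \<subseteq> S \<longrightarrow>
        smono (sord ?Q) F (sord b) (\<lambda>z. case (Inl z :: 'q + 'o) of Inl p \<Rightarrow> id (e p) | Inr k \<Rightarrow> k)"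
      by simp
  qed auto
  then have "EM_equiv M A ?Q b" by (rule avg_indiscernible(2)[OF A N(3) b(3,2) N(4) Q])
  then show thesis using that Q by blast
qed

text \<open>The part of a stretched sequence on the image of \<open>h\<close> has the order and the
  Ehrenfeucht-Mostowski type of \<open>Q\<close>, so it is conjugate to \<open>Q\<close> over
  \<open>A\<close>. Moving the stretched sequence by the conjugating automorphism turns it into an
  extension of \<open>Q\<close>.\<close>

lemma extend:
  fixes r :: "'q rel"
  assumes A: "hyp_at A a" and b: "indiscernible \<kappa> M A b" "infinite_seq b" "ysq y b"
    and Q: "ysq y Q" "EM_equiv M A Q b" and r: "Linear_order r" "sm (Field r)"
    and h: "smono (sord Q) (Field (sord Q)) r h"
  obtains t where "ysq y \<lparr>sord = r, stup = t\<rparr>" "EM_equiv M A \<lparr>sord = r, stup = t\<rparr> b"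
    "indiscernible \<kappa> M A \<lparr>sord = r, stup = t\<rparr>" "\<And>i j. i \<in> Field (sord Q) \<Longrightarrow> t (h i, j) = stup Q (i, j)"
proof -
  have bl: "block M A" using A by (rule hyp_at_block)
  obtain t where t: "ysq y \<lparr>sord = r, stup = t\<rparr>" "EM_equiv M A \<lparr>sord = r, stup = t\<rparr> b"
    by (rule stretch[OF A b r])
  let ?t = "\<lparr>sord = r, stup = t\<rparr>"
  define Q1 where "Q1 = \<lparr>sord = sord Q, stup = \<lambda>(i, j). if i \<in> Field (sord Q) then t (h i, j) else None\<rparr>"
  have hF: "h i \<in> Field r" if "i \<in> Field (sord Q)" for i using h that unfolding smono_def by blast
  have domt: "(i, j) \<in> dom t \<longleftrightarrow> i \<in> Field r \<and> j \<in> y" for i j using ysqD(4)[OF t(1)] by simp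
  have "dom (stup Q1) = Field (sord Q) \<times> y"
  proof (rule set_eqI, clarify)
    show "(i, j) \<in> dom (stup Q1) \<longleftrightarrow> (i, j) \<in> Field (sord Q) \<times> y" for i j
      using domt[of "h i" j] hF[of i] by (auto simp: Q1_def dom_def)
  qed
  then have yQ1: "ysq y Q1" using Q(1) unfolding ysq_def tuples_def by (simp add: Q1_def)
  have "EM_equiv M A Q1 b"
    by (rule EM_pull[where Q = ?t and h = h]) (use h t(2) in \<open>simp_all add: Q1_def\<close>)
  then have EM: "EM_equiv M A Q1 Q"
    using EM_trans[OF _ EM_sym[OF bl Q(2)] ysqD(1)[OF b(3)] b(2)] by blast
  have "conj_over M A (stup Q1) (stup Q)" by (rule EM_conj[OF A yQ1 Q(1) _ EM]) (simp add: Q1_def)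
  then obtain \<sigma> where \<sigma>: "\<sigma> \<in> Aut M A" "act \<sigma> (stup Q1) = stup Q" unfolding conj_over_def by blast
  have eq: "aseq \<sigma> ?t = \<lparr>sord = r, stup = act \<sigma> t\<rparr>" by (simp add: aseq_def)
  have y': "ysq y \<lparr>sord = r, stup = act \<sigma> t\<rparr>" using t(1) unfolding eq[symmetric] by simp
  have E': "EM_equiv M A \<lparr>sord = r, stup = act \<sigma> t\<rparr> b"
    using EM_aseq_left[OF bl \<sigma>(1) t(2)] unfolding eq .
  have I': "indiscernible \<kappa> M A \<lparr>sord = r, stup = act \<sigma> t\<rparr>"
    by (rule EM_indiscernible[OF bl b(1,2) ysqD(5)[OF y'] E'])
  have "act \<sigma> t (h i, j) = stup Q (i, j)" if "i \<in> Field (sord Q)" for i j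
    using fun_cong[OF \<sigma>(2), of "(i, j)"] that by (simp add: act_apply Q1_def)
  then show thesis using that[OF y' E' I'] by blast
qed

lemma Las_equiv_sym: "Las_equiv \<kappa> M A I J \<Longrightarrow> block M A \<Longrightarrow> Las_equiv \<kappa> M A J I"
  unfolding Las_equiv_def using Autf.inverse Autf_Aut Aut_automorphisms act_inv(1) by metis

lemma Las_equiv_trans: "Las_equiv \<kappa> M A I J \<Longrightarrow> Las_equiv \<kappa> M A J K \<Longrightarrow> Las_equiv \<kappa> M A I K"
  unfolding Las_equiv_def using Autf.mult act_comp by metis

lemma append_infinite: "infinite_seq I \<Longrightarrow> infinite_seq (seq_append I J)" "infinite_seq J \<Longrightarrow> infinite_seq (seq_append I J)"
  by (auto simp: infinite_seq_def Field_append finite_Plus_iff)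

text \<open>Over a model for which the concatenation stays indiscernible, both halves have the same
  type, and automorphisms over that model are generators of \<open>Autf\<close>. The common index
  order matches the entries of the two halves.\<close>

lemma Las_equiv_append:
  assumes A: "hyp_at A a" and ind: "indiscernible \<kappa> M A (seq_append P K)" and y: "ysq y P" "ysq y K"
    and inf: "infinite_seq P" and s: "sord P = sord K"
  shows "Las_equiv \<kappa> M A P K"
proof -
  obtain N where N: "elem_sub M N" "sm N" "Fix M N \<subseteq> Aut M A" "indiscernible \<kappa> M {idm N} (seq_append P K)"
    by (rule indiscernible_over_model[OF A ind append_infinite(1)[OF inf]])
  have bl: "block M {idm N}" using hyp_at_block[OF hyp_at_idm[OF N(2)]] .
  have E: "EM_equiv M {idm N} (seq_append P K) (seq_append P K)" using N(4) by (simp add: indiscernible_iff)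
  have "EM_equiv M {idm N} P (seq_append P K)"
    by (rule EM_pull[where h = Inl, OF _ smono_Inl E]) simp
  from EM_sym[OF bl this] have "EM_equiv M {idm N} (seq_append P K) P" .
  then have "EM_equiv M {idm N} K P"
    by (intro EM_pull[where h = Inr and Q = "seq_append P K"] smono_Inr) simp_all
  then have "EM_equiv M {idm N} P K" by (rule EM_sym[OF bl])
  from EM_conj[OF hyp_at_idm[OF N(2)] y s this] obtain \<sigma> where \<sigma>: "\<sigma> \<in> Fix M N" "act \<sigma> (stup P) = stup K"
    unfolding conj_over_def Aut_idm by blast
  then have "\<sigma> \<in> Autf \<kappa> M A" using Fix_Autf[OF N(1-3)] by blast
  then show ?thesis unfolding Las_equiv_def using s \<sigma>(2) by blast
qed

lemma seq_sim_sym: "seq_sim \<kappa> M A I J \<Longrightarrow> seq_sim \<kappa> M A J I"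
  by (auto simp: seq_sim_def)

lemma seq_sim_ysq:
  assumes "seq_sim \<kappa> M A I J" obtains y where "ysq y I" "ysq y J"
proof -
  have "is_seq \<kappa> I" "is_seq \<kappa> J" "is_seq \<kappa> (seq_append I J) \<or> is_seq \<kappa> (seq_append J I)"
    using assms by (auto simp: seq_sim_def indiscernible_def)
  then show thesis using append_ysq[of I J] append_ysq[of J I] that by metis
qed

lemma seq_simI:
  assumes "ysq y I" "ysq y J" "infinite_seq I" "infinite_seq J"
    "indiscernible \<kappa> M A (seq_append I J) \<or> indiscernible \<kappa> M A (seq_append J I)"
  shows "seq_sim \<kappa> M A I J"
  using assms ysqD(5) by (auto simp: seq_sim_def)

lemma indiscernible_append_left:
  assumes "block M A" "indiscernible \<kappa> M A (seq_append I J)" "is_seq \<kappa> I" shows "indiscernible \<kappa> M A I"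
  by (rule indiscernible_pull[where h = Inl, OF _ smono_Inl assms(3,2,1)]) simp

lemma indiscernible_append_right:
  assumes "block M A" "indiscernible \<kappa> M A (seq_append I J)" "is_seq \<kappa> J" shows "indiscernible \<kappa> M A J"
  by (rule indiscernible_pull[where h = Inr, OF _ smono_Inr assms(3,2,1)]) simp

lemma seq_sim_indiscernible: "block M A \<Longrightarrow> seq_sim \<kappa> M A I J \<Longrightarrow> indiscernible \<kappa> M A I"
  unfolding seq_sim_def using indiscernible_append_left indiscernible_append_right by blast

lemma seq_sim_Las:
  assumes A: "hyp_at A a" and sim: "seq_sim \<kappa> M A P K" and s: "sord P = sord K"
  shows "Las_equiv \<kappa> M A P K"
proof -
  obtain y where y: "ysq y P" "ysq y K" by (rule seq_sim_ysq[OF sim])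
  have "indiscernible \<kappa> M A (seq_append P K) \<or> indiscernible \<kappa> M A (seq_append K P)"
    and inf: "infinite_seq P" "infinite_seq K" using sim by (simp_all add: seq_sim_def)
  then show ?thesis
    using Las_equiv_append[OF A _ y inf(1) s] Las_equiv_append[OF A _ y(2,1) inf(2) s[symmetric]]
      Las_equiv_sym[OF _ hyp_at_block[OF A]] by blast
qed

lemma seq_sim_over_model:
  assumes A: "hyp_at A a" and sim: "seq_sim \<kappa> M A I K"
  obtains N where "sm N" "Fix M N \<subseteq> Aut M A"
    "indiscernible \<kappa> M {idm N} (seq_append I K) \<or> indiscernible \<kappa> M {idm N} (seq_append K I)"
proof -
  have "indiscernible \<kappa> M A (seq_append I K) \<or> indiscernible \<kappa> M A (seq_append K I)"
    and inf: "infinite_seq I" using sim by (simp_all add: seq_sim_def)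
  then show thesis
    using indiscernible_over_model[OF A, of "seq_append I K"] indiscernible_over_model[OF A, of "seq_append K I"]
      append_infinite[OF inf] that by metis
qed

lemma ran_append: "ran (stup (seq_append I K)) \<subseteq> ran (stup I) \<union> ran (stup K)"
proof
  fix v assume "v \<in> ran (stup (seq_append I K))"
  then obtain z j where z: "stup (seq_append I K) (z, j) = Some v" by (auto simp: ran_def)
  then show "v \<in> ran (stup I) \<union> ran (stup K)" by (cases z) (auto intro: ranI)
qed

lemma avg_seq_sim:
  fixes I K :: "('o, 'v, 'm) seqn" and r :: "'o rel"
  assumes A: "hyp_at A a" and N: "sm N" "Fix M N \<subseteq> Aut M A"
    "indiscernible \<kappa> M {idm N} (seq_append I K) \<or> indiscernible \<kappa> M {idm N} (seq_append K I)"
    and y: "ysq y I" "ysq y K" and inf: "infinite_seq I" "infinite_seq K" "infinite (Field r)"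
    and r: "Linear_order r" "sm (Field r)" and av: "avg C y I {Field (sord I)} r t"
    and C: "N \<subseteq> C" "ran (stup I) \<subseteq> C" "ran (stup K) \<subseteq> C"
  shows "seq_sim \<kappa> M A \<lparr>sord = r, stup = t\<rparr> K"
proof -
  let ?P = "\<lparr>sord = r, stup = t\<rparr>"
  have P: "ysq y ?P" using avg_tuples[OF av] r ysqD(3)[OF y(1)] by (simp add: ysq_def)
  have infP: "infinite_seq ?P" using inf(3) by (simp add: infinite_seq_def)
  from N(3) have "indiscernible \<kappa> M A (seq_append ?P K) \<or> indiscernible \<kappa> M A (seq_append K ?P)"
  proof
    assume ind: "indiscernible \<kappa> M {idm N} (seq_append I K)"
    have "EM_equiv M {idm N} (seq_append I K) (seq_append ?P K)"
    proof (rule avg_EM[OF av ysq_append[OF y] ind N(1) C(1) _ _ ysq_append[OF P y(2)],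
          where f = Inl and d = "case_sum Inl (Inr \<circ> Inr)"])
      show "ran (stup (seq_append I K)) \<subseteq> C" using ran_append[of I K] C(2,3) by blast
      fix F assume F: "finite F" "F \<subseteq> Field (sord (seq_append ?P K))"
      show "\<exists>S\<in>{Field (sord I)}. \<forall>e. smono r {p. Inl p \<in> case_sum Inl (Inr \<circ> Inr) ` F} (sord I) e \<longrightarrow>
          e ` {p. Inl p \<in> case_sum Inl (Inr \<circ> Inr) ` F} \<subseteq> S \<longrightarrow>
          smono (sord (seq_append ?P K)) F (sord (seq_append I K))
            (\<lambda>z. case case_sum Inl (Inr \<circ> Inr) z of Inl p \<Rightarrow> Inl (e p) | Inr k \<Rightarrow> k)"
        using smono_ext_left[OF _ F(2)] by auto
    qed (auto simp: Field_append)
    then show ?thesis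
      using avg_indiscernible(1)[OF A N(2) ysq_append[OF y] append_infinite(1)[OF inf(1)] ind ysq_append[OF P y(2)]] by blast
  next
    assume ind: "indiscernible \<kappa> M {idm N} (seq_append K I)"
    have "EM_equiv M {idm N} (seq_append K I) (seq_append K ?P)"
    proof (rule avg_EM[OF av ysq_append[OF y(2,1)] ind N(1) C(1) _ _ ysq_append[OF y(2) P],
          where f = Inr and d = "case_sum (Inr \<circ> Inl) Inl"])
      show "ran (stup (seq_append K I)) \<subseteq> C" using ran_append[of K I] C(2,3) by blast
      fix F assume F: "finite F" "F \<subseteq> Field (sord (seq_append K ?P))"
      show "\<exists>S\<in>{Field (sord I)}. \<forall>e. smono r {p. Inl p \<in> case_sum (Inr \<circ> Inl) Inl ` F} (sord I) e \<longrightarrow>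
          e ` {p. Inl p \<in> case_sum (Inr \<circ> Inl) Inl ` F} \<subseteq> S \<longrightarrow>
          smono (sord (seq_append K ?P)) F (sord (seq_append K I))
            (\<lambda>z. case case_sum (Inr \<circ> Inl) Inl z of Inl p \<Rightarrow> Inr (e p) | Inr k \<Rightarrow> k)"
        using smono_ext_right[OF _ F(2)] by auto
    qed (auto simp: Field_append)
    then show ?thesis
      using avg_indiscernible(1)[OF A N(2) ysq_append[OF y(2,1)] append_infinite(2)[OF inf(1)] ind ysq_append[OF y(2) P]] by blast
  qed
  then show ?thesis by (rule seq_simI[OF P y(2) infP inf(2)])
qed

text \<open>One limit of \<open>J\<close> serves both sides because its defining conditions take
  parameters from both models and both sequences at once. \<open>K1\<close> and \<open>K2\<close>
  may be unrelated and may lie on different sides of \<open>J\<close>.\<close>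

lemma amalgamate:
  fixes J K1 K2 :: "('o, 'v, 'm) seqn" and r :: "'o rel"
  assumes A: "hyp_at A a" and sim: "seq_sim \<kappa> M A J K1" "seq_sim \<kappa> M A J K2"
    and r: "Linear_order r" "sm (Field r)" "infinite (Field r)"
  obtains t where "seq_sim \<kappa> M A \<lparr>sord = r, stup = t\<rparr> K1" "seq_sim \<kappa> M A \<lparr>sord = r, stup = t\<rparr> K2"
proof -
  obtain y where y: "ysq y J" "ysq y K1" by (rule seq_sim_ysq[OF sim(1)])
  obtain y' where y': "ysq y' J" "ysq y' K2" by (rule seq_sim_ysq[OF sim(2)])
  have inf: "infinite_seq J" "infinite_seq K1" "infinite_seq K2" using sim by (simp_all add: seq_sim_def)
  have "Field (sord J) \<noteq> {}" using inf(1) by (auto simp: infinite_seq_def)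
  moreover have "Field (sord J) \<times> y = Field (sord J) \<times> y'" using ysqD(4)[OF y(1)] ysqD(4)[OF y'(1)] by simp
  ultimately have "y' = y" by (auto simp: times_eq_iff)
  then have y2: "ysq y K2" using y'(2) by simp
  obtain N1 where N1: "sm N1" "Fix M N1 \<subseteq> Aut M A"
    "indiscernible \<kappa> M {idm N1} (seq_append J K1) \<or> indiscernible \<kappa> M {idm N1} (seq_append K1 J)"
    by (rule seq_sim_over_model[OF A sim(1)])
  obtain N2 where N2: "sm N2" "Fix M N2 \<subseteq> Aut M A"
    "indiscernible \<kappa> M {idm N2} (seq_append J K2) \<or> indiscernible \<kappa> M {idm N2} (seq_append K2 J)"
    by (rule seq_sim_over_model[OF A sim(2)])
  define C where "C = N1 \<union> N2 \<union> ran (stup J) \<union> ran (stup K1) \<union> ran (stup K2)"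
  have C: "sm C" unfolding C_def using N1(1) N2(1) small_ran[OF y(1)] small_ran[OF y(2)] small_ran[OF y2]
    by (intro small_Un)
  have F: "infinite S \<and> S \<subseteq> Field (sord J)" if "S \<in> {Field (sord J)}" for S
    using that inf(1) by (simp add: infinite_seq_def)
  have D: "\<exists>U\<in>{Field (sord J)}. U \<subseteq> S \<inter> T" if "S \<in> {Field (sord J)}" "T \<in> {Field (sord J)}" for S T
    using that by simp
  obtain t where t: "avg C y J {Field (sord J)} r t"
    by (rule ex_avg[OF y(1) _ F D r(1,2) C]) simp
  have "seq_sim \<kappa> M A \<lparr>sord = r, stup = t\<rparr> K1"
    by (rule avg_seq_sim[OF A N1 y inf(1,2) r(3,1,2) t]) (auto simp: C_def)
  moreover have "seq_sim \<kappa> M A \<lparr>sord = r, stup = t\<rparr> K2"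
    by (rule avg_seq_sim[OF A N2 y(1) y2 inf(1,3) r(3,1,2) t]) (auto simp: C_def)
  ultimately show thesis by (rule that)
qed

text \<open>\<open>P\<close> always comes right after \<open>I\<close>; only the side of
  \<open>K\<close> varies, since \<open>seq_sim\<close> leaves it open.\<close>

definition tri :: "('u \<rightharpoonup> 'm) set \<Rightarrow> ('o, 'v, 'm) seqn \<Rightarrow> ('o, 'v, 'm) seqn \<Rightarrow> ('o, 'v, 'm) seqn \<Rightarrow> bool" where
  "tri A I P K \<longleftrightarrow> indiscernible \<kappa> M A (seq_append (seq_append I P) K) \<or> indiscernible \<kappa> M A (seq_append (seq_append K I) P)"

lemma avg_tri:
  fixes I K :: "('o, 'v, 'm) seqn" and r :: "'o rel"
  assumes A: "hyp_at A a" and N: "sm N" "Fix M N \<subseteq> Aut M A"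
    "indiscernible \<kappa> M {idm N} (seq_append I K) \<or> indiscernible \<kappa> M {idm N} (seq_append K I)"
    and y: "ysq y I" "ysq y K" and inf: "infinite_seq I"
    and r: "Linear_order r" "sm (Field r)" and av: "avg C y I (tails (sord I)) r t"
    and C: "N \<subseteq> C" "ran (stup I) \<subseteq> C" "ran (stup K) \<subseteq> C"
  shows "tri A I \<lparr>sord = r, stup = t\<rparr> K"
proof -
  let ?P = "\<lparr>sord = r, stup = t\<rparr>"
  have P: "ysq y ?P" using avg_tuples[OF av] r ysqD(3)[OF y(1)] by (simp add: ysq_def)
  have lin: "Linear_order (sord I)" by (rule ysqD(1)[OF y(1)])
  have ne: "Field (sord I) \<noteq> {}" using inf by (auto simp: infinite_seq_def)
  from N(3) show ?thesis unfolding tri_def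
  proof
    assume ind: "indiscernible \<kappa> M {idm N} (seq_append I K)"
    let ?d = "case_sum (case_sum (Inr \<circ> Inl) Inl) (Inr \<circ> Inr)"
    let ?Q = "seq_append (seq_append I ?P) K"
    have yQ: "ysq y ?Q" by (intro ysq_append y P)
    have "EM_equiv M {idm N} (seq_append I K) ?Q"
    proof (rule avg_EM[OF av ysq_append[OF y] ind N(1) C(1) _ _ yQ, where f = Inl and d = ?d])
      show "ran (stup (seq_append I K)) \<subseteq> C" using ran_append[of I K] C(2,3) by blast
      fix F assume F: "finite F" "F \<subseteq> Field (sord ?Q)"
      let ?X = "{i. Inl (Inl i) \<in> F}"
      have "?X = (Inl \<circ> Inl) -` F" by auto
      then have "finite ?X" using F(1) by (simp add: finite_vimageI inj_compose)
      moreover have "?X \<subseteq> Field (sord I)" using F(2) by (auto simp: Field_append)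
      ultimately obtain S where S: "S \<in> tails (sord I)" "\<And>x s. x \<in> ?X \<Longrightarrow> s \<in> S \<Longrightarrow> (x, s) \<in> sord I \<and> x \<noteq> s"
        using tails_above[OF lin _ _ ne, of ?X] by blast
      have "smono (sord ?Q) F (sord (seq_append I K)) (\<lambda>z. case ?d z of Inl p \<Rightarrow> Inl (e p) | Inr k \<Rightarrow> k)"
        if e: "smono r {p. Inl p \<in> ?d ` F} (sord I) e" "e ` {p. Inl p \<in> ?d ` F} \<subseteq> S" for e
      proof (rule smono_ext_mid[OF e(1) F(2)])
        fix i p assume i: "Inl (Inl i) \<in> F" and p: "p \<in> {p. Inl p \<in> ?d ` F}"
        have "e p \<in> S" using e(2) p by blast
        then show "(i, e p) \<in> sord I \<and> i \<noteq> e p" using S(2)[of i "e p"] i by simp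
      qed simp
      then show "\<exists>S\<in>tails (sord I). \<forall>e. smono r {p. Inl p \<in> ?d ` F} (sord I) e \<longrightarrow>
          e ` {p. Inl p \<in> ?d ` F} \<subseteq> S \<longrightarrow>
          smono (sord ?Q) F (sord (seq_append I K)) (\<lambda>z. case ?d z of Inl p \<Rightarrow> Inl (e p) | Inr k \<Rightarrow> k)"
        using S(1) by blast
    qed (auto simp: Field_append)
    then show "indiscernible \<kappa> M A ?Q \<or> indiscernible \<kappa> M A (seq_append (seq_append K I) ?P)"
      using avg_indiscernible(1)[OF A N(2) ysq_append[OF y] append_infinite(1)[OF inf] ind yQ] by blast
  next
    assume ind: "indiscernible \<kappa> M {idm N} (seq_append K I)"
    let ?d = "case_sum Inr Inl"
    let ?Q = "seq_append (seq_append K I) ?P"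
    have yQ: "ysq y ?Q" by (intro ysq_append y P)
    have "EM_equiv M {idm N} (seq_append K I) ?Q"
    proof (rule avg_EM[OF av ysq_append[OF y(2,1)] ind N(1) C(1) _ _ yQ, where f = Inr and d = ?d])
      show "ran (stup (seq_append K I)) \<subseteq> C" using ran_append[of K I] C(2,3) by blast
      fix F assume F: "finite F" "F \<subseteq> Field (sord ?Q)"
      let ?X = "{i. Inl (Inr i) \<in> F}"
      have "?X = (Inl \<circ> Inr) -` F" by auto
      then have "finite ?X" using F(1) by (simp add: finite_vimageI inj_compose)
      moreover have "?X \<subseteq> Field (sord I)" using F(2) by (auto simp: Field_append)
      ultimately obtain S where S: "S \<in> tails (sord I)" "\<And>x s. x \<in> ?X \<Longrightarrow> s \<in> S \<Longrightarrow> (x, s) \<in> sord I \<and> x \<noteq> s"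
        using tails_above[OF lin _ _ ne, of ?X] by blast
      have "smono (sord ?Q) F (sord (seq_append K I)) (\<lambda>z. case ?d z of Inl p \<Rightarrow> Inr (e p) | Inr k \<Rightarrow> k)"
        if e: "smono r {p. Inl p \<in> ?d ` F} (sord I) e" "e ` {p. Inl p \<in> ?d ` F} \<subseteq> S" for e
      proof (rule smono_ext_end[OF e(1) F(2)])
        fix i p assume i: "Inl (Inr i) \<in> F" and p: "p \<in> {p. Inl p \<in> ?d ` F}"
        have "e p \<in> S" using e(2) p by blast
        then show "(i, e p) \<in> sord I \<and> i \<noteq> e p" using S(2)[of i "e p"] i by simp
      qed simp
      then show "\<exists>S\<in>tails (sord I). \<forall>e. smono r {p. Inl p \<in> ?d ` F} (sord I) e \<longrightarrow>
          e ` {p. Inl p \<in> ?d ` F} \<subseteq> S \<longrightarrow>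
          smono (sord ?Q) F (sord (seq_append K I)) (\<lambda>z. case ?d z of Inl p \<Rightarrow> Inr (e p) | Inr k \<Rightarrow> k)"
        using S(1) by blast
    qed (auto simp: Field_append)
    then show "indiscernible \<kappa> M A (seq_append (seq_append I ?P) K) \<or> indiscernible \<kappa> M A ?Q"
      using avg_indiscernible(1)[OF A N(2) ysq_append[OF y(2,1)] append_infinite(2)[OF inf] ind yQ] by blast
  qed
qed

text \<open>In contrast to \<open>amalgamate\<close>, the limit is taken along final segments. It
  then continues \<open>I\<close> as well, so that \<open>I\<close>, the limit and either
  \<open>K1\<close> or \<open>K2\<close> form a single indiscernible sequence, inside which
  boundedness can be exchanged.\<close>

lemma amalgamate_tri:
  fixes I K1 K2 :: "('o, 'v, 'm) seqn" and r :: "'o rel"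
  assumes A: "hyp_at A a" and sim: "seq_sim \<kappa> M A I K1" "seq_sim \<kappa> M A I K2" and nm: "no_max (sord I)"
    and r: "Linear_order r" "sm (Field r)" and y: "ysq y I" "ysq y K1" "ysq y K2"
  obtains t where "ysq y \<lparr>sord = r, stup = t\<rparr>" "tri A I \<lparr>sord = r, stup = t\<rparr> K1" "tri A I \<lparr>sord = r, stup = t\<rparr> K2"
proof -
  have inf: "infinite_seq I" using sim by (simp add: seq_sim_def)
  obtain N1 where N1: "sm N1" "Fix M N1 \<subseteq> Aut M A"
    "indiscernible \<kappa> M {idm N1} (seq_append I K1) \<or> indiscernible \<kappa> M {idm N1} (seq_append K1 I)"
    by (rule seq_sim_over_model[OF A sim(1)])
  obtain N2 where N2: "sm N2" "Fix M N2 \<subseteq> Aut M A"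
    "indiscernible \<kappa> M {idm N2} (seq_append I K2) \<or> indiscernible \<kappa> M {idm N2} (seq_append K2 I)"
    by (rule seq_sim_over_model[OF A sim(2)])
  define C where "C = N1 \<union> N2 \<union> ran (stup I) \<union> ran (stup K1) \<union> ran (stup K2)"
  have C: "sm C" unfolding C_def using N1(1) N2(1) small_ran[OF y(1)] small_ran[OF y(2)] small_ran[OF y(3)]
    by (intro small_Un)
  have lin: "Linear_order (sord I)" by (rule ysqD(1)[OF y(1)])
  have ne: "tails (sord I) \<noteq> {}" using inf by (auto simp: infinite_seq_def tails_def)
  have F: "infinite S \<and> S \<subseteq> Field (sord I)" if "S \<in> tails (sord I)" for S
    using tails_infinite[OF lin nm that] by blast
  have D: "\<exists>U\<in>tails (sord I). U \<subseteq> S \<inter> T" if "S \<in> tails (sord I)" "T \<in> tails (sord I)" for S T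
    using tails_directed[OF lin that] .
  obtain t where t: "avg C y I (tails (sord I)) r t"
    by (rule ex_avg[OF y(1) ne F D r C])
  have "ysq y \<lparr>sord = r, stup = t\<rparr>" using avg_tuples[OF t] r ysqD(3)[OF y(1)] by (simp add: ysq_def)
  moreover have "tri A I \<lparr>sord = r, stup = t\<rparr> K1"
    by (rule avg_tri[OF A N1 y(1,2) inf r t]) (auto simp: C_def)
  moreover have "tri A I \<lparr>sord = r, stup = t\<rparr> K2"
    by (rule avg_tri[OF A N2 y(1,3) inf r t]) (auto simp: C_def)
  ultimately show thesis by (rule that)
qed

end

section \<open>Equivalence classes of sequences\<close>

lemma aseq_inv:
  assumes "\<sigma> \<in> automorphisms M" shows "aseq (inv \<sigma>) (aseq \<sigma> Q) = Q" "aseq \<sigma> (aseq (inv \<sigma>) Q) = Q"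
  by (simp_all add: aseq_def act_inv[OF assms])

lemma aseq_record: "aseq \<sigma> \<lparr>sord = r, stup = t\<rparr> = \<lparr>sord = r, stup = act \<sigma> t\<rparr>"
  by (simp add: aseq_def)

lemma infinite_seq_aseq [simp]: "infinite_seq (aseq \<sigma> Q) = infinite_seq Q"
  by (simp add: infinite_seq_def)

lemma seq_sim_aseq:
  assumes "\<sigma> \<in> automorphisms M" "seq_sim \<kappa> M A I J"
  shows "seq_sim \<kappa> M (act \<sigma> ` A) (aseq \<sigma> I) (aseq \<sigma> J)"
  using assms(2) indiscernible_aseq[OF assms(1), of \<kappa> A "seq_append I J"]
    indiscernible_aseq[OF assms(1), of \<kappa> A "seq_append J I"]
  unfolding seq_sim_def aseq_append by auto

lemma seq_approx_aseq:
  assumes "\<sigma> \<in> automorphisms M" "seq_approx \<kappa> M A I J"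
  shows "seq_approx \<kappa> M (act \<sigma> ` A) (aseq \<sigma> I) (aseq \<sigma> J)"
  using assms(2) unfolding seq_approx_def
proof (induction rule: tranclp_induct)
  case (base y)
  show ?case by (rule tranclp.r_into_trancl) (rule seq_sim_aseq[OF assms(1) base])
next
  case (step y z)
  show ?case by (rule tranclp.trancl_into_trancl[OF step.IH]) (rule seq_sim_aseq[OF assms(1) step.hyps(2)])
qed

lemma seq_approx_sym: "seq_approx \<kappa> M A I J \<Longrightarrow> seq_approx \<kappa> M A J I"
  unfolding seq_approx_def
proof (induction rule: tranclp_induct)
  case (base y)
  then show ?case by (intro tranclp.r_into_trancl) (auto simp: seq_sim_def)
next
  case (step y z)
  then show ?case by (intro tranclp_into_tranclp2[of _ z y]) (auto simp: seq_sim_def)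
qed

lemma seq_approx_trans: "seq_approx \<kappa> M A I J \<Longrightarrow> seq_approx \<kappa> M A J K \<Longrightarrow> seq_approx \<kappa> M A I K"
  unfolding seq_approx_def by (rule tranclp_trans)

lemma seq_sim_approx: "seq_sim \<kappa> M A I J \<Longrightarrow> seq_approx \<kappa> M A I J"
  unfolding seq_approx_def by (rule tranclp.r_into_trancl)

text \<open>\<open>EA\<close> and the representative \<open>a\<close> are kept beside the class
  \<open>A\<close>, because the relation defining the class of a sequence lets the parameter vary
  over all classes of \<open>EA\<close>.\<close>

locale hyper_params = monster \<kappa> M
  for \<kappa> :: "'k rel" and M :: "('f, 'p, 'm, 'z) struct_scheme" +
  fixes X :: "'u set" and EA :: "('u \<rightharpoonup> 'm) rel" and a :: "'u \<rightharpoonup> 'm" and A :: "('u \<rightharpoonup> 'm) set"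
  assumes A_def: "A = EA `` {a}" and hyp: "hyp_at A a" and eqv: "equiv (tuples X) EA"
    and invA: "aut_invariant M EA" and smX: "sm X" and aX: "a \<in> tuples X"
begin

lemma blockA: "block M A"
  using hyp by (rule hyp_at_block)

lemma A_ne: "A \<noteq> {}"
  using blockA by (simp add: block_def)

lemma Aut_AI: "Aut M (upair A {s}) = {\<sigma> \<in> Aut M A. act \<sigma> s = s}"
  by (rule Aut_upair[OF A_ne])

lemma Aut_aut: "\<sigma> \<in> Aut M A \<Longrightarrow> \<sigma> \<in> automorphisms M"
  by (rule Aut_automorphisms)

lemma seq_sim_Aut: "\<sigma> \<in> Aut M A \<Longrightarrow> seq_sim \<kappa> M A I J \<Longrightarrow> seq_sim \<kappa> M A (aseq \<sigma> I) (aseq \<sigma> J)"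
  using seq_sim_aseq[OF Aut_aut, of \<sigma> \<kappa> A I J] Aut_image[OF blockA] by simp

lemma indiscernible_Aut: "\<sigma> \<in> Aut M A \<Longrightarrow> indiscernible \<kappa> M A Q \<Longrightarrow> indiscernible \<kappa> M A (aseq \<sigma> Q)"
  using indiscernible_aseq[OF Aut_aut, of \<sigma> \<kappa> A Q] Aut_image[OF blockA] by simp

lemma approx_rel_iff:
  "(case_sum c s, case_sum d t) \<in> approx_rel \<kappa> M EA r y \<longleftrightarrow>
     (c, d) \<in> EA \<and> s \<in> tuples (Field r \<times> y) \<and> t \<in> tuples (Field r \<times> y) \<and>
     (s = t \<or> seq_approx \<kappa> M (EA `` {c}) \<lparr>sord = r, stup = s\<rparr> \<lparr>sord = r, stup = t\<rparr>)"
  unfolding approx_rel_def by (auto simp: case_sum_eq_iff)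

lemma approx_rel_tuples:
  "approx_rel \<kappa> M EA r y \<subseteq> tuples (X <+> Field r \<times> y) \<times> tuples (X <+> Field r \<times> y)"
  unfolding approx_rel_def using equiv_tuples_subset[OF eqv] by (auto simp: case_sum_tuples)

lemma approx_rel_equiv:
  fixes y :: "'v set"
  shows "equiv (tuples (X <+> Field r \<times> y)) (approx_rel \<kappa> M EA r y)"
proof (rule equivI)
  let ?E = "approx_rel \<kappa> M EA r y"
  show "?E \<subseteq> tuples (X <+> Field r \<times> y) \<times> tuples (X <+> Field r \<times> y)" by (rule approx_rel_tuples)
  have split: "\<exists>c s. w = case_sum c s" for w :: "'u + 'k \<times> 'v \<rightharpoonup> 'm" using sum_fun_split[of w] by blast
  show "refl_on (tuples (X <+> Field r \<times> y)) ?E"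
    unfolding refl_on_def
  proof
    fix w :: "'u + 'k \<times> 'v \<rightharpoonup> 'm" assume w: "w \<in> tuples (X <+> Field r \<times> y)"
    obtain c s where cs: "w = case_sum c s" using split by blast
    have "c \<in> tuples X" "s \<in> tuples (Field r \<times> y)" using w unfolding cs by (simp_all add: case_sum_tuples)
    moreover have "(c, c) \<in> EA" using eqv calculation(1) by (meson equiv_def refl_onD)
    ultimately show "(w, w) \<in> ?E" unfolding cs approx_rel_iff by simp
  qed
  show "sym ?E"
  proof (rule symI)
    fix v w assume vw: "(v, w) \<in> ?E"
    obtain c s where v: "v = case_sum c s" using split by blast
    obtain d t where w: "w = case_sum d t" using split by blast
    have *: "(c, d) \<in> EA" "s \<in> tuples (Field r \<times> y)" "t \<in> tuples (Field r \<times> y)"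
      "s = t \<or> seq_approx \<kappa> M (EA `` {c}) \<lparr>sord = r, stup = s\<rparr> \<lparr>sord = r, stup = t\<rparr>"
      using vw unfolding v w approx_rel_iff by blast+
    have "EA `` {c} = EA `` {d}" using equiv_class_eq[OF eqv *(1)] .
    moreover have "(d, c) \<in> EA" using eqv *(1) by (meson equiv_def symD)
    ultimately show "(w, v) \<in> ?E" unfolding v w approx_rel_iff using * seq_approx_sym by metis
  qed
  show "trans ?E"
  proof (rule transI)
    fix u v w assume uv: "(u, v) \<in> ?E" and vw: "(v, w) \<in> ?E"
    obtain b q where u: "u = case_sum b q" using split by blast
    obtain c s where v: "v = case_sum c s" using split by blast
    obtain d t where w: "w = case_sum d t" using split by blast
    have 1: "(b, c) \<in> EA" "q \<in> tuples (Field r \<times> y)" "s \<in> tuples (Field r \<times> y)"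
      "q = s \<or> seq_approx \<kappa> M (EA `` {b}) \<lparr>sord = r, stup = q\<rparr> \<lparr>sord = r, stup = s\<rparr>"
      using uv unfolding u v approx_rel_iff by blast+
    have 2: "(c, d) \<in> EA" "t \<in> tuples (Field r \<times> y)"
      "s = t \<or> seq_approx \<kappa> M (EA `` {c}) \<lparr>sord = r, stup = s\<rparr> \<lparr>sord = r, stup = t\<rparr>"
      using vw unfolding v w approx_rel_iff by blast+
    have "EA `` {b} = EA `` {c}" using equiv_class_eq[OF eqv 1(1)] .
    moreover have "(b, d) \<in> EA" using eqv 1(1) 2(1) by (meson equiv_def transD)
    ultimately show "(u, w) \<in> ?E" unfolding u w approx_rel_iff using 1 2 seq_approx_trans by metis
  qed
qed

lemma approx_rel_invariant: "aut_invariant M (approx_rel \<kappa> M EA r y)"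
  unfolding aut_invariant_def
proof (intro ballI allI impI)
  fix \<sigma> v w assume \<sigma>: "\<sigma> \<in> automorphisms M" and "(v, w) \<in> approx_rel \<kappa> M EA r y"
  then obtain c d s t where vw: "v = case_sum c s" "w = case_sum d t" and *: "(c, d) \<in> EA"
    "s \<in> tuples (Field r \<times> y)" "t \<in> tuples (Field r \<times> y)"
    "s = t \<or> seq_approx \<kappa> M (EA `` {c}) \<lparr>sord = r, stup = s\<rparr> \<lparr>sord = r, stup = t\<rparr>"
    unfolding approx_rel_def by blast
  have "act \<sigma> s = act \<sigma> t \<or> seq_approx \<kappa> M (EA `` {act \<sigma> c}) \<lparr>sord = r, stup = act \<sigma> s\<rparr> \<lparr>sord = r, stup = act \<sigma> t\<rparr>"
    using *(4) seq_approx_aseq[OF \<sigma>, of \<kappa> "EA `` {c}" "\<lparr>sord = r, stup = s\<rparr>" "\<lparr>sord = r, stup = t\<rparr>"]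
    unfolding aseq_record act_image_class[OF eqv invA \<sigma>] by blast
  then show "(act \<sigma> v, act \<sigma> w) \<in> approx_rel \<kappa> M EA r y"
    unfolding vw act_case_sum approx_rel_iff using * aut_invariantD[OF invA \<sigma> *(1)] by simp
qed

lemma snd_dom:
  assumes "ysq y b" "infinite_seq b" shows "snd ` dom (stup b) = y"
proof -
  have "Field (sord b) \<noteq> {}" using assms(2) by (auto simp: infinite_seq_def)
  then show ?thesis unfolding ysqD(4)[OF assms(1)] by simp
qed

lemma approx_class_eq:
  "ysq y b \<Longrightarrow> infinite_seq b \<Longrightarrow> approx_class \<kappa> M EA a b = approx_rel \<kappa> M EA (sord b) y `` {case_sum a (stup b)}"
  by (simp add: approx_class_def snd_dom)

lemma approx_class_mem:
  assumes "ysq y b" shows "case_sum a (stup b) \<in> tuples (X <+> Field (sord b) \<times> y)"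
  using aX assms by (simp add: case_sum_tuples ysq_def)

lemma approx_class_ultraimaginary:
  assumes "ysq y b" "infinite_seq b" shows "ultraimaginary \<kappa> M (approx_class \<kappa> M EA a b)"
  unfolding approx_class_eq[OF assms] ultraimaginary_def
proof (intro exI conjI)
  show sm: "sm (X <+> Field (sord b) \<times> y)"
    using smX ysqD(2,3)[OF assms(1)] by (intro small_Plus small_Times)
  show "invariant_equiv M (X <+> Field (sord b) \<times> y) (approx_rel \<kappa> M EA (sord b) y)"
    by (rule invariant_equivI[OF sm approx_rel_equiv approx_rel_invariant])
  show "case_sum a (stup b) \<in> tuples (X <+> Field (sord b) \<times> y)" by (rule approx_class_mem[OF assms(1)])
qed simp

lemma approx_class_eq_iff:
  assumes "ysq y b" "ysq y b'" "sord b = sord b'" "infinite_seq b"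
  shows "approx_class \<kappa> M EA a b = approx_class \<kappa> M EA a b' \<longleftrightarrow> stup b = stup b' \<or> seq_approx \<kappa> M A b b'"
proof -
  have inf: "infinite_seq b'" using assms(3,4) by (simp add: infinite_seq_def)
  have rec: "\<lparr>sord = sord b, stup = stup b\<rparr> = b" "\<lparr>sord = sord b, stup = stup b'\<rparr> = b'"
    using assms(3) by simp_all
  have "approx_class \<kappa> M EA a b = approx_class \<kappa> M EA a b' \<longleftrightarrow>
      (case_sum a (stup b), case_sum a (stup b')) \<in> approx_rel \<kappa> M EA (sord b) y"
    unfolding approx_class_eq[OF assms(1,4)] approx_class_eq[OF assms(2) inf] assms(3)[symmetric]
    using approx_class_mem[OF assms(1)] approx_class_mem[OF assms(2)] assms(3)
    by (intro eq_equiv_class_iff[OF approx_rel_equiv]) simp_all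
  also have "\<dots> \<longleftrightarrow> stup b = stup b' \<or> seq_approx \<kappa> M A b b'"
    unfolding approx_rel_iff rec A_def[symmetric] using assms hyp_at_mem[OF hyp] unfolding A_def
    by (auto simp: ysq_def)
  finally show ?thesis .
qed

lemma act_approx_class:
  assumes "ysq y b" "infinite_seq b" "\<sigma> \<in> Aut M A"
  shows "act \<sigma> ` approx_class \<kappa> M EA a b = approx_class \<kappa> M EA a (aseq \<sigma> b)"
proof -
  have y': "ysq y (aseq \<sigma> b)" using assms(1) by simp
  have \<sigma>: "\<sigma> \<in> automorphisms M" using assms(3) by (rule Aut_aut)
  have "act \<sigma> a \<in> A" using assms(3) hyp_at_mem[OF hyp] by (simp add: Aut_def)
  then have "(a, act \<sigma> a) \<in> EA" unfolding A_def by blast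
  \<comment> \<open>The automorphism also moves the representative \<open>a\<close>, but within its
    class, so the original representative may be restored.\<close>
  then have "(case_sum a (act \<sigma> (stup b)), case_sum (act \<sigma> a) (act \<sigma> (stup b))) \<in> approx_rel \<kappa> M EA (sord b) y"
    unfolding approx_rel_iff using assms(1) by (simp add: ysq_def)
  from equiv_class_eq[OF approx_rel_equiv this] show ?thesis
    unfolding approx_class_eq[OF assms(1,2)] act_image_class[OF approx_rel_equiv approx_rel_invariant \<sigma>] act_case_sum
    using approx_class_eq[OF y'] assms(2) by simp
qed

section \<open>Relative indiscernibility\<close>

definition natord :: "nat \<Rightarrow> nat rel" where
  "natord n = {(i, j). i \<le> j \<and> j < n}"

lemma natord_iff: "(i, j) \<in> natord n \<longleftrightarrow> i \<le> j \<and> j < n"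
  by (simp add: natord_def)

lemma Field_natord: "Field (natord n) = {..<n}"
  by (auto simp: natord_def Field_def)

lemma Linear_natord: "Linear_order (natord n)"
proof (rule LinearI)
  fix x y z
  show "(x, x) \<in> natord n" if "x \<in> Field (natord n)" using that unfolding Field_natord by (simp add: natord_def)
  show "(x, z) \<in> natord n" if "(x, y) \<in> natord n" "(y, z) \<in> natord n" using that by (simp add: natord_def)
  show "x = y" if "(x, y) \<in> natord n" "(y, x) \<in> natord n" using that by (simp add: natord_def)
  show "(x, y) \<in> natord n \<or> (y, x) \<in> natord n" if "x \<in> Field (natord n)" "y \<in> Field (natord n)"
    using that unfolding Field_natord by (auto simp: natord_def)
qed

text \<open>As a sequence in its own right, a finite subtuple can be concatenated with an infinite
  sequence, and \<open>EM_conj\<close> applies to the result.\<close>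

definition fin_seq :: "('o, 'v, 'm) seqn \<Rightarrow> 'o list \<Rightarrow> (nat, 'v, 'm) seqn" where
  "fin_seq Q is = \<lparr>sord = natord (length is), stup = subtup Q is\<rparr>"

lemma fin_seq_ysq: "ysq y Q \<Longrightarrow> set is \<subseteq> Field (sord Q) \<Longrightarrow> ysq y (fin_seq Q is)"
proof -
  assume Q: "ysq y Q" "set is \<subseteq> Field (sord Q)"
  have "Linear_order (sord (fin_seq Q is))" by (simp add: fin_seq_def Linear_natord)
  moreover have "Field (sord (fin_seq Q is)) = {..<length is}" by (simp add: fin_seq_def Field_natord)
  moreover have "dom (stup (fin_seq Q is)) = {..<length is} \<times> y" by (simp add: fin_seq_def dom_subtup[OF Q])
  ultimately show ?thesis unfolding ysq_def tuples_def using small_nat ysqD(3)[OF Q(1)] by simp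
qed

lemma increasing_nth:
  assumes "increasing r is" "m < n" "n < length is" shows "(is ! m, is ! n) \<in> r \<and> is ! m \<noteq> is ! n"
  using assms sorted_wrt_nth_less[of "\<lambda>i j. (i, j) \<in> r \<and> i \<noteq> j" "is" m n] unfolding increasing_def by blast

lemma EM_fin_left:
  assumes "EM_equiv M A (seq_append I W) Q" "increasing (sord W) is"
  shows "EM_equiv M A (seq_append I (fin_seq W is)) Q"
proof (rule EM_pull[OF _ _ assms(1), where h = "map_sum id ((!) is)"])
  fix i j assume i: "i \<in> Field (sord (seq_append I (fin_seq W is)))"
  show "stup (seq_append I (fin_seq W is)) (i, j) = stup (seq_append I W) (map_sum id ((!) is) i, j)"
    using i by (cases i) (auto simp: Field_append fin_seq_def Field_natord subtup_nth)
next
  have F: "is ! m \<in> Field (sord W)" if "m < length is" for m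
    using assms(2) nth_mem[OF that] by (auto simp: increasing_def)
  show "smono (sord (seq_append I (fin_seq W is))) (Field (sord (seq_append I (fin_seq W is))))
     (sord (seq_append I W)) (map_sum id ((!) is))"
    unfolding smono_def
  proof (intro conjI ballI impI)
    fix x assume "x \<in> Field (sord (seq_append I (fin_seq W is)))"
    then show "map_sum id ((!) is) x \<in> Field (sord (seq_append I W))"
      using F by (cases x) (auto simp: Field_append fin_seq_def Field_natord)
  next
    fix x z assume x: "x \<in> Field (sord (seq_append I (fin_seq W is)))" "z \<in> Field (sord (seq_append I (fin_seq W is)))"
      "(x, z) \<in> sord (seq_append I (fin_seq W is)) \<and> x \<noteq> z"
    have "(map_sum id ((!) is) x, map_sum id ((!) is) z) \<in> sord (seq_append I W) \<and> map_sum id ((!) is) x \<noteq> map_sum id ((!) is) z"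
      using x F increasing_nth[OF assms(2)]
      by (cases x; cases z) (auto simp: Field_append fin_seq_def Field_natord natord_iff)
    then show "(map_sum id ((!) is) x, map_sum id ((!) is) z) \<in> sord (seq_append I W)"
      "map_sum id ((!) is) x \<noteq> map_sum id ((!) is) z" by blast+
  qed
qed

lemma EM_fin_right:
  assumes "EM_equiv M A (seq_append W I) Q" "increasing (sord W) is"
  shows "EM_equiv M A (seq_append (fin_seq W is) I) Q"
proof (rule EM_pull[OF _ _ assms(1), where h = "map_sum ((!) is) id"])
  fix i j assume i: "i \<in> Field (sord (seq_append (fin_seq W is) I))"
  show "stup (seq_append (fin_seq W is) I) (i, j) = stup (seq_append W I) (map_sum ((!) is) id i, j)"
    using i by (cases i) (auto simp: Field_append fin_seq_def Field_natord subtup_nth)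
next
  have F: "is ! m \<in> Field (sord W)" if "m < length is" for m
    using assms(2) nth_mem[OF that] by (auto simp: increasing_def)
  show "smono (sord (seq_append (fin_seq W is) I)) (Field (sord (seq_append (fin_seq W is) I)))
     (sord (seq_append W I)) (map_sum ((!) is) id)"
    unfolding smono_def
  proof (intro conjI ballI impI)
    fix x assume "x \<in> Field (sord (seq_append (fin_seq W is) I))"
    then show "map_sum ((!) is) id x \<in> Field (sord (seq_append W I))"
      using F by (cases x) (auto simp: Field_append fin_seq_def Field_natord)
  next
    fix x z assume x: "x \<in> Field (sord (seq_append (fin_seq W is) I))" "z \<in> Field (sord (seq_append (fin_seq W is) I))"
      "(x, z) \<in> sord (seq_append (fin_seq W is) I) \<and> x \<noteq> z"
    have "(map_sum ((!) is) id x, map_sum ((!) is) id z) \<in> sord (seq_append W I) \<and> map_sum ((!) is) id x \<noteq> map_sum ((!) is) id z"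
      using x F increasing_nth[OF assms(2)]
      by (cases x; cases z) (auto simp: Field_append fin_seq_def Field_natord natord_iff)
    then show "(map_sum ((!) is) id x, map_sum ((!) is) id z) \<in> sord (seq_append W I)"
      "map_sum ((!) is) id x \<noteq> map_sum ((!) is) id z" by blast+
  qed
qed

lemma act_append_eq:
  assumes "act \<sigma> (stup (seq_append I J)) = stup (seq_append I' J')"
  shows "act \<sigma> (stup I) = stup I'" "act \<sigma> (stup J) = stup J'"
proof -
  show "act \<sigma> (stup I) = stup I'"
  proof
    show "act \<sigma> (stup I) z = stup I' z" for z
      using fun_cong[OF assms, of "(Inl (fst z), snd z)"] by (cases z) (simp add: act_apply)
  qed
  show "act \<sigma> (stup J) = stup J'"
  proof
    show "act \<sigma> (stup J) z = stup J' z" for z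
      using fun_cong[OF assms, of "(Inr (fst z), snd z)"] by (cases z) (simp add: act_apply)
  qed
qed

text \<open>Two finite subtuples of \<open>W\<close> of the same length yield concatenations with
  \<open>I\<close> that have the same order and the same Ehrenfeucht-Mostowski type. The
  automorphism over \<open>A\<close> between these fixes \<open>I\<close> entrywise, so it is an
  automorphism over \<open>A\<close> and \<open>I\<close>.\<close>

lemma indiscernible_over_left:
  assumes y: "ysq y I" "ysq y W" and ind: "indiscernible \<kappa> M A (seq_append I W)"
  shows "indiscernible \<kappa> M (upair A {stup I}) W"
  unfolding indiscernible_def
proof (intro conjI allI impI, goal_cases)
  case 1
  then show ?case by (rule ysqD(5)[OF y(2)])
next
  case (2 "is" js)
  then have inc: "increasing (sord W) is" "increasing (sord W) js" "length is = length js" by blast+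
  have E: "EM_equiv M A (seq_append I W) (seq_append I W)" using ind by (simp add: indiscernible_iff)
  have "EM_equiv M A (seq_append I W) (seq_append I (fin_seq W js))"
    using EM_sym[OF blockA EM_fin_left[OF E inc(2)]] .
  then have "EM_equiv M A (seq_append I (fin_seq W is)) (seq_append I (fin_seq W js))"
    using inc(1) by (rule EM_fin_left)
  moreover have "ysq y (seq_append I (fin_seq W is))" "ysq y (seq_append I (fin_seq W js))"
    using y inc by (auto intro!: ysq_append fin_seq_ysq simp: increasing_def)
  moreover have "sord (seq_append I (fin_seq W is)) = sord (seq_append I (fin_seq W js))"
    using inc(3) by (simp add: sord_append fin_seq_def)
  ultimately have "conj_over M A (stup (seq_append I (fin_seq W is))) (stup (seq_append I (fin_seq W js)))"
    using EM_conj[OF hyp] by blast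
  then obtain \<sigma> where \<sigma>: "\<sigma> \<in> Aut M A" "act \<sigma> (stup (seq_append I (fin_seq W is))) = stup (seq_append I (fin_seq W js))"
    unfolding conj_over_def by blast
  have "act \<sigma> (stup I) = stup I" "act \<sigma> (subtup W is) = subtup W js"
    using act_append_eq[OF \<sigma>(2)] by (simp_all add: fin_seq_def)
  then show ?case unfolding conj_over_def Aut_AI using \<sigma>(1) by blast
qed

lemma indiscernible_over_right:
  assumes y: "ysq y W" "ysq y I" and ind: "indiscernible \<kappa> M A (seq_append W I)"
  shows "indiscernible \<kappa> M (upair A {stup I}) W"
  unfolding indiscernible_def
proof (intro conjI allI impI, goal_cases)
  case 1
  then show ?case by (rule ysqD(5)[OF y(1)])
next
  case (2 "is" js)
  then have inc: "increasing (sord W) is" "increasing (sord W) js" "length is = length js" by blast+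
  have E: "EM_equiv M A (seq_append W I) (seq_append W I)" using ind by (simp add: indiscernible_iff)
  have "EM_equiv M A (seq_append W I) (seq_append (fin_seq W js) I)"
    using EM_sym[OF blockA EM_fin_right[OF E inc(2)]] .
  then have "EM_equiv M A (seq_append (fin_seq W is) I) (seq_append (fin_seq W js) I)"
    using inc(1) by (rule EM_fin_right)
  moreover have "ysq y (seq_append (fin_seq W is) I)" "ysq y (seq_append (fin_seq W js) I)"
    using y inc by (auto intro!: ysq_append fin_seq_ysq simp: increasing_def)
  moreover have "sord (seq_append (fin_seq W is) I) = sord (seq_append (fin_seq W js) I)"
    using inc(3) by (simp add: sord_append fin_seq_def)
  ultimately have "conj_over M A (stup (seq_append (fin_seq W is) I)) (stup (seq_append (fin_seq W js) I))"
    using EM_conj[OF hyp] by blast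
  then obtain \<sigma> where \<sigma>: "\<sigma> \<in> Aut M A" "act \<sigma> (stup (seq_append (fin_seq W is) I)) = stup (seq_append (fin_seq W js) I)"
    unfolding conj_over_def by blast
  have "act \<sigma> (stup I) = stup I" "act \<sigma> (subtup W is) = subtup W js"
    using act_append_eq[OF \<sigma>(2)] by (simp_all add: fin_seq_def)
  then show ?case unfolding conj_over_def Aut_AI using \<sigma>(1) by blast
qed

lemma hyp_AI: "ysq y I \<Longrightarrow> hyp_at (upair A {stup I}) (case_sum a (stup I))"
  by (intro hyp_at_upair[OF hyp] hyp_at_singleton) (simp add: ysqD small_Times)

text \<open>Over \<open>A\<close> and \<open>I\<close> the sequences \<open>P\<close> and
  \<open>K\<close> are Lascar equivalent, and a Lascar strong automorphism over these parameters
  fixes \<open>e\<close>. It therefore carries boundedness over \<open>P\<close> to boundedness over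
  \<open>K\<close>.\<close>

lemma bddu_swap:
  assumes y: "ysq y I" "ysq y P" "ysq y K" and inf: "infinite_seq P" and s: "sord P = sord K"
    and ind: "indiscernible \<kappa> M (upair A {stup I}) (seq_append P K)"
    and e: "e \<in> bddu \<kappa> M (upair A {stup I})"
  shows "e \<in> bddu \<kappa> M (upair A {stup P}) \<longleftrightarrow> e \<in> bddu \<kappa> M (upair A {stup K})"
proof -
  have L: "Las_equiv \<kappa> M (upair A {stup I}) P K"
    by (rule Las_equiv_append[OF hyp_AI[OF y(1)] ind y(2,3) inf s])
  have L': "Las_equiv \<kappa> M (upair A {stup I}) K P"
    by (rule Las_equiv_sym[OF L hyp_at_block[OF hyp_AI[OF y(1)]]])
  have "e \<in> bddu \<kappa> M (upair A {stup K})" if las: "Las_equiv \<kappa> M (upair A {stup I}) P K"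
    and eP: "e \<in> bddu \<kappa> M (upair A {stup P})" for P K
  proof -
    obtain \<sigma> where \<sigma>: "\<sigma> \<in> Autf \<kappa> M (upair A {stup I})" "act \<sigma> (stup P) = stup K"
      using las unfolding Las_equiv_def by blast
    have "\<sigma> \<in> Aut M (upair A {stup I})" using Autf_Aut[OF \<sigma>(1) hyp_at_block[OF hyp_AI[OF y(1)]]] .
    then have A: "\<sigma> \<in> Aut M A" unfolding Aut_AI by blast
    have "act \<sigma> ` e = e" using Autf_fixes_bddu[OF \<sigma>(1) e] by blast
    moreover have "act \<sigma> ` e \<in> bddu \<kappa> M (act \<sigma> ` upair A {stup P})" using bddu_act[OF eP Aut_aut[OF A]] .
    ultimately show ?thesis unfolding act_image_upair Aut_image[OF blockA A] \<sigma>(2) by simp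
  qed
  from this[OF L] this[OF L'] show ?thesis by blast
qed

lemma smono_assoc: "smono (sord (seq_append I (seq_append P K))) (Field (sord (seq_append I (seq_append P K))))
    (sord (seq_append (seq_append I P) K)) (case_sum (Inl \<circ> Inl) (case_sum (Inl \<circ> Inr) Inr))"
  unfolding smono_def
proof (intro conjI ballI impI)
  let ?h = "case_sum (Inl \<circ> Inl) (case_sum (Inl \<circ> Inr) Inr)"
  fix x assume "x \<in> Field (sord (seq_append I (seq_append P K)))"
  then show "?h x \<in> Field (sord (seq_append (seq_append I P) K))"
    by (auto simp: Field_append)
next
  let ?h = "case_sum (Inl \<circ> Inl) (case_sum (Inl \<circ> Inr) Inr)"
  fix x z assume x: "x \<in> Field (sord (seq_append I (seq_append P K)))" "z \<in> Field (sord (seq_append I (seq_append P K)))"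
    "(x, z) \<in> sord (seq_append I (seq_append P K)) \<and> x \<noteq> z"
  have "(?h x, ?h z) \<in> sord (seq_append (seq_append I P) K) \<and> ?h x \<noteq> ?h z"
    using x unfolding Field_append by (auto simp: Field_append)
  then show "(?h x, ?h z) \<in> sord (seq_append (seq_append I P) K)" "?h x \<noteq> ?h z" by blast+
qed

lemma indiscernible_assoc:
  assumes y: "ysq y I" "ysq y P" "ysq y K" and ind: "indiscernible \<kappa> M A (seq_append (seq_append I P) K)"
  shows "indiscernible \<kappa> M A (seq_append I (seq_append P K))"
proof (rule indiscernible_pull[OF _ smono_assoc _ ind blockA])
  show "is_seq \<kappa> (seq_append I (seq_append P K))" by (rule ysqD(5)[OF ysq_append[OF y(1) ysq_append[OF y(2,3)]]])
  fix i j
  show "stup (seq_append I (seq_append P K)) (i, j) =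
      stup (seq_append (seq_append I P) K) (case_sum (Inl \<circ> Inl) (case_sum (Inl \<circ> Inr) Inr) i, j)"
    by (auto split: sum.split)
qed

text \<open>Over either outer block the other two form an indiscernible sequence, so
  \<open>bddu_swap\<close> applies with that block as base. Any two blocks include an outer one,
  hence boundedness over two blocks always yields the third.\<close>

lemma bddu_third:
  assumes y: "ysq y I" "ysq y P" "ysq y K" and inf: "infinite_seq I" and s: "sord P = sord I" "sord K = sord I"
    and ind: "indiscernible \<kappa> M A (seq_append (seq_append I P) K)"
  shows "e \<in> bddu \<kappa> M (upair A {stup I}) \<Longrightarrow>
      e \<in> bddu \<kappa> M (upair A {stup P}) \<longleftrightarrow> e \<in> bddu \<kappa> M (upair A {stup K})"
    and "e \<in> bddu \<kappa> M (upair A {stup K}) \<Longrightarrow>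
      e \<in> bddu \<kappa> M (upair A {stup I}) \<longleftrightarrow> e \<in> bddu \<kappa> M (upair A {stup P})"
proof -
  have infP: "infinite_seq P" using inf s by (simp add: infinite_seq_def)
  have 1: "indiscernible \<kappa> M (upair A {stup I}) (seq_append P K)"
    by (rule indiscernible_over_left[OF y(1) ysq_append[OF y(2,3)] indiscernible_assoc[OF y ind]])
  show "e \<in> bddu \<kappa> M (upair A {stup I}) \<Longrightarrow>
      e \<in> bddu \<kappa> M (upair A {stup P}) \<longleftrightarrow> e \<in> bddu \<kappa> M (upair A {stup K})"
    using bddu_swap[OF y infP _ 1] s by simp
  have 2: "indiscernible \<kappa> M (upair A {stup K}) (seq_append I P)"
    by (rule indiscernible_over_right[OF ysq_append[OF y(1,2)] y(3) ind])
  show "e \<in> bddu \<kappa> M (upair A {stup K}) \<Longrightarrow>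
      e \<in> bddu \<kappa> M (upair A {stup I}) \<longleftrightarrow> e \<in> bddu \<kappa> M (upair A {stup P})"
    using bddu_swap[OF y(3,1,2) inf _ 2] s by simp
qed

end

section \<open>Reindexing\<close>

text \<open>Independence is expressed by ultraimaginaries with variables in \<open>'k\<close>,
  whereas the class of a sequence has variables in a sum type. Renaming along an injection moves the
  class into the required type and keeps its orbits in bijection.\<close>

definition reindex :: "('w \<Rightarrow> 'x) \<Rightarrow> ('w \<rightharpoonup> 'm) \<Rightarrow> ('x \<rightharpoonup> 'm)" where
  "reindex g d = (\<lambda>k. if k \<in> range g then d (inv g k) else None)"

lemma reindex_apply: "inj g \<Longrightarrow> reindex g d (g z) = d z"
  by (simp add: reindex_def)

lemma reindex_inj: "inj g \<Longrightarrow> reindex g c = reindex g d \<longleftrightarrow> c = d"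
  by (metis ext reindex_apply)

lemma dom_reindex: "inj g \<Longrightarrow> dom (reindex g d) = g ` dom d"
  by (auto simp: reindex_def dom_def inj_eq split: if_splits)

lemma act_reindex: "act \<sigma> (reindex g d) = reindex g (act \<sigma> d)"
  by (rule ext) (simp add: act_apply reindex_def)

context monster
begin

lemma ultraimaginary_reindex:
  fixes g :: "'w \<Rightarrow> 'x" and D :: "('w \<rightharpoonup> 'm) set"
  assumes g: "inj g" and D: "ultraimaginary \<kappa> M D" shows "ultraimaginary \<kappa> M (reindex g ` D)"
proof -
  obtain x E d where *: "sm x" "invariant_equiv M x E" "d \<in> tuples x" "D = E `` {d}"
    using D unfolding ultraimaginary_def by blast
  have eq: "equiv (tuples x) E" using *(2) by (simp add: invariant_equiv_def)
  have inv: "aut_invariant M E" by (rule invariant_equiv_imp_aut_invariant[OF *(2)])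
  define E' where "E' = {(reindex g c, reindex g d) | c d. (c, d) \<in> E}"
  have iff: "(reindex g c, reindex g d) \<in> E' \<longleftrightarrow> (c, d) \<in> E" for c d
    unfolding E'_def by (auto simp: reindex_inj[OF g])
  have t: "reindex g c \<in> tuples (g ` x)" if "c \<in> tuples x" for c :: "'w \<rightharpoonup> 'm"
    using that by (simp add: tuples_def dom_reindex[OF g])
  have ex: "\<exists>c\<in>tuples x. w = reindex g c" if "w \<in> tuples (g ` x)" for w :: "'x \<rightharpoonup> 'm"
  proof
    have dw: "dom w = g ` x" using that by (simp add: tuples_def)
    show "w = reindex g (w \<circ> g)"
    proof
      fix k
      show "w k = reindex g (w \<circ> g) k"
      proof (cases "k \<in> range g")
        case True
        then show ?thesis by (auto simp: reindex_def g)
      next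
        case False
        then have "k \<notin> dom w" using dw by blast
        then show ?thesis using False by (auto simp: reindex_def)
      qed
    qed
    have "dom (w \<circ> g) = x"
    proof (rule set_eqI)
      fix z
      have "z \<in> dom (w \<circ> g) \<longleftrightarrow> g z \<in> dom w" by (auto simp: dom_def)
      then show "z \<in> dom (w \<circ> g) \<longleftrightarrow> z \<in> x" unfolding dw using g by (auto simp: inj_image_mem_iff)
    qed
    then show "w \<circ> g \<in> tuples x" by (simp add: tuples_def)
  qed
  have eq': "equiv (tuples (g ` x)) E'"
  proof (rule equivI)
    show "E' \<subseteq> tuples (g ` x) \<times> tuples (g ` x)"
      unfolding E'_def using equiv_tuples_subset[OF eq] t by blast
    show "refl_on (tuples (g ` x)) E'"
      unfolding refl_on_def
    proof
      fix w :: "'x \<rightharpoonup> 'm" assume "w \<in> tuples (g ` x)"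
      then obtain c where c: "c \<in> tuples x" "w = reindex g c" using ex by blast
      have "(c, c) \<in> E" using eq c(1) by (meson equiv_def refl_onD)
      then show "(w, w) \<in> E'" unfolding c(2) iff .
    qed
    show "sym E'"
    proof (rule symI)
      fix v w assume "(v, w) \<in> E'"
      then obtain c d where cd: "(c, d) \<in> E" "v = reindex g c" "w = reindex g d" unfolding E'_def by blast
      have "(d, c) \<in> E" using eq cd(1) by (meson equiv_def symD)
      then show "(w, v) \<in> E'" unfolding cd(2,3) iff .
    qed
    show "trans E'"
    proof (rule transI)
      fix u v w assume "(u, v) \<in> E'" "(v, w) \<in> E'"
      then obtain b c c' d where cd: "(b, c) \<in> E" "(c', d) \<in> E" "u = reindex g b" "v = reindex g c" "v = reindex g c'" "w = reindex g d"
        unfolding E'_def by blast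
      then have "c = c'" using reindex_inj[OF g] by metis
      then have "(b, d) \<in> E" using eq cd(1,2) by (meson equiv_def transD)
      then show "(u, w) \<in> E'" unfolding cd(3,6) iff .
    qed
  qed
  have inv': "aut_invariant M E'"
    unfolding aut_invariant_def
  proof (intro ballI allI impI)
    fix \<sigma> v w assume \<sigma>: "\<sigma> \<in> automorphisms M" and "(v, w) \<in> E'"
    then obtain c d where cd: "(c, d) \<in> E" "v = reindex g c" "w = reindex g d" unfolding E'_def by blast
    show "(act \<sigma> v, act \<sigma> w) \<in> E'"
      unfolding cd(2,3) act_reindex iff by (rule aut_invariantD[OF inv \<sigma> cd(1)])
  qed
  have sm': "sm (g ` x)" using *(1) by (rule small_image)
  have "reindex g ` D = E' `` {reindex g d}"
  proof
    show "reindex g ` D \<subseteq> E' `` {reindex g d}" using *(4) iff by auto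
    show "E' `` {reindex g d} \<subseteq> reindex g ` D"
    proof
      fix w assume "w \<in> E' `` {reindex g d}"
      then obtain c c' where c: "(c, c') \<in> E" "reindex g d = reindex g c" "w = reindex g c'" unfolding E'_def by auto
      then have "d = c" using reindex_inj[OF g] by metis
      then show "w \<in> reindex g ` D" unfolding *(4) using c by blast
    qed
  qed
  then show ?thesis unfolding ultraimaginary_def
    using sm' invariant_equivI[OF sm' eq' inv'] t[OF *(3)] by blast
qed

lemma bddu_reindex:
  fixes g :: "'w \<Rightarrow> 'x" and D :: "('w \<rightharpoonup> 'm) set"
  assumes g: "inj g" and D: "ultraimaginary \<kappa> M D"
  shows "reindex g ` D \<in> bddu \<kappa> M B \<longleftrightarrow> D \<in> bddu \<kappa> M B"
proof -
  let ?O = "(\<lambda>\<sigma>. act \<sigma> ` D) ` Aut M B"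
  have eq: "(\<lambda>\<sigma>. act \<sigma> ` reindex g ` D) ` Aut M B = image (reindex g) ` ?O"
    by (simp add: image_image act_reindex)
  have "inj (reindex g :: _ \<Rightarrow> _ \<rightharpoonup> 'm)" using reindex_inj[OF g] by (auto intro: injI)
  then have inj: "inj_on (image (reindex g)) ?O" by (meson inj_image_eq_iff inj_onI)
  have "sm (image (reindex g) ` ?O) \<longleftrightarrow> sm ?O"
    using small_image[of ?O "image (reindex g)"] small_inj_image[OF inj order_refl] by blast
  then show ?thesis unfolding bddu_def mem_Collect_eq eq using D ultraimaginary_reindex[OF g D] by blast
qed

end

context hyper_params
begin

section \<open>Extensions of sequences\<close>

text \<open>Conjugate tuples have the same domain, so one-element tuples identify the two variable
  sets. A sequence without entries fits any variable set.\<close>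

lemma EM_ysq:
  assumes "is_seq \<kappa> Q" "EM_equiv M A Q b" "ysq y b" "infinite_seq b" shows "ysq y Q"
proof -
  obtain y' where y': "ysq y' Q" using assms(1) is_seq_ysq by blast
  have "Field (sord Q) \<times> y' = Field (sord Q) \<times> y"
  proof (cases "Field (sord Q) = {}")
    case False
    then obtain i where i: "i \<in> Field (sord Q)" by blast
    obtain k where k: "k \<in> Field (sord b)" using assms(4) unfolding infinite_seq_def by (metis ex_in_conv finite.emptyI)
    have "increasing (sord Q) [i]" "increasing (sord b) [k]" using i k by (simp_all add: increasing_def)
    then have "conj_over M A (subtup Q [i]) (subtup b [k])" using assms(2) unfolding EM_equiv_def by simp
    then have "dom (subtup Q [i]) = dom (subtup b [k])" unfolding conj_over_def by (metis dom_act)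
    moreover have "dom (subtup Q [i]) = {..<1} \<times> y'" using dom_subtup[OF y', of "[i]"] i by simp
    moreover have "dom (subtup b [k]) = {..<1} \<times> y" using dom_subtup[OF assms(3), of "[k]"] k by simp
    ultimately have "{..<1 :: nat} \<times> y' = {..<1} \<times> y" by simp
    then have "y' = y" by (auto simp: times_eq_iff lessThan_empty_iff)
    then show ?thesis by simp
  qed simp
  then show ?thesis using y' ysqD(3)[OF assms(3)] by (simp add: ysq_def)
qed

lemma append_after:
  fixes r :: "'q rel"
  assumes b: "indiscernible \<kappa> M A b" "infinite_seq b" "ysq y b"
    and Q: "ysq y Q" "EM_equiv M A Q b" and r: "Linear_order r" "sm (Field r)"
  obtains P where "ysq y P" "sord P = r" "indiscernible \<kappa> M A (seq_append Q P)" "EM_equiv M A P b"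
proof -
  \<comment> \<open>A placeholder without entries: only its order matters, to build the index order
    of the concatenation.\<close>
  define d :: "('q, 'b, 'm) seqn" where "d = \<lparr>sord = r, stup = Map.empty\<rparr>"
  let ?r = "sord (seq_append Q d)"
  have lin: "Linear_order ?r" using ysqD(1)[OF Q(1)] r(1) by (intro Linear_order_append) (simp_all add: d_def)
  have smF: "sm (Field ?r)" unfolding Field_append using ysqD(2)[OF Q(1)] r(2) by (intro small_Plus) (simp_all add: d_def)
  obtain t where t: "ysq y \<lparr>sord = ?r, stup = t\<rparr>" "EM_equiv M A \<lparr>sord = ?r, stup = t\<rparr> b"
    "indiscernible \<kappa> M A \<lparr>sord = ?r, stup = t\<rparr>" "\<And>i j. i \<in> Field (sord Q) \<Longrightarrow> t (Inl i, j) = stup Q (i, j)"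
    by (rule extend[OF hyp b Q lin smF smono_Inl]) blast
  define P where "P = \<lparr>sord = r, stup = \<lambda>(i, j). t (Inr i, j)\<rparr>"
  have domt: "(k, j) \<in> dom t \<longleftrightarrow> k \<in> Field ?r \<and> j \<in> y" for k j using ysqD(4)[OF t(1)] by simp
  have "dom (stup P) = Field r \<times> y"
  proof (rule set_eqI, clarify)
    show "(i, j) \<in> dom (stup P) \<longleftrightarrow> (i, j) \<in> Field r \<times> y" for i j
      using domt[of "Inr i" j] by (auto simp: P_def d_def dom_def Field_append)
  qed
  then have P: "ysq y P" using r ysqD(3)[OF Q(1)] by (simp add: ysq_def P_def tuples_def)
  have so: "sord (seq_append Q P) = ?r" by (simp add: sord_append P_def d_def)
  have st: "stup (seq_append Q P) (k, j) = t (k, j)" if "k \<in> Field (sord (seq_append Q P))" for k j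
    using that t(4) by (cases k) (auto simp: Field_append P_def)
  have sm: "smono (sord (seq_append Q P)) (Field (sord (seq_append Q P))) ?r id"
    unfolding so by (simp add: smono_def)
  have ind: "indiscernible \<kappa> M A (seq_append Q P)"
    by (rule indiscernible_pull[where h = id, OF _ _ ysqD(5)[OF ysq_append[OF Q(1) P]] t(3) blockA]) (use st sm in simp_all)
  have "EM_equiv M A P b"
    by (rule EM_pull[where h = Inr, OF _ _ t(2)]) (use smono_Inr[of d Q] in \<open>simp_all add: P_def d_def\<close>)
  then show thesis using that[OF P _ ind] by (simp add: P_def)
qed

lemma append_before:
  fixes r :: "'q rel"
  assumes b: "indiscernible \<kappa> M A b" "infinite_seq b" "ysq y b"
    and Q: "ysq y Q" "EM_equiv M A Q b" and r: "Linear_order r" "sm (Field r)"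
  obtains P where "ysq y P" "sord P = r" "indiscernible \<kappa> M A (seq_append P Q)" "EM_equiv M A P b"
proof -
  define d :: "('q, 'b, 'm) seqn" where "d = \<lparr>sord = r, stup = Map.empty\<rparr>"
  let ?r = "sord (seq_append d Q)"
  have lin: "Linear_order ?r" using ysqD(1)[OF Q(1)] r(1) by (intro Linear_order_append) (simp_all add: d_def)
  have smF: "sm (Field ?r)" unfolding Field_append using ysqD(2)[OF Q(1)] r(2) by (intro small_Plus) (simp_all add: d_def)
  obtain t where t: "ysq y \<lparr>sord = ?r, stup = t\<rparr>" "EM_equiv M A \<lparr>sord = ?r, stup = t\<rparr> b"
    "indiscernible \<kappa> M A \<lparr>sord = ?r, stup = t\<rparr>" "\<And>i j. i \<in> Field (sord Q) \<Longrightarrow> t (Inr i, j) = stup Q (i, j)"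
    by (rule extend[OF hyp b Q lin smF smono_Inr]) blast
  define P where "P = \<lparr>sord = r, stup = \<lambda>(i, j). t (Inl i, j)\<rparr>"
  have domt: "(k, j) \<in> dom t \<longleftrightarrow> k \<in> Field ?r \<and> j \<in> y" for k j using ysqD(4)[OF t(1)] by simp
  have "dom (stup P) = Field r \<times> y"
  proof (rule set_eqI, clarify)
    show "(i, j) \<in> dom (stup P) \<longleftrightarrow> (i, j) \<in> Field r \<times> y" for i j
      using domt[of "Inl i" j] by (auto simp: P_def d_def dom_def Field_append)
  qed
  then have P: "ysq y P" using r ysqD(3)[OF Q(1)] by (simp add: ysq_def P_def tuples_def)
  have so: "sord (seq_append P Q) = ?r" by (simp add: sord_append P_def d_def)
  have st: "stup (seq_append P Q) (k, j) = t (k, j)" if "k \<in> Field (sord (seq_append P Q))" for k j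
    using that t(4) by (cases k) (auto simp: Field_append P_def)
  have sm: "smono (sord (seq_append P Q)) (Field (sord (seq_append P Q))) ?r id"
    unfolding so by (simp add: smono_def)
  have ind: "indiscernible \<kappa> M A (seq_append P Q)"
    by (rule indiscernible_pull[where h = id, OF _ _ ysqD(5)[OF ysq_append[OF P Q(1)]] t(3) blockA]) (use st sm in simp_all)
  have "EM_equiv M A P b"
    by (rule EM_pull[where h = Inl, OF _ _ t(2)]) (use smono_Inl[of d Q] in \<open>simp_all add: P_def d_def\<close>)
  then show thesis using that[OF P _ ind] by (simp add: P_def)
qed

lemma EM_conj_aseq:
  assumes "ysq y b'" "ysq y b" "sord b' = sord b" "EM_equiv M A b' b"
  obtains \<rho> where "\<rho> \<in> Aut M A" "aseq \<rho> b' = b"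
proof -
  obtain \<rho> where "\<rho> \<in> Aut M A" "act \<rho> (stup b') = stup b"
    using EM_conj[OF hyp assms] unfolding conj_over_def by blast
  then show thesis using that assms(3) by (simp add: aseq_def)
qed

section \<open>The equivalences\<close>

text \<open>Independence itself comes from the definition of a total sequence. What remains is an
  infinite pair to apply it to, obtained by continuing \<open>b\<close> with a sequence of the same
  order.\<close>

lemma total_imp_indep:
  fixes b :: "('k, 'v, 'm) seqn"
  assumes b: "indiscernible \<kappa> M A b" "infinite_seq b"
  obtains I J :: "('k, 'v, 'm) seqn" where "is_seq \<kappa> I" "is_seq \<kappa> J" "infinite_seq I" "infinite_seq J"
    "EM_equiv M A (seq_append I J) b"
proof -
  obtain y where y: "ysq y b" using b(1) is_seq_ysq[of b] by (auto simp: indiscernible_def)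
  have E: "EM_equiv M A b b" using b(1) by (simp add: indiscernible_iff)
  obtain P where P: "ysq y P" "sord P = sord b" "indiscernible \<kappa> M A (seq_append b P)"
    by (rule append_after[OF b y y E ysqD(1,2)[OF y]])
  have "EM_equiv M A (seq_append b P) (seq_append b P)" using P(3) by (simp add: indiscernible_iff)
  then have "EM_equiv M A b (seq_append b P)"
    by (intro EM_pull[where h = Inl and Q = "seq_append b P"] smono_Inl) simp_all
  then have "EM_equiv M A (seq_append b P) b" by (rule EM_sym[OF blockA])
  moreover have "infinite_seq P" using b(2) P(2) by (simp add: infinite_seq_def)
  ultimately show thesis using that[of b P] ysqD(5)[OF y] ysqD(5)[OF P(1)] b(2) by blast
qed

text \<open>An automorphism over \<open>A\<close> and \<open>I\<close> takes \<open>b\<close> to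
  another sequence related to \<open>I\<close>, hence to one in the class of \<open>b\<close>. The
  class is even fixed, so its orbit has one element.\<close>

lemma approx_class_fixed:
  fixes b I :: "('k, 'v, 'm) seqn"
  assumes b: "ysq y b" "infinite_seq b" and sim: "seq_sim \<kappa> M A b I"
  shows "approx_class \<kappa> M EA a b \<in> bddu \<kappa> M (upair A {stup I})"
proof -
  let ?D = "approx_class \<kappa> M EA a b"
  have "act \<sigma> ` ?D = ?D" if \<sigma>: "\<sigma> \<in> Aut M (upair A {stup I})" for \<sigma>
  proof -
    have s: "\<sigma> \<in> Aut M A" "act \<sigma> (stup I) = stup I" using \<sigma> unfolding Aut_AI by blast+
    have "aseq \<sigma> I = I" using s(2) by (simp add: aseq_def)
    then have "seq_sim \<kappa> M A (aseq \<sigma> b) I" using seq_sim_Aut[OF s(1) sim] by simp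
    then have "seq_approx \<kappa> M A (aseq \<sigma> b) b"
      using seq_approx_trans[OF seq_sim_approx seq_sim_approx[OF seq_sim_sym[OF sim]]] by blast
    then have "approx_class \<kappa> M EA a (aseq \<sigma> b) = ?D"
      using approx_class_eq_iff[of y "aseq \<sigma> b" b] b by simp
    then show ?thesis using act_approx_class[OF b s(1)] by simp
  qed
  then have "(\<lambda>\<sigma>. act \<sigma> ` ?D) ` Aut M (upair A {stup I}) \<subseteq> {?D}" by blast
  from small_subset[OF small_finite this] have "sm ((\<lambda>\<sigma>. act \<sigma> ` ?D) ` Aut M (upair A {stup I}))" by simp
  then show ?thesis unfolding bddu_def using approx_class_ultraimaginary[OF b] by blast
qed

lemma indep_imp_bounded:
  fixes b I J :: "('k, 'v, 'm) seqn" and g :: "'u + 'k \<times> 'v \<Rightarrow> 'k"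
  assumes g: "inj g" and b: "indiscernible \<kappa> M A b" "infinite_seq b"
    and IJ: "is_seq \<kappa> I" "is_seq \<kappa> J" "infinite_seq I" "infinite_seq J" "EM_equiv M A (seq_append I J) b"
    and ind: "bu_indep \<kappa> M A {stup I} {stup J}"
  shows "approx_class \<kappa> M EA a b \<in> bddu \<kappa> M A"
proof -
  obtain y where y: "ysq y b" using b(1) is_seq_ysq[of b] by (auto simp: indiscernible_def)
  have EI: "EM_equiv M A I b" by (rule EM_pull[where h = Inl, OF _ smono_Inl IJ(5)]) simp
  have EJ: "EM_equiv M A J b" by (rule EM_pull[where h = Inr, OF _ smono_Inr IJ(5)]) simp
  have yI: "ysq y I" by (rule EM_ysq[OF IJ(1) EI y b(2)])
  have yJ: "ysq y J" by (rule EM_ysq[OF IJ(2) EJ y b(2)])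
  obtain b' where b': "ysq y b'" "sord b' = sord b" "indiscernible \<kappa> M A (seq_append b' (seq_append I J))" "EM_equiv M A b' b"
    by (rule append_before[OF b y ysq_append[OF yI yJ] IJ(5) ysqD(1,2)[OF y]])
  have inf': "infinite_seq b'" using b(2) b'(2) by (simp add: infinite_seq_def)
  have "indiscernible \<kappa> M A (seq_append b' I)"
    by (rule indiscernible_pull[where h = "map_sum id Inl", OF _ _ ysqD(5)[OF ysq_append[OF b'(1) yI]] b'(3) blockA])
      (auto simp: smono_def Field_append elim!: PlusE)
  then have simI: "seq_sim \<kappa> M A b' I" by (intro seq_simI[OF b'(1) yI inf' IJ(3)]) blast
  have "indiscernible \<kappa> M A (seq_append b' J)"
    by (rule indiscernible_pull[where h = "map_sum id Inr", OF _ _ ysqD(5)[OF ysq_append[OF b'(1) yJ]] b'(3) blockA])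
      (auto simp: smono_def Field_append elim!: PlusE)
  then have simJ: "seq_sim \<kappa> M A b' J" by (intro seq_simI[OF b'(1) yJ inf' IJ(4)]) blast
  let ?D = "approx_class \<kappa> M EA a b'"
  have u: "ultraimaginary \<kappa> M ?D" by (rule approx_class_ultraimaginary[OF b'(1) inf'])
  have "reindex g ` ?D \<in> bddu \<kappa> M (upair A {stup I}) \<inter> bddu \<kappa> M (upair A {stup J})"
    using approx_class_fixed[OF b'(1) inf' simI] approx_class_fixed[OF b'(1) inf' simJ] bddu_reindex[OF g u] by blast
  then have "reindex g ` ?D \<in> bddu \<kappa> M A" using ind unfolding bu_indep_def by blast
  then have D: "?D \<in> bddu \<kappa> M A" using bddu_reindex[OF g u] by blast
  \<comment> \<open>The class treated so far is that of \<open>b'\<close>, placed in front of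
    \<open>I\<close> and \<open>J\<close>; an automorphism over \<open>A\<close> transfers its
    boundedness to the class of \<open>b\<close>.\<close>
  obtain \<rho> where \<rho>: "\<rho> \<in> Aut M A" "aseq \<rho> b' = b" by (rule EM_conj_aseq[OF b'(1) y b'(2,4)])
  have "act \<rho> ` ?D \<in> bddu \<kappa> M (act \<rho> ` A)" by (rule bddu_act[OF D Aut_aut[OF \<rho>(1)]])
  then show ?thesis unfolding Aut_image[OF blockA \<rho>(1)] act_approx_class[OF b'(1) inf' \<rho>(1)] \<rho>(2) .
qed

text \<open>The induction starts at the end of the chain next to \<open>b\<close>. At each step
  \<open>amalgamate\<close> joins the new sequence and the current copy of \<open>b\<close> through
  one that has the order of \<open>b\<close>; since the orders agree, it is Lascar equivalent to
  that copy.\<close>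

lemma seq_approx_imp_Las:
  fixes b I :: "('k, 'v, 'm) seqn"
  assumes "seq_approx \<kappa> M A I b"
  shows "\<exists>b'. Las_equiv \<kappa> M A b' b \<and> seq_sim \<kappa> M A I b'"
  using assms unfolding seq_approx_def
proof (induction rule: converse_tranclp_induct)
  case (base I)
  have "Las_equiv \<kappa> M A b b" unfolding Las_equiv_def using Autf.one act_id by blast
  then show ?case using base by blast
next
  case (step I I1)
  then obtain b' where b': "Las_equiv \<kappa> M A b' b" "seq_sim \<kappa> M A I1 b'" by blast
  have r: "Linear_order (sord b')" "sm (Field (sord b'))" "infinite (Field (sord b'))"
    using b'(2) by (auto simp: seq_sim_def is_seq_def infinite_seq_def)
  obtain t where t: "seq_sim \<kappa> M A \<lparr>sord = sord b', stup = t\<rparr> I" "seq_sim \<kappa> M A \<lparr>sord = sord b', stup = t\<rparr> b'"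
    by (rule amalgamate[OF hyp seq_sim_sym[OF step.hyps(1)] b'(2) r])
  have "Las_equiv \<kappa> M A \<lparr>sord = sord b', stup = t\<rparr> b'" by (rule seq_sim_Las[OF hyp t(2)]) simp
  then have "Las_equiv \<kappa> M A \<lparr>sord = sord b', stup = t\<rparr> b" using b'(1) by (rule Las_equiv_trans)
  then show ?case using seq_sim_sym[OF t(1)] by blast
qed

lemma seq_approx_imp_LEM:
  fixes b I :: "('k, 'v, 'm) seqn"
  assumes app: "seq_approx \<kappa> M A I b" and b: "indiscernible \<kappa> M A b" "infinite_seq b"
  shows "LEM_equiv \<kappa> M A I b"
proof -
  obtain b' where b': "Las_equiv \<kappa> M A b' b" "seq_sim \<kappa> M A I b'" using seq_approx_imp_Las[OF app] by blast
  obtain y where y: "ysq y I" "ysq y b'" by (rule seq_sim_ysq[OF b'(2)])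
  have inf: "infinite_seq I" "infinite_seq b'" using b'(2) by (simp_all add: seq_sim_def)
  have "\<exists>J'. Las_equiv \<kappa> M A J' b \<and> indiscernible \<kappa> M A (seq_append I J')"
  proof (cases "indiscernible \<kappa> M A (seq_append I b')")
    case True
    then show ?thesis using b'(1) by blast
  next
    case False
    then have ind: "indiscernible \<kappa> M A (seq_append b' I)" using b'(2) by (simp add: seq_sim_def)
    have E: "EM_equiv M A (seq_append b' I) (seq_append b' I)" using ind by (simp add: indiscernible_iff)
    have yQ: "ysq y (seq_append b' I)" by (rule ysq_append[OF y(2,1)])
    \<comment> \<open>Here \<open>b'\<close> precedes \<open>I\<close>, whereas the definition wants
      the copy of \<open>b\<close> to follow it. A continuation \<open>P\<close> with the order of
      \<open>b'\<close> is Lascar equivalent to \<open>b'\<close> and takes over its role on the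
      other side.\<close>
    obtain P where P: "ysq y P" "sord P = sord b'" "indiscernible \<kappa> M A (seq_append (seq_append b' I) P)"
      by (rule append_after[OF ind append_infinite(1)[OF inf(2)] yQ yQ E ysqD(1,2)[OF y(2)]])
    have "indiscernible \<kappa> M A (seq_append b' P)"
      by (rule indiscernible_pull[where h = "map_sum Inl id", OF _ _ ysqD(5)[OF ysq_append[OF y(2) P(1)]] P(3) blockA])
        (auto simp: smono_def Field_append elim!: PlusE)
    then have "Las_equiv \<kappa> M A b' P" by (rule Las_equiv_append[OF hyp _ y(2) P(1) inf(2)]) (simp add: P(2))
    then have "Las_equiv \<kappa> M A P b" using b'(1) Las_equiv_sym[OF _ blockA] Las_equiv_trans by blast
    moreover have "indiscernible \<kappa> M A (seq_append I P)"
      by (rule indiscernible_pull[where h = "map_sum Inr id", OF _ _ ysqD(5)[OF ysq_append[OF y(1) P(1)]] P(3) blockA])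
        (auto simp: smono_def Field_append elim!: PlusE)
    ultimately show ?thesis by blast
  qed
  then show ?thesis unfolding LEM_equiv_def
    using seq_sim_indiscernible[OF blockA b'(2)] b inf(1) by blast
qed

lemma bounded_imp_LEM_approx:
  fixes b I :: "('k, 'v, 'm) seqn"
  assumes bdd: "approx_class \<kappa> M EA a b \<in> bddu \<kappa> M A" and LEM: "LEM_equiv \<kappa> M A I b"
  shows "seq_approx \<kappa> M A I b"
proof -
  obtain b' where b': "Las_equiv \<kappa> M A b' b" "indiscernible \<kappa> M A (seq_append I b')"
    and ind: "indiscernible \<kappa> M A I" "indiscernible \<kappa> M A b" and inf: "infinite_seq I" "infinite_seq b"
    using LEM unfolding LEM_equiv_def by blast
  obtain \<sigma> where \<sigma>: "\<sigma> \<in> Autf \<kappa> M A" "act \<sigma> (stup b') = stup b" and s: "sord b' = sord b"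
    using b'(1) unfolding Las_equiv_def by blast
  have A: "\<sigma> \<in> Aut M A" by (rule Autf_Aut[OF \<sigma>(1) blockA])
  have bb: "aseq \<sigma> b' = b" using \<sigma>(2) s by (simp add: aseq_def)
  obtain y where yb: "ysq y b" using ind(2) is_seq_ysq[of b] by (auto simp: indiscernible_def)
  then have yb': "ysq y b'" using ysq_aseq[of y \<sigma> b'] bb by simp
  have inf': "infinite_seq b'" using inf(2) s by (simp add: infinite_seq_def)
  have "seq_sim \<kappa> M A I b'"
    using ind(1) b'(2) ysqD(5)[OF yb'] inf(1) inf' by (auto simp: seq_sim_def indiscernible_def)
  then have Ib': "seq_approx \<kappa> M A I b'" by (rule seq_sim_approx)
  have "act \<sigma> ` approx_class \<kappa> M EA a b = approx_class \<kappa> M EA a b" using Autf_fixes_bddu[OF \<sigma>(1) bdd] by blast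
  moreover have "act \<sigma> ` approx_class \<kappa> M EA a b' = approx_class \<kappa> M EA a b"
    using act_approx_class[OF yb' inf' A] bb by simp
  ultimately have "act (inv \<sigma>) ` act \<sigma> ` approx_class \<kappa> M EA a b' = act (inv \<sigma>) ` act \<sigma> ` approx_class \<kappa> M EA a b"
    by simp
  then have "approx_class \<kappa> M EA a b' = approx_class \<kappa> M EA a b"
    by (simp only: act_image_inv(1)[OF Aut_aut[OF A]])
  then have "stup b' = stup b \<or> seq_approx \<kappa> M A b' b"
    using approx_class_eq_iff[OF yb' yb s inf'] by blast
  then show ?thesis
  proof
    assume "stup b' = stup b"
    then have "b' = b" using s by simp
    then show ?thesis using Ib' by simp
  next
    assume "seq_approx \<kappa> M A b' b"
    then show ?thesis by (rule seq_approx_trans[OF Ib'])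
  qed
qed

text \<open>A continuation of \<open>b1\<close> with the same order is Lascar equivalent to
  \<open>b1\<close>, hence to \<open>b\<close>, and witnesses the definition. \<open>b\<close>
  itself may be unsuitable, since its concatenation after \<open>b1\<close> need not be
  indiscernible.\<close>

lemma Las_imp_LEM:
  fixes b b1 :: "('k, 'v, 'm) seqn"
  assumes las: "Las_equiv \<kappa> M A b1 b" and b: "indiscernible \<kappa> M A b" "infinite_seq b"
  shows "LEM_equiv \<kappa> M A b1 b"
proof -
  obtain \<sigma> where \<sigma>: "\<sigma> \<in> Autf \<kappa> M A" "act \<sigma> (stup b1) = stup b" and s: "sord b1 = sord b"
    using las unfolding Las_equiv_def by blast
  have A: "inv \<sigma> \<in> Aut M A" by (rule Aut_inv[OF blockA Autf_Aut[OF \<sigma>(1) blockA]])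
  have "aseq \<sigma> b1 = b" using \<sigma>(2) s by (simp add: aseq_def)
  then have b1: "aseq (inv \<sigma>) b = b1" using aseq_inv(1)[OF Aut_aut[OF Autf_Aut[OF \<sigma>(1) blockA]], of b1] by simp
  have ind: "indiscernible \<kappa> M A b1" using indiscernible_Aut[OF A b(1)] b1 by simp
  have inf: "infinite_seq b1" using b(2) s by (simp add: infinite_seq_def)
  obtain y where y: "ysq y b1" using ind is_seq_ysq[of b1] by (auto simp: indiscernible_def)
  have E: "EM_equiv M A b1 b1" using ind by (simp add: indiscernible_iff)
  obtain P where P: "ysq y P" "sord P = sord b1" "indiscernible \<kappa> M A (seq_append b1 P)"
    by (rule append_after[OF ind inf y y E ysqD(1,2)[OF y]])
  have "Las_equiv \<kappa> M A b1 P" by (rule Las_equiv_append[OF hyp P(3) y P(1) inf]) (simp add: P(2))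
  then have "Las_equiv \<kappa> M A P b" using las Las_equiv_sym[OF _ blockA] Las_equiv_trans by blast
  then show ?thesis unfolding LEM_equiv_def using ind b inf P(3) by blast
qed

lemma LEM_imp_bounded:
  fixes b :: "('k, 'v, 'm) seqn"
  assumes LEM: "\<And>I :: ('k, 'v, 'm) seqn. LEM_equiv \<kappa> M A I b \<Longrightarrow> seq_approx \<kappa> M A I b"
    and b: "indiscernible \<kappa> M A b" "infinite_seq b"
  shows "approx_class \<kappa> M EA a b \<in> bddu \<kappa> M A"
proof -
  let ?D = "approx_class \<kappa> M EA a b"
  obtain y where y: "ysq y b" using b(1) is_seq_ysq[of b] by (auto simp: indiscernible_def)
  obtain N where N: "ran a \<subseteq> N" "sm N" "elem_sub M N" using small_model[OF hyp_at_small_ran[OF hyp]] by blast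
  have FN: "Fix M N \<subseteq> Aut M A" by (rule hyp_at_Fix[OF hyp N(1)])
  let ?Z = "dom (stup b)"
  have smZ: "sm ?Z" unfolding ysqD(4)[OF y] by (rule small_Times[OF ysqD(2,3)[OF y]])
  let ?tp = "\<lambda>\<sigma>. ptype N ?Z (the \<circ> act \<sigma> (stup b))"
  have key: "act \<sigma> ` ?D = act \<tau> ` ?D" if \<sigma>: "\<sigma> \<in> Aut M A" and \<tau>: "\<tau> \<in> Aut M A" and tp: "?tp \<sigma> = ?tp \<tau>" for \<sigma> \<tau>
  proof -
    have \<sigma>': "\<sigma> \<in> automorphisms M" by (rule Aut_aut[OF \<sigma>])
    have "\<exists>\<rho>\<in>Fix M N. act \<rho> (act \<sigma> (stup b)) = act \<tau> (stup b)"
    proof (rule homogeneity_tuple[OF _ N(2)])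
      fix P assume "pdfn N (dom (act \<sigma> (stup b))) P" "P (the \<circ> act \<sigma> (stup b))"
      then have "P \<in> ?tp \<sigma>" by (simp add: ptype_def)
      then have "P \<in> ?tp \<tau>" using tp by (simp only:)
      then show "P (the \<circ> act \<tau> (stup b))" by (simp add: ptype_def)
    qed (use smZ in simp_all)
    then obtain \<rho> where \<rho>: "\<rho> \<in> Fix M N" "act \<rho> (act \<sigma> (stup b)) = act \<tau> (stup b)" by blast
    have \<rho>A: "\<rho> \<in> Aut M A" using \<rho>(1) FN by blast
    let ?N = "inv \<sigma> ` N"
    have "\<sigma> ` ?N = N" using automorphisms_bij[OF \<sigma>'] by (simp add: image_image bij_is_surj surj_f_inv_f)
    \<comment> \<open>Conjugating \<open>\<rho>\<close> by \<open>\<sigma>\<close> gives an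
      automorphism over another model, again a generator of \<open>Autf\<close>. So \<open>b\<close>
      and its image are Lascar equivalent, (3) puts them into one class, and undoing the conjugation
      compares the two translates of the class.\<close>
    then have \<theta>: "inv \<sigma> \<circ> \<rho> \<circ> \<sigma> \<in> Fix M ?N" using Fix_conjugate[OF \<sigma>', of \<rho> ?N] \<rho>(1) by simp
    let ?\<theta> = "inv \<sigma> \<circ> \<rho> \<circ> \<sigma>"
    have "?\<theta> \<in> Autf \<kappa> M A"
      by (rule Fix_Autf[OF elem_sub_image[OF N(3) automorphisms_inv[OF \<sigma>']] small_image[OF N(2)]
            Fix_image_subset_Aut[OF blockA FN Aut_inv[OF blockA \<sigma>]] \<theta>])
    then have "Las_equiv \<kappa> M A b (aseq ?\<theta> b)" unfolding Las_equiv_def by auto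
    then have "Las_equiv \<kappa> M A (aseq ?\<theta> b) b" by (rule Las_equiv_sym[OF _ blockA])
    then have app: "seq_approx \<kappa> M A (aseq ?\<theta> b) b" using LEM Las_imp_LEM[OF _ b] by blast
    have \<theta>A: "?\<theta> \<in> Aut M A" by (intro Aut_comp Aut_inv[OF blockA] \<sigma> \<rho>A)
    have "act ?\<theta> ` ?D = ?D"
      unfolding act_approx_class[OF y b(2) \<theta>A] using approx_class_eq_iff[of y "aseq ?\<theta> b" b] y b(2) app by simp
    then have "act \<sigma> ` ?D = act \<sigma> ` act (inv \<sigma>) ` act \<rho> ` act \<sigma> ` ?D" by (simp only: act_image_comp)
    also have "\<dots> = act \<rho> ` act \<sigma> ` ?D" by (simp only: act_image_inv(2)[OF \<sigma>'])
    also have "\<dots> = approx_class \<kappa> M EA a (aseq (\<rho> \<circ> \<sigma>) b)"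
      using act_approx_class[OF y b(2) Aut_comp[OF \<rho>A \<sigma>]] by (simp only: act_image_comp)
    also have "aseq (\<rho> \<circ> \<sigma>) b = aseq \<tau> b" using \<rho>(2) by (simp add: aseq_def act_comp)
    also have "approx_class \<kappa> M EA a (aseq \<tau> b) = act \<tau> ` ?D" using act_approx_class[OF y b(2) \<tau>] by simp
    finally show ?thesis .
  qed
  \<comment> \<open>By \<open>key\<close> the translate depends only on the type, so any
    automorphism with that type may be chosen, and the orbit is covered by an image of the set of
    types.\<close>
  define G where "G T = act (SOME \<sigma>. \<sigma> \<in> Aut M A \<and> ?tp \<sigma> = T) ` ?D" for T
  have "(\<lambda>\<sigma>. act \<sigma> ` ?D) ` Aut M A \<subseteq> G ` range (ptype N ?Z)"
  proof
    fix Z assume "Z \<in> (\<lambda>\<sigma>. act \<sigma> ` ?D) ` Aut M A"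
    then obtain \<sigma> where \<sigma>: "\<sigma> \<in> Aut M A" "Z = act \<sigma> ` ?D" by blast
    let ?s = "SOME \<sigma>'. \<sigma>' \<in> Aut M A \<and> ?tp \<sigma>' = ?tp \<sigma>"
    have "?s \<in> Aut M A \<and> ?tp ?s = ?tp \<sigma>" by (rule someI[of _ \<sigma>]) (simp add: \<sigma>(1))
    then have "act ?s ` ?D = act \<sigma> ` ?D" using key \<sigma>(1) by blast
    then have "Z = G (?tp \<sigma>)" unfolding G_def \<sigma>(2) by simp
    then show "Z \<in> G ` range (ptype N ?Z)" by blast
  qed
  then have "sm ((\<lambda>\<sigma>. act \<sigma> ` ?D) ` Aut M A)"
    using small_subset[OF small_image[OF small_range_ptype[OF N(2) smZ]]] by blast
  then show ?thesis unfolding bddu_def using approx_class_ultraimaginary[OF y b(2)] by blast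
qed

end

section \<open>Transport of orders and index types\<close>

lemma Linear_order_inj_image:
  assumes "Linear_order r" "inj g"
  shows "Linear_order (map_prod g g ` r)" "Field (map_prod g g ` r) = g ` Field r"
    "\<And>u v. (g u, g v) \<in> map_prod g g ` r \<longleftrightarrow> (u, v) \<in> r"
proof -
  show F: "Field (map_prod g g ` r) = g ` Field r" by (force simp: Field_def)
  show iff: "(g u, g v) \<in> map_prod g g ` r \<longleftrightarrow> (u, v) \<in> r" for u v
    using assms(2) by (auto simp: inj_eq)
  have mem: "z \<in> map_prod g g ` r \<longleftrightarrow> (\<exists>u v. z = (g u, g v) \<and> (u, v) \<in> r)" for z by force
  show "Linear_order (map_prod g g ` r)"
  proof (rule LinearI)
    fix x y z
    show "(x, x) \<in> map_prod g g ` r" if "x \<in> Field (map_prod g g ` r)"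
      using that lin_refl[OF assms(1)] unfolding F by (auto simp: iff)
    show "(x, z) \<in> map_prod g g ` r" if xy: "(x, y) \<in> map_prod g g ` r" "(y, z) \<in> map_prod g g ` r"
    proof -
      obtain u v w v' where "x = g u" "y = g v" "(u, v) \<in> r" "y = g v'" "z = g w" "(v', w) \<in> r"
        using xy unfolding mem by blast
      then show ?thesis using lin_trans[OF assms(1)] assms(2) by (metis iff injD)
    qed
    show "x = y" if xy: "(x, y) \<in> map_prod g g ` r" "(y, x) \<in> map_prod g g ` r"
    proof -
      obtain u v where uv: "x = g u" "y = g v" "(u, v) \<in> r" using xy(1) unfolding mem by blast
      then have "(v, u) \<in> r" using xy(2) iff by simp
      then show ?thesis using uv lin_antisym[OF assms(1)] by blast
    qed
    show "(x, y) \<in> map_prod g g ` r \<or> (y, x) \<in> map_prod g g ` r"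
      if xy: "x \<in> Field (map_prod g g ` r)" "y \<in> Field (map_prod g g ` r)"
    proof -
      obtain u v where "x = g u" "y = g v" "u \<in> Field r" "v \<in> Field r" using xy unfolding F by blast
      then show ?thesis using lin_total[OF assms(1)] iff by simp
    qed
  qed
qed

lemma omega_seq_infinite_no_max:
  assumes "omega_seq b" shows "infinite_seq b" "no_max (sord b)"
proof -
  obtain f where f: "iso (sord b) natLeq f" and wo: "Well_order (sord b)"
    using assms unfolding omega_seq_def ordIso_def by blast
  have bij: "bij_betw f (Field (sord b)) UNIV" using f unfolding iso_def Field_natLeq by blast
  show "infinite_seq b" unfolding infinite_seq_def using bij_betw_finite[OF bij] by simp
  have lin: "Linear_order (sord b)" using wo unfolding well_order_on_def by blast
  have fwd: "f x \<le> f z" if "(x, z) \<in> sord b" for x z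
    using iso_forward[OF that f] by (simp add: natLeq_def)
  show "no_max (sord b)"
    unfolding no_max_def
  proof
    fix x assume x: "x \<in> Field (sord b)"
    have "Suc (f x) \<in> f ` Field (sord b)" using bij by (simp add: bij_betw_def)
    then obtain z where z: "z \<in> Field (sord b)" "f z = Suc (f x)" by auto
    have "(z, x) \<notin> sord b" using fwd[of z x] z(2) by auto
    then have "(x, z) \<in> sord b" using lin_total[OF lin x z(1)] by blast
    moreover have "x \<noteq> z" using z(2) by auto
    ultimately show "\<exists>z. (x, z) \<in> sord b \<and> x \<noteq> z" by blast
  qed
qed

context monster
begin

lemma ex_inj_index:
  obtains g :: "'k \<times> 'k + 'k \<times> 'k \<Rightarrow> 'k" and h :: "('k + 'k) + 'k \<Rightarrow> 'k" where "inj g" "inj h"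
proof -
  let ?r = "|UNIV :: 'k set|"
  have r: "\<not> finite (Field ?r)" "Card_order ?r" using infinite_\<kappa> by (simp_all add: Field_card_of card_of_card_order_on)
  have k: "|UNIV :: 'k set| \<le>o ?r" by (rule card_of_mono1[OF order_refl])
  have kk: "|(UNIV :: 'k set) \<times> (UNIV :: 'k set)| \<le>o ?r"
    by (rule card_of_Times_ordLeq_infinite_Field[OF r(1) k k r(2)])
  have "|((UNIV :: 'k set) \<times> (UNIV :: 'k set)) <+> ((UNIV :: 'k set) \<times> (UNIV :: 'k set))| \<le>o ?r"
    by (rule card_of_Plus_ordLeq_infinite_Field[OF r(1) kk kk r(2)])
  then obtain g where "inj_on g (((UNIV :: 'k set) \<times> (UNIV :: 'k set)) <+> ((UNIV :: 'k set) \<times> (UNIV :: 'k set)))"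
    "g ` (((UNIV :: 'k set) \<times> (UNIV :: 'k set)) <+> ((UNIV :: 'k set) \<times> (UNIV :: 'k set))) \<subseteq> (UNIV :: 'k set)"
    unfolding card_of_ordLeq[symmetric] by (elim exE conjE)
  then have g: "inj g" by simp
  have "|(UNIV :: 'k set) <+> (UNIV :: 'k set)| \<le>o ?r"
    by (rule card_of_Plus_ordLeq_infinite_Field[OF r(1) k k r(2)])
  from card_of_Plus_ordLeq_infinite_Field[OF r(1) this k r(2)]
  obtain h where "inj_on h (((UNIV :: 'k set) <+> (UNIV :: 'k set)) <+> (UNIV :: 'k set))"
    "h ` (((UNIV :: 'k set) <+> (UNIV :: 'k set)) <+> (UNIV :: 'k set)) \<subseteq> (UNIV :: 'k set)"
    unfolding card_of_ordLeq[symmetric] by (elim exE conjE)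
  then have "inj h" by simp
  then show thesis using g that by blast
qed

end

context hyper_params
begin

section \<open>Boundedness along chains of sequences\<close>

lemma ysq_unique:
  assumes "ysq y I" "ysq y' I" "infinite_seq I" shows "y' = y"
  using snd_dom[OF assms(1,3)] snd_dom[OF assms(2,3)] by simp

lemma tri_sim:
  fixes I P K :: "('o, 'v, 'm) seqn"
  assumes tri: "tri A I P K" and y: "ysq y I" "ysq y P" "ysq y K"
    and inf: "infinite_seq I" "infinite_seq P" "infinite_seq K"
  shows "seq_sim \<kappa> M A I P" "seq_sim \<kappa> M A P K"
proof -
  from tri have "indiscernible \<kappa> M A (seq_append I P) \<and>
      (indiscernible \<kappa> M A (seq_append P K) \<or> indiscernible \<kappa> M A (seq_append K P))"
    unfolding tri_def
  proof
    assume ind: "indiscernible \<kappa> M A (seq_append (seq_append I P) K)"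
    have "indiscernible \<kappa> M A (seq_append I P)"
      by (rule indiscernible_append_left[OF blockA ind ysqD(5)[OF ysq_append[OF y(1,2)]]])
    moreover have "indiscernible \<kappa> M A (seq_append P K)"
      by (rule indiscernible_pull[where h = "map_sum Inr id", OF _ _ ysqD(5)[OF ysq_append[OF y(2,3)]] ind blockA])
        (auto simp: smono_def Field_append elim!: PlusE)
    ultimately show ?thesis by blast
  next
    assume ind: "indiscernible \<kappa> M A (seq_append (seq_append K I) P)"
    have "indiscernible \<kappa> M A (seq_append I P)"
      by (rule indiscernible_pull[where h = "map_sum Inr id", OF _ _ ysqD(5)[OF ysq_append[OF y(1,2)]] ind blockA])
        (auto simp: smono_def Field_append elim!: PlusE)
    moreover have "indiscernible \<kappa> M A (seq_append K P)"
      by (rule indiscernible_pull[where h = "map_sum Inl id", OF _ _ ysqD(5)[OF ysq_append[OF y(3,2)]] ind blockA])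
        (auto simp: smono_def Field_append elim!: PlusE)
    ultimately show ?thesis by blast
  qed
  then show "seq_sim \<kappa> M A I P" "seq_sim \<kappa> M A P K"
    using seq_simI[OF y(1,2) inf(1,2)] seq_simI[OF y(2,3) inf(2,3)] by blast+
qed

text \<open>A limit \<open>P\<close> of \<open>I\<close> continues \<open>I\<close> compatibly with
  both \<open>K\<close> and \<open>K'\<close>. In each indiscernible triple \<open>e\<close> is
  bounded over two blocks and hence over the third: first over \<open>P\<close>, then over
  \<open>K'\<close>, whichever side these sequences lie on.\<close>

lemma bddu_transfer:
  fixes I K K' :: "('o, 'v, 'm) seqn"
  assumes sim: "seq_sim \<kappa> M A I K" "seq_sim \<kappa> M A I K'" and nm: "no_max (sord I)"
    and s: "sord K = sord I" "sord K' = sord I"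
    and e: "e \<in> bddu \<kappa> M (upair A {stup I})" "e \<in> bddu \<kappa> M (upair A {stup K})"
  shows "e \<in> bddu \<kappa> M (upair A {stup K'})"
proof -
  have inf: "infinite_seq I" "infinite_seq K" "infinite_seq K'" using sim by (simp_all add: seq_sim_def)
  obtain y where y: "ysq y I" "ysq y K" by (rule seq_sim_ysq[OF sim(1)])
  obtain y' where y': "ysq y' I" "ysq y' K'" by (rule seq_sim_ysq[OF sim(2)])
  have yK': "ysq y K'" using y'(2) ysq_unique[OF y(1) y'(1) inf(1)] by simp
  obtain t where t: "ysq y \<lparr>sord = sord I, stup = t\<rparr>" "tri A I \<lparr>sord = sord I, stup = t\<rparr> K" "tri A I \<lparr>sord = sord I, stup = t\<rparr> K'"
    by (rule amalgamate_tri[OF hyp sim nm ysqD(1,2)[OF y(1)] y yK'])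
  define P where "P = \<lparr>sord = sord I, stup = t\<rparr>"
  have P: "ysq y P" "tri A I P K" "tri A I P K'" "sord P = sord I" using t by (simp_all add: P_def)
  have eP: "e \<in> bddu \<kappa> M (upair A {stup P})"
    using P(2) unfolding tri_def
  proof
    assume "indiscernible \<kappa> M A (seq_append (seq_append I P) K)"
    from bddu_third(1)[OF y(1) P(1) y(2) inf(1) P(4) s(1) this e(1)] show ?thesis using e(2) by blast
  next
    assume "indiscernible \<kappa> M A (seq_append (seq_append K I) P)"
    from bddu_third(1)[OF y(2,1) P(1) inf(2) _ _ this e(2)] show ?thesis using e(1) s P(4) by simp
  qed
  show ?thesis
    using P(3) unfolding tri_def
  proof
    assume "indiscernible \<kappa> M A (seq_append (seq_append I P) K')"
    from bddu_third(1)[OF y(1) P(1) yK' inf(1) P(4) s(2) this e(1)] show ?thesis using eP by blast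
  next
    assume "indiscernible \<kappa> M A (seq_append (seq_append K' I) P)"
    from bddu_third(2)[OF yK' y(1) P(1) inf(3) _ _ this eP] show ?thesis using e(1) s P(4) by simp
  qed
qed

text \<open>A boundedness condition on \<open>e\<close> that propagates along \<open>\<sim>\<close>, by the previous lemma.\<close>

definition linked :: "('x \<rightharpoonup> 'm) set \<Rightarrow> 'o rel \<Rightarrow> ('o, 'v, 'm) seqn \<Rightarrow> bool" where
  "linked e r K \<longleftrightarrow> sord K = r \<and> e \<in> bddu \<kappa> M (upair A {stup K}) \<and>
     (\<exists>K'. sord K' = r \<and> seq_sim \<kappa> M A K K' \<and> e \<in> bddu \<kappa> M (upair A {stup K'}))"

text \<open>The link of \<open>K\<close> is a neighbour over which \<open>e\<close> is bounded;
  \<open>bddu_transfer\<close> passes from it to the new neighbour \<open>K'\<close>, for which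
  \<open>K\<close> then serves as the link.\<close>

lemma linked_step:
  assumes nm: "no_max r" and K: "linked e r K" and sim: "seq_sim \<kappa> M A K K'" and s: "sord K' = r"
  shows "linked e r K'"
proof -
  obtain K1 where K1: "sord K = r" "e \<in> bddu \<kappa> M (upair A {stup K})" "sord K1 = r" "seq_sim \<kappa> M A K K1"
    "e \<in> bddu \<kappa> M (upair A {stup K1})" using K unfolding linked_def by blast
  have "e \<in> bddu \<kappa> M (upair A {stup K'})"
    by (rule bddu_transfer[OF K1(4) sim _ _ _ K1(2,5)]) (simp_all add: nm s K1)
  then show ?thesis unfolding linked_def using s K1(1,2) seq_sim_sym[OF sim] by blast
qed

text \<open>A chain passes through sequences of any order, but \<open>linked\<close> requires the
  order \<open>r\<close>. So a linked companion \<open>P\<close> of order \<open>r\<close> is kept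
  next to the current sequence, and \<open>amalgamate\<close> renews it at each step.\<close>

lemma linked_approx:
  fixes I L :: "('k, 'v, 'm) seqn"
  assumes nm: "no_max r" and I: "linked e r I" and app: "seq_approx \<kappa> M A I L"
  shows "\<exists>P. linked e r P \<and> seq_sim \<kappa> M A P L"
  using app unfolding seq_approx_def
proof (induction rule: tranclp_induct)
  case (base L)
  have s: "sord I = r" using I by (simp add: linked_def)
  obtain y where y: "ysq y I" "ysq y L" by (rule seq_sim_ysq[OF base])
  have inf: "infinite_seq I" "infinite_seq L" using base by (simp_all add: seq_sim_def)
  \<comment> \<open>\<open>L\<close> plays both roles in \<open>amalgamate_tri\<close>, as all that
    is wanted is a sequence of order \<open>r\<close> related to \<open>I\<close> and to
    \<open>L\<close>.\<close>
  obtain t where t: "ysq y \<lparr>sord = sord I, stup = t\<rparr>" "tri A I \<lparr>sord = sord I, stup = t\<rparr> L"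
    by (rule amalgamate_tri[OF hyp base base _ ysqD(1,2)[OF y(1)] y y(2)]) (simp_all add: nm s)
  have infP: "infinite_seq \<lparr>sord = sord I, stup = t\<rparr>" using inf(1) by (simp add: infinite_seq_def)
  note sims = tri_sim[OF t(2) y(1) t(1) y(2) inf(1) infP inf(2)]
  have "linked e r \<lparr>sord = sord I, stup = t\<rparr>" by (rule linked_step[OF nm I sims(1)]) (simp add: s)
  then show ?case using sims(2) by blast
next
  case (step L L')
  then obtain P where P: "linked e r P" "seq_sim \<kappa> M A P L" by blast
  have s: "sord P = r" using P(1) by (simp add: linked_def)
  have r: "Linear_order r" "sm (Field r)" "infinite (Field r)"
    using P(2) s by (auto simp: seq_sim_def is_seq_def infinite_seq_def)
  obtain t where t: "seq_sim \<kappa> M A \<lparr>sord = r, stup = t\<rparr> P" "seq_sim \<kappa> M A \<lparr>sord = r, stup = t\<rparr> L'"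
    by (rule amalgamate[OF hyp seq_sim_sym[OF P(2)] step.hyps(2) r])
  have "linked e r \<lparr>sord = r, stup = t\<rparr>" by (rule linked_step[OF nm P(1) seq_sim_sym[OF t(1)]]) simp
  then show ?case using t(2) by blast
qed

lemma Aut_subsequence:
  fixes I :: "('i, 'v, 'm) seqn" and I' :: "('j, 'v, 'm) seqn"
  assumes "ysq y I" "\<And>i j. i \<in> Field (sord I) \<Longrightarrow> stup I (i, j) = stup I' (h i, j)"
  shows "Aut M (upair A {stup I'}) \<subseteq> Aut M (upair A {stup I})"
proof
  fix \<sigma> assume "\<sigma> \<in> Aut M (upair A {stup I'})"
  then have \<sigma>: "\<sigma> \<in> Aut M A" "act \<sigma> (stup I') = stup I'" unfolding Aut_AI by blast+
  have "act \<sigma> (stup I) = stup I"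
  proof
    fix z :: "'i \<times> 'v"
    obtain i j where z: "z = (i, j)" by (cases z)
    show "act \<sigma> (stup I) z = stup I z"
    proof (cases "i \<in> Field (sord I)")
      case True
      then show ?thesis unfolding z using fun_cong[OF \<sigma>(2), of "(h i, j)"] assms(2) by (simp add: act_apply)
    next
      case False
      then have "(i, j) \<notin> dom (stup I)" using ysqD(4)[OF assms(1)] by blast
      then have "stup I (i, j) = None" by (simp add: domIff)
      then show ?thesis unfolding z by (simp add: act_apply)
    qed
  qed
  then show "\<sigma> \<in> Aut M (upair A {stup I})" unfolding Aut_AI using \<sigma>(1) by blast
qed

text \<open>\<open>I\<close> and \<open>J\<close> may be finite or have different order types, while
  the exchange arguments need equal orders without maximum. The order of I + J + b contains both and
  owes the absence of a maximum to \<open>b\<close>, so two copies of it are used. Boundedness over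
  the given sequences persists over their extensions.\<close>

lemma common_extension:
  fixes b I J :: "('k, 'v, 'm) seqn" and g :: "('k + 'k) + 'k \<Rightarrow> 'k"
  assumes g: "inj g" and b: "indiscernible \<kappa> M A b" "infinite_seq b" "ysq y b" "no_max (sord b)"
    and y: "ysq y I" "ysq y J" and EM: "EM_equiv M A (seq_append I J) b"
  obtains I' J' :: "('k, 'v, 'm) seqn" where "ysq y I'" "ysq y J'" "sord J' = sord I'" "no_max (sord I')" "infinite_seq I'"
    "indiscernible \<kappa> M A (seq_append I' J')" "EM_equiv M A I' b"
    "Aut M (upair A {stup I'}) \<subseteq> Aut M (upair A {stup I})" "Aut M (upair A {stup J'}) \<subseteq> Aut M (upair A {stup J})"
proof -
  let ?O = "sord (seq_append (seq_append I J) b)"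
  have yO: "ysq y (seq_append (seq_append I J) b)" by (rule ysq_append[OF ysq_append[OF y] b(3)])
  \<comment> \<open>The order is transported into \<open>'k\<close>, the index type on which
    \<open>seq_approx\<close> is defined.\<close>
  define r where "r = map_prod g g ` ?O"
  note r = Linear_order_inj_image[OF ysqD(1)[OF yO] g, folded r_def]
  have smr: "sm (Field r)" unfolding r(2) by (rule small_image[OF ysqD(2)[OF yO]])
  have "infinite (Field ?O)" using append_infinite(2)[OF b(2), of "seq_append I J"] by (simp add: infinite_seq_def)
  then have infr: "infinite (Field r)" unfolding r(2) using g by (metis finite_imageD inj_on_subset subset_UNIV)
  have "no_max ?O"
    unfolding no_max_def
  proof
    fix x assume x: "x \<in> Field ?O"
    obtain k where k: "k \<in> Field (sord b)" using b(2) unfolding infinite_seq_def by (metis ex_in_conv finite.emptyI)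
    show "\<exists>z. (x, z) \<in> ?O \<and> x \<noteq> z"
    proof (cases x)
      case (Inl u)
      then show ?thesis using x k by (intro exI[of _ "Inr k"]) (simp add: Field_append)
    next
      case (Inr v)
      then have "v \<in> Field (sord b)" using x by (simp add: Field_append)
      then obtain z where "(v, z) \<in> sord b" "v \<noteq> z" using b(4) unfolding no_max_def by blast
      then show ?thesis using Inr by (intro exI[of _ "Inr z"]) simp
    qed
  qed
  then have nm: "no_max r" unfolding no_max_def r(2) using r(3) g by (metis imageE injD)
  define d :: "('k, 'v, 'm) seqn" where "d = \<lparr>sord = r, stup = Map.empty\<rparr>"
  let ?R = "sord (seq_append d d)"
  have linR: "Linear_order ?R" using r(1) by (intro Linear_order_append) (simp_all add: d_def)
  have smR: "sm (Field ?R)" unfolding Field_append using smr by (intro small_Plus) (simp_all add: d_def)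
  \<comment> \<open>\<open>I\<close> keeps its place in the first copy of the order and
    \<open>J\<close> its place in the second, so all of \<open>I\<close> still precedes all of
    \<open>J\<close>.\<close>
  let ?h = "map_sum (g \<circ> Inl \<circ> Inl) (g \<circ> Inl \<circ> Inr)"
  have h: "smono (sord (seq_append I J)) (Field (sord (seq_append I J))) ?R ?h"
    unfolding smono_def
  proof (intro conjI ballI impI)
    fix x assume "x \<in> Field (sord (seq_append I J))"
    then show "?h x \<in> Field ?R" by (cases x) (auto simp: Field_append d_def r(2))
  next
    fix x z assume x: "x \<in> Field (sord (seq_append I J))" "z \<in> Field (sord (seq_append I J))"
      "(x, z) \<in> sord (seq_append I J) \<and> x \<noteq> z"
    have "(?h x, ?h z) \<in> ?R \<and> ?h x \<noteq> ?h z"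
      using x g by (cases x; cases z) (auto simp: Field_append d_def r(2,3) inj_eq)
    then show "(?h x, ?h z) \<in> ?R" "?h x \<noteq> ?h z" by blast+
  qed
  obtain t where t: "ysq y \<lparr>sord = ?R, stup = t\<rparr>" "EM_equiv M A \<lparr>sord = ?R, stup = t\<rparr> b"
    "indiscernible \<kappa> M A \<lparr>sord = ?R, stup = t\<rparr>"
    "\<And>i j. i \<in> Field (sord (seq_append I J)) \<Longrightarrow> t (?h i, j) = stup (seq_append I J) (i, j)"
    by (rule extend[OF hyp b(1-3) ysq_append[OF y] EM linR smR h]) blast
  define I' where "I' = \<lparr>sord = r, stup = \<lambda>(i, j). t (Inl i, j)\<rparr>"
  define J' where "J' = \<lparr>sord = r, stup = \<lambda>(i, j). t (Inr i, j)\<rparr>"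
  have domt: "(k, j) \<in> dom t \<longleftrightarrow> k \<in> Field ?R \<and> j \<in> y" for k j using ysqD(4)[OF t(1)] by simp
  have "dom (stup I') = Field r \<times> y"
  proof (rule set_eqI, clarify)
    show "(i, j) \<in> dom (stup I') \<longleftrightarrow> (i, j) \<in> Field r \<times> y" for i j
      using domt[of "Inl i" j] by (auto simp: I'_def d_def dom_def Field_append)
  qed
  then have yI': "ysq y I'" using r(1) smr ysqD(3)[OF b(3)] by (simp add: ysq_def I'_def tuples_def)
  have "dom (stup J') = Field r \<times> y"
  proof (rule set_eqI, clarify)
    show "(i, j) \<in> dom (stup J') \<longleftrightarrow> (i, j) \<in> Field r \<times> y" for i j
      using domt[of "Inr i" j] by (auto simp: J'_def d_def dom_def Field_append)
  qed
  then have yJ': "ysq y J'" using r(1) smr ysqD(3)[OF b(3)] by (simp add: ysq_def J'_def tuples_def)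
  have so: "sord (seq_append I' J') = ?R" by (simp add: sord_append I'_def J'_def d_def)
  have st: "stup (seq_append I' J') (k, j) = t (k, j)" for k j
    by (cases k) (auto simp: I'_def J'_def)
  have sm: "smono (sord (seq_append I' J')) (Field (sord (seq_append I' J'))) ?R id"
    unfolding so by (simp add: smono_def)
  have ind: "indiscernible \<kappa> M A (seq_append I' J')"
    by (rule indiscernible_pull[where h = id, OF _ _ ysqD(5)[OF ysq_append[OF yI' yJ']] t(3) blockA]) (use st sm in simp_all)
  have EI': "EM_equiv M A I' b"
    by (rule EM_pull[where h = Inl, OF _ _ t(2)]) (use smono_Inl[of d d] in \<open>simp_all add: I'_def d_def\<close>)
  have "stup I (i, j) = stup I' (g (Inl (Inl i)), j)" if "i \<in> Field (sord I)" for i j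
    using t(4)[of "Inl i" j] that by (simp add: I'_def Field_append)
  from Aut_subsequence[OF y(1) this] have AI: "Aut M (upair A {stup I'}) \<subseteq> Aut M (upair A {stup I})" .
  have "stup J (i, j) = stup J' (g (Inl (Inr i)), j)" if "i \<in> Field (sord J)" for i j
    using t(4)[of "Inr i" j] that by (simp add: J'_def Field_append)
  from Aut_subsequence[OF y(2) this] have AJ: "Aut M (upair A {stup J'}) \<subseteq> Aut M (upair A {stup J})" .
  have inf': "infinite_seq I'" using infr by (simp add: infinite_seq_def I'_def)
  show thesis by (rule that[OF yI' yJ' _ _ inf' ind EI' AI AJ]) (simp_all add: I'_def J'_def nm)
qed

lemma bounded_imp_total:
  fixes b I J :: "('k, 'v, 'm) seqn" and g :: "('k + 'k) + 'k \<Rightarrow> 'k"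
  assumes g: "inj g" and b: "indiscernible \<kappa> M A b" "infinite_seq b" "no_max (sord b)"
    and bdd: "approx_class \<kappa> M EA a b \<in> bddu \<kappa> M A"
    and IJ: "is_seq \<kappa> I" "is_seq \<kappa> J" "EM_equiv M A (seq_append I J) b"
  shows "bu_indep \<kappa> M A {stup I} {stup J}"
proof -
  obtain y where y: "ysq y b" using b(1) is_seq_ysq[of b] by (auto simp: indiscernible_def)
  have EI: "EM_equiv M A I b" by (rule EM_pull[where h = Inl, OF _ smono_Inl IJ(3)]) simp
  have EJ: "EM_equiv M A J b" by (rule EM_pull[where h = Inr, OF _ smono_Inr IJ(3)]) simp
  have yI: "ysq y I" by (rule EM_ysq[OF IJ(1) EI y b(2)])
  have yJ: "ysq y J" by (rule EM_ysq[OF IJ(2) EJ y b(2)])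
  obtain I' J' :: "('k, 'v, 'm) seqn" where I': "ysq y I'" "ysq y J'" "sord J' = sord I'" "no_max (sord I')" "infinite_seq I'"
    "indiscernible \<kappa> M A (seq_append I' J')" "EM_equiv M A I' b"
    "Aut M (upair A {stup I'}) \<subseteq> Aut M (upair A {stup I})" "Aut M (upair A {stup J'}) \<subseteq> Aut M (upair A {stup J})"
    by (rule common_extension[OF g b(1,2) y b(3) yI yJ IJ(3)])
  have infJ': "infinite_seq J'" using I'(3,5) by (simp add: infinite_seq_def)
  have simIJ: "seq_sim \<kappa> M A I' J'" using I'(6) by (intro seq_simI[OF I'(1,2,5) infJ']) blast
  \<comment> \<open>The hypothesis concerns a class of sequences with the order of \<open>b\<close>,
    which differs from that of \<open>I'\<close>. The copy \<open>c\<close> of \<open>b\<close>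
    after \<open>I'\<close> is related to \<open>I'\<close>, so its bounded class stands in for that
    of \<open>I'\<close>.\<close>
  obtain c where c: "ysq y c" "sord c = sord b" "indiscernible \<kappa> M A (seq_append I' c)" "EM_equiv M A c b"
    by (rule append_after[OF b(1,2) y I'(1,7) ysqD(1,2)[OF y]])
  have infc: "infinite_seq c" using b(2) c(2) by (simp add: infinite_seq_def)
  have simIc: "seq_sim \<kappa> M A I' c" using c(3) by (intro seq_simI[OF I'(1) c(1) I'(5) infc]) blast
  let ?D = "approx_class \<kappa> M EA a c"
  obtain \<rho> where \<rho>: "\<rho> \<in> Aut M A" "aseq \<rho> c = b" by (rule EM_conj_aseq[OF c(1) y c(2,4)])
  have "act \<rho> ` ?D = approx_class \<kappa> M EA a b" using act_approx_class[OF c(1) infc \<rho>(1)] \<rho>(2) by simp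
  then have "?D = act (inv \<rho>) ` approx_class \<kappa> M EA a b" using act_image_inv(1)[OF Aut_aut[OF \<rho>(1)], of ?D] by simp
  moreover have "inv \<rho> \<in> Aut M A" by (rule Aut_inv[OF blockA \<rho>(1)])
  ultimately have D: "?D \<in> bddu \<kappa> M A"
    using bddu_act[OF bdd Aut_aut] Aut_image[OF blockA] by metis
  have "e \<in> bddu \<kappa> M A" if eI: "e \<in> bddu \<kappa> M (upair A {stup I})" and eJ: "e \<in> bddu \<kappa> M (upair A {stup J})"
    for e :: "('k \<rightharpoonup> 'm) set"
  proof -
    have e': "e \<in> bddu \<kappa> M (upair A {stup I'})" "e \<in> bddu \<kappa> M (upair A {stup J'})"
      using eI eJ bddu_mono[OF I'(8)] bddu_mono[OF I'(9)] by blast+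
    have u: "ultraimaginary \<kappa> M e" using eI by (simp add: bddu_def)
    have link: "linked e (sord I') I'" unfolding linked_def using e' I'(3) simIJ by blast
    \<comment> \<open>Images of \<open>e\<close> under automorphisms over \<open>A\<close> that fix
      the class of \<open>c\<close> will be shown to lie in this small set.\<close>
    define W where "W = {F \<in> bddu \<kappa> M (upair A {stup I'}). \<exists>\<sigma>\<in>automorphisms M. F = act \<sigma> ` e}"
    have hI: "hyp_at (upair A {stup I'}) (case_sum a (stup I'))" by (rule hyp_AI[OF I'(1)])
    obtain N where N: "ran (case_sum a (stup I')) \<subseteq> N" "sm N" "elem_sub M N"
      using small_model[OF hyp_at_small_ran[OF hI]] by blast
    have W: "sm W" unfolding W_def by (rule small_bddu_conjugates[OF N(3,2) hyp_at_Fix[OF hI N(1)] u])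
    let ?f = "\<lambda>\<sigma>. act \<sigma> ` ?D"
    \<comment> \<open>\<open>T\<close> represents the few conjugates of the class of
      \<open>c\<close>. Each conjugate of \<open>e\<close> will be a member of \<open>W\<close>
      moved by some element of \<open>T\<close>.\<close>
    obtain T where T: "T \<subseteq> Aut M A" "inj_on ?f T" "?f ` Aut M A = ?f ` T"
      using subset_refl[of "?f ` Aut M A"] unfolding subset_image_inj[of "?f ` Aut M A" ?f "Aut M A"] by (elim exE conjE)
    have "sm (?f ` T)" using D T(3) by (simp add: bddu_def)
    then have smT: "sm T" by (rule small_inj_image[OF T(2) order_refl])
    have "(\<lambda>\<sigma>. act \<sigma> ` e) ` Aut M A \<subseteq> (\<lambda>(\<tau>, F). act \<tau> ` F) ` (T \<times> W)"
    proof
      fix Z assume "Z \<in> (\<lambda>\<sigma>. act \<sigma> ` e) ` Aut M A"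
      then obtain \<sigma> where \<sigma>: "\<sigma> \<in> Aut M A" "Z = act \<sigma> ` e" by blast
      have "?f \<sigma> \<in> ?f ` T" using T(3) \<sigma>(1) by blast
      then obtain \<tau> where \<tau>: "\<tau> \<in> T" "act \<sigma> ` ?D = act \<tau> ` ?D" by blast
      have \<tau>A: "\<tau> \<in> Aut M A" using \<tau>(1) T(1) by blast
      \<comment> \<open>Splitting off \<open>\<tau>\<close> leaves an automorphism that fixes the
        class of \<open>c\<close>.\<close>
      let ?\<mu> = "inv \<tau> \<circ> \<sigma>"
      have \<mu>: "?\<mu> \<in> Aut M A" by (intro Aut_comp Aut_inv[OF blockA] \<tau>A \<sigma>(1))
      have \<theta>: "inv ?\<mu> \<in> Aut M A" by (rule Aut_inv[OF blockA \<mu>])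
      have "act ?\<mu> ` ?D = act (inv \<tau>) ` act \<tau> ` ?D" unfolding act_image_comp \<tau>(2) ..
      then have "act ?\<mu> ` ?D = ?D" unfolding act_image_inv(1)[OF Aut_aut[OF \<tau>A]] .
      then have "act (inv ?\<mu>) ` act ?\<mu> ` ?D = act (inv ?\<mu>) ` ?D" by simp
      then have "?D = act (inv ?\<mu>) ` ?D" unfolding act_image_inv(1)[OF Aut_aut[OF \<mu>]] .
      then have "?D = approx_class \<kappa> M EA a (aseq (inv ?\<mu>) c)" using act_approx_class[OF c(1) infc \<theta>] by simp
      moreover have "ysq y (aseq (inv ?\<mu>) c)" using c(1) by simp
      ultimately have "stup c = stup (aseq (inv ?\<mu>) c) \<or> seq_approx \<kappa> M A c (aseq (inv ?\<mu>) c)"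
        using approx_class_eq_iff[OF c(1), of "aseq (inv ?\<mu>) c"] infc by simp
      moreover have "seq_sim \<kappa> M A (aseq (inv ?\<mu>) c) (aseq (inv ?\<mu>) I')"
        by (rule seq_sim_sym[OF seq_sim_Aut[OF \<theta> simIc]])
      \<comment> \<open>Whether \<open>c\<close> equals its image or is only related to it, a chain
        leads from \<open>I'\<close> through both to the image of \<open>I'\<close>.\<close>
      ultimately have "seq_approx \<kappa> M A I' (aseq (inv ?\<mu>) I')"
      proof (elim disjE)
        assume sim: "seq_sim \<kappa> M A (aseq (inv ?\<mu>) c) (aseq (inv ?\<mu>) I')" and st: "stup c = stup (aseq (inv ?\<mu>) c)"
        have "aseq (inv ?\<mu>) c = c" by (rule seqn.equality[OF aseq_simps(1) st[symmetric]]) simp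
        then have "seq_sim \<kappa> M A c (aseq (inv ?\<mu>) I')" using sim by simp
        then show ?thesis using seq_approx_trans[OF seq_sim_approx[OF simIc] seq_sim_approx] by blast
      next
        assume sim: "seq_sim \<kappa> M A (aseq (inv ?\<mu>) c) (aseq (inv ?\<mu>) I')" and app: "seq_approx \<kappa> M A c (aseq (inv ?\<mu>) c)"
        show ?thesis
          by (rule seq_approx_trans[OF seq_sim_approx[OF simIc] seq_approx_trans[OF app seq_sim_approx[OF sim]]])
      qed
      from linked_approx[OF I'(4) link this] obtain P where P: "linked e (sord I') P" "seq_sim \<kappa> M A P (aseq (inv ?\<mu>) I')"
        by blast
      \<comment> \<open>The chain ends at the image of \<open>I'\<close> under the inverse of
        \<open>?\<mu>\<close>, so \<open>e\<close> is bounded over that image. Applying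
        \<open>?\<mu>\<close> restores \<open>I'\<close> and shows that the image of
        \<open>e\<close> is bounded over \<open>A\<close> and \<open>I'\<close>.\<close>
      have "linked e (sord I') (aseq (inv ?\<mu>) I')" by (rule linked_step[OF I'(4) P]) simp
      then have e1: "e \<in> bddu \<kappa> M (upair A {act (inv ?\<mu>) (stup I')})" by (simp add: linked_def)
      have "act ?\<mu> ` e \<in> bddu \<kappa> M (act ?\<mu> ` upair A {act (inv ?\<mu>) (stup I')})"
        by (rule bddu_act[OF e1 Aut_aut[OF \<mu>]])
      then have "act ?\<mu> ` e \<in> bddu \<kappa> M (upair A {stup I'})"
        unfolding act_image_upair Aut_image[OF blockA \<mu>] act_inv(2)[OF Aut_aut[OF \<mu>]] .
      then have "act ?\<mu> ` e \<in> W" unfolding W_def using Aut_aut[OF \<mu>] by blast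
      moreover have "Z = act \<tau> ` act ?\<mu> ` e"
        unfolding \<sigma>(2) act_image_comp act_image_inv(2)[OF Aut_aut[OF \<tau>A]] ..
      ultimately show "Z \<in> (\<lambda>(\<tau>, F). act \<tau> ` F) ` (T \<times> W)" using \<tau>(1) by (intro image_eqI[of _ _ "(\<tau>, act ?\<mu> ` e)"]) simp_all
    qed
    moreover have "sm ((\<lambda>(\<tau>, F). act \<tau> ` F) ` (T \<times> W))" by (rule small_image[OF small_Times[OF smT W]])
    ultimately have "sm ((\<lambda>\<sigma>. act \<sigma> ` e) ` Aut M A)" by (rule small_subset[rotated])
    then show ?thesis unfolding bddu_def using u by blast
  qed
  moreover have "bddu \<kappa> M A \<subseteq> bddu \<kappa> M (upair A {stup I})" "bddu \<kappa> M A \<subseteq> bddu \<kappa> M (upair A {stup J})"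
    by (rule bddu_mono; auto simp: Aut_AI)+
  ultimately show ?thesis unfolding bu_indep_def by blast
qed

end

theorem theorem4p8:
  fixes \<kappa> :: "'k rel"
    and T :: "('f, 'p) fm set"
    and M :: "('f, 'p, 'm) struct"
    and K :: "'k set" and x :: "'k \<Rightarrow> 'k set"
    and E :: "'k \<Rightarrow> ('k \<rightharpoonup> 'm) rel" and a :: "'k \<times> 'k \<rightharpoonup> 'm"
    and EA :: "('k \<times> 'k \<rightharpoonup> 'm) rel" and A :: "('k \<times> 'k \<rightharpoonup> 'm) set"
    and b :: "('k, 'k, 'm) seqn"
  assumes T: "complete_theory M T"
    and M: "monster_model \<kappa> T M"
    and hyp: "hyperimaginary_family \<kappa> M K x E a"
    and EA: "EA = product_rel K x E"
    and A: "A = EA `` {a}"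
    and b: "omega_seq b" "indiscernible \<kappa> M A b"
  shows
    "(total_bu_Morley \<kappa> M A b \<longleftrightarrow>
        (\<exists>(I :: ('k, 'k, 'm) seqn) (J :: ('k, 'k, 'm) seqn).
           is_seq \<kappa> I \<and> is_seq \<kappa> J \<and> infinite_seq I \<and> infinite_seq J \<and>
           EM_equiv M A (seq_append I J) b \<and> bu_indep \<kappa> M A {stup I} {stup J})) \<and>
     (total_bu_Morley \<kappa> M A b \<longleftrightarrow>
        (\<forall>I :: ('k, 'k, 'm) seqn.
           is_seq \<kappa> I \<longrightarrow> (seq_approx \<kappa> M A I b \<longleftrightarrow> LEM_equiv \<kappa> M A I b))) \<and>
     (total_bu_Morley \<kappa> M A b \<longleftrightarrow> approx_class \<kappa> M EA a b \<in> bddu \<kappa> M A)"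
    (is "(?P1 \<longleftrightarrow> ?P2) \<and> (?P1 \<longleftrightarrow> ?P3) \<and> (?P1 \<longleftrightarrow> ?P4)")
proof -
  interpret monster \<kappa> M
    using M unfolding monster_model_def by unfold_locales auto
  interpret hyper_params \<kappa> M "Sigma K x" EA a A
    by (intro hyper_params.intro monster_axioms hyper_params_axioms.intro)
      (unfold A EA, (rule refl hyp_at_family[OF hyp])+)
  \<comment> \<open>\<open>g\<close> recodes the variables of the class of \<open>b\<close> for use
    in the definition of independence; \<open>h\<close> makes room in \<open>'k\<close> for the
    order of I + J + b.\<close>
  obtain g :: "'k \<times> 'k + 'k \<times> 'k \<Rightarrow> 'k" and h :: "('k + 'k) + 'k \<Rightarrow> 'k" where g: "inj g" and h: "inj h"
    by (rule ex_inj_index)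
  note inf = omega_seq_infinite_no_max[OF b(1)]
  have 12: "?P1 \<Longrightarrow> ?P2"
    using total_imp_indep[OF b(2) inf(1)] unfolding total_bu_Morley_def by metis
  have 24: "?P2 \<Longrightarrow> ?P4"
    using indep_imp_bounded[OF g b(2) inf(1)] by blast
  have 41: "?P4 \<Longrightarrow> ?P1"
    unfolding total_bu_Morley_def using b bounded_imp_total[OF h b(2) inf] by blast
  have 43: "?P4 \<Longrightarrow> ?P3"
    using seq_approx_imp_LEM[OF _ b(2) inf(1)] bounded_imp_LEM_approx by blast
  have 34: "?P3 \<Longrightarrow> ?P4"
  proof (rule LEM_imp_bounded[OF _ b(2) inf(1)])
    fix I :: "('k, 'k, 'm) seqn"
    assume P3: ?P3 and L: "LEM_equiv \<kappa> M A I b"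
    then have "is_seq \<kappa> I" by (simp add: LEM_equiv_def indiscernible_def)
    then show "seq_approx \<kappa> M A I b" using P3 L by blast
  qed
  from 12 24 41 43 34 show ?thesis by blast
qed

end
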